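(* $$\lim_{N\to\infty}\frac1N\,\mathbb E\max_{\mathbf m\in[-1,1]^N}F_{\mathrm{TAP}}(\mathbf m)=\inf_{\zeta\in\mathcal P([0,1])}P_\zeta .$$
   Context: $\xi(x)=\sum_{p\ge2}\beta_p^2x^p$ with $\beta_p^2\ge0$ has radius of convergence larger than $1$ and is strictly convex on $[-1,1]$ (and $\xi(0)=\xi'(0)=0$). $(H_N(\mathbf m))_{\mathbf m\in[-1,1]^N}$ is the centered Gaussian process with $\mathbb E[H_N(\mathbf m)H_N(\mathbf m')]=N\xi(\langle\mathbf m,\mathbf m'\rangle/N)$. Write $q_{\mathbf m}=\|\mathbf m\|^2/N$; $\mathcal P([a,b])$ is the set of probability measures on $[a,b]$. For $\zeta\in\mathcal P([0,1])$, $\Phi_\zeta:[0,1]\times\mathbb R\to\mathbb R$ solves $\partial_s\Phi_\zeta+\frac{\xi''(s)}2\left[\partial_{xx}\Phi_\zeta+\zeta([0,s])(\partial_x\Phi_\zeta)^2\right]=0$ with $\Phi_\zeta(1,x)=\log\cosh x$, and $P_\zeta=\Phi_\zeta(0,0)-\frac12\int_0^1s\xi''(s)\zeta([0,s])\,ds$. For $\eta\in\mathcal P([q,1])$, $\Phi_\eta$ solves the same equation on $[q,1]$, with $\eta([0,s])$ meaning $\eta([q,s])$. Let $\Phi_\eta^*(q,a)=\inf_{x\in\mathbb R}\{\Phi_\eta(q,x)-ax\}$. For $\eta\in\mathcal P([q_{\mathbf m},1])$, $F_{\mathrm{TAP},\eta}(\mathbf m)=H_N(\mathbf m)+\sum_{i=1}^N\Phi_\eta^*(q_{\mathbf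 m},m_i)-\frac N2\int_{q_{\mathbf m}}^1s\xi''(s)\eta([0,s])\,ds$, and $F_{\mathrm{TAP}}(\mathbf m)=\inf_{\eta\in\mathcal P([q_{\mathbf m},1])}F_{\mathrm{TAP},\eta}(\mathbf m)$. *)

theory Defs
  imports "HOL-Probability.Probability"
begin

definition strictly_convex_on :: "real set \<Rightarrow> (real \<Rightarrow> real) \<Rightarrow> bool" where
  "strictly_convex_on S f \<longleftrightarrow> convex S \<and>
     (\<forall>x\<in>S. \<forall>y\<in>S. \<forall>t. x \<noteq> y \<longrightarrow> 0 < t \<longrightarrow> t < 1 \<longrightarrow>
        f ((1 - t) * x + t * y) < (1 - t) * f x + t * f y)"

definition mixture_coeff :: "(nat \<Rightarrow> real) \<Rightarrow> nat \<Rightarrow> real" where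
  "mixture_coeff \<beta> p = (if 2 \<le> p then (\<beta> p)\<^sup>2 else 0)"

definition mixture :: "(nat \<Rightarrow> real) \<Rightarrow> real \<Rightarrow> real" where
  "mixture \<beta> x = (\<Sum>p. mixture_coeff \<beta> p * x ^ p)"

(* Vectors in R^N are extensional functions on {..<N}. The product topology on
   nat => real induces the Euclidean topology on this set. *)
definition cube :: "nat \<Rightarrow> (nat \<Rightarrow> real) set" where
  "cube N = ({..<N} \<rightarrow>\<^sub>E {-1..1})"

definition dotp :: "nat \<Rightarrow> (nat \<Rightarrow> real) \<Rightarrow> (nat \<Rightarrow> real) \<Rightarrow> real" where
  "dotp N m m' = (\<Sum>i<N. m i * m' i)"

definition self_overlap :: "nat \<Rightarrow> (nat \<Rightarrow> real) \<Rightarrow> real" where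
  "self_overlap N m = dotp N m m / real N"

(* The second disjunct is the degenerate Gaussian of variance 0, which
   normal_density does not cover. *)
definition centered_gaussian :: "'w measure \<Rightarrow> ('w \<Rightarrow> real) \<Rightarrow> bool" where
  "centered_gaussian M X \<longleftrightarrow> X \<in> borel_measurable M \<and>
     ((\<exists>\<sigma>>0. distributed M lborel X (\<lambda>x. ennreal (normal_density 0 \<sigma> x))) \<or>
      (AE w in M. X w = 0))"

definition centered_gaussian_process ::
    "'w measure \<Rightarrow> 't set \<Rightarrow> ('t \<Rightarrow> 'w \<Rightarrow> real) \<Rightarrow> bool" where
  "centered_gaussian_process M T X \<longleftrightarrow> prob_space M \<and>
     (\<forall>S c. finite S \<longrightarrow> S \<subseteq> T \<longrightarrow> centered_gaussian M (\<lambda>w. \<Sum>t\<in>S. c t * X t w))"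

(* A probability measure on [a,b] is represented as a Borel probability measure on
   the whole line that is carried by [a,b]. *)
definition probs_on :: "real \<Rightarrow> real \<Rightarrow> real measure set" where
  "probs_on a b = {\<mu>. prob_space \<mu> \<and> sets \<mu> = sets borel \<and> measure \<mu> {a..b} = 1}"

(* The equation is required at each s in (q,1) that is not an atom of \<eta>: at an atom the
   coefficient \<eta>([q,s]) jumps and \<Phi> need not be differentiable in s. Since \<Phi> and its
   x-derivatives up to order two are continuous, the countably many excluded times
   are determined by the rest. The bound on the x-derivative is the growth condition
   that selects one solution; log cosh itself is 1-Lipschitz. *)
definition parisi_pde_solution ::
    "(real \<Rightarrow> real) \<Rightarrow> real \<Rightarrow> real measure \<Rightarrow> (real \<Rightarrow> real \<Rightarrow> real) \<Rightarrow> bool" where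
  "parisi_pde_solution \<xi> q \<eta> \<Phi> \<longleftrightarrow>
     (\<forall>s\<in>{q..1}. \<forall>x. \<Phi> s differentiable at x \<and> deriv (\<Phi> s) differentiable at x) \<and>
     continuous_on ({q..1} \<times> UNIV) (\<lambda>(s, x). \<Phi> s x) \<and>
     continuous_on ({q..1} \<times> UNIV) (\<lambda>(s, x). deriv (\<Phi> s) x) \<and>
     continuous_on ({q..1} \<times> UNIV) (\<lambda>(s, x). deriv (deriv (\<Phi> s)) x) \<and>
     (\<exists>C. \<forall>s\<in>{q..1}. \<forall>x. \<bar>deriv (\<Phi> s) x\<bar> \<le> C) \<and>
     (\<forall>s\<in>{q<..<1}. measure \<eta> {s} = 0 \<longrightarrow> (\<forall>x.
        ((\<lambda>t. \<Phi> t x) has_real_derivative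
          - (deriv (deriv \<xi>) s / 2 *
              (deriv (deriv (\<Phi> s)) x + measure \<eta> {q..s} * (deriv (\<Phi> s) x)\<^sup>2))) (at s))) \<and>
     (\<forall>x. \<Phi> 1 x = ln (cosh x))"

(* The solution is unique on [q,1] x R; the choice only fixes irrelevant values
   outside that strip. *)
definition parisi_Phi :: "(real \<Rightarrow> real) \<Rightarrow> real \<Rightarrow> real measure \<Rightarrow> real \<Rightarrow> real \<Rightarrow> real" where
  "parisi_Phi \<xi> q \<eta> = (SOME \<Phi>. parisi_pde_solution \<xi> q \<eta> \<Phi>)"

definition penalty :: "(real \<Rightarrow> real) \<Rightarrow> real \<Rightarrow> real measure \<Rightarrow> real" where
  "penalty \<xi> q \<eta> = (LBINT s:{q..1}. s * deriv (deriv \<xi>) s * measure \<eta> {q..s})"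

definition parisi_functional :: "(real \<Rightarrow> real) \<Rightarrow> real measure \<Rightarrow> real" where
  "parisi_functional \<xi> \<zeta> = parisi_Phi \<xi> 0 \<zeta> 0 0 - penalty \<xi> 0 \<zeta> / 2"

definition Phi_star :: "(real \<Rightarrow> real) \<Rightarrow> real \<Rightarrow> real measure \<Rightarrow> real \<Rightarrow> real" where
  "Phi_star \<xi> q \<eta> a = (INF x. parisi_Phi \<xi> q \<eta> q x - a * x)"

(* The argument h is one realisation of the Hamiltonian. *)
definition F_TAP_at ::
    "(real \<Rightarrow> real) \<Rightarrow> nat \<Rightarrow> ((nat \<Rightarrow> real) \<Rightarrow> real) \<Rightarrow> real measure \<Rightarrow> (nat \<Rightarrow> real) \<Rightarrow> real" where
  "F_TAP_at \<xi> N h \<eta> m =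
     h m + (\<Sum>i<N. Phi_star \<xi> (self_overlap N m) \<eta> (m i))
         - real N / 2 * penalty \<xi> (self_overlap N m) \<eta>"

definition F_TAP ::
    "(real \<Rightarrow> real) \<Rightarrow> nat \<Rightarrow> ((nat \<Rightarrow> real) \<Rightarrow> real) \<Rightarrow> (nat \<Rightarrow> real) \<Rightarrow> real" where
  "F_TAP \<xi> N h m = (INF \<eta>\<in>probs_on (self_overlap N m) 1. F_TAP_at \<xi> N h \<eta> m)"

(* A genuine maximum: unlike a supremum, it is unspecified unless it is attained. *)
definition maximum_on :: "'t set \<Rightarrow> ('t \<Rightarrow> real) \<Rightarrow> real" where
  "maximum_on S f = (GREATEST v. v \<in> f ` S)"

end

(*
  Lower bound: Phi_zeta(0,.) is even and convex, so its lower conjugate at 0 is Phi_zeta(0,0). Hence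
  F_TAP(0) = H(0) + N inf P, and H(0) = 0 almost surely because xi(0) = 0.

  Upper bound: fix zeta and push it forward under max(q_m, .). Then F_TAP(m) is at most
  H(m) + sum_i Phi_zeta^*(q_m, m_i) minus the penalty on [q_m, 1]. Replace the cumulative distribution
  function of zeta by a dyadic step function, which turns the Parisi equation into a Cole-Hopf recursion,
  and treat together the m whose self-overlap q_m lies in one dyadic cell ending at r. On such a class
  Guerra's interpolation compares H plus scalar Gaussians of variance N (r xi'(r) - xi(r)) with N
  independent fields x_i of variance xi'(r) acting through sum_i m_i x_i; nested exponential averages play
  the role of the Ruelle cascade. The difference N (xi(R) - xi(r) - xi'(r) (R - r)) of the covariances at
  overlap R is nonnegative by convexity of xi on [-1,1], and nearly vanishes at R = q_m. On the side of
  the fields m disappears, since m_i x + Phi^*(m_i) <= Phi(x), and the recursion leaves N Phi_zeta(0,0).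
  This bounds an exponential moment of fixed order of the maximum over a class, so the union over the
  2^n classes costs O(1), and n tends to infinity after N.

  The maximum: F_TAP is an infimum of continuous functions of m, hence attains its maximum on the cube,
  and the maximum is a limit of maxima over finite sets that do not depend on the realisation.
*)

theory Submission
  imports Defs
begin

text \<open>\<open>parisi_Phi\<close> is a choice, so nothing can be computed with it before
  existence and uniqueness hold for every order parameter, atoms included. Both rest on right time
  derivatives, which the step solutions and the true solutions have at every time. The maximum runs
  over finite sets of unbounded size, so the inverse temperature \<open>lam\<close> of the softmax
  is unbounded, while the self-overlap varies inside a class. An error of \<open>lam\<close> times
  that variation could not be afforded. It is removed exactly: one more Gaussian level, with
  coefficient proportional to the deviation of the self-overlap from \<open>r\<close>, enforces
  \<open>D i i + D k k <= 2 * D i k\<close>, after which \<open>lam\<close> may be replaced by an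
  exponent at most 1. This is possible because the defect is quadratic in the difference of two
  self-overlaps. The exponents are kept at least \<open>1 / 2 ^ n\<close>, since the recursion
  divides by them. The smallest, common to all classes, is the order of the exponential moment. The
  interpolation runs along the sine and cosine of an angle, which keeps derivatives bounded at both
  ends.\<close>

lemma
  fixes f :: "real \<Rightarrow> 'a \<Rightarrow> real"
  assumes e: "e > 0"
    and meas: "\<And>s. \<bar>s - s0\<bar> < e \<Longrightarrow> f s \<in> borel_measurable M"
    and int: "integrable M (f s0)"
    and der: "\<And>s a. \<bar>s - s0\<bar> < e \<Longrightarrow> ((\<lambda>s. f s a) has_real_derivative f' s a) (at s)"
    and bd: "\<And>s a. \<bar>s - s0\<bar> < e \<Longrightarrow> \<bar>f' s a\<bar> \<le> B a"
    and B: "integrable M B"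
  shows integrable_DERIV_under_integral: "integrable M (f' s0)"
    and DERIV_under_integral:
      "((\<lambda>s. \<integral>a. f s a \<partial>M) has_real_derivative (\<integral>a. f' s0 a \<partial>M)) (at s0)"
proof -
  let ?S = "{s0 - e<..<s0 + e}"
  have S: "s \<in> ?S \<longleftrightarrow> \<bar>s - s0\<bar> < e" for s by (auto simp: abs_if)
  \<comment> \<open>By the mean value inequality \<open>B\<close> also dominates the difference
    quotients, as dominated convergence requires.\<close>
  have lip: "\<bar>f s a - f s0 a\<bar> \<le> B a * \<bar>s - s0\<bar>" if "s \<in> ?S" for s a
  proof -
    have "norm (f s a - f s0 a) \<le> B a * norm (s - s0)"
    proof (rule field_differentiable_bound[where S="?S" and f'="\<lambda>s. f' s a"])
      show "convex ?S" by (rule convex_real_interval)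
      fix t assume "t \<in> ?S"
      then show "((\<lambda>s. f s a) has_field_derivative f' t a) (at t within ?S)"
        using der[of t a] S has_field_derivative_at_within by blast
      show "norm (f' t a) \<le> B a" using bd[of t a] S \<open>t \<in> ?S\<close> by simp
    qed (use that e in auto)
    then show ?thesis by simp
  qed
  have intS: "integrable M (f s)" if "s \<in> ?S" for s
  proof -
    have "integrable M (\<lambda>a. f s a - f s0 a)"
    proof (rule Bochner_Integration.integrable_bound[where f="\<lambda>a. B a * \<bar>s - s0\<bar>"])
      show "integrable M (\<lambda>a. B a * \<bar>s - s0\<bar>)" using B by simp
      show "(\<lambda>a. f s a - f s0 a) \<in> borel_measurable M"
        using meas[of s] meas[of s0] that S[of s] e by auto
      show "AE a in M. norm (f s a - f s0 a) \<le> norm (B a * \<bar>s - s0\<bar>)"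
        using lip[OF that] by (intro AE_I2) (smt (verit) real_norm_def)
    qed
    from Bochner_Integration.integrable_add[OF this int] show ?thesis by simp
  qed
  have seq: "integrable M (f' s0) \<and> (\<lambda>n. \<integral>a. (f (X n) a - f s0 a) / (X n - s0) \<partial>M) \<longlonglongrightarrow> (\<integral>a. f' s0 a \<partial>M)"
    if X: "\<And>n. X n \<in> ?S - {s0}" "X \<longlonglongrightarrow> s0" for X
  proof -
    have m: "(\<lambda>a. (f (X n) a - f s0 a) / (X n - s0)) \<in> borel_measurable M" for n
    proof -
      have "\<bar>X n - s0\<bar> < e" using X(1)[of n] S[of "X n"] by blast
      note [measurable] = meas[OF this] meas[of s0, simplified, OF e]
      show ?thesis by measurable
    qed
    have lim: "(\<lambda>n. (f (X n) a - f s0 a) / (X n - s0)) \<longlonglongrightarrow> f' s0 a" for a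
    proof -
      have "((\<lambda>y. (f y a - f s0 a) / (y - s0)) \<longlongrightarrow> f' s0 a) (at s0)"
        using der[of s0 a] e by (simp add: has_field_derivative_iff)
      then show ?thesis
        using X unfolding tendsto_at_iff_sequentially by (auto simp: comp_def)
    qed
    \<comment> \<open>The derivative is measurable as a pointwise limit of difference
      quotients.\<close>
    have m': "f' s0 \<in> borel_measurable M"
      by (rule borel_measurable_LIMSEQ_real[OF lim m])
    have bdd: "norm ((f (X n) a - f s0 a) / (X n - s0)) \<le> B a" for n a
    proof -
      have "X n - s0 \<noteq> 0" "X n \<in> ?S" using X(1)[of n] by auto
      then show ?thesis using lip[of "X n" a] by (simp add: divide_le_eq mult.commute)
    qed
    show ?thesis
    proof
      show "integrable M (f' s0)"
        by (rule integrable_dominated_convergence[where w=B and s="\<lambda>n a. (f (X n) a - f s0 a) / (X n - s0)"])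
          (use m' m B lim bdd in \<open>simp_all add: AE_I2\<close>)
      show "(\<lambda>n. \<integral>a. (f (X n) a - f s0 a) / (X n - s0) \<partial>M) \<longlonglongrightarrow> (\<integral>a. f' s0 a \<partial>M)"
        by (rule integral_dominated_convergence[where w=B and s="\<lambda>n a. (f (X n) a - f s0 a) / (X n - s0)"])
          (use m' m B lim bdd in \<open>simp_all add: AE_I2\<close>)
    qed
  qed
  \<comment> \<open>Integrability of \<open>f' s0\<close> is part of \<open>seq\<close>, so one
    explicit sequence approaching \<open>s0\<close> inside the neighbourhood is required.\<close>
  have "(\<lambda>n. s0 + e / 2 / real (Suc n)) \<longlonglongrightarrow> s0 + 0"
    by (intro tendsto_add tendsto_const LIMSEQ_Suc[OF lim_const_over_n[of "e / 2"]])
  moreover have "s0 + e / 2 / real (Suc n) \<in> ?S - {s0}" for n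
  proof -
    have "e / 2 / real (Suc n) \<le> e / 2 / 1" using e by (intro divide_left_mono) auto
    moreover have "0 < e / 2 / real (Suc n)" using e by simp
    ultimately have "\<bar>e / 2 / real (Suc n)\<bar> < e" "e / 2 / real (Suc n) \<noteq> 0" using e by linarith+
    then show ?thesis unfolding Diff_iff S by simp
  qed
  ultimately show "integrable M (f' s0)" unfolding add_0_right by (intro conjunct1[OF seq])
  have "((\<lambda>y. ((\<integral>a. f y a \<partial>M) - (\<integral>a. f s0 a \<partial>M)) / (y - s0)) \<longlongrightarrow> (\<integral>a. f' s0 a \<partial>M)) (at s0 within ?S)"
    unfolding tendsto_at_iff_sequentially
  proof (intro allI impI)
    fix X :: "nat \<Rightarrow> real" assume X: "\<forall>i. X i \<in> ?S - {s0}" "X \<longlonglongrightarrow> s0"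
    have eq: "(\<integral>a. (f (X n) a - f s0 a) / (X n - s0) \<partial>M)
        = ((\<integral>a. f (X n) a \<partial>M) - (\<integral>a. f s0 a \<partial>M)) / (X n - s0)" for n
    proof -
      have "integrable M (f (X n))" using intS[of "X n"] X(1) by blast
      then show ?thesis using int by (simp add: Bochner_Integration.integral_diff)
    qed
    show "((\<lambda>y. ((\<integral>a. f y a \<partial>M) - (\<integral>a. f s0 a \<partial>M)) / (y - s0)) \<circ> X) \<longlonglongrightarrow> (\<integral>a. f' s0 a \<partial>M)"
      using conjunct2[OF seq[of X]] X unfolding comp_def eq by blast
  qed
  then show "((\<lambda>s. \<integral>a. f s a \<partial>M) has_real_derivative (\<integral>a. f' s0 a \<partial>M)) (at s0)"
    unfolding has_field_derivative_iff by (subst (asm) at_within_open) (use e in auto)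
qed

section \<open>Gaussian integrals of functions of exponential growth\<close>

abbreviation gauss :: "real measure" where "gauss \<equiv> std_normal_distribution"

lemma prob_space_gauss: "prob_space gauss"
  by (rule prob_space_normal_density) simp

lemma borel_measurable_gauss: "borel_measurable gauss = borel_measurable borel"
  by (rule measurable_cong_sets) simp_all

lemma integrable_gauss_const [simp]: "integrable gauss (\<lambda>g. c::real)"
  using finite_measure.integrable_const[OF prob_space.finite_measure[OF prob_space_gauss]] .

lemma integral_gauss_const [simp]: "(\<integral>g. c \<partial>gauss) = (c::real)"
  using prob_space.prob_space[OF prob_space_gauss] by simp

text \<open>The Cameron-Martin formula: substituting \<open>x + s\<close> moves the shift into the
  density, and the quotient of the two densities is
  \<open>exp (g * s - s\<^sup>2 / 2)\<close>.\<close>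

lemma
  fixes j :: "real \<Rightarrow> real"
  assumes [measurable]: "j \<in> borel_measurable borel"
  shows integrable_gauss_shift: "integrable gauss (\<lambda>g. j (g + s)) \<longleftrightarrow> integrable gauss (\<lambda>g. j g * exp (g * s - s\<^sup>2 / 2))"
    and integral_gauss_shift: "(\<integral>g. j (g + s) \<partial>gauss) = (\<integral>g. j g * exp (g * s - s\<^sup>2 / 2) \<partial>gauss)"
proof -
  have dens: "std_normal_density (x - s) = std_normal_density x * exp (x * s - s\<^sup>2 / 2)" for x
  proof -
    have "- (x - s)\<^sup>2 / 2 = - x\<^sup>2 / 2 + (x * s - s\<^sup>2 / 2)" by (simp add: power2_eq_square field_simps)
    then show ?thesis unfolding std_normal_density_def by (simp only: exp_add mult.assoc)
  qed
  have *: "(\<lambda>x. std_normal_density (x - s) * j x) = (\<lambda>x. std_normal_density x * (j x * exp (x * s - s\<^sup>2 / 2)))"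
    by (simp add: dens mult_ac)
  have "integrable gauss (\<lambda>g. j (g + s)) \<longleftrightarrow> integrable lborel (\<lambda>x. std_normal_density x * j (x + s))"
    by (subst integrable_density) (auto)
  also have "\<dots> \<longleftrightarrow> integrable lborel (\<lambda>x. std_normal_density (x - s) * j x)"
    using lborel_integrable_real_affine_iff[of 1 "\<lambda>x. std_normal_density (x - s) * j x" s]
    by (simp add: add.commute)
  also have "\<dots> \<longleftrightarrow> integrable gauss (\<lambda>g. j g * exp (g * s - s\<^sup>2 / 2))"
    unfolding * by (subst integrable_density) (auto)
  finally show "integrable gauss (\<lambda>g. j (g + s)) \<longleftrightarrow> integrable gauss (\<lambda>g. j g * exp (g * s - s\<^sup>2 / 2))" .
  have "(\<integral>g. j (g + s) \<partial>gauss) = (\<integral>x. std_normal_density x * j (x + s) \<partial>lborel)"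
    by (subst integral_density) (auto)
  also have "\<dots> = (\<integral>x. std_normal_density (x - s) * j x \<partial>lborel)"
    using lborel_integral_real_affine[of 1 "\<lambda>x. std_normal_density (x - s) * j x" s]
    by (simp add: add.commute)
  also have "\<dots> = (\<integral>g. j g * exp (g * s - s\<^sup>2 / 2) \<partial>gauss)"
    unfolding * by (subst integral_density) (auto)
  finally show "(\<integral>g. j (g + s) \<partial>gauss) = (\<integral>g. j g * exp (g * s - s\<^sup>2 / 2) \<partial>gauss)" .
qed

text \<open>The shift formula for the constant function \<open>1\<close> is the exponential moment,
  up to the factor \<open>exp (a\<^sup>2 / 2)\<close>.\<close>

lemma
  shows integrable_gauss_exp: "integrable gauss (\<lambda>g. exp (a * g))"
    and integral_gauss_exp: "(\<integral>g. exp (a * g) \<partial>gauss) = exp (a\<^sup>2 / 2)"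
proof -
  have "integrable gauss (\<lambda>g. 1 * exp (g * a - a\<^sup>2 / 2))"
    using integrable_gauss_shift[of "\<lambda>_. 1" a] by simp
  then have 1: "integrable gauss (\<lambda>g. exp (a\<^sup>2 / 2) * exp (g * a - a\<^sup>2 / 2))" by simp
  have e: "exp (a\<^sup>2 / 2) * exp (g * a - a\<^sup>2 / 2) = exp (a * g)" for g
    by (simp add: exp_add[symmetric] mult.commute)
  show "integrable gauss (\<lambda>g. exp (a * g))" using 1 unfolding e .
  have "(\<integral>g. 1 * exp (g * a - a\<^sup>2 / 2) \<partial>gauss) = 1"
    using integral_gauss_shift[of "\<lambda>_. 1" a] by (simp del: lebesgue_integral_const)
  then have "(\<integral>g. exp (a\<^sup>2 / 2) * exp (g * a - a\<^sup>2 / 2) \<partial>gauss) = exp (a\<^sup>2 / 2)" by simp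
  then show "(\<integral>g. exp (a * g) \<partial>gauss) = exp (a\<^sup>2 / 2)" unfolding e .
qed

lemma
  assumes "a \<ge> 0"
  shows integrable_gauss_exp_abs: "integrable gauss (\<lambda>g. exp (a * \<bar>g\<bar>))"
    and integral_gauss_exp_abs_le: "(\<integral>g. exp (a * \<bar>g\<bar>) \<partial>gauss) \<le> 2 * exp (a\<^sup>2 / 2)"
proof -
  have i: "integrable gauss (\<lambda>g. exp (a * g) + exp (- a * g))"
    by (intro Bochner_Integration.integrable_add integrable_gauss_exp)
  have le: "exp (a * \<bar>g\<bar>) \<le> exp (a * g) + exp (- a * g)" for g by (cases "g \<ge> 0") auto
  show j: "integrable gauss (\<lambda>g. exp (a * \<bar>g\<bar>))"
    by (rule Bochner_Integration.integrable_bound[OF i]) (use le in \<open>auto simp: borel_measurable_gauss\<close>)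
  have "(\<integral>g. exp (a * \<bar>g\<bar>) \<partial>gauss) \<le> (\<integral>g. exp (a * g) + exp (- a * g) \<partial>gauss)"
    by (rule integral_mono[OF j i le])
  also have "\<dots> = 2 * exp (a\<^sup>2 / 2)"
    by (subst Bochner_Integration.integral_add[OF integrable_gauss_exp integrable_gauss_exp]) (simp only: integral_gauss_exp, simp)
  finally show "(\<integral>g. exp (a * \<bar>g\<bar>) \<partial>gauss) \<le> 2 * exp (a\<^sup>2 / 2)" .
qed

lemma integrable_gauss_bound:
  fixes j :: "real \<Rightarrow> real"
  assumes "j \<in> borel_measurable borel" "a \<ge> 0" "\<And>g. \<bar>j g\<bar> \<le> A * exp (a * \<bar>g\<bar>)"
  shows "integrable gauss j"
proof (rule Bochner_Integration.integrable_bound[where f="\<lambda>g. A * exp (a * \<bar>g\<bar>)"])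
  show "integrable gauss (\<lambda>g. A * exp (a * \<bar>g\<bar>))" using integrable_gauss_exp_abs[OF assms(2)] by simp
  show "j \<in> borel_measurable gauss" using assms(1) by (simp add: borel_measurable_gauss)
  show "AE g in gauss. norm (j g) \<le> norm (A * exp (a * \<bar>g\<bar>))"
    using assms(3) by (intro AE_I2) (smt (verit) real_norm_def)
qed

lemma abs_le_exp_abs: "\<bar>g::real\<bar> \<le> exp \<bar>g\<bar>" 
  using exp_ge_add_one_self[of "\<bar>g\<bar>"] by linarith

text \<open>Obtained by differentiating the shift formula at zero.\<close>

lemma gauss_integration_by_parts:
  fixes j j' :: "real \<Rightarrow> real"
  assumes der: "\<And>x. (j has_real_derivative j' x) (at x)"
    and a: "a \<ge> 0" and bj: "\<And>g. \<bar>j g\<bar> \<le> A * exp (a * \<bar>g\<bar>)" and bj': "\<And>g. \<bar>j' g\<bar> \<le> A * exp (a * \<bar>g\<bar>)"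
  shows "(\<integral>g. g * j g \<partial>gauss) = (\<integral>g. j' g \<partial>gauss)"
proof -
  have "continuous_on UNIV j" using der by (meson DERIV_continuous_on has_field_derivative_at_within)
  then have m[measurable]: "j \<in> borel_measurable borel" by (rule borel_measurable_continuous_onI)
  have A: "A \<ge> 0" using bj[of 0] by simp
  \<comment> \<open>The two sides of the shift formula are the same function of \<open>s\<close>.
    Differentiating the left one at 0 gives the integral of \<open>j'\<close>.\<close>
  have "((\<lambda>s. \<integral>g. j (g + s) \<partial>gauss) has_real_derivative (\<integral>g. j' (g + 0) \<partial>gauss)) (at 0)"
  proof (rule DERIV_under_integral[where e=1 and B="\<lambda>g. A * exp a * exp (a * \<bar>g\<bar>)"])
    show "integrable gauss (\<lambda>g. j (g + 0))" using integrable_gauss_bound[OF m a bj] by simp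
    show "integrable gauss (\<lambda>g. A * exp a * exp (a * \<bar>g\<bar>))" using integrable_gauss_exp_abs[OF a] by simp
    fix s g :: real assume s: "\<bar>s - 0\<bar> < 1"
    show "(\<lambda>g. j (g + s)) \<in> borel_measurable gauss" by (simp add: borel_measurable_gauss)
    show "((\<lambda>s. j (g + s)) has_real_derivative j' (g + s)) (at s)"
      by (rule DERIV_chain'[where g=j and f="\<lambda>s. g + s" and E="j' (g+s)" and D=1, simplified])
        (auto intro!: derivative_eq_intros der)
    have "\<bar>g + s\<bar> \<le> 1 + \<bar>g\<bar>" using s by linarith
    then have "a * \<bar>g + s\<bar> \<le> a * (1 + \<bar>g\<bar>)" using a by (rule mult_left_mono)
    then have "exp (a * \<bar>g + s\<bar>) \<le> exp (a * (1 + \<bar>g\<bar>))" by simp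
    then have "A * exp (a * \<bar>g + s\<bar>) \<le> A * exp (a * (1 + \<bar>g\<bar>))" using A by (rule mult_left_mono)
    then show "\<bar>j' (g + s)\<bar> \<le> A * exp a * exp (a * \<bar>g\<bar>)"
      using bj'[of "g+s"] by (simp add: algebra_simps exp_add)
  qed simp
  \<comment> \<open>The right one yields the factor \<open>g\<close>, the derivative of
    \<open>g * s - s\<^sup>2 / 2\<close> at 0.\<close>
  moreover have "((\<lambda>s. \<integral>g. j g * exp (g * s - s\<^sup>2 / 2) \<partial>gauss) has_real_derivative (\<integral>g. j g * ((g - 0) * exp (g * 0 - 0\<^sup>2 / 2)) \<partial>gauss)) (at 0)"
  proof (rule DERIV_under_integral[where e=1 and B="\<lambda>g. 2 * A * exp ((a+2) * \<bar>g\<bar>)"])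
    show "integrable gauss (\<lambda>g. j g * exp (g * 0 - 0\<^sup>2 / 2))" using integrable_gauss_bound[OF m a bj] by simp
    show "integrable gauss (\<lambda>g. 2 * A * exp ((a+2) * \<bar>g\<bar>))" using integrable_gauss_exp_abs[of "a+2"] a by simp
    fix s g :: real assume s: "\<bar>s - 0\<bar> < 1"
    show "(\<lambda>g. j g * exp (g * s - s\<^sup>2 / 2)) \<in> borel_measurable gauss" by (simp add: borel_measurable_gauss)
    show "((\<lambda>s. j g * exp (g * s - s\<^sup>2 / 2)) has_real_derivative j g * ((g - s) * exp (g * s - s\<^sup>2 / 2))) (at s)"
      by (auto intro!: derivative_eq_intros)
    have 1: "\<bar>g - s\<bar> \<le> 2 * exp \<bar>g\<bar>" using s exp_ge_add_one_self[of "\<bar>g\<bar>"] by linarith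
    have "\<bar>g * s\<bar> \<le> \<bar>g\<bar>" using s by (simp add: abs_mult mult_left_le)
    then have "g * s - s\<^sup>2 / 2 \<le> \<bar>g\<bar>" by (smt (verit) zero_le_power2 divide_nonneg_nonneg)
    then have "\<bar>(g - s) * exp (g * s - s\<^sup>2 / 2)\<bar> \<le> (2 * exp \<bar>g\<bar>) * exp \<bar>g\<bar>"
      unfolding abs_mult using 1 by (intro mult_mono) auto
    then have "\<bar>j g * ((g - s) * exp (g * s - s\<^sup>2 / 2))\<bar> \<le> (A * exp (a * \<bar>g\<bar>)) * ((2 * exp \<bar>g\<bar>) * exp \<bar>g\<bar>)"
      unfolding abs_mult[of "j g"] using bj[of g] A by (intro mult_mono) auto
    also have "\<dots> = 2 * A * exp ((a+2) * \<bar>g\<bar>)"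
    proof -
      have "(a + 2) * \<bar>g\<bar> = a * \<bar>g\<bar> + (\<bar>g\<bar> + \<bar>g\<bar>)" by (simp add: distrib_right)
      then show ?thesis by (simp only: exp_add mult_ac)
    qed
    finally show "\<bar>j g * ((g - s) * exp (g * s - s\<^sup>2 / 2))\<bar> \<le> 2 * A * exp ((a+2) * \<bar>g\<bar>)" .
  qed simp
  ultimately have "(\<integral>g. j' (g + 0) \<partial>gauss) = (\<integral>g. j g * ((g - 0) * exp (g * 0 - 0\<^sup>2 / 2)) \<partial>gauss)"
    unfolding integral_gauss_shift[OF m] by (rule DERIV_unique)
  then show ?thesis by (simp add: mult.commute)
qed

text \<open>A class closed under products and affine substitutions, in which every Gaussian integral
  converges and some \<open>exp (a * \<bar>x\<bar>)\<close> dominates locally in all parameters.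
  Measurability is included so that membership alone implies integrability.\<close>

definition exp_growth :: "(real \<Rightarrow> real) \<Rightarrow> bool" where
  "exp_growth k \<longleftrightarrow> k \<in> borel_measurable borel \<and> (\<exists>A a. a \<ge> 0 \<and> (\<forall>x. \<bar>k x\<bar> \<le> A * exp (a * \<bar>x\<bar>)))"

lemma exp_growthI:
  "k \<in> borel_measurable borel \<Longrightarrow> a \<ge> 0 \<Longrightarrow> (\<And>x. \<bar>k x\<bar> \<le> A * exp (a * \<bar>x\<bar>)) \<Longrightarrow> exp_growth k"
  unfolding exp_growth_def by (intro conjI exI[of _ A] exI[of _ a] allI)

lemma exp_growth_measurable: "exp_growth k \<Longrightarrow> k \<in> borel_measurable borel"
  by (simp add: exp_growth_def)

lemma exp_growth2E:
  assumes "exp_growth j" "exp_growth k"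
  obtains A a where "A \<ge> 0" "a \<ge> 0" "\<And>x. \<bar>j x\<bar> \<le> A * exp (a * \<bar>x\<bar>)" "\<And>x. \<bar>k x\<bar> \<le> A * exp (a * \<bar>x\<bar>)"
proof -
  obtain A a where 1: "a \<ge> 0" "\<And>x. \<bar>j x\<bar> \<le> A * exp (a * \<bar>x\<bar>)" using assms(1) by (auto simp: exp_growth_def)
  obtain B b where 2: "b \<ge> 0" "\<And>x. \<bar>k x\<bar> \<le> B * exp (b * \<bar>x\<bar>)" using assms(2) by (auto simp: exp_growth_def)
  have "A \<ge> 0" "B \<ge> 0" using 1(2)[of 0] 2(2)[of 0] by auto
  have mono: "C * exp (c * \<bar>x\<bar>) \<le> max A B * exp (max a b * \<bar>x\<bar>)" if "C \<le> max A B" "c \<le> max a b" for C c x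
  proof -
    have "c * \<bar>x\<bar> \<le> max a b * \<bar>x\<bar>" by (rule mult_right_mono[OF that(2)]) simp
    then show ?thesis using \<open>A \<ge> 0\<close> by (intro mult_mono that(1)) auto
  qed
  show thesis
  proof (rule that[of "max A B" "max a b"])
    show "max A B \<ge> 0" "max a b \<ge> 0" using \<open>A \<ge> 0\<close> 1(1) by auto
    show "\<bar>j x\<bar> \<le> max A B * exp (max a b * \<bar>x\<bar>)" for x by (rule order_trans[OF 1(2) mono]) auto
    show "\<bar>k x\<bar> \<le> max A B * exp (max a b * \<bar>x\<bar>)" for x by (rule order_trans[OF 2(2) mono]) auto
  qed
qed

lemma exp_growth_mult:
  assumes "exp_growth j" "exp_growth k" shows "exp_growth (\<lambda>x. j x * k x)"
proof -
  obtain A a where A: "A \<ge> 0" "a \<ge> 0" "\<And>x. \<bar>j x\<bar> \<le> A * exp (a * \<bar>x\<bar>)" "\<And>x. \<bar>k x\<bar> \<le> A * exp (a * \<bar>x\<bar>)"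
    by (rule exp_growth2E[OF assms]) (rule that)
  have "\<bar>j x * k x\<bar> \<le> (A * A) * exp ((a + a) * \<bar>x\<bar>)" for x
  proof -
    have "\<bar>j x\<bar> * \<bar>k x\<bar> \<le> (A * exp (a * \<bar>x\<bar>)) * (A * exp (a * \<bar>x\<bar>))"
      using A by (intro mult_mono) auto
    then show ?thesis unfolding abs_mult distrib_right exp_add by (simp only: mult_ac)
  qed
  moreover have "(\<lambda>x. j x * k x) \<in> borel_measurable borel"
    using assms by (intro borel_measurable_times exp_growth_measurable)
  ultimately show ?thesis using A(2) by (intro exp_growthI[of _ "a + a" "A * A"]) auto
qed

lemma exp_growth_bounded:
  assumes "k \<in> borel_measurable borel" "\<And>x. \<bar>k x\<bar> \<le> B" shows "exp_growth k"
  by (rule exp_growthI[of _ 0 B]) (use assms in auto)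

lemma exp_growth_lipschitz_exp:
  fixes f :: "real \<Rightarrow> real"
  assumes lip: "\<And>x y. \<bar>f x - f y\<bar> \<le> b * \<bar>x - y\<bar>"
  shows "exp_growth (\<lambda>x. exp (c * f x))"
proof -
  have b: "b \<ge> 0" using order_trans[OF abs_ge_zero lip[of 1 0]] by simp
  then have "b-lipschitz_on UNIV f" using lip by (auto simp: lipschitz_on_def dist_real_def)
  then have "continuous_on UNIV f" by (rule lipschitz_on_continuous_on)
  then have [measurable]: "f \<in> borel_measurable borel" by (rule borel_measurable_continuous_onI)
  have "\<bar>exp (c * f x)\<bar> \<le> exp (\<bar>c\<bar> * \<bar>f 0\<bar>) * exp ((\<bar>c\<bar> * b) * \<bar>x\<bar>)" for x
  proof -
    have "\<bar>f x\<bar> \<le> \<bar>f 0\<bar> + b * \<bar>x\<bar>" using lip[of x 0] by simp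
    then have "\<bar>c\<bar> * \<bar>f x\<bar> \<le> \<bar>c\<bar> * (\<bar>f 0\<bar> + b * \<bar>x\<bar>)" by (intro mult_left_mono) auto
    moreover have "c * f x \<le> \<bar>c\<bar> * \<bar>f x\<bar>" by (metis abs_ge_self abs_mult)
    ultimately have "c * f x \<le> \<bar>c\<bar> * \<bar>f 0\<bar> + (\<bar>c\<bar> * b) * \<bar>x\<bar>" by (simp add: algebra_simps)
    then have "exp (c * f x) \<le> exp (\<bar>c\<bar> * \<bar>f 0\<bar> + (\<bar>c\<bar> * b) * \<bar>x\<bar>)" by simp
    then show ?thesis by (simp only: exp_add abs_exp_cancel)
  qed
  with b show ?thesis by (intro exp_growthI[of _ "\<bar>c\<bar> * b" "exp (\<bar>c\<bar> * \<bar>f 0\<bar>)"]) auto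
qed

text \<open>The bound is uniform over all factors \<open>s\<close> of modulus at most
  \<open>V\<close>, so it dominates a whole range of variances at once.\<close>

lemma exp_abs_shift_le:
  fixes a x s g V :: real
  assumes "a \<ge> 0" "A \<ge> 0" "\<bar>s\<bar> \<le> V"
  shows "A * exp (a * \<bar>x + s * g\<bar>) \<le> A * exp (a * \<bar>x\<bar>) * exp (a * V * \<bar>g\<bar>)"
proof -
  have "\<bar>x + s * g\<bar> \<le> \<bar>x\<bar> + \<bar>s\<bar> * \<bar>g\<bar>" by (simp add: abs_mult[symmetric])
  also have "\<dots> \<le> \<bar>x\<bar> + V * \<bar>g\<bar>" using assms(3) by (intro add_left_mono mult_right_mono) auto
  finally have "a * \<bar>x + s * g\<bar> \<le> a * \<bar>x\<bar> + a * V * \<bar>g\<bar>"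
    using mult_left_mono[OF _ assms(1), of "\<bar>x + s * g\<bar>" "\<bar>x\<bar> + V * \<bar>g\<bar>"] by (simp add: distrib_left mult.assoc)
  then have "exp (a * \<bar>x + s * g\<bar>) \<le> exp (a * \<bar>x\<bar>) * exp (a * V * \<bar>g\<bar>)"
    by (simp add: exp_add[symmetric])
  then show ?thesis using assms(2) by (simp add: mult.assoc mult_left_mono)
qed

lemma exp_growth_affine:
  assumes "exp_growth k" shows "exp_growth (\<lambda>g. k (x + s * g))"
proof -
  obtain A a where A: "A \<ge> 0" "a \<ge> 0" "\<And>x. \<bar>k x\<bar> \<le> A * exp (a * \<bar>x\<bar>)"
    by (rule exp_growth2E[OF assms assms]) (rule that)
  note [measurable] = exp_growth_measurable[OF assms]
  have "\<bar>k (x + s * g)\<bar> \<le> A * exp (a * \<bar>x\<bar>) * exp ((a * \<bar>s\<bar>) * \<bar>g\<bar>)" for g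
    using order_trans[OF A(3) exp_abs_shift_le[OF A(2,1) order_refl]] .
  with A(2) show ?thesis by (intro exp_growthI[of _ "a * \<bar>s\<bar>" "A * exp (a * \<bar>x\<bar>)"]) auto
qed

lemma exp_growth_integrable:
  assumes "exp_growth k" shows "integrable gauss (\<lambda>g. k (x + s * g))"
  using exp_growth_affine[OF assms, of x s] integrable_gauss_bound unfolding exp_growth_def by blast

lemma exp_growth_integrable0: "exp_growth k \<Longrightarrow> integrable gauss k"
  using exp_growth_integrable[of k 0 1] by simp

lemma exp_growth_id: "exp_growth (\<lambda>x. x)"
  by (rule exp_growthI[of _ 1 1]) (auto simp: abs_le_exp_abs)

lemma gauss_conv_DERIV:
  assumes der: "\<And>x. (k has_real_derivative k' x) (at x)"
    and k: "exp_growth k" "exp_growth k'"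
  shows "((\<lambda>x. \<integral>g. k (x + s * g) \<partial>gauss) has_real_derivative (\<integral>g. k' (x + s * g) \<partial>gauss)) (at x)"
proof -
  obtain A a where A: "A \<ge> 0" "a \<ge> 0" "\<And>x. \<bar>k x\<bar> \<le> A * exp (a * \<bar>x\<bar>)" "\<And>x. \<bar>k' x\<bar> \<le> A * exp (a * \<bar>x\<bar>)"
    by (rule exp_growth2E[OF k]) (rule that)
  show ?thesis
  proof (rule DERIV_under_integral[where e=1 and B="\<lambda>g. A * exp a * exp (a * \<bar>x\<bar>) * exp (a * \<bar>s\<bar> * \<bar>g\<bar>)"])
    show "integrable gauss (\<lambda>g. k (x + s * g))" by (rule exp_growth_integrable[OF k(1)])
    show "integrable gauss (\<lambda>g. A * exp a * exp (a * \<bar>x\<bar>) * exp (a * \<bar>s\<bar> * \<bar>g\<bar>))"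
      using integrable_gauss_exp_abs[of "a * \<bar>s\<bar>"] A by simp
    fix y g :: real assume y: "\<bar>y - x\<bar> < 1"
    show "(\<lambda>g. k (y + s * g)) \<in> borel_measurable gauss"
      using exp_growth_measurable[OF k(1)] by (simp add: borel_measurable_gauss)
    show "((\<lambda>y. k (y + s * g)) has_real_derivative k' (y + s * g)) (at y)"
      by (rule DERIV_chain'[where g=k and f="\<lambda>y. y + s * g" and E="k' (y + s * g)" and D=1, simplified])
        (auto intro!: derivative_eq_intros der)
    have "a * \<bar>y\<bar> \<le> a * (1 + \<bar>x\<bar>)" using y A(2) by (intro mult_left_mono) auto
    then have "exp (a * \<bar>y\<bar>) \<le> exp (a + a * \<bar>x\<bar>)" by (simp add: distrib_left)
    then have "exp (a * \<bar>y\<bar>) \<le> exp a * exp (a * \<bar>x\<bar>)" by (simp only: exp_add)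
    then have "A * exp (a * \<bar>y\<bar>) * exp (a * \<bar>s\<bar> * \<bar>g\<bar>) \<le> A * (exp a * exp (a * \<bar>x\<bar>)) * exp (a * \<bar>s\<bar> * \<bar>g\<bar>)"
      using A(1) by (intro mult_right_mono mult_left_mono) auto
    then show "\<bar>k' (y + s * g)\<bar> \<le> A * exp a * exp (a * \<bar>x\<bar>) * exp (a * \<bar>s\<bar> * \<bar>g\<bar>)"
      using order_trans[OF A(4)[of "y + s * g"] exp_abs_shift_le[OF A(2,1) order_refl, of y s g]] by (simp add: mult.assoc)
  qed simp
qed

text \<open>The heat equation. Differentiating \<open>sqrt v\<close> leaves the factor
  \<open>g / (2 * sqrt v)\<close>; Gaussian integration by parts trades the \<open>g\<close> for
  \<open>sqrt v\<close> and one more derivative of \<open>k\<close>, and \<open>sqrt v\<close>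
  cancels.\<close>

lemma gauss_conv_heat:
  assumes der: "\<And>x. (k has_real_derivative k' x) (at x)" "\<And>x. (k' has_real_derivative k'' x) (at x)"
    and k: "exp_growth k" "exp_growth k'" "exp_growth k''" and v: "v > 0"
  shows "((\<lambda>v. \<integral>g. k (x + sqrt v * g) \<partial>gauss) has_real_derivative (\<integral>g. k'' (x + sqrt v * g) \<partial>gauss) / 2) (at v)"
proof -
  obtain A a where A: "A \<ge> 0" "a \<ge> 0" "\<And>x. \<bar>k x\<bar> \<le> A * exp (a * \<bar>x\<bar>)" "\<And>x. \<bar>k' x\<bar> \<le> A * exp (a * \<bar>x\<bar>)"
    by (rule exp_growth2E[OF k(1,2)]) (rule that)
  define C where "C = A * exp (a * \<bar>x\<bar>) / (2 * sqrt (v / 2))"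
  have "((\<lambda>v. \<integral>g. k (x + sqrt v * g) \<partial>gauss) has_real_derivative (\<integral>g. k' (x + sqrt v * g) * (g / (2 * sqrt v)) \<partial>gauss)) (at v)"
  \<comment> \<open>A neighbourhood of radius \<open>v / 2\<close> keeps \<open>u\<close> between
    \<open>v / 2\<close> and \<open>2 * v\<close>, away from the singularity of
    \<open>1 / sqrt u\<close> at 0.\<close>
  proof (rule DERIV_under_integral[where e="v/2" and B="\<lambda>g. C * (\<bar>g\<bar> * exp (a * sqrt (2 * v) * \<bar>g\<bar>))"])
    show "integrable gauss (\<lambda>g. k (x + sqrt v * g))" by (rule exp_growth_integrable[OF k(1)])
    have "exp_growth (\<lambda>g. exp ((a * sqrt (2 * v)) * \<bar>g\<bar>))"
      by (rule exp_growth_lipschitz_exp[where b=1]) simp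
    moreover have "exp_growth (\<lambda>g. \<bar>g\<bar>)"
      by (rule exp_growthI[of _ 1 1]) (auto simp: abs_le_exp_abs)
    ultimately show "integrable gauss (\<lambda>g. C * (\<bar>g\<bar> * exp (a * sqrt (2 * v) * \<bar>g\<bar>)))"
      using exp_growth_integrable0[OF exp_growth_mult] by simp
    fix u g :: real assume "\<bar>u - v\<bar> < v / 2"
    then have u: "v / 2 < u" "u < 2 * v" "u > 0" using v by (auto simp: abs_if split: if_splits)
    show "(\<lambda>g. k (x + sqrt u * g)) \<in> borel_measurable gauss"
      using exp_growth_measurable[OF k(1)] by (simp add: borel_measurable_gauss)
    show "((\<lambda>u. k (x + sqrt u * g)) has_real_derivative k' (x + sqrt u * g) * (g / (2 * sqrt u))) (at u)"
      by (rule DERIV_chain'[where g=k and f="\<lambda>u. x + sqrt u * g"])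
        (use u in \<open>auto intro!: derivative_eq_intros der simp: field_simps\<close>)
    have 1: "\<bar>k' (x + sqrt u * g)\<bar> \<le> A * exp (a * \<bar>x\<bar>) * exp (a * sqrt (2 * v) * \<bar>g\<bar>)"
      by (rule order_trans[OF A(4) exp_abs_shift_le[OF A(2,1)]]) (use u in simp)
    have 2: "\<bar>g / (2 * sqrt u)\<bar> \<le> \<bar>g\<bar> / (2 * sqrt (v / 2))"
      using u v by (auto simp: abs_div intro!: divide_left_mono)
    have "\<bar>k' (x + sqrt u * g) * (g / (2 * sqrt u))\<bar> \<le> (A * exp (a * \<bar>x\<bar>) * exp (a * sqrt (2 * v) * \<bar>g\<bar>)) * (\<bar>g\<bar> / (2 * sqrt (v / 2)))"
      unfolding abs_mult using 1 2 A(1) by (intro mult_mono) auto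
    then show "\<bar>k' (x + sqrt u * g) * (g / (2 * sqrt u))\<bar> \<le> C * (\<bar>g\<bar> * exp (a * sqrt (2 * v) * \<bar>g\<bar>))"
      by (simp add: C_def mult_ac)
  qed (use v in simp)
  moreover have "(\<integral>g. g * k' (x + sqrt v * g) \<partial>gauss) = (\<integral>g. sqrt v * k'' (x + sqrt v * g) \<partial>gauss)"
  proof -
    have c: "exp_growth (\<lambda>g. sqrt v * k'' (x + sqrt v * g))"
      by (rule exp_growth_mult[OF exp_growth_bounded[where B="\<bar>sqrt v\<bar>"] exp_growth_affine[OF k(3)]]) auto
    obtain B b where B: "b \<ge> 0" "\<And>g. \<bar>k' (x + sqrt v * g)\<bar> \<le> B * exp (b * \<bar>g\<bar>)" "\<And>g. \<bar>sqrt v * k'' (x + sqrt v * g)\<bar> \<le> B * exp (b * \<bar>g\<bar>)"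
      by (rule exp_growth2E[OF exp_growth_affine[OF k(2)] c]) (rule that)
    have "((\<lambda>g. k' (x + sqrt v * g)) has_real_derivative sqrt v * k'' (x + sqrt v * g)) (at g)" for g
    proof -
      have "((\<lambda>g. x + sqrt v * g) has_real_derivative sqrt v) (at g)" by (auto intro!: derivative_eq_intros)
      from DERIV_chain'[OF this der(2)] show ?thesis by (simp add: mult.commute)
    qed
    then show ?thesis by (rule gauss_integration_by_parts[OF _ B])
  qed
  then have "(\<integral>g. g * k' (x + sqrt v * g) / (2 * sqrt v) \<partial>gauss) = (\<integral>g. k'' (x + sqrt v * g) \<partial>gauss) / 2"
    using v by simp
  moreover have "k' (x + sqrt v * g) * (g / (2 * sqrt v)) = g * k' (x + sqrt v * g) / (2 * sqrt v)" for g by simp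
  ultimately show ?thesis by (simp only:)
qed

text \<open>The heat equation says nothing at variance 0. Continuity up to there lets mean value
  arguments reach it and successive steps be glued.\<close>

lemma gauss_conv_continuous:
  assumes "continuous_on UNIV k" and k: "exp_growth k"
  shows "continuous_on {0..V} (\<lambda>v. \<integral>g. k (x + sqrt v * g) \<partial>gauss)"
  unfolding continuous_on_sequentially
proof (intro allI ballI impI)
  fix X v assume vX: "v \<in> {0..V}" and X: "(\<forall>n. X n \<in> {0..V}) \<and> X \<longlonglongrightarrow> v"
  obtain A a where A: "A \<ge> 0" "a \<ge> 0" "\<And>x. \<bar>k x\<bar> \<le> A * exp (a * \<bar>x\<bar>)" by (rule exp_growth2E[OF k k]) (rule that)
  have "(\<lambda>n. \<integral>g. k (x + sqrt (X n) * g) \<partial>gauss) \<longlonglongrightarrow> (\<integral>g. k (x + sqrt v * g) \<partial>gauss)"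
  proof (rule integral_dominated_convergence[where w="\<lambda>g. A * exp (a * \<bar>x\<bar>) * exp (a * sqrt V * \<bar>g\<bar>)"])
    show "(\<lambda>g. k (x + sqrt v * g)) \<in> borel_measurable gauss" "\<And>n. (\<lambda>g. k (x + sqrt (X n) * g)) \<in> borel_measurable gauss"
      using exp_growth_measurable[OF k] by (simp_all add: borel_measurable_gauss)
    show "integrable gauss (\<lambda>g. A * exp (a * \<bar>x\<bar>) * exp (a * sqrt V * \<bar>g\<bar>))"
      using integrable_gauss_exp_abs[of "a * sqrt V"] A vX by simp
    show "AE g in gauss. (\<lambda>n. k (x + sqrt (X n) * g)) \<longlonglongrightarrow> k (x + sqrt v * g)"
    proof (intro AE_I2)
      fix g
      have "(\<lambda>n. x + sqrt (X n) * g) \<longlonglongrightarrow> x + sqrt v * g"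
        using X by (intro tendsto_intros) auto
      moreover have "isCont k (x + sqrt v * g)" using assms(1) by (simp add: continuous_on_eq_continuous_at)
      ultimately show "(\<lambda>n. k (x + sqrt (X n) * g)) \<longlonglongrightarrow> k (x + sqrt v * g)"
        by (rule isCont_tendsto_compose[rotated])
    qed
    show "AE g in gauss. norm (k (x + sqrt (X n) * g)) \<le> A * exp (a * \<bar>x\<bar>) * exp (a * sqrt V * \<bar>g\<bar>)" for n
    proof (intro AE_I2)
      fix g
      have "\<bar>sqrt (X n)\<bar> \<le> sqrt V" using X by simp
      from order_trans[OF A(3) exp_abs_shift_le[OF A(2,1) this]]
      show "norm (k (x + sqrt (X n) * g)) \<le> A * exp (a * \<bar>x\<bar>) * exp (a * sqrt V * \<bar>g\<bar>)" by simp
    qed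
  qed
  then show "((\<lambda>v. \<integral>g. k (x + sqrt v * g) \<partial>gauss) \<circ> X) \<longlonglongrightarrow> (\<integral>g. k (x + sqrt v * g) \<partial>gauss)" by (simp add: comp_def)
qed

subsection \<open>The Cole-Hopf recursion\<close>

text \<open>One step of the Parisi recursion: the Cole-Hopf solution, after time \<open>v\<close>, of the equation
  with constant coefficient \<open>c\<close> and terminal value \<open>f\<close>.\<close>

definition cole_hopf :: "real \<Rightarrow> real \<Rightarrow> (real \<Rightarrow> real) \<Rightarrow> real \<Rightarrow> real" where
  "cole_hopf c v f x = ln (\<integral>g. exp (c * f (x + sqrt v * g)) \<partial>gauss) / c"

text \<open>Expectation under the Gaussian law tilted by \<open>exp (c * f)\<close>, the transition
  kernel of the diffusion attached to the Parisi equation. The space derivatives of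
  \<open>cole_hopf\<close> are expressed through it.\<close>

definition tilt :: "real \<Rightarrow> real \<Rightarrow> (real \<Rightarrow> real) \<Rightarrow> (real \<Rightarrow> real) \<Rightarrow> real \<Rightarrow> real" where
  "tilt c v f h x = (\<integral>g. h (x + sqrt v * g) * exp (c * f (x + sqrt v * g)) \<partial>gauss)
     / (\<integral>g. exp (c * f (x + sqrt v * g)) \<partial>gauss)"

text \<open>Up to the factor \<open>v\<close>, an upper bound for the second moment of the
  displacement under \<open>tilt\<close>. The exponential pays for the change of density caused by a
  1-Lipschitz \<open>f\<close> and an exponent at most 1.\<close>

definition quad_moment :: "real \<Rightarrow> real" where
  "quad_moment V = (\<integral>g. g\<^sup>2 * exp (sqrt V * \<bar>g\<bar>) \<partial>gauss)"

text \<open>The quantity \<open>f2 + c * f1\<^sup>2\<close> solves a linear equation, so that its bounds propagate;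
  \<open>f3 + 2 * c * f1 * f2\<close> is its derivative.\<close>

definition parisi_profile ::
    "real \<Rightarrow> real \<Rightarrow> (real \<Rightarrow> real) \<Rightarrow> (real \<Rightarrow> real) \<Rightarrow> (real \<Rightarrow> real) \<Rightarrow> (real \<Rightarrow> real) \<Rightarrow> bool" where
  "parisi_profile c K f f1 f2 f3 \<longleftrightarrow>
     (\<forall>x. (f has_real_derivative f1 x) (at x)) \<and> (\<forall>x. (f1 has_real_derivative f2 x) (at x)) \<and>
     (\<forall>x. (f2 has_real_derivative f3 x) (at x)) \<and> (\<forall>x. \<bar>f1 x\<bar> \<le> 1) \<and> (\<forall>x. 0 \<le> f2 x) \<and>
     (\<forall>x. f2 x + c * (f1 x)\<^sup>2 \<le> 1) \<and> (\<forall>x. \<bar>f3 x + 2 * c * f1 x * f2 x\<bar> \<le> K)"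

lemma DERIV_abs_bound_lipschitz:
  fixes f f' :: "real \<Rightarrow> real"
  assumes "\<And>x. (f has_real_derivative f' x) (at x)" "\<And>x. \<bar>f' x\<bar> \<le> B"
  shows "\<bar>f x - f y\<bar> \<le> B * \<bar>x - y\<bar>"
  using field_differentiable_bound[of UNIV f f' B x y] assms by simp

lemma DERIV_imp_borel_measurable:
  fixes f f' :: "real \<Rightarrow> real"
  assumes "\<And>x. (f has_real_derivative f' x) (at x)"
  shows "f \<in> borel_measurable borel"
proof (rule borel_measurable_continuous_onI)
  show "continuous_on UNIV f" using assms by (meson DERIV_continuous_on has_field_derivative_at_within)
qed

lemma DERIV_borel_measurable:
  fixes f f' :: "real \<Rightarrow> real"
  assumes d: "\<And>x. (f has_real_derivative f' x) (at x)"
  shows "f' \<in> borel_measurable borel"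
proof (rule borel_measurable_LIMSEQ_real)
  note [measurable] = DERIV_imp_borel_measurable[OF d]
  show "(\<lambda>x. (f (x + 1 / real (Suc n)) - f x) / (1 / real (Suc n))) \<in> borel_measurable borel" for n by simp
  fix x
  have "((\<lambda>h. (f (x + h) - f x) / h) \<longlongrightarrow> f' x) (at 0)" using d[of x] by (simp add: DERIV_def)
  moreover have "filterlim (\<lambda>n. 1 / real (Suc n)) (at 0) sequentially"
    by (simp add: filterlim_at LIMSEQ_Suc[OF lim_const_over_n[of 1], simplified])
  ultimately show "(\<lambda>n. (f (x + 1 / real (Suc n)) - f x) / (1 / real (Suc n))) \<longlonglongrightarrow> f' x"
    by (rule filterlim_compose)
qed

locale profile_step =
  fixes c v K :: real and f f1 f2 f3 :: "real \<Rightarrow> real"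
  assumes c: "0 < c" "c \<le> 1" and v: "0 \<le> v" and prof: "parisi_profile c K f f1 f2 f3"
begin

lemma der: "(f has_real_derivative f1 x) (at x)" "(f1 has_real_derivative f2 x) (at x)"
    "(f2 has_real_derivative f3 x) (at x)"
  and f1_le: "\<bar>f1 x\<bar> \<le> 1" and f2_nn: "0 \<le> f2 x" and w_le: "f2 x + c * (f1 x)\<^sup>2 \<le> 1"
  and w'_le: "\<bar>f3 x + 2 * c * f1 x * f2 x\<bar> \<le> K"
  using prof by (auto simp: parisi_profile_def)

definition w where "w x = f2 x + c * (f1 x)\<^sup>2"
definition w' where "w' x = f3 x + 2 * c * f1 x * f2 x"

lemma K_nn: "K \<ge> 0" using w'_le[of 0] by linarith

lemma w_nn: "0 \<le> w x" and w_le1: "w x \<le> 1"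
  using f2_nn w_le c by (auto simp: w_def)

lemma der_w: "(w has_real_derivative w' x) (at x)"
  unfolding w_def w'_def by (auto intro!: derivative_eq_intros der)

lemma f2_le: "f2 x \<le> 1" using w_le[of x] c zero_le_power2[of "f1 x"] mult_nonneg_nonneg[of c "(f1 x)\<^sup>2"] by linarith

lemma lip: "\<bar>f x - f y\<bar> \<le> \<bar>x - y\<bar>" "\<bar>f1 x - f1 y\<bar> \<le> \<bar>x - y\<bar>" "\<bar>w x - w y\<bar> \<le> K * \<bar>x - y\<bar>"
  using DERIV_abs_bound_lipschitz[of f f1 1 x y] DERIV_abs_bound_lipschitz[of f1 f2 1 x y]
    DERIV_abs_bound_lipschitz[of w w' K x y] der f1_le f2_nn f2_le der_w w'_le
  by (auto simp: w'_def)

lemma meas [measurable]: "f \<in> borel_measurable borel" "f1 \<in> borel_measurable borel" "f2 \<in> borel_measurable borel"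
    "f3 \<in> borel_measurable borel" "w \<in> borel_measurable borel" "w' \<in> borel_measurable borel"
  using DERIV_imp_borel_measurable[OF der(1)] DERIV_imp_borel_measurable[OF der(2)] DERIV_imp_borel_measurable[OF der(3)]
    DERIV_borel_measurable[OF der(3)] DERIV_imp_borel_measurable[OF der_w] DERIV_borel_measurable[OF der_w] by auto

lemma growth_exp: "exp_growth (\<lambda>x. exp (c * f x))"
  by (rule exp_growth_lipschitz_exp[where b=1]) (use lip in simp)

lemma growth_bounded: "exp_growth f1" "exp_growth f2" "exp_growth w" "exp_growth w'"
proof -
  show "exp_growth f1" by (rule exp_growth_bounded[where B=1]) (use f1_le in auto)
  show "exp_growth f2" by (rule exp_growth_bounded[where B=1]) (use f2_nn f2_le in auto)
  show "exp_growth w" by (rule exp_growth_bounded[where B=1]) (use w_nn w_le1 in auto)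
  show "exp_growth w'" by (rule exp_growth_bounded[where B=K]) (use w'_le in \<open>auto simp: w'_def\<close>)
qed

definition N where "N h x = (\<integral>g. h (x + sqrt v * g) * exp (c * f (x + sqrt v * g)) \<partial>gauss)"

lemma N_integrable: "exp_growth h \<Longrightarrow> integrable gauss (\<lambda>g. h (x + sqrt v * g) * exp (c * f (x + sqrt v * g)))"
  using exp_growth_integrable[OF exp_growth_mult[OF _ growth_exp]] .

lemma growth_const: "exp_growth (\<lambda>_. a)" by (rule exp_growth_bounded[where B="\<bar>a\<bar>"]) auto

lemma growth_add: assumes "exp_growth h" "exp_growth k" shows "exp_growth (\<lambda>x. h x + k x)"
proof -
  obtain A a where A: "A \<ge> 0" "a \<ge> 0" "\<And>x. \<bar>h x\<bar> \<le> A * exp (a * \<bar>x\<bar>)" "\<And>x. \<bar>k x\<bar> \<le> A * exp (a * \<bar>x\<bar>)"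
    by (rule exp_growth2E[OF assms]) (rule that)
  show ?thesis
  proof (rule exp_growthI[of _ a "2 * A"])
    show "\<bar>h x + k x\<bar> \<le> 2 * A * exp (a * \<bar>x\<bar>)" for x using A(3,4)[of x] by linarith
  qed (use A assms exp_growth_measurable in auto)
qed

lemma N_add: "exp_growth h \<Longrightarrow> exp_growth k \<Longrightarrow> N (\<lambda>x. h x + k x) x = N h x + N k x"
  unfolding N_def by (simp add: distrib_right Bochner_Integration.integral_add N_integrable)

lemma N_cmult: "N (\<lambda>x. a * h x) x = a * N h x"
  unfolding N_def by (simp add: mult.assoc)

lemma N_mono: "exp_growth h \<Longrightarrow> exp_growth k \<Longrightarrow> (\<And>x. h x \<le> k x) \<Longrightarrow> N h x \<le> N k x"
  unfolding N_def by (intro integral_mono N_integrable) (auto intro: mult_right_mono)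

text \<open>A convex \<open>f\<close> lies above its tangent at \<open>x\<close>, so the integrand
  dominates \<open>exp (c * f x)\<close> times the exponential of a centered Gaussian variable,
  whose mean is at least 1.\<close>

lemma Z_pos: "N (\<lambda>_. 1) x > 0" and Z_ge: "N (\<lambda>_. 1) x \<ge> exp (c * f x)"
proof -
  have tangent: "f y \<ge> f x + f1 x * (y - x)" for y
  proof -
    have "convex_on UNIV f"
      by (rule f''_ge0_imp_convex[where f'=f1 and f''=f2]) (use der f2_nn in auto)
    then have "f y - f x \<ge> f1 x * (y - x)"
      by (rule convex_on_imp_above_tangent) (use der in \<open>auto intro: has_field_derivative_at_within\<close>)
    then show ?thesis by simp
  qed
  have "exp (c * f x) * 1 \<le> exp (c * f x) * exp ((c * f1 x * sqrt v)\<^sup>2 / 2)" by (intro mult_left_mono) auto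
  also have "\<dots> = (\<integral>g. exp (c * f x) * exp ((c * f1 x * sqrt v) * g) \<partial>gauss)" by (simp add: integral_gauss_exp)
  also have "\<dots> \<le> N (\<lambda>_. 1) x"
    unfolding N_def
  proof (rule integral_mono)
    show "integrable gauss (\<lambda>g. exp (c * f x) * exp ((c * f1 x * sqrt v) * g))"
      by (intro integrable_mult_right integrable_gauss_exp)
    show "integrable gauss (\<lambda>g. 1 * exp (c * f (x + sqrt v * g)))" by (rule N_integrable[OF growth_const])
    fix g
    have "c * f (x + sqrt v * g) \<ge> c * (f x + f1 x * (sqrt v * g))"
      using tangent[of "x + sqrt v * g"] c by (intro mult_left_mono) auto
    then have "exp (c * f x + (c * f1 x * sqrt v) * g) \<le> exp (c * f (x + sqrt v * g))" by (simp add: algebra_simps)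
    then show "exp (c * f x) * exp ((c * f1 x * sqrt v) * g) \<le> 1 * exp (c * f (x + sqrt v * g))"
      by (simp only: exp_add mult_1)
  qed
  finally show "N (\<lambda>_. 1) x \<ge> exp (c * f x)" by simp
  then show "N (\<lambda>_. 1) x > 0" using exp_gt_zero[of "c * f x"] by linarith
qed

abbreviation E where "E h x \<equiv> tilt c v f h x"

lemma E_eq: "E h x = N h x / N (\<lambda>_. 1) x" by (simp add: tilt_def N_def)

lemma cole_hopf_eq: "cole_hopf c v f x = ln (N (\<lambda>_. 1) x) / c" by (simp add: cole_hopf_def N_def)

lemma E_const: "E (\<lambda>_. a) x = a"
  using Z_pos[of x] N_cmult[of a "\<lambda>_. 1" x] by (simp add: E_eq)

lemma E_add: "exp_growth h \<Longrightarrow> exp_growth k \<Longrightarrow> E (\<lambda>x. h x + k x) x = E h x + E k x"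
  by (simp add: E_eq N_add add_divide_distrib)

lemma E_cmult: "E (\<lambda>x. a * h x) x = a * E h x"
  by (simp add: E_eq N_cmult)

lemma E_mono: "exp_growth h \<Longrightarrow> exp_growth k \<Longrightarrow> (\<And>x. h x \<le> k x) \<Longrightarrow> E h x \<le> E k x"
  using Z_pos[of x] by (simp add: E_eq N_mono divide_right_mono)

lemma E_abs_le: "exp_growth h \<Longrightarrow> (\<And>x. \<bar>h x\<bar> \<le> k x) \<Longrightarrow> exp_growth k \<Longrightarrow> \<bar>E h x\<bar> \<le> E k x"
  using E_mono[of h k x] E_mono[of "\<lambda>x. (-1) * h x" k x] E_cmult[of "-1" h x]
    exp_growth_mult[OF growth_const[of "-1"], of h] by (auto simp: abs_le_iff)

text \<open>Expand the nonnegative \<open>(h - m)\<^sup>2\<close>, where \<open>m\<close> is the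
  tilted mean.\<close>

lemma E_square_le: assumes h: "exp_growth h" shows "(E h x)\<^sup>2 \<le> E (\<lambda>x. (h x)\<^sup>2) x"
proof -
  define m where "m = E h x"
  have h2: "exp_growth (\<lambda>x. (h x)\<^sup>2)" using exp_growth_mult[OF h h] by (simp add: power2_eq_square)
  have h1: "exp_growth (\<lambda>x. (- 2 * m) * h x)" by (rule exp_growth_mult[OF growth_const h])
  have "0 = E (\<lambda>_. 0) x" by (simp add: E_const)
  also have "\<dots> \<le> E (\<lambda>x. ((h x)\<^sup>2 + (- 2 * m) * h x) + m\<^sup>2) x"
  proof (rule E_mono)
    fix y show "0 \<le> ((h y)\<^sup>2 + (- 2 * m) * h y) + m\<^sup>2"
      using zero_le_power2[of "h y - m"] by (simp add: power2_eq_square algebra_simps)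
  qed (intro growth_const growth_add h1 h2)+
  also have "\<dots> = E (\<lambda>x. (h x)\<^sup>2) x + (- 2 * m) * m + m\<^sup>2"
    by (simp only: E_add[OF growth_add[OF h2 h1] growth_const] E_add[OF h2 h1] E_cmult E_const m_def[symmetric])
  finally show ?thesis by (simp add: m_def power2_eq_square)
qed

lemma N_DERIV:
  assumes d: "\<And>x. (h has_real_derivative h' x) (at x)" and h: "exp_growth h" "exp_growth h'"
  shows "(N h has_real_derivative N (\<lambda>x. h' x + c * (h x * f1 x)) x) (at x)"
proof -
  have "((\<lambda>x. \<integral>g. h (x + sqrt v * g) * exp (c * f (x + sqrt v * g)) \<partial>gauss) has_real_derivative
     (\<integral>g. (h' (x + sqrt v * g) + c * (h (x + sqrt v * g) * f1 (x + sqrt v * g))) * exp (c * f (x + sqrt v * g)) \<partial>gauss)) (at x)"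
  proof (rule gauss_conv_DERIV[where k="\<lambda>y. h y * exp (c * f y)" and k'="\<lambda>y. (h' y + c * (h y * f1 y)) * exp (c * f y)"])
    show "((\<lambda>y. h y * exp (c * f y)) has_real_derivative (h' y + c * (h y * f1 y)) * exp (c * f y)) (at y)" for y
      by (auto intro!: derivative_eq_intros d der simp: algebra_simps)
    show "exp_growth (\<lambda>y. h y * exp (c * f y))" by (rule exp_growth_mult[OF h(1) growth_exp])
    show "exp_growth (\<lambda>y. (h' y + c * (h y * f1 y)) * exp (c * f y))"
      by (rule exp_growth_mult[OF growth_add[OF h(2) exp_growth_mult[OF growth_const exp_growth_mult[OF h(1) growth_bounded(1)]]] growth_exp])
  qed
  then show ?thesis unfolding N_def .
qed

lemma Z_DERIV: "(N (\<lambda>_. 1) has_real_derivative c * N f1 x) (at x)"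
  using N_DERIV[of "\<lambda>_. 1" "\<lambda>_. 0" x] growth_const N_cmult[of c f1 x] by simp

text \<open>Moving \<open>x\<close> also changes the tilt, which adds \<open>c\<close> times the
  covariance with \<open>f1\<close>.\<close>

lemma E_DERIV:
  assumes d: "\<And>x. (h has_real_derivative h' x) (at x)" and h: "exp_growth h" "exp_growth h'"
  shows "(E h has_real_derivative E h' x + c * (E (\<lambda>x. h x * f1 x) x - E h x * E f1 x)) (at x)"
proof -
  have g: "exp_growth (\<lambda>x. c * (h x * f1 x))"
    by (rule exp_growth_mult[OF growth_const exp_growth_mult[OF h(1) growth_bounded(1)]])
  have "((\<lambda>x. N h x / N (\<lambda>_. 1) x) has_real_derivative
     (N (\<lambda>x. h' x + c * (h x * f1 x)) x * N (\<lambda>_. 1) x - N h x * (c * N f1 x)) / (N (\<lambda>_. 1) x * N (\<lambda>_. 1) x)) (at x)"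
    by (rule DERIV_divide[OF N_DERIV[OF d h] Z_DERIV]) (use Z_pos[of x] in simp)
  moreover have "(N (\<lambda>x. h' x + c * (h x * f1 x)) x * N (\<lambda>_. 1) x - N h x * (c * N f1 x)) / (N (\<lambda>_. 1) x * N (\<lambda>_. 1) x)
     = E h' x + c * (E (\<lambda>x. h x * f1 x) x - E h x * E f1 x)"
  proof -
    have "N (\<lambda>x. h' x + c * (h x * f1 x)) x = N h' x + c * N (\<lambda>x. h x * f1 x) x"
      by (simp only: N_add[OF h(2) g] N_cmult)
    then show ?thesis unfolding E_eq using Z_pos[of x] by (simp add: field_simps)
  qed
  ultimately show ?thesis unfolding E_eq[abs_def] by simp
qed

text \<open>The derivatives of \<open>cole_hopf c v f\<close>, arranged so that
  \<open>F2 + c * F1\<^sup>2\<close> is the tilted mean of \<open>w\<close>. Then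
  \<open>F3 + 2 * c * F1 * F2\<close> is the derivative of that mean, the quantity bounded in
  \<open>parisi_profile\<close>.\<close>

definition F1 where "F1 = E f1"
definition F2 where "F2 x = E w x - c * (E f1 x)\<^sup>2"
definition F3 where "F3 x = E w' x + c * (E (\<lambda>x. w x * f1 x) x - E w x * E f1 x) - 2 * c * F1 x * F2 x"

lemma DERIV_cole_hopf: "(cole_hopf c v f has_real_derivative F1 x) (at x)"
proof -
  have "((\<lambda>x. ln (N (\<lambda>_. 1) x) / c) has_real_derivative F1 x) (at x)"
    using Z_pos[of x] c by (auto intro!: derivative_eq_intros Z_DERIV simp: F1_def E_eq)
  then show ?thesis unfolding cole_hopf_eq[abs_def] .
qed

lemma DERIV_F1: "(F1 has_real_derivative F2 x) (at x)"
proof -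
  have g: "exp_growth (\<lambda>x. c * (f1 x * f1 x))"
    by (rule exp_growth_mult[OF growth_const exp_growth_mult[OF growth_bounded(1) growth_bounded(1)]])
  have "E w x = E f2 x + c * E (\<lambda>x. f1 x * f1 x) x"
    using E_add[OF growth_bounded(2) g, of x] by (simp add: w_def[abs_def] power2_eq_square E_cmult)
  then show ?thesis
    using E_DERIV[OF der(2) growth_bounded(1,2), of x] by (simp add: F1_def F2_def power2_eq_square algebra_simps)
qed

lemma F2_nn: "F2 x \<ge> 0"
proof -
  have s: "exp_growth (\<lambda>x. (f1 x)\<^sup>2)" using exp_growth_mult[OF growth_bounded(1) growth_bounded(1)] by (simp add: power2_eq_square)
  have "E w x = E f2 x + c * E (\<lambda>x. (f1 x)\<^sup>2) x"
    using E_add[OF growth_bounded(2) exp_growth_mult[OF growth_const s], of c x] by (simp add: w_def[abs_def] E_cmult)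
  moreover have "E f2 x \<ge> 0" using E_mono[OF growth_const growth_bounded(2), of 0 x] f2_nn by (simp add: E_const)
  moreover have "c * (E f1 x)\<^sup>2 \<le> c * E (\<lambda>x. (f1 x)\<^sup>2) x" using E_square_le[OF growth_bounded(1)] c by (intro mult_left_mono) auto
  ultimately show ?thesis by (simp add: F2_def)
qed

lemma DERIV_F2: "(F2 has_real_derivative F3 x) (at x)"
  unfolding F2_def[abs_def] F3_def
  by (rule derivative_eq_intros E_DERIV[OF der_w growth_bounded(3,4)] DERIV_F1[unfolded F1_def] refl)+
    (simp add: F1_def F2_def)

lemma F1_le: "\<bar>F1 x\<bar> \<le> 1"
  using E_abs_le[OF growth_bounded(1) f1_le growth_const, of x] by (simp add: F1_def E_const)

lemma Ew: "F2 x + c * (F1 x)\<^sup>2 = E w x" by (simp add: F2_def F1_def)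

lemma Ew_le: "E w x \<le> 1" and Ew_nn: "0 \<le> E w x"
  using E_mono[OF growth_bounded(3) growth_const, of 1 x] E_mono[OF growth_const growth_bounded(3), of 0 x] w_nn w_le1
  by (simp_all add: E_const)

lemma growth_sq: "exp_growth (\<lambda>y. (y - x)\<^sup>2)"
proof -
  have "exp_growth (\<lambda>y. y + (- x))" by (rule growth_add[OF exp_growth_id growth_const])
  from exp_growth_mult[OF this this] show ?thesis by (simp add: power2_eq_square)
qed

text \<open>The Lipschitz bound on \<open>f\<close> makes the tilting factor at most
  \<open>exp (sqrt V * \<bar>g\<bar>)\<close> times its value at the centre, and by
  \<open>Z_ge\<close> the normalisation is no smaller than that value.\<close>

lemma E_sq_le: assumes V: "v \<le> V" shows "E (\<lambda>y. (y - x)\<^sup>2) x \<le> v * quad_moment V"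
proof -
  have V0: "V \<ge> 0" using v V by linarith
  have g: "exp_growth (\<lambda>g. g * g)" by (rule exp_growth_mult[OF exp_growth_id exp_growth_id])
  have ge: "exp_growth (\<lambda>g. exp (sqrt V * \<bar>g\<bar>))"
    by (rule exp_growth_lipschitz_exp[where b=1]) simp
  have i: "integrable gauss (\<lambda>g. g\<^sup>2 * exp (sqrt V * \<bar>g\<bar>))"
    using exp_growth_integrable0[OF exp_growth_mult[OF g ge]] by (simp add: power2_eq_square)
  have "N (\<lambda>y. (y - x)\<^sup>2) x \<le> (\<integral>g. (v * exp (c * f x)) * (g\<^sup>2 * exp (sqrt V * \<bar>g\<bar>)) \<partial>gauss)"
    unfolding N_def
  proof (rule integral_mono[OF N_integrable[OF growth_sq] integrable_mult_right[OF i]])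
    fix g
    have "c * f (x + sqrt v * g) - c * f x \<le> c * \<bar>f (x + sqrt v * g) - f x\<bar>" using c by (simp add: right_diff_distrib[symmetric])
    also have "\<dots> \<le> 1 * (sqrt v * \<bar>g\<bar>)"
      using c lip(1)[of "x + sqrt v * g" x] v by (intro mult_mono) (auto simp: abs_mult)
    also have "\<dots> \<le> sqrt V * \<bar>g\<bar>" using V v by (simp add: mult_right_mono)
    finally have "exp (c * f (x + sqrt v * g)) \<le> exp (c * f x + sqrt V * \<bar>g\<bar>)" by simp
    then have "v * g\<^sup>2 * exp (c * f (x + sqrt v * g)) \<le> v * g\<^sup>2 * (exp (c * f x) * exp (sqrt V * \<bar>g\<bar>))"
      using v unfolding exp_add by (intro mult_left_mono) auto
    then show "(x + sqrt v * g - x)\<^sup>2 * exp (c * f (x + sqrt v * g)) \<le> v * exp (c * f x) * (g\<^sup>2 * exp (sqrt V * \<bar>g\<bar>))"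
      using v by (simp add: power_mult_distrib mult_ac)
  qed
  also have "\<dots> = v * exp (c * f x) * quad_moment V" by (simp add: quad_moment_def)
  also have "\<dots> \<le> v * N (\<lambda>_. 1) x * quad_moment V"
  proof -
    have "quad_moment V \<ge> 0" unfolding quad_moment_def by (rule Bochner_Integration.integral_nonneg) simp
    then show ?thesis using v Z_ge[of x] by (intro mult_right_mono mult_left_mono) auto
  qed
  finally show ?thesis using Z_pos[of x] by (simp add: E_eq divide_le_eq mult_ac)
qed

text \<open>Both factors are Lipschitz, with constants \<open>K\<close> and 1, so after recentring
  at their values in \<open>x\<close> everything is bounded by the mean square displacement. By
  \<open>E_sq_le\<close> this is of order \<open>v\<close>, not \<open>sqrt v\<close>, and losses of
  order \<open>v\<close> stay bounded when summed over a refined mesh.\<close>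

lemma E_cov_le: "\<bar>E (\<lambda>x. w x * f1 x) x - E w x * E f1 x\<bar> \<le> 2 * K * E (\<lambda>y. (y - x)\<^sup>2) x"
proof -
  let ?a = "w x" and ?b = "f1 x"
  let ?D = "\<lambda>y. (w y + (- ?a)) * (f1 y + (- ?b))" and ?R = "\<lambda>y. \<bar>y - x\<bar>"
  have gw: "exp_growth (\<lambda>y. w y + (- ?a))" and gf: "exp_growth (\<lambda>y. f1 y + (- ?b))"
    by (rule growth_add[OF growth_bounded(3) growth_const], rule growth_add[OF growth_bounded(1) growth_const])
  have gR: "exp_growth ?R"
  proof -
    obtain A a where "a \<ge> 0" "\<And>y. \<bar>y + (- x)\<bar> \<le> A * exp (a * \<bar>y\<bar>)"
      using growth_add[OF exp_growth_id growth_const[of "-x"]] unfolding exp_growth_def by blast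
    then show ?thesis by (intro exp_growthI[of _ a A]) auto
  qed
  have gRK: "exp_growth (\<lambda>y. K * ?R y)" and gK: "exp_growth (\<lambda>y. K * (y - x)\<^sup>2)"
    by (rule exp_growth_mult[OF growth_const gR], rule exp_growth_mult[OF growth_const growth_sq])
  have g1: "exp_growth (\<lambda>y. ?a * f1 y)" and g2: "exp_growth (\<lambda>y. ?b * w y)"
    by (rule exp_growth_mult[OF growth_const growth_bounded(1)], rule exp_growth_mult[OF growth_const growth_bounded(3)])
  \<comment> \<open>Recentring at \<open>x\<close> leaves the mean of a product of two increments
    and a product of two mean increments.\<close>
  have "E (\<lambda>x. w x * f1 x) x = E (\<lambda>y. ?D y + (?a * f1 y + (?b * w y + (- (?a * ?b))))) x"
    by (rule arg_cong[where f="\<lambda>h. E h x"]) (simp add: algebra_simps)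
  also have "\<dots> = E ?D x + (?a * E f1 x + (?b * E w x + (- (?a * ?b))))"
    by (simp only: E_add[OF exp_growth_mult[OF gw gf] growth_add[OF g1 growth_add[OF g2 growth_const]]]
        E_add[OF g1 growth_add[OF g2 growth_const]] E_add[OF g2 growth_const] E_cmult E_const)
  finally have 1: "E (\<lambda>x. w x * f1 x) x - E w x * E f1 x = E ?D x - (E w x - ?a) * (E f1 x - ?b)"
    by (simp add: algebra_simps)
  have "\<bar>E ?D x\<bar> \<le> E (\<lambda>y. K * (y - x)\<^sup>2) x"
  proof (rule E_abs_le[OF exp_growth_mult[OF gw gf] _ gK])
    fix y
    have "\<bar>w y + - ?a\<bar> * \<bar>f1 y + - ?b\<bar> \<le> (K * \<bar>y - x\<bar>) * \<bar>y - x\<bar>"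
      using lip(2,3)[of y x] K_nn by (intro mult_mono) auto
    then show "\<bar>?D y\<bar> \<le> K * (y - x)\<^sup>2" by (simp add: abs_mult power2_eq_square mult.assoc)
  qed
  then have 2: "\<bar>E ?D x\<bar> \<le> K * E (\<lambda>y. (y - x)\<^sup>2) x" by (simp only: E_cmult)
  have 3: "\<bar>E w x - ?a\<bar> \<le> K * E ?R x"
    using E_abs_le[OF gw _ gRK, of x] lip(3)[of _ x] by (simp add: E_add[OF growth_bounded(3) growth_const, of "- w x", simplified] E_const E_cmult)
  have 4: "\<bar>E f1 x - ?b\<bar> \<le> E ?R x"
    using E_abs_le[OF gf _ gR, of x] lip(2)[of _ x] by (simp add: E_add[OF growth_bounded(1) growth_const, of "- f1 x", simplified] E_const)
  have "\<bar>(E w x - ?a) * (E f1 x - ?b)\<bar> \<le> (K * E ?R x) * E ?R x"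
    unfolding abs_mult using 3 4 by (intro mult_mono) auto
  also have "\<dots> = K * (E ?R x)\<^sup>2" by (simp add: power2_eq_square)
  also have "\<dots> \<le> K * E (\<lambda>y. (y - x)\<^sup>2) x"
    using E_square_le[OF gR, of x] K_nn by (intro mult_left_mono) auto
  finally show ?thesis using 1 2 by linarith
qed

text \<open>The zeroth order bounds are those of the tilted mean of \<open>w\<close>. The bound
  \<open>K\<close> on its derivative grows only by a factor \<open>1 + O(v)\<close>, the second term
  coming from the covariance.\<close>

lemma parisi_profile_step:
  assumes "v \<le> V"
  shows "parisi_profile c (K * (1 + 2 * quad_moment V * v)) (cole_hopf c v f) F1 F2 F3"
  unfolding parisi_profile_def
proof (intro conjI allI)
  fix x
  show "F2 x + c * (F1 x)\<^sup>2 \<le> 1" using Ew_le by (simp add: Ew)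
  have "\<bar>E w' x\<bar> \<le> K"
    using E_abs_le[OF growth_bounded(4) _ growth_const, of K x] w'_le by (simp add: w'_def E_const)
  moreover have "\<bar>c * (E (\<lambda>x. w x * f1 x) x - E w x * E f1 x)\<bar> \<le> 1 * (2 * K * (v * quad_moment V))"
    unfolding abs_mult
  proof (rule mult_mono)
    have "\<bar>E (\<lambda>x. w x * f1 x) x - E w x * E f1 x\<bar> \<le> 2 * K * E (\<lambda>y. (y - x)\<^sup>2) x" by (rule E_cov_le)
    also have "\<dots> \<le> 2 * K * (v * quad_moment V)" using E_sq_le[OF assms] K_nn by (intro mult_left_mono) auto
    finally show "\<bar>E (\<lambda>x. w x * f1 x) x - E w x * E f1 x\<bar> \<le> 2 * K * (v * quad_moment V)" .
  qed (use c in auto)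
  ultimately show "\<bar>F3 x + 2 * c * F1 x * F2 x\<bar> \<le> K * (1 + 2 * quad_moment V * v)"
    unfolding F3_def by (simp add: algebra_simps)
qed (use DERIV_cole_hopf DERIV_F1 DERIV_F2 F1_le F2_nn in auto)

text \<open>\<open>exp (c * f)\<close> evolves by the heat equation and its second derivative is
  \<open>c * w * exp (c * f)\<close>. After the logarithm this is the Parisi equation with constant
  coefficient.\<close>

lemma DERIV_cole_hopf_time:
  assumes "v > 0"
  shows "((\<lambda>v. cole_hopf c v f x) has_real_derivative (F2 x + c * (F1 x)\<^sup>2) / 2) (at v)"
proof -
  have "((\<lambda>v. \<integral>g. exp (c * f (x + sqrt v * g)) \<partial>gauss) has_real_derivative
     (\<integral>g. c * (w (x + sqrt v * g) * exp (c * f (x + sqrt v * g))) \<partial>gauss) / 2) (at v)"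
  proof (rule gauss_conv_heat[where k'="\<lambda>y. c * (f1 y * exp (c * f y))"])
    show "((\<lambda>y. exp (c * f y)) has_real_derivative c * (f1 y * exp (c * f y))) (at y)" for y
      by (auto intro!: derivative_eq_intros der)
    show "((\<lambda>y. c * (f1 y * exp (c * f y))) has_real_derivative c * (w y * exp (c * f y))) (at y)" for y
      by (auto intro!: derivative_eq_intros der simp: w_def algebra_simps power2_eq_square)
    show "exp_growth (\<lambda>y. c * (f1 y * exp (c * f y)))" "exp_growth (\<lambda>y. c * (w y * exp (c * f y)))"
      by (rule exp_growth_mult[OF growth_const exp_growth_mult[OF _ growth_exp]], rule growth_bounded)+
  qed (use assms growth_exp in auto)
  then have "((\<lambda>v. \<integral>g. exp (c * f (x + sqrt v * g)) \<partial>gauss) has_real_derivative c * N w x / 2) (at v)"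
    by (simp add: N_def)
  then have "((\<lambda>v. ln (\<integral>g. exp (c * f (x + sqrt v * g)) \<partial>gauss) / c) has_real_derivative E w x / 2) (at v)"
    using Z_pos[of x] c by (auto intro!: derivative_eq_intros simp: E_eq N_def)
  then show ?thesis unfolding cole_hopf_def Ew .
qed

end

lemma cole_hopf_0 [simp]: "c > 0 \<Longrightarrow> cole_hopf c 0 f x = f x"
  by (simp add: cole_hopf_def del: lebesgue_integral_const)

lemma cole_hopf_continuous_time:
  assumes c: "0 < c" "c \<le> 1" and prof: "parisi_profile c K f f1 f2 f3"
  shows "continuous_on {0..V} (\<lambda>v. cole_hopf c v f x)"
proof -
  have 1: "profile_step c v K f f1 f2 f3" if "v \<ge> 0" for v using that assms by (simp add: profile_step_def)
  interpret profile_step c 0 K f f1 f2 f3 by (rule 1) simp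
  have "continuous_on UNIV (\<lambda>x. exp (c * f x))"
    using der(1) by (intro continuous_intros) (meson DERIV_continuous_on has_field_derivative_at_within)
  from gauss_conv_continuous[OF this growth_exp]
  have "continuous_on {0..V} (\<lambda>v. \<integral>g. exp (c * f (x + sqrt v * g)) \<partial>gauss)" .
  moreover have "(\<integral>g. exp (c * f (x + sqrt v * g)) \<partial>gauss) > 0" if "v \<in> {0..V}" for v
    using profile_step.Z_pos[OF 1, of v x] that by (simp add: profile_step.N_def[OF 1])
  ultimately show ?thesis unfolding cole_hopf_def using c
    by (intro continuous_intros) (auto simp: less_imp_neq[symmetric] intro: less_imp_neq[symmetric])
qed

text \<open>The time derivative is half the tilted mean of \<open>w\<close>, hence lies between 0
  and \<open>1 / 2\<close>.\<close>

lemma cole_hopf_time_increment: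
  assumes c: "0 < c" "c \<le> 1" and prof: "parisi_profile c K f f1 f2 f3" and v: "0 \<le> v" "v \<le> v'"
  shows "cole_hopf c v f x \<le> cole_hopf c v' f x" "cole_hopf c v' f x \<le> cole_hopf c v f x + (v' - v) / 2"
proof -
  have 1: "profile_step c v K f f1 f2 f3" if "v \<ge> 0" for v using that assms by (simp add: profile_step_def)
  have "cole_hopf c v f x \<le> cole_hopf c v' f x \<and> cole_hopf c v' f x \<le> cole_hopf c v f x + (v' - v) / 2"
  proof (cases "v = v'")
    case False
    then have vv: "v < v'" using v by simp
    have "continuous_on {v..v'} (\<lambda>v. cole_hopf c v f x)"
      by (rule continuous_on_subset[OF cole_hopf_continuous_time[OF c prof, of v']]) (use v in auto)
    moreover have "(\<lambda>v. cole_hopf c v f x) differentiable (at u)" if "v < u" "u < v'" for u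
      using profile_step.DERIV_cole_hopf_time[OF 1, of u x] that v unfolding real_differentiable_def by auto
    ultimately obtain l z where z: "v < z" "z < v'" "DERIV (\<lambda>v. cole_hopf c v f x) z :> l"
        "cole_hopf c v' f x - cole_hopf c v f x = (v' - v) * l"
      using MVT[OF vv, of "\<lambda>v. cole_hopf c v f x"] by blast
    have z0: "z \<ge> 0" "z > 0" using z v by auto
    have "l = tilt c z f (profile_step.w c f1 f2) x / 2"
      using DERIV_unique[OF z(3) profile_step.DERIV_cole_hopf_time[OF 1[OF z0(1)] z0(2)]] profile_step.Ew[OF 1[OF z0(1)]] by simp
    then have "0 \<le> l" "l \<le> 1/2"
      using profile_step.Ew_le[OF 1[OF z0(1)], of x] profile_step.Ew_nn[OF 1[OF z0(1)], of x] by auto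
    then have "0 \<le> (v' - v) * l" "(v' - v) * l \<le> (v' - v) * (1/2)" using vv by (auto intro!: mult_left_mono)
    then show ?thesis using z(4) by (intro conjI) linarith+
  qed simp
  then show "cole_hopf c v f x \<le> cole_hopf c v' f x" "cole_hopf c v' f x \<le> cole_hopf c v f x + (v' - v) / 2" by auto
qed

text \<open>Going backwards in time the coefficient drops from \<open>c\<close> to
  \<open>c'\<close>. The bound 1 on \<open>f2 + c * f1\<^sup>2\<close> survives, and the third order
  bound loses only \<open>2 * (c - c')\<close>, which telescopes over all drops.\<close>

lemma parisi_profile_mono:
  assumes "parisi_profile c K f f1 f2 f3" "0 \<le> c'" "c' \<le> c"
  shows "parisi_profile c' (K + 2 * (c - c')) f f1 f2 f3"
proof -
  note p = assms(1)[unfolded parisi_profile_def]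
  have f2: "f2 x \<le> 1" for x
  proof -
    have "f2 x + c * (f1 x)\<^sup>2 \<le> 1" using p by blast
    moreover have "0 \<le> c * (f1 x)\<^sup>2" using assms by auto
    ultimately show ?thesis by linarith
  qed
  have 1: "f2 x + c' * (f1 x)\<^sup>2 \<le> 1" for x
  proof -
    have "c' * (f1 x)\<^sup>2 \<le> c * (f1 x)\<^sup>2" using assms(3) by (intro mult_right_mono) auto
    moreover have "f2 x + c * (f1 x)\<^sup>2 \<le> 1" using p by blast
    ultimately show ?thesis by linarith
  qed
  have 2: "\<bar>f3 x + 2 * c' * f1 x * f2 x\<bar> \<le> K + 2 * (c - c')" for x
  proof -
    have "\<bar>f1 x\<bar> * \<bar>f2 x\<bar> \<le> 1 * 1" using p f2[of x] by (intro mult_mono) auto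
    then have "2 * (c - c') * \<bar>f1 x * f2 x\<bar> \<le> 2 * (c - c') * 1"
      using assms(3) by (intro mult_left_mono) (auto simp: abs_mult)
    moreover have "f3 x + 2 * c' * f1 x * f2 x = (f3 x + 2 * c * f1 x * f2 x) - 2 * (c - c') * (f1 x * f2 x)"
      by (simp add: algebra_simps)
    moreover have "\<bar>2 * (c - c') * (f1 x * f2 x)\<bar> = 2 * (c - c') * \<bar>f1 x * f2 x\<bar>"
      using assms(3) by (simp add: abs_mult)
    moreover have "\<bar>f3 x + 2 * c * f1 x * f2 x\<bar> \<le> K" using p by blast
    ultimately show ?thesis by linarith
  qed
  show ?thesis using p 1 2 by (auto simp: parisi_profile_def)
qed

lemma parisi_profile_ln_cosh:
  assumes "0 \<le> c" "c \<le> 1"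
  shows "parisi_profile c 4 (\<lambda>x. ln (cosh x)) tanh (\<lambda>x. 1 - (tanh x)\<^sup>2) (\<lambda>x. - 2 * tanh x * (1 - (tanh x)\<^sup>2))"
proof -
  have t: "\<bar>tanh x\<bar> \<le> (1::real)" for x by (simp add: tanh_real_lt_1 tanh_real_gt_neg1 abs_le_iff less_imp_le minus_le_iff)
  have t2: "(tanh x)\<^sup>2 \<le> (1::real)" for x using t[of x] by (simp add: abs_square_le_1)
  have "((\<lambda>x. ln (cosh x)) has_real_derivative tanh x) (at x)" for x :: real
    by (auto intro!: derivative_eq_intros simp: tanh_def cosh_real_pos)
  moreover have "(tanh has_real_derivative 1 - (tanh x)\<^sup>2) (at x)" for x :: real
    by (auto intro!: derivative_eq_intros)
  moreover have "((\<lambda>x. 1 - (tanh x)\<^sup>2) has_real_derivative - 2 * tanh x * (1 - (tanh x)\<^sup>2)) (at x)" for x :: real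
    by (auto intro!: derivative_eq_intros)
  moreover have "1 - (tanh x)\<^sup>2 + c * (tanh x)\<^sup>2 \<le> 1" for x
    using mult_right_mono[OF assms(2), of "(tanh x)\<^sup>2"] by simp
  moreover have "\<bar>- 2 * tanh x * (1 - (tanh x)\<^sup>2) + 2 * c * tanh x * (1 - (tanh x)\<^sup>2)\<bar> \<le> 4" for x
  proof -
    have "\<bar>tanh x\<bar> * \<bar>1 - (tanh x)\<^sup>2\<bar> \<le> 1 * 1" using t[of x] t2[of x] by (intro mult_mono) auto
    then have "(2 * (1 - c)) * (\<bar>tanh x\<bar> * \<bar>1 - (tanh x)\<^sup>2\<bar>) \<le> 2 * 1" using assms by (intro mult_mono) auto
    moreover have "- 2 * tanh x * (1 - (tanh x)\<^sup>2) + 2 * c * tanh x * (1 - (tanh x)\<^sup>2) = - ((2 * (1 - c)) * (tanh x * (1 - (tanh x)\<^sup>2)))"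
      by (simp add: algebra_simps)
    ultimately show ?thesis using assms by (simp add: abs_mult)
  qed
  ultimately show ?thesis unfolding parisi_profile_def using t t2 by auto
qed

subsection \<open>A comparison principle for the Parisi equation\<close>

lemma local_max_derivatives:
  fixes f f1 :: "real \<Rightarrow> real"
  assumes d: "\<And>x. (f has_real_derivative f1 x) (at x)" and d2: "(f1 has_real_derivative D) (at x0)"
    and e: "e > 0" and max: "\<And>x. \<bar>x - x0\<bar> < e \<Longrightarrow> f x \<le> f x0"
  shows "f1 x0 = 0" "D \<le> 0"
proof -
  show 0: "f1 x0 = 0"
    by (rule DERIV_local_max[OF d e]) (use max in \<open>auto simp: abs_minus_commute\<close>)
  show "D \<le> 0"
  proof (rule ccontr)
    assume "\<not> D \<le> 0"
    then obtain r where r: "r > 0" "\<And>h. 0 < h \<Longrightarrow> h < r \<Longrightarrow> f1 x0 < f1 (x0 + h)"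
      using DERIV_pos_inc_right[OF d2] by auto
    define h where "h = min r e / 2"
    have h: "0 < h" "h < r" "h < e" using r(1) e by (auto simp: h_def)
    obtain z where z: "x0 < z" "z < x0 + h" "f (x0 + h) - f x0 = (x0 + h - x0) * f1 z"
      using MVT2[of x0 "x0 + h" f f1] h d by auto
    have "f1 z > 0" using r(2)[of "z - x0"] z h 0 by auto
    then have "0 < h * f1 z" using h(1) by (intro mult_pos_pos)
    then have "f (x0 + h) > f x0" using z(3) by simp
    then show False using max[of "x0 + h"] h by auto
  qed
qed

lemma right_derivative_max:
  fixes f :: "real \<Rightarrow> real"
  assumes d: "(f has_real_derivative D) (at s within {s..})" and e: "e > 0"
    and max: "\<And>t. s < t \<Longrightarrow> t < s + e \<Longrightarrow> f t \<le> f s"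
  shows "D \<le> 0"
proof (rule tendsto_upperbound)
  show "((\<lambda>y. (f y - f s) / (y - s)) \<longlongrightarrow> D) (at_right s)"
    using d unfolding has_field_derivative_iff by (rule tendsto_within_subset) auto
  have "\<forall>\<^sub>F t in at_right s. s < t \<and> t < s + e"
    using e by (auto simp: eventually_at_right[of s "s + e"] intro!: exI[of _ "s + e"])
  then show "\<forall>\<^sub>F y in at_right s. (f y - f s) / (y - s) \<le> 0"
    by eventually_elim (use max in \<open>auto simp: divide_le_0_iff\<close>)
qed simp

text \<open>A maximum principle. The equation is solved backwards from time 1, so at a maximum of
  the penalised difference only later times have to compete, and right time derivatives are enough.
  In this form it applies at atoms of the order parameter and at the jumps of the step solutions.
  The larger coefficient \<open>z\<close> gives the larger solution because it multiplies a
  square.\<close>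

lemma parisi_comparison:
  fixes u u1 u2 v v1 v2 :: "real \<Rightarrow> real \<Rightarrow> real"
  assumes u: "\<And>s x. s \<in> {q..1} \<Longrightarrow> (u s has_real_derivative u1 s x) (at x)"
      "\<And>s x. s \<in> {q..1} \<Longrightarrow> (u1 s has_real_derivative u2 s x) (at x)"
      "\<And>s x. s \<in> {q..1} \<Longrightarrow> \<bar>u1 s x\<bar> \<le> C" "continuous_on ({q..1} \<times> UNIV) (\<lambda>(s, x). u s x)"
      "\<And>s x. q \<le> s \<Longrightarrow> s < 1 \<Longrightarrow>
        ((\<lambda>t. u t x) has_real_derivative - (a s * (u2 s x + z s * (u1 s x)\<^sup>2))) (at s within {s..})"
    and v: "\<And>s x. s \<in> {q..1} \<Longrightarrow> (v s has_real_derivative v1 s x) (at x)"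
      "\<And>s x. s \<in> {q..1} \<Longrightarrow> (v1 s has_real_derivative v2 s x) (at x)"
      "\<And>s x. s \<in> {q..1} \<Longrightarrow> \<bar>v1 s x\<bar> \<le> C" "continuous_on ({q..1} \<times> UNIV) (\<lambda>(s, x). v s x)"
      "\<And>s x. q \<le> s \<Longrightarrow> s < 1 \<Longrightarrow>
        ((\<lambda>t. v t x) has_real_derivative - (a s * (v2 s x + y s * (v1 s x)\<^sup>2))) (at s within {s..})"
    and a: "\<And>s. q \<le> s \<Longrightarrow> s < 1 \<Longrightarrow> 0 \<le> a s" "\<And>s. q \<le> s \<Longrightarrow> s < 1 \<Longrightarrow> a s \<le> A"
    and z: "\<And>s. q \<le> s \<Longrightarrow> s < 1 \<Longrightarrow> y s \<le> z s" "\<And>s. q \<le> s \<Longrightarrow> s < 1 \<Longrightarrow> 0 \<le> z s" "\<And>s. q \<le> s \<Longrightarrow> s < 1 \<Longrightarrow> z s \<le> 1"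
    and A: "0 \<le> A" and terminal: "\<And>x. u 1 x = v 1 x" and s: "s \<in> {q..1}"
  shows "v s x \<le> u s x"
proof (rule ccontr)
  assume "\<not> v s x \<le> u s x"
  define d where "d t y = v t y - u t y" for t y
  \<comment> \<open>Term by term: \<open>2 * A\<close> absorbs the second derivative of the penalty,
    \<open>2 * C * A\<close> the difference of the squared gradients, and the additional 1 makes the
    final inequality strict.\<close>
  define lam where "lam = A * (2 + 2 * C) + 1"
  have C: "C \<ge> 0" using order_trans[OF abs_ge_zero u(3)[OF s]] .
  have lam: "lam > 0" using A C by (simp add: lam_def add_nonneg_pos)
  have dpos: "d s x > 0" using \<open>\<not> v s x \<le> u s x\<close> by (simp add: d_def)
  define P where "P = (1 + x\<^sup>2) * exp (lam * (1 - s))"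
  have P: "P > 0" unfolding P_def by (intro mult_pos_pos add_pos_nonneg) auto
  \<comment> \<open>With this factor half of the presumed violation at \<open>(s, x)\<close> is left
    after the penalty.\<close>
  define \<epsilon> where "\<epsilon> = d s x / (2 * P)"
  have eps: "\<epsilon> > 0" using dpos P by (simp add: \<epsilon>_def)
  define k where "k t y = d t y - \<epsilon> * ((1 + y\<^sup>2) * exp (lam * (1 - t)))" for t y
  have kpos: "k s x > 0"
  proof -
    have "\<epsilon> * P = d s x / 2" using P by (simp add: \<epsilon>_def)
    then show ?thesis using dpos by (simp add: k_def P_def[symmetric])
  qed
  have contd: "continuous_on ({q..1} \<times> UNIV) (\<lambda>(t, y). d t y)"
    unfolding d_def using continuous_on_diff[OF v(4) u(4)] by (simp add: case_prod_unfold)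
  have contk: "continuous_on ({q..1} \<times> UNIV) (\<lambda>(t, y). k t y)"
    using contd unfolding k_def case_prod_unfold by (intro continuous_intros)
  obtain B where B: "\<And>t. t \<in> {q..1} \<Longrightarrow> \<bar>d t 0\<bar> \<le> B"
  proof -
    have "continuous_on {q..1} (\<lambda>t. (\<lambda>(t, y). d t y) (t, 0))"
      by (rule continuous_on_compose2[OF contd]) (auto intro!: continuous_intros)
    then have "compact ((\<lambda>t. d t 0) ` {q..1})" by (intro compact_continuous_image) auto
    then obtain B where "\<forall>w\<in>(\<lambda>t. d t 0) ` {q..1}. norm w \<le> B" using compact_imp_bounded bounded_iff by meson
    then show thesis by (intro that[of B]) auto
  qed
  have B0: "B \<ge> 0" using order_trans[OF abs_ge_zero B[OF s]] .
  have growth: "d t y \<le> B + 2 * C * \<bar>y\<bar>" if t: "t \<in> {q..1}" for t y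
  proof -
    have "\<bar>u t y - u t 0\<bar> \<le> C * \<bar>y - 0\<bar>" "\<bar>v t y - v t 0\<bar> \<le> C * \<bar>y - 0\<bar>"
      by (rule DERIV_abs_bound_lipschitz[OF u(1)[OF t] u(3)[OF t]], rule DERIV_abs_bound_lipschitz[OF v(1)[OF t] v(3)[OF t]])
    then show ?thesis using B[OF t] unfolding d_def by auto
  qed
  define R where "R = (B + 2 * C) / \<epsilon> + 1 + \<bar>x\<bar>"
  have R1: "R \<ge> 1" using B0 C eps by (simp add: R_def)
  \<comment> \<open>Lipschitz functions grow linearly and the penalty quadratically, so a positive
    maximum is confined to a compact box.\<close>
  have far: "k t y < 0" if t: "t \<in> {q..1}" and y: "\<bar>y\<bar> \<ge> R" for t y
  proof -
    have "\<bar>y\<bar> * R \<le> \<bar>y\<bar> * \<bar>y\<bar>" using y by (intro mult_left_mono) auto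
    from mult_left_mono[OF this less_imp_le[OF eps]] have "\<epsilon> * (\<bar>y\<bar> * R) \<le> \<epsilon> * (\<bar>y\<bar> * \<bar>y\<bar>)" .
    moreover have "\<epsilon> * (\<bar>y\<bar> * ((B + 2 * C) / \<epsilon>)) \<le> \<epsilon> * (\<bar>y\<bar> * R)"
      using eps by (intro mult_left_mono) (auto simp: R_def)
    moreover have "\<epsilon> * (\<bar>y\<bar> * ((B + 2 * C) / \<epsilon>)) = B * \<bar>y\<bar> + 2 * C * \<bar>y\<bar>"
    proof -
      have "\<epsilon> * (\<bar>y\<bar> * ((B + 2 * C) / \<epsilon>)) = \<bar>y\<bar> * (\<epsilon> * ((B + 2 * C) / \<epsilon>))" by (rule mult.left_commute)
      also have "\<epsilon> * ((B + 2 * C) / \<epsilon>) = B + 2 * C" using eps by simp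
      finally show ?thesis by (simp add: algebra_simps)
    qed
    moreover have "B * 1 \<le> B * \<bar>y\<bar>" using B0 y R1 by (intro mult_left_mono) auto
    ultimately have 1: "B + 2 * C * \<bar>y\<bar> \<le> \<epsilon> * y\<^sup>2" by (simp add: power2_eq_square)
    have "1 \<le> exp (lam * (1 - t))" using lam t by simp
    then have "(1 + y\<^sup>2) * 1 \<le> (1 + y\<^sup>2) * exp (lam * (1 - t))" by (intro mult_left_mono) auto
    then have "\<epsilon> * (1 + y\<^sup>2) \<le> \<epsilon> * ((1 + y\<^sup>2) * exp (lam * (1 - t)))" using eps by (intro mult_left_mono) auto
    then show ?thesis using 1 growth[OF t, of y] eps unfolding k_def by (simp add: distrib_left)
  qed
  have "\<exists>p\<in>{q..1} \<times> {-R..R}. \<forall>p'\<in>{q..1} \<times> {-R..R}. (\<lambda>(t, y). k t y) p' \<le> (\<lambda>(t, y). k t y) p"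
  proof (rule continuous_attains_sup)
    show "compact ({q..1} \<times> {-R..R})" by (intro compact_Times) auto
    show "{q..1} \<times> {-R..R} \<noteq> {}" using s R1 by auto
    show "continuous_on ({q..1} \<times> {-R..R}) (\<lambda>(t, y). k t y)" by (rule continuous_on_subset[OF contk]) auto
  qed
  then obtain s0 x0 where m: "s0 \<in> {q..1}" "x0 \<in> {-R..R}"
      and maxk: "\<And>t y. t \<in> {q..1} \<Longrightarrow> y \<in> {-R..R} \<Longrightarrow> k t y \<le> k s0 x0" by auto
  have "0 \<le> (B + 2 * C) / \<epsilon>" using B0 C eps by simp
  then have "\<bar>x\<bar> \<le> R" unfolding R_def by linarith
  then have "x \<in> {-R..R}" by (simp add: abs_le_iff minus_le_iff)
  then have kp: "k s0 x0 > 0" using maxk[OF s] kpos by fastforce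
  have x0: "\<bar>x0\<bar> < R" using far[OF m(1), of x0] kp by fastforce
  have "k 1 x0 < 0"
  proof -
    have "0 < 1 + x0\<^sup>2" by (intro add_pos_nonneg) auto
    then show ?thesis using terminal eps by (simp add: k_def d_def)
  qed
  then have s0: "q \<le> s0" "s0 < 1" using m kp by (auto simp: less_le)
  define e where "e = exp (lam * (1 - s0))"
  have e: "e > 0" by (simp add: e_def)
  define k1 where "k1 y = v1 s0 y - u1 s0 y - \<epsilon> * (2 * y * e)" for y
  have dk: "(k s0 has_real_derivative k1 y) (at y)" for y
    unfolding k_def[abs_def] d_def k1_def e_def by (auto intro!: derivative_eq_intros u(1)[OF m(1)] v(1)[OF m(1)])
  have dk1: "(k1 has_real_derivative v2 s0 x0 - u2 s0 x0 - \<epsilon> * (2 * e)) (at x0)"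
    unfolding k1_def[abs_def] by (auto intro!: derivative_eq_intros u(2)[OF m(1)] v(2)[OF m(1)])
  have "k1 x0 = 0 \<and> v2 s0 x0 - u2 s0 x0 - \<epsilon> * (2 * e) \<le> 0"
  proof -
    have "k s0 y \<le> k s0 x0" if "\<bar>y - x0\<bar> < R - \<bar>x0\<bar>" for y
    proof (rule maxk[OF m(1)])
      have "\<bar>y\<bar> < R" using that by linarith
      then show "y \<in> {-R..R}" by (simp add: abs_less_iff)
    qed
    with local_max_derivatives[OF dk dk1, of "R - \<bar>x0\<bar>"] x0 show ?thesis by simp
  qed
  \<comment> \<open>At the interior maximum the gradients differ only by the derivative of the
    penalty, so the difference of their squares is of the size of the penalty itself.\<close>
  then have d1: "v1 s0 x0 - u1 s0 x0 = \<epsilon> * (2 * x0 * e)" and d2: "v2 s0 x0 - u2 s0 x0 \<le> \<epsilon> * (2 * e)"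
    by (auto simp: k1_def)
  let ?D = "- (a s0 * (v2 s0 x0 + y s0 * (v1 s0 x0)\<^sup>2)) + a s0 * (u2 s0 x0 + z s0 * (u1 s0 x0)\<^sup>2)
      + \<epsilon> * ((1 + x0\<^sup>2) * (lam * e))"
  have "((\<lambda>t. k t x0) has_real_derivative ?D) (at s0 within {s0..})"
    unfolding k_def d_def e_def
    by (rule derivative_eq_intros u(5)[OF s0] v(5)[OF s0] refl)+ simp
  then have D: "?D \<le> 0"
    by (rule right_derivative_max[where e="1 - s0"]) (use s0 maxk m in auto)
  have as: "0 \<le> a s0" "a s0 \<le> A" using a s0 by auto
  have "a s0 * (v2 s0 x0 - u2 s0 x0) \<le> a s0 * (\<epsilon> * (2 * e))" using d2 as by (intro mult_left_mono) auto
  also have "\<dots> \<le> A * (\<epsilon> * (2 * e))" using as eps e by (intro mult_right_mono) auto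
  finally have 1: "a s0 * (v2 s0 x0 - u2 s0 x0) \<le> 2 * A * (\<epsilon> * e)" by simp
  have "(v1 s0 x0)\<^sup>2 - (u1 s0 x0)\<^sup>2 = (\<epsilon> * (2 * x0 * e)) * (v1 s0 x0 + u1 s0 x0)"
    unfolding d1[symmetric] by (simp add: power2_eq_square algebra_simps)
  also have "\<dots> \<le> \<bar>\<epsilon> * (2 * x0 * e)\<bar> * \<bar>v1 s0 x0 + u1 s0 x0\<bar>" by (metis abs_ge_self abs_mult)
  also have "\<dots> \<le> (\<epsilon> * (2 * \<bar>x0\<bar> * e)) * (2 * C)"
    using u(3)[OF m(1), of x0] v(3)[OF m(1), of x0] eps e by (intro mult_mono) (auto simp: abs_mult)
  also have "\<dots> \<le> (\<epsilon> * ((1 + x0\<^sup>2) * e)) * (2 * C)"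
  proof -
    have "2 * \<bar>x0\<bar> \<le> 1 + x0\<^sup>2" using zero_le_power2[of "\<bar>x0\<bar> - 1"] by (simp add: power2_eq_square algebra_simps)
    then show ?thesis using eps e C by (intro mult_right_mono mult_left_mono) auto
  qed
  finally have w: "(v1 s0 x0)\<^sup>2 - (u1 s0 x0)\<^sup>2 \<le> (\<epsilon> * ((1 + x0\<^sup>2) * e)) * (2 * C)" .
  have nn: "0 \<le> (\<epsilon> * ((1 + x0\<^sup>2) * e)) * (2 * C)" using eps e C by auto
  have "z s0 * ((v1 s0 x0)\<^sup>2 - (u1 s0 x0)\<^sup>2) \<le> z s0 * ((\<epsilon> * ((1 + x0\<^sup>2) * e)) * (2 * C))"
    using w z(2)[OF s0] by (rule mult_left_mono)
  also have "\<dots> \<le> 1 * ((\<epsilon> * ((1 + x0\<^sup>2) * e)) * (2 * C))" using z(3)[OF s0] nn by (rule mult_right_mono)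
  finally have 2: "z s0 * ((v1 s0 x0)\<^sup>2 - (u1 s0 x0)\<^sup>2) \<le> (\<epsilon> * ((1 + x0\<^sup>2) * e)) * (2 * C)" by simp
  have "y s0 * (v1 s0 x0)\<^sup>2 \<le> z s0 * (v1 s0 x0)\<^sup>2" using z(1)[OF s0] by (intro mult_right_mono) auto
  then have "y s0 * (v1 s0 x0)\<^sup>2 - z s0 * (u1 s0 x0)\<^sup>2 \<le> (\<epsilon> * ((1 + x0\<^sup>2) * e)) * (2 * C)"
    using 2 by (simp add: algebra_simps)
  then have "a s0 * (y s0 * (v1 s0 x0)\<^sup>2 - z s0 * (u1 s0 x0)\<^sup>2) \<le> a s0 * ((\<epsilon> * ((1 + x0\<^sup>2) * e)) * (2 * C))"
    using as by (intro mult_left_mono) auto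
  also have "\<dots> \<le> A * ((\<epsilon> * ((1 + x0\<^sup>2) * e)) * (2 * C))" using as nn by (intro mult_right_mono) auto
  finally have 3: "a s0 * (y s0 * (v1 s0 x0)\<^sup>2 - z s0 * (u1 s0 x0)\<^sup>2) \<le> A * (2 * C) * (\<epsilon> * ((1 + x0\<^sup>2) * e))" by (simp add: mult_ac)
  have "2 * A * (\<epsilon> * e) * 1 \<le> 2 * A * (\<epsilon> * e) * (1 + x0\<^sup>2)" using A eps e by (intro mult_left_mono) auto
  then have 4: "2 * A * (\<epsilon> * e) \<le> A * 2 * (\<epsilon> * ((1 + x0\<^sup>2) * e))" by (simp add: mult_ac)
  have "lam * (\<epsilon> * ((1 + x0\<^sup>2) * e)) \<le> a s0 * (v2 s0 x0 - u2 s0 x0) + a s0 * (y s0 * (v1 s0 x0)\<^sup>2 - z s0 * (u1 s0 x0)\<^sup>2)"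
    using D by (simp add: algebra_simps)
  also have "\<dots> \<le> (A * 2 + A * (2 * C)) * (\<epsilon> * ((1 + x0\<^sup>2) * e))" using 1 3 4 by (simp add: distrib_right)
  finally have "\<epsilon> * ((1 + x0\<^sup>2) * e) \<le> 0" by (simp add: lam_def algebra_simps)
  moreover have "0 < \<epsilon> * ((1 + x0\<^sup>2) * e)" using eps e by (intro mult_pos_pos add_pos_nonneg) auto
  ultimately show False by simp
qed

text \<open>A function whose derivative is negative off a countable set decreases: each value between
  \<open>f a\<close> and \<open>f b\<close> would be taken for the last time at an exceptional point.\<close>

lemma DERIV_neg_except_countable:
  fixes f :: "real \<Rightarrow> real"
  assumes ab: "a \<le> b" and cont: "continuous_on {a..b} f" and N: "countable N"
    and neg: "\<And>t. a < t \<Longrightarrow> t < b \<Longrightarrow> t \<notin> N \<Longrightarrow> \<exists>D<0. (f has_real_derivative D) (at t)"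
  shows "f b \<le> f a"
proof (rule ccontr)
  assume "\<not> f b \<le> f a"
  then have lt: "f a < f b" by simp
  have "{f a<..<f b} \<subseteq> f ` N"
  proof
    fix y assume y: "y \<in> {f a<..<f b}"
    let ?S = "{t \<in> {a..b}. f t = y}"
    have "closed ?S"
      using continuous_closed_preimage_constant[OF cont, of y] by simp
    then have comp: "compact ?S" unfolding compact_eq_bounded_closed by (auto intro: bounded_subset[OF bounded_closed_interval[of a b]])
    have "\<exists>t\<ge>a. t \<le> b \<and> f t = y" using IVT'[of f a y b] y ab cont by auto
    then have ne: "?S \<noteq> {}" by auto
    obtain t where t: "t \<in> ?S" "\<And>t'. t' \<in> ?S \<Longrightarrow> t' \<le> t" using compact_attains_sup[OF comp ne] by blast
    have tb: "a < t" "t < b" using t(1) y by (auto simp: less_le)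
    have above: "y < f t'" if t': "t < t'" "t' \<le> b" for t'
    proof (rule ccontr)
      assume "\<not> y < f t'"
      moreover have "continuous_on {t'..b} f" by (rule continuous_on_subset[OF cont]) (use t' tb in auto)
      ultimately obtain r where "t' \<le> r" "r \<le> b" "f r = y" using IVT'[of f t' y b] y t' by auto
      then show False using t(2)[of r] t' tb by auto
    qed
    have "t \<in> N"
    proof (rule ccontr)
      assume "t \<notin> N"
      then obtain D where D: "D < 0" "(f has_real_derivative D) (at t)" using neg tb by blast
      obtain r where r: "r > 0" "\<And>h. 0 < h \<Longrightarrow> h < r \<Longrightarrow> f t > f (t + h)" using DERIV_neg_dec_right[OF D(2,1)] by auto
      define h where "h = min r (b - t) / 2"
      have "0 < h" "h < r" "h \<le> (b - t) / 2" using r(1) tb by (auto simp: h_def)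
      moreover from this(3) have "t + h \<le> b" using tb by (simp add: field_simps)
      ultimately have "0 < h" "h < r" "t + h \<le> b" by auto
      then show False using r(2)[of h] above[of "t + h"] t(1) by auto
    qed
    then show "y \<in> f ` N" using t(1) by auto
  qed
  then have "countable {f a<..<f b}" by (rule countable_subset) (intro countable_image N)
  then show False using uncountable_open_interval[of "f a" "f b"] lt by simp
qed

lemma DERIV_le_except_countable:
  fixes f k :: "real \<Rightarrow> real"
  assumes ab: "a \<le> b" and cont: "continuous_on {a..b} f" and N: "countable N"
    and der: "\<And>t. a < t \<Longrightarrow> t < b \<Longrightarrow> t \<notin> N \<Longrightarrow> (f has_real_derivative k t) (at t)"
    and k: "\<And>t. a < t \<Longrightarrow> t < b \<Longrightarrow> k t < M"
  shows "f b - f a \<le> M * (b - a)"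
proof -
  have "f b - M * b \<le> f a - M * a"
  proof (rule DERIV_neg_except_countable[OF ab _ N])
    show "continuous_on {a..b} (\<lambda>t. f t - M * t)" by (intro continuous_intros cont)
    fix t assume t: "a < t" "t < b" "t \<notin> N"
    have "((\<lambda>t. f t - M * t) has_real_derivative k t - M) (at t)"
      by (auto intro!: derivative_eq_intros der t)
    then show "\<exists>D<0. ((\<lambda>t. f t - M * t) has_real_derivative D) (at t)" using k[OF t(1,2)] by (intro exI[of _ "k t - M"]) auto
  qed
  then show ?thesis by (simp add: algebra_simps)
qed

text \<open>The mean value inequality with a countable exceptional set turns the limit of the
  derivatives from the right into a right derivative. This recovers the Parisi equation at atoms,
  where the definition of a solution is silent.\<close>

lemma right_derivative_except_countable:
  fixes f k :: "real \<Rightarrow> real"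
  assumes sb: "s < b" and cont: "continuous_on {s..b} f" and N: "countable N"
    and der: "\<And>t. s < t \<Longrightarrow> t < b \<Longrightarrow> t \<notin> N \<Longrightarrow> (f has_real_derivative k t) (at t)"
    and k: "(k \<longlongrightarrow> L) (at_right s)"
  shows "(f has_real_derivative L) (at s within {s..})"
proof -
  have "((\<lambda>t. (f t - f s) / (t - s)) \<longlongrightarrow> L) (at_right s)"
  proof (rule tendstoI)
    fix \<epsilon> :: real assume e: "\<epsilon> > 0"
    have "\<forall>\<^sub>F t in at_right s. dist (k t) L < \<epsilon> / 2" using tendstoD[OF k, of "\<epsilon> / 2"] e by simp
    then obtain b' where b': "b' > s" "\<And>t. s < t \<Longrightarrow> t < b' \<Longrightarrow> dist (k t) L < \<epsilon> / 2"
      unfolding eventually_at_right[OF sb] by auto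
    have "\<bar>(f t - f s) / (t - s) - L\<bar> < \<epsilon>" if t: "s < t" "t < min b b'" for t
    proof -
      have c: "continuous_on {s..t} f" by (rule continuous_on_subset[OF cont]) (use t in auto)
      have kt: "\<bar>k r - L\<bar> < \<epsilon> / 2" if "s < r" "r < t" for r using b'(2)[of r] that t by (auto simp: dist_real_def)
      have "f t - f s \<le> (L + \<epsilon> / 2) * (t - s)"
      proof (rule DERIV_le_except_countable[OF _ c N, of k])
        show "(f has_real_derivative k r) (at r)" if "s < r" "r < t" "r \<notin> N" for r
          using der[of r] that t by auto
        show "k r < L + \<epsilon> / 2" if "s < r" "r < t" for r using kt[OF that] by linarith
      qed (use t in auto)
      moreover have "- f t - - f s \<le> (- L + \<epsilon> / 2) * (t - s)"
      proof (rule DERIV_le_except_countable[OF _ continuous_on_minus[OF c] N, of "\<lambda>r. - k r"])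
        show "((\<lambda>t. - f t) has_real_derivative - k r) (at r)" if "s < r" "r < t" "r \<notin> N" for r
          using der[of r] that t by (intro DERIV_minus) auto
        show "- k r < - L + \<epsilon> / 2" if "s < r" "r < t" for r using kt[OF that] by linarith
      qed (use t in auto)
      moreover define p r where "p = L * (t - s)" and "r = \<epsilon> / 2 * (t - s)"
      moreover have "(L + \<epsilon> / 2) * (t - s) = p + r" "(- L + \<epsilon> / 2) * (t - s) = - p + r"
        unfolding p_def r_def by (simp_all add: distrib_right left_diff_distrib)
      ultimately have "f t - f s \<le> p + r" "- f t - - f s \<le> - p + r" by (simp_all only:)
      then have "\<bar>(f t - f s) - p\<bar> \<le> r" by linarith
      then have "\<bar>(f t - f s) - L * (t - s)\<bar> \<le> \<epsilon> / 2 * (t - s)" unfolding p_def r_def .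
      also have "\<dots> < \<epsilon> * (t - s)" using e t by (intro mult_strict_right_mono) auto
      finally have "\<bar>(f t - f s) - L * (t - s)\<bar> / (t - s) < \<epsilon>" using t by (simp add: divide_less_eq)
      moreover have "\<bar>(f t - f s) - L * (t - s)\<bar> / (t - s) = \<bar>((f t - f s) - L * (t - s)) / (t - s)\<bar>" using t by simp
      moreover have "((f t - f s) - L * (t - s)) / (t - s) = (f t - f s) / (t - s) - L" using t by (simp add: diff_divide_distrib)
      ultimately show ?thesis by simp
    qed
    then show "\<forall>\<^sub>F t in at_right s. dist ((f t - f s) / (t - s)) L < \<epsilon>"
      unfolding eventually_at_right[OF sb] dist_real_def using sb b'(1) by (intro exI[of _ "min b b'"]) auto
  qed
  moreover have "at s within {s..} = at_right s"
    by (rule at_within_nhd[of _ UNIV]) auto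
  ultimately show ?thesis by (simp add: has_field_derivative_iff)
qed

text \<open>Since the derivatives are equi-Lipschitz, a difference quotient with increment
  \<open>h\<close> differs from \<open>G n x\<close> by at most \<open>B * \<bar>h\<bar>\<close> for
  every \<open>n\<close>. Hence pointwise convergence of \<open>F n\<close> alone forces that of
  \<open>G n\<close>, and no subsequence is taken.\<close>

lemma C11_pointwise_limit:
  fixes F G :: "nat \<Rightarrow> real \<Rightarrow> real" and f :: "real \<Rightarrow> real"
  assumes der: "\<And>n x. (F n has_real_derivative G n x) (at x)"
    and lip: "\<And>n x y. \<bar>G n x - G n y\<bar> \<le> B * \<bar>x - y\<bar>"
    and lim: "\<And>x. (\<lambda>n. F n x) \<longlonglongrightarrow> f x"
  obtains g where "\<And>x. (\<lambda>n. G n x) \<longlonglongrightarrow> g x" "\<And>x. (f has_real_derivative g x) (at x)"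
    "\<And>x y. \<bar>g x - g y\<bar> \<le> B * \<bar>x - y\<bar>"
proof -
  have B: "B \<ge> 0" using order_trans[OF abs_ge_zero lip[of 0 1 0]] by simp
  have q: "\<bar>(F n (x + h) - F n x) / h - G n x\<bar> \<le> B * \<bar>h\<bar>" if h: "h \<noteq> 0" for n x h
  proof -
    have "\<bar>(F n (x + h) - G n x * (x + h)) - (F n x - G n x * x)\<bar> \<le> (B * \<bar>h\<bar>) * \<bar>(x + h) - x\<bar>"
    proof -
      have "norm ((\<lambda>y. F n y - G n x * y) (x + h) - (\<lambda>y. F n y - G n x * y) x) \<le> (B * \<bar>h\<bar>) * norm ((x + h) - x)"
      proof (rule field_differentiable_bound[where S="cball x \<bar>h\<bar>" and f'="\<lambda>y. G n y - G n x"])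
        fix y assume y: "y \<in> cball x \<bar>h\<bar>"
        show "((\<lambda>y. F n y - G n x * y) has_field_derivative G n y - G n x) (at y within cball x \<bar>h\<bar>)"
          by (auto intro!: derivative_eq_intros has_field_derivative_at_within[OF der])
        have "B * \<bar>y - x\<bar> \<le> B * \<bar>h\<bar>" using y B by (intro mult_left_mono) (auto simp: dist_real_def)
        then show "norm (G n y - G n x) \<le> B * \<bar>h\<bar>" using lip[of n y x] by simp
      qed (auto simp: dist_real_def)
      then show ?thesis by simp
    qed
    then have "\<bar>F n (x + h) - F n x - G n x * h\<bar> \<le> (B * \<bar>h\<bar>) * \<bar>h\<bar>" by (simp add: algebra_simps)
    then have "\<bar>F n (x + h) - F n x - G n x * h\<bar> / \<bar>h\<bar> \<le> B * \<bar>h\<bar>" using h by (simp add: divide_le_eq)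
    moreover have "\<bar>F n (x + h) - F n x - G n x * h\<bar> / \<bar>h\<bar> = \<bar>(F n (x + h) - F n x) / h - G n x\<bar>"
      using h by (simp add: abs_divide[symmetric] diff_divide_distrib)
    ultimately show ?thesis by simp
  qed
  have "Cauchy (\<lambda>n. G n x)" for x
  proof (rule metric_CauchyI)
    fix \<epsilon> :: real assume e: "\<epsilon> > 0"
    \<comment> \<open>Three errors, each below a quarter of \<open>\<epsilon>\<close>: two for
      replacing \<open>G\<close> by a quotient, one for the Cauchy property of the
      quotients.\<close>
    define h where "h = \<epsilon> / (4 * (B + 1))"
    have h: "h > 0" "B * h < \<epsilon> / 4"
    proof -
      show "h > 0" using e B by (simp add: h_def)
      have "B * h < (B + 1) * h" using \<open>h > 0\<close> by simp
      also have "\<dots> = \<epsilon> / 4" using B by (simp add: h_def field_simps)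
      finally show "B * h < \<epsilon> / 4" .
    qed
    have "(\<lambda>n. (F n (x + h) - F n x) / h) \<longlonglongrightarrow> (f (x + h) - f x) / h"
      by (intro tendsto_intros lim) (use h in auto)
    then have "Cauchy (\<lambda>n. (F n (x + h) - F n x) / h)" by (rule LIMSEQ_imp_Cauchy)
    then have "\<exists>M. \<forall>m\<ge>M. \<forall>n\<ge>M. dist ((F m (x + h) - F m x) / h) ((F n (x + h) - F n x) / h) < \<epsilon> / 4"
      by (rule metric_CauchyD) (use e in simp)
    then obtain M where M: "\<forall>m\<ge>M. \<forall>n\<ge>M. dist ((F m (x + h) - F m x) / h) ((F n (x + h) - F n x) / h) < \<epsilon> / 4" ..
    have "dist (G m x) (G n x) < \<epsilon>" if "m \<ge> M" "n \<ge> M" for m n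
    proof -
      have "dist ((F m (x + h) - F m x) / h) ((F n (x + h) - F n x) / h) < \<epsilon> / 4" using M that by blast
      moreover have "B * \<bar>h\<bar> < \<epsilon> / 4" using h by simp
      moreover have "\<bar>(F m (x + h) - F m x) / h - G m x\<bar> \<le> B * \<bar>h\<bar>" "\<bar>(F n (x + h) - F n x) / h - G n x\<bar> \<le> B * \<bar>h\<bar>"
        using q[of h] h by auto
      ultimately show ?thesis unfolding dist_real_def by linarith
    qed
    then show "\<exists>M. \<forall>m\<ge>M. \<forall>n\<ge>M. dist (G m x) (G n x) < \<epsilon>" by blast
  qed
  then have "\<forall>x. \<exists>l. (\<lambda>n. G n x) \<longlonglongrightarrow> l" using Cauchy_convergent convergent_def by blast
  then obtain g where g: "\<And>x. (\<lambda>n. G n x) \<longlonglongrightarrow> g x" by metis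
  have "(f has_real_derivative g x) (at x)" for x
  proof -
    have "\<bar>(f (x + h) - f x) / h - g x\<bar> \<le> B * \<bar>h\<bar>" if "h \<noteq> 0" for h
    proof (rule tendsto_upperbound)
      show "(\<lambda>n. \<bar>(F n (x + h) - F n x) / h - G n x\<bar>) \<longlonglongrightarrow> \<bar>(f (x + h) - f x) / h - g x\<bar>"
        by (intro tendsto_intros lim g) (use that in auto)
    qed (use q[OF that] in auto)
    then have "\<forall>\<^sub>F h in at 0. norm ((f (x + h) - f x) / h - g x) \<le> B * \<bar>h\<bar>"
      by (simp add: eventually_at_filter)
    moreover have "((\<lambda>h. B * \<bar>h\<bar>) \<longlongrightarrow> B * \<bar>0\<bar>) (at 0)" by (intro tendsto_intros)
    ultimately have "((\<lambda>h. (f (x + h) - f x) / h - g x) \<longlongrightarrow> 0) (at 0)"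
      by (intro Lim_null_comparison[of "\<lambda>h. (f (x + h) - f x) / h - g x" "\<lambda>h. B * \<bar>h\<bar>"]) auto
    then show ?thesis unfolding DERIV_def by (simp add: LIM_zero_iff)
  qed
  moreover have "\<bar>g x - g y\<bar> \<le> B * \<bar>x - y\<bar>" for x y
    by (rule tendsto_upperbound[where f="\<lambda>n. \<bar>G n x - G n y\<bar>" and F=sequentially])
      (use lip in \<open>auto intro!: tendsto_intros g\<close>)
  ultimately show thesis using that g by blast
qed

section \<open>Measures on an interval, regular profiles, and uniqueness for the Parisi
  equation\<close>

lemma probs_on_real_distribution: "\<eta> \<in> probs_on a b \<Longrightarrow> real_distribution \<eta>"
  by (auto simp: probs_on_def real_distribution_def real_distribution_axioms_def)

text \<open>All mass sits in \<open>[q, b]\<close>, so the coefficient of the equation is a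
  distribution function and no longer refers to \<open>q\<close>. Order parameters on different
  intervals become comparable.\<close>

lemma probs_on_cdf:
  assumes "\<eta> \<in> probs_on q b" "q \<le> s"
  shows "measure \<eta> {q..s} = cdf \<eta> s"
proof -
  interpret real_distribution \<eta> using assms(1) by (rule probs_on_real_distribution)
  have "measure \<eta> ({..<q} \<union> {q..b}) = measure \<eta> {..<q} + measure \<eta> {q..b}"
    by (rule finite_measure_Union) auto
  moreover have "measure \<eta> ({..<q} \<union> {q..b}) \<le> 1" by (rule prob_le_1)
  ultimately have 0: "measure \<eta> {..<q} = 0"
    using assms(1) measure_nonneg[of \<eta> "{..<q}"] by (simp add: probs_on_def measure_le_0_iff)
  have "measure \<eta> ({..<q} \<union> {q..s}) = measure \<eta> {..<q} + measure \<eta> {q..s}"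
    by (rule finite_measure_Union) auto
  moreover have "{..<q} \<union> {q..s} = {..s}" using assms(2) by auto
  ultimately show ?thesis using 0 by (simp add: cdf_def2)
qed

text \<open>Separate continuity becomes joint because the Lipschitz bound in \<open>x\<close> is
  uniform in \<open>s\<close>.\<close>

lemma continuous_on_strip:
  fixes u :: "real \<Rightarrow> real \<Rightarrow> real"
  assumes lip: "\<And>s x y. s \<in> S \<Longrightarrow> \<bar>u s x - u s y\<bar> \<le> B * \<bar>x - y\<bar>"
    and cont: "\<And>x. continuous_on S (\<lambda>s. u s x)"
  shows "continuous_on (S \<times> UNIV) (\<lambda>(s, x). u s x)"
  unfolding continuous_on_sequentially
proof (intro allI ballI impI)
  fix X :: "nat \<Rightarrow> real \<times> real" and p assume p: "p \<in> S \<times> UNIV" and X: "(\<forall>n. X n \<in> S \<times> UNIV) \<and> X \<longlonglongrightarrow> p"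
  obtain s x where sx: "p = (s, x)" by force
  have 1: "(\<lambda>n. fst (X n)) \<longlonglongrightarrow> s" "(\<lambda>n. snd (X n)) \<longlonglongrightarrow> x"
    using tendsto_fst[of X p sequentially] tendsto_snd[of X p sequentially] X sx by auto
  have mem: "fst (X n) \<in> S" for n using X by (metis mem_Times_iff)
  have "(\<lambda>n. u (fst (X n)) x) \<longlonglongrightarrow> u s x"
    using cont[of x] 1(1) mem p sx unfolding continuous_on_sequentially by (auto simp: comp_def)
  moreover have "(\<lambda>n. u (fst (X n)) (snd (X n)) - u (fst (X n)) x) \<longlonglongrightarrow> 0"
  proof (rule Lim_null_comparison)
    show "\<forall>\<^sub>F n in sequentially. norm (u (fst (X n)) (snd (X n)) - u (fst (X n)) x) \<le> B * \<bar>snd (X n) - x\<bar>"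
      using lip[OF mem] by simp
    show "(\<lambda>n. B * \<bar>snd (X n) - x\<bar>) \<longlonglongrightarrow> 0"
      using tendsto_mult[OF tendsto_const[of B] tendsto_rabs[OF LIM_zero[OF 1(2)]]] by simp
  qed
  ultimately have "(\<lambda>n. u (fst (X n)) x + (u (fst (X n)) (snd (X n)) - u (fst (X n)) x)) \<longlonglongrightarrow> u s x + 0"
    by (rule tendsto_add)
  then show "((\<lambda>(s, x). u s x) \<circ> X) \<longlonglongrightarrow> (\<lambda>(s, x). u s x) p" by (simp add: comp_def sx case_prod_unfold)
qed

text \<open>The derivatives are determined by \<open>f\<close>, so naming them by
  \<open>deriv\<close> avoids existential quantifiers in the induction over the levels.\<close>

definition nice :: "real \<Rightarrow> real \<Rightarrow> (real \<Rightarrow> real) \<Rightarrow> bool" where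
  "nice c K f \<longleftrightarrow> parisi_profile c K f (deriv f) (deriv (deriv f)) (deriv (deriv (deriv f)))"

lemma parisi_profile_nice:
  assumes "parisi_profile c K f f1 f2 f3" shows "nice c K f"
proof -
  have "f1 = deriv f" "f2 = deriv f1" "f3 = deriv f2"
    using assms by (auto simp: parisi_profile_def fun_eq_iff intro!: DERIV_imp_deriv[symmetric])
  then show ?thesis using assms by (simp add: nice_def)
qed

lemma nice_mono_K: "nice c K f \<Longrightarrow> K \<le> K' \<Longrightarrow> nice c K' f"
  unfolding nice_def parisi_profile_def by (meson order_trans)

text \<open>Replacing \<open>1 + t\<close> by \<open>exp t\<close> makes the losses of consecutive
  steps multiply to an exponential of the total variance, whatever the mesh.\<close>

lemma nice_cole_hopf:
  assumes "nice c K f" "0 < c" "c \<le> 1" "0 \<le> v" "v \<le> V"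
  shows "nice c (K * exp (2 * quad_moment V * v)) (cole_hopf c v f)"
proof -
  interpret profile_step c v K f "deriv f" "deriv (deriv f)" "deriv (deriv (deriv f))"
    using assms by (simp add: profile_step_def nice_def)
  have "nice c (K * (1 + 2 * quad_moment V * v)) (cole_hopf c v f)"
    by (rule parisi_profile_nice[OF parisi_profile_step[OF assms(5)]])
  then show ?thesis
    by (rule nice_mono_K) (use K_nn exp_ge_add_one_self[of "2 * quad_moment V * v"] in \<open>auto intro!: mult_left_mono\<close>)
qed

text \<open>The bounds are read off after lowering the coefficient to 0, where they no longer mix
  derivatives of different order.\<close>

lemma nice_bounds:
  assumes "nice c K f" "0 \<le> c"
  shows "(f has_real_derivative deriv f x) (at x)" "(deriv f has_real_derivative deriv (deriv f) x) (at x)"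
    "\<bar>deriv f x\<bar> \<le> 1" "0 \<le> deriv (deriv f) x" "deriv (deriv f) x \<le> 1"
    "\<bar>f x - f y\<bar> \<le> \<bar>x - y\<bar>" "\<bar>deriv f x - deriv f y\<bar> \<le> \<bar>x - y\<bar>"
    "\<bar>deriv (deriv f) x - deriv (deriv f) y\<bar> \<le> (K + 2 * c) * \<bar>x - y\<bar>"
proof -
  have p: "parisi_profile 0 (K + 2 * c) f (deriv f) (deriv (deriv f)) (deriv (deriv (deriv f)))"
    using parisi_profile_mono[OF assms(1)[unfolded nice_def], of 0] assms(2) by simp
  note q = p[unfolded parisi_profile_def]
  show a: "(f has_real_derivative deriv f x) (at x)" for x using q by blast
  show b: "(deriv f has_real_derivative deriv (deriv f) x) (at x)" for x using q by blast
  show c: "\<bar>deriv f x\<bar> \<le> 1" for x using q by blast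
  show d: "0 \<le> deriv (deriv f) x" for x using q by blast
  show e: "deriv (deriv f) x \<le> 1" for x using q by simp
  have g: "(deriv (deriv f) has_real_derivative deriv (deriv (deriv f)) x) (at x)" for x using q by blast
  have h: "\<bar>deriv (deriv (deriv f)) x\<bar> \<le> K + 2 * c" for x using q by simp
  show "\<bar>f x - f y\<bar> \<le> \<bar>x - y\<bar>" using DERIV_abs_bound_lipschitz[of f "deriv f" 1] a c by simp
  show "\<bar>deriv f x - deriv f y\<bar> \<le> \<bar>x - y\<bar>" using DERIV_abs_bound_lipschitz[of "deriv f" "deriv (deriv f)" 1] b d e by simp
  show "\<bar>deriv (deriv f) x - deriv (deriv f) y\<bar> \<le> (K + 2 * c) * \<bar>x - y\<bar>"
    by (rule DERIV_abs_bound_lipschitz[OF g h])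
qed

lemma nice_ln_cosh: "0 \<le> c \<Longrightarrow> c \<le> 1 \<Longrightarrow> nice c 4 (\<lambda>x. ln (cosh x))"
  by (rule parisi_profile_nice[OF parisi_profile_ln_cosh])

lemma Suc_div_le: "l < 2 ^ n \<Longrightarrow> real (Suc l) / 2 ^ n \<le> 1"
proof -
  assume "l < 2 ^ n"
  then have "real (Suc l) \<le> real (2 ^ n)" by (simp only: of_nat_le_iff Suc_le_eq)
  then show ?thesis by simp
qed

text \<open>The properties of the mixture on which the Parisi equation and the interpolation rest.
  \<open>tangent\<close> covers negative \<open>x\<close> because overlaps of points of the cube can
  be negative, whereas the points of tangency are levels of the self-overlap. \<open>pos2\<close>
  makes \<open>deriv \<xi>\<close> strictly increasing on \<open>[0, 1]\<close>, so that it serves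
  as a change of time.\<close>

locale mixture_function =
  fixes \<xi> :: "real \<Rightarrow> real"
  assumes der1: "\<And>x. x \<in> {-1..1} \<Longrightarrow> (\<xi> has_real_derivative deriv \<xi> x) (at x)"
    and der2: "\<And>x. x \<in> {-1..1} \<Longrightarrow> (deriv \<xi> has_real_derivative deriv (deriv \<xi>) x) (at x)"
    and cont2: "continuous_on {0..1} (deriv (deriv \<xi>))"
    and pos2: "\<And>x. 0 < x \<Longrightarrow> x \<le> 1 \<Longrightarrow> 0 < deriv (deriv \<xi>) x" and nn2: "0 \<le> deriv (deriv \<xi>) 0"
    and zero: "\<xi> 0 = 0" "deriv \<xi> 0 = 0"
    and tangent: "\<And>x r. x \<in> {-1..1} \<Longrightarrow> r \<in> {0..1} \<Longrightarrow> \<xi> r + deriv \<xi> r * (x - r) \<le> \<xi> x"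
begin

abbreviation "\<xi>1 \<equiv> deriv \<xi>"
abbreviation "\<xi>2 \<equiv> deriv (deriv \<xi>)"

lemma \<xi>2_nn: "x \<in> {0..1} \<Longrightarrow> 0 \<le> \<xi>2 x"
  using pos2[of x] nn2 by (cases "x = 0") auto

lemma \<xi>1_cont: "continuous_on {0..1} \<xi>1"
  by (rule DERIV_continuous_on[of _ _ \<xi>2]) (auto intro!: has_field_derivative_at_within der2)

lemma \<xi>1_less: assumes "0 \<le> s" "s < t" "t \<le> 1" shows "\<xi>1 s < \<xi>1 t"
proof (rule DERIV_pos_imp_increasing_open[OF assms(2)])
  show "\<exists>y. (\<xi>1 has_real_derivative y) (at x) \<and> 0 < y" if "s < x" "x < t" for x
    using that assms by (intro exI[of _ "\<xi>2 x"]) (auto intro!: der2 pos2)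
  show "continuous_on {s..t} \<xi>1" by (rule continuous_on_subset[OF \<xi>1_cont]) (use assms in auto)
qed

lemma \<xi>1_le: "0 \<le> s \<Longrightarrow> s \<le> t \<Longrightarrow> t \<le> 1 \<Longrightarrow> \<xi>1 s \<le> \<xi>1 t"
  using \<xi>1_less[of s t] by (cases "s = t") auto

lemma \<xi>1_nn: "0 \<le> s \<Longrightarrow> s \<le> 1 \<Longrightarrow> 0 \<le> \<xi>1 s"
  using \<xi>1_le[of 0 s] zero by simp

definition A2 where "A2 = (SOME A. A \<ge> 0 \<and> (\<forall>x\<in>{0..1}. \<xi>2 x \<le> A))"

lemma A2: "A2 \<ge> 0" "\<And>x. x \<in> {0..1} \<Longrightarrow> \<xi>2 x \<le> A2"
proof -
  have "compact (\<xi>2 ` {0..1})" by (intro compact_continuous_image cont2) auto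
  then obtain B where "\<forall>w\<in>\<xi>2 ` {0..1}. norm w \<le> B" using compact_imp_bounded bounded_iff by meson
  then have "\<exists>A. A \<ge> 0 \<and> (\<forall>x\<in>{0..1}. \<xi>2 x \<le> A)" by (intro exI[of _ "\<bar>B\<bar>"]) force
  from someI_ex[OF this] show "A2 \<ge> 0" "\<And>x. x \<in> {0..1} \<Longrightarrow> \<xi>2 x \<le> A2" by (auto simp: A2_def)
qed

lemma solution_bounds:
  assumes "parisi_pde_solution \<xi> q \<eta> \<Phi>"
  shows "s \<in> {q..1} \<Longrightarrow> (\<Phi> s has_real_derivative deriv (\<Phi> s) x) (at x)"
    "s \<in> {q..1} \<Longrightarrow> (deriv (\<Phi> s) has_real_derivative deriv (deriv (\<Phi> s)) x) (at x)"
    "continuous_on ({q..1} \<times> UNIV) (\<lambda>(s, x). \<Phi> s x)"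
    "\<exists>C. \<forall>s\<in>{q..1}. \<forall>x. \<bar>deriv (\<Phi> s) x\<bar> \<le> C"
    "\<Phi> 1 x = ln (cosh x)"
  using assms unfolding parisi_pde_solution_def by (auto simp: DERIV_deriv_iff_real_differentiable)

text \<open>The definition asks for the equation only off the atoms. Its right side is right
  continuous in time, since the distribution function is and the space derivatives are continuous,
  so a right derivative exists at every time, also at \<open>q\<close>.\<close>

lemma solution_right_derivative:
  assumes \<eta>: "\<eta> \<in> probs_on q 1" and q: "0 \<le> q" "q \<le> s" "s < 1" and sol: "parisi_pde_solution \<xi> q \<eta> \<Phi>"
  shows "((\<lambda>t. \<Phi> t x) has_real_derivative
     - (\<xi>2 s / 2 * (deriv (deriv (\<Phi> s)) x + measure \<eta> {q..s} * (deriv (\<Phi> s) x)\<^sup>2))) (at s within {s..})"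
proof -
  interpret real_distribution \<eta> using \<eta> by (rule probs_on_real_distribution)
  have line: "continuous_on {q..1} (\<lambda>t. (\<lambda>(s, x). h s x) (t, x))"
    if "continuous_on ({q..1} \<times> UNIV) (\<lambda>(s, x). h s x)" for h :: "real \<Rightarrow> real \<Rightarrow> real"
    by (rule continuous_on_compose2[OF that]) (auto intro!: continuous_intros)
  have "continuous_on ({q..1} \<times> UNIV) (\<lambda>(s, x). \<Phi> s x)" "continuous_on ({q..1} \<times> UNIV) (\<lambda>(s, x). deriv (\<Phi> s) x)"
      "continuous_on ({q..1} \<times> UNIV) (\<lambda>(s, x). deriv (deriv (\<Phi> s)) x)"
    using sol by (auto simp: parisi_pde_solution_def)
  from this[THEN line] have c: "continuous_on {q..1} (\<lambda>t. \<Phi> t x)" "continuous_on {q..1} (\<lambda>t. deriv (\<Phi> t) x)"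
     "continuous_on {q..1} (\<lambda>t. deriv (deriv (\<Phi> t)) x)" by auto
  have lim: "(h \<longlongrightarrow> h s) (at_right s)" if "continuous_on {q..1} h" for h :: "real \<Rightarrow> real"
  proof -
    have "continuous_on {s..1} h" using continuous_on_subset[OF that] q by auto
    then have "(h \<longlongrightarrow> h s) (at s within {s..1})" using q by (simp add: continuous_on_def)
    moreover have "at s within {s..1} = at_right s" using q by (intro at_within_Icc_at_right)
    ultimately show ?thesis by simp
  qed
  show ?thesis
  proof (rule right_derivative_except_countable[OF q(3), where N="{s. measure \<eta> {s} \<noteq> 0}"
      and k="\<lambda>t. - (\<xi>2 t / 2 * (deriv (deriv (\<Phi> t)) x + measure \<eta> {q..t} * (deriv (\<Phi> t) x)\<^sup>2))"])
    show "continuous_on {s..1} (\<lambda>t. \<Phi> t x)" by (rule continuous_on_subset[OF c(1)]) (use q in auto)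
    show "countable {s. measure \<eta> {s} \<noteq> 0}" by (rule countable_support)
    show "((\<lambda>t. \<Phi> t x) has_real_derivative - (\<xi>2 t / 2 * (deriv (deriv (\<Phi> t)) x + measure \<eta> {q..t} * (deriv (\<Phi> t) x)\<^sup>2))) (at t)"
      if "s < t" "t < 1" "t \<notin> {s. measure \<eta> {s} \<noteq> 0}" for t
      using sol that q unfolding parisi_pde_solution_def by auto
    have "(cdf \<eta> \<longlongrightarrow> cdf \<eta> s) (at_right s)" using cdf_is_right_cont[of s] by (simp add: continuous_within)
    moreover have "\<forall>\<^sub>F t in at_right s. cdf \<eta> t = measure \<eta> {q..t}"
      using q by (auto simp: eventually_at_filter probs_on_cdf[OF \<eta>])
    ultimately have m: "((\<lambda>t. measure \<eta> {q..t}) \<longlongrightarrow> measure \<eta> {q..s}) (at_right s)"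
      using q by (simp add: probs_on_cdf[OF \<eta>] Lim_transform_eventually)
    have x: "continuous_on {q..1} \<xi>2" by (rule continuous_on_subset[OF cont2]) (use q in auto)
    show "((\<lambda>t. - (\<xi>2 t / 2 * (deriv (deriv (\<Phi> t)) x + measure \<eta> {q..t} * (deriv (\<Phi> t) x)\<^sup>2))) \<longlongrightarrow>
       - (\<xi>2 s / 2 * (deriv (deriv (\<Phi> s)) x + measure \<eta> {q..s} * (deriv (\<Phi> s) x)\<^sup>2))) (at_right s)"
      by (intro tendsto_intros m lim[OF x] lim[OF c(2)] lim[OF c(3)]) auto
  qed
qed

text \<open>With equal coefficients the comparison principle applies in both directions.\<close>

lemma solution_unique:
  assumes \<eta>: "\<eta> \<in> probs_on q 1" and q: "0 \<le> q" "s \<in> {q..1}"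
    and sol: "parisi_pde_solution \<xi> q \<eta> \<Phi>" "parisi_pde_solution \<xi> q \<eta> \<Psi>"
  shows "\<Phi> s x = \<Psi> s x"
proof -
  have le: "\<Psi> s x \<le> \<Phi> s x" if sol: "parisi_pde_solution \<xi> q \<eta> \<Phi>" "parisi_pde_solution \<xi> q \<eta> \<Psi>" for \<Phi> \<Psi>
  proof -
    obtain C D where C: "\<And>s x. s\<in>{q..1} \<Longrightarrow> \<bar>deriv (\<Phi> s) x\<bar> \<le> C" and D: "\<And>s x. s\<in>{q..1} \<Longrightarrow> \<bar>deriv (\<Psi> s) x\<bar> \<le> D"
      using solution_bounds(4)[OF sol(1)] solution_bounds(4)[OF sol(2)] by blast
    interpret real_distribution \<eta> using \<eta> by (rule probs_on_real_distribution)
    show ?thesis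
    proof (rule parisi_comparison[where u=\<Phi> and q=q and s=s and x=x and a="\<lambda>s. \<xi>2 s / 2" and A="A2 / 2" and z="\<lambda>s. measure \<eta> {q..s}" and y="\<lambda>s. measure \<eta> {q..s}" and C="max C D" and v=\<Psi>
          and ?u1.0="\<lambda>s. deriv (\<Phi> s)" and ?u2.0="\<lambda>s. deriv (deriv (\<Phi> s))" and ?v1.0="\<lambda>s. deriv (\<Psi> s)" and ?v2.0="\<lambda>s. deriv (deriv (\<Psi> s))"])
      show "\<bar>deriv (\<Phi> s) x\<bar> \<le> max C D" if "s\<in>{q..1}" for s x using C[OF that, of x] by linarith
      show "\<bar>deriv (\<Psi> s) x\<bar> \<le> max C D" if "s\<in>{q..1}" for s x using D[OF that, of x] by linarith
      show "((\<lambda>t. \<Phi> t x) has_real_derivative - (\<xi>2 s / 2 * (deriv (deriv (\<Phi> s)) x + measure \<eta> {q..s} * (deriv (\<Phi> s) x)\<^sup>2))) (at s within {s..})"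
        if "q \<le> s" "s < 1" for s x by (rule solution_right_derivative[OF \<eta> q(1) that sol(1)])
      show "((\<lambda>t. \<Psi> t x) has_real_derivative - (\<xi>2 s / 2 * (deriv (deriv (\<Psi> s)) x + measure \<eta> {q..s} * (deriv (\<Psi> s) x)\<^sup>2))) (at s within {s..})"
        if "q \<le> s" "s < 1" for s x by (rule solution_right_derivative[OF \<eta> q(1) that sol(2)])
    qed (use q \<xi>2_nn A2 solution_bounds[OF sol(1)] solution_bounds[OF sol(2)] in auto)
  qed
  show ?thesis using le[OF sol] le[OF sol(2,1)] by simp
qed

text \<open>The reflected function satisfies the same equation, in which the gradient is squared,
  with the same even terminal value, so the two can be compared.\<close>

lemma solution_even:
  assumes \<eta>: "\<eta> \<in> probs_on q 1" and q: "0 \<le> q" "s \<in> {q..1}" and sol: "parisi_pde_solution \<xi> q \<eta> \<Phi>"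
  shows "\<Phi> s (- x) = \<Phi> s x"
proof -
  obtain C where C: "\<And>s x. s\<in>{q..1} \<Longrightarrow> \<bar>deriv (\<Phi> s) x\<bar> \<le> C"
    using solution_bounds(4)[OF sol(1)] by blast
  interpret real_distribution \<eta> using \<eta> by (rule probs_on_real_distribution)
  have le: "\<Phi> s (- x) \<le> \<Phi> s x" for x
  proof (rule parisi_comparison[where u=\<Phi> and q=q and s=s and x=x and a="\<lambda>s. \<xi>2 s / 2" and A="A2 / 2" and z="\<lambda>s. measure \<eta> {q..s}" and y="\<lambda>s. measure \<eta> {q..s}"
        and C=C and v="\<lambda>s x. \<Phi> s (- x)" and ?v1.0="\<lambda>s x. - deriv (\<Phi> s) (- x)" and ?v2.0="\<lambda>s x. deriv (deriv (\<Phi> s)) (- x)"])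
    show "((\<lambda>t. \<Phi> t x) has_real_derivative - (\<xi>2 s / 2 * (deriv (deriv (\<Phi> s)) x + measure \<eta> {q..s} * (deriv (\<Phi> s) x)\<^sup>2))) (at s within {s..})"
      if "q \<le> s" "s < 1" for s x by (rule solution_right_derivative[OF \<eta> q(1) that sol(1)])
    show "((\<lambda>t. \<Phi> t (- x)) has_real_derivative - (\<xi>2 s / 2 * (deriv (deriv (\<Phi> s)) (- x) + measure \<eta> {q..s} * (- deriv (\<Phi> s) (- x))\<^sup>2))) (at s within {s..})"
      if "q \<le> s" "s < 1" for s x using solution_right_derivative[OF \<eta> q(1) that sol(1), of "- x"] by simp
    show "((\<lambda>x. \<Phi> s (- x)) has_real_derivative - deriv (\<Phi> s) (- x)) (at x)" if "s \<in> {q..1}" for s x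
      using DERIV_mirror[of "\<Phi> s" "deriv (\<Phi> s) (- x)" x] solution_bounds(1)[OF sol that, of "- x"] by simp
    show "((\<lambda>x. - deriv (\<Phi> s) (- x)) has_real_derivative deriv (deriv (\<Phi> s)) (- x)) (at x)" if "s \<in> {q..1}" for s x
      using DERIV_minus[OF iffD1[OF DERIV_mirror[of "deriv (\<Phi> s)" "deriv (deriv (\<Phi> s)) (- x)" x] solution_bounds(2)[OF sol that, of "- x"]]] by simp
    show "continuous_on ({q..1} \<times> UNIV) (\<lambda>(s, x). \<Phi> s (- x))"
    proof -
      have "continuous_on ({q..1} \<times> UNIV) (\<lambda>p. (\<lambda>(s, x). \<Phi> s x) (fst p, - snd p))"
        by (rule continuous_on_compose2[OF solution_bounds(3)[OF sol]]) (auto intro!: continuous_intros)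
      then show ?thesis by (simp add: case_prod_unfold)
    qed
  qed (use q \<xi>2_nn A2 solution_bounds[OF sol(1)] C in auto)
  show ?thesis using le[of x] le[of "- x"] by simp
qed

subsection \<open>Step approximations of the order parameter\<close>

context
  fixes Z :: "real \<Rightarrow> real"
  assumes Z_mono: "\<And>s t. s \<le> t \<Longrightarrow> Z s \<le> Z t" and Z_nn: "\<And>s. 0 \<le> Z s" and Z_le: "\<And>s. Z s \<le> 1"
    and Z_right: "\<And>s. (Z \<longlongrightarrow> Z s) (at_right s)"
begin

text \<open>As the coefficient of the cell ending at \<open>real l / 2 ^ n\<close>, this value
  dominates \<open>Z\<close> on the cell and does not increase under refinement. The floor
  \<open>1 / 2 ^ n\<close> keeps the exponent positive, as the recursion divides by it, and
  disappears in the limit.\<close>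

definition lev :: "nat \<Rightarrow> nat \<Rightarrow> real" where "lev n l = max (Z (real l / 2 ^ n)) (1 / 2 ^ n)"

text \<open>\<open>iter n k\<close> is the step solution at time \<open>1 - k / 2 ^ n\<close>.\<close>

primrec iter :: "nat \<Rightarrow> nat \<Rightarrow> real \<Rightarrow> real" where
  "iter n 0 = (\<lambda>x. ln (cosh x))"
| "iter n (Suc k) = cole_hopf (lev n (2 ^ n - k)) (\<xi>1 (real (2 ^ n - k) / 2 ^ n) - \<xi>1 (real (2 ^ n - k - 1) / 2 ^ n)) (iter n k)"

definition node :: "nat \<Rightarrow> nat \<Rightarrow> real \<Rightarrow> real" where "node n l = iter n (2 ^ n - l)"

lemma node_last: "node n (2 ^ n) = (\<lambda>x. ln (cosh x))" by (simp add: node_def)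

lemma node_step:
  assumes "l < 2 ^ n"
  shows "node n l = cole_hopf (lev n (Suc l)) (\<xi>1 (real (Suc l) / 2 ^ n) - \<xi>1 (real l / 2 ^ n)) (node n (Suc l))"
proof -
  have 1: "2 ^ n - l = Suc (2 ^ n - Suc l)" using assms by simp
  have 2: "(2::nat) ^ n - (2 ^ n - Suc l) = Suc l" using assms by (simp only: diff_diff_cancel Suc_leI)
  show ?thesis unfolding node_def 1 iter.simps 2 by simp
qed

lemma lev_pos: "lev n l > 0" unfolding lev_def by (rule less_max_iff_disj[THEN iffD2]) simp

lemma lev_le: "lev n l \<le> 1" unfolding lev_def using Z_le by simp

lemma lev_mono: "l \<le> l' \<Longrightarrow> lev n l \<le> lev n l'"
  unfolding lev_def using Z_mono[of "real l / 2 ^ n" "real l' / 2 ^ n"]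
  by (intro max.mono) (auto simp: divide_right_mono)

definition Q where "Q = 2 * quad_moment (\<xi>1 1)"

lemma Q_nn: "Q \<ge> 0"
  unfolding Q_def quad_moment_def by (simp add: Bochner_Integration.integral_nonneg)

text \<open>The constant is an invariant of the backward induction: the exponential collects the
  losses of the Cole-Hopf steps over the elapsed time, \<open>4\<close> is the bound for
  \<open>ln cosh\<close>, and \<open>2 * (1 - lev n l)\<close> collects the losses at the drops of
  the coefficient.\<close>

lemma nice_node:
  assumes "1 \<le> l" "l \<le> 2 ^ n"
  shows "nice (lev n l) (exp (Q * (\<xi>1 1 - \<xi>1 (real l / 2 ^ n))) * (4 + 2 * (1 - lev n l))) (node n l)"
  using assms(2,1)
proof (induction l rule: inc_induct)
  case base
  have "nice (lev n (2 ^ n)) 4 (node n (2 ^ n))"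
    unfolding node_last using nice_ln_cosh lev_pos[of n "2^n"] lev_le[of n "2^n"] by simp
  then show ?case by (rule nice_mono_K) (use lev_le[of n "2^n"] in simp)
next
  case (step l)
  let ?c = "lev n (Suc l)" and ?s = "real l / 2 ^ n" and ?t = "real (Suc l) / 2 ^ n"
  have le: "0 \<le> ?s" "?s \<le> ?t" "?t \<le> 1" using step.hyps by (auto simp: divide_right_mono field_simps)
     (metis of_nat_Suc of_nat_le_iff of_nat_numeral of_nat_power Suc_leI add.commute)
  have v: "0 \<le> \<xi>1 ?t - \<xi>1 ?s" "\<xi>1 ?t - \<xi>1 ?s \<le> \<xi>1 1"
  proof -
    have "0 \<le> ?t" "?s \<le> 1" using le by linarith+
    then show "0 \<le> \<xi>1 ?t - \<xi>1 ?s" "\<xi>1 ?t - \<xi>1 ?s \<le> \<xi>1 1"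
      using \<xi>1_le[OF le] \<xi>1_le[of ?t 1] \<xi>1_nn[of ?s] le by linarith+
  qed
  have "nice ?c (exp (Q * (\<xi>1 1 - \<xi>1 ?t)) * (4 + 2 * (1 - ?c)) * exp (2 * quad_moment (\<xi>1 1) * (\<xi>1 ?t - \<xi>1 ?s))) (node n l)"
    unfolding node_step[OF step.hyps(2)] by (rule nice_cole_hopf[OF step.IH lev_pos lev_le v]) simp
  then have "nice ?c (exp (Q * (\<xi>1 1 - \<xi>1 ?s)) * (4 + 2 * (1 - ?c))) (node n l)"
  proof (rule nice_mono_K)
    have "exp (Q * (\<xi>1 1 - \<xi>1 ?s)) = exp (Q * (\<xi>1 1 - \<xi>1 ?t) + Q * (\<xi>1 ?t - \<xi>1 ?s))" by (simp add: algebra_simps)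
    then show "exp (Q * (\<xi>1 1 - \<xi>1 ?t)) * (4 + 2 * (1 - ?c)) * exp (2 * quad_moment (\<xi>1 1) * (\<xi>1 ?t - \<xi>1 ?s))
        \<le> exp (Q * (\<xi>1 1 - \<xi>1 ?s)) * (4 + 2 * (1 - ?c))" unfolding exp_add Q_def by (simp add: mult_ac)
  qed
  from parisi_profile_nice[OF parisi_profile_mono[OF this[unfolded nice_def], of "lev n l"]]
  have "nice (lev n l) (exp (Q * (\<xi>1 1 - \<xi>1 ?s)) * (4 + 2 * (1 - ?c)) + 2 * (?c - lev n l)) (node n l)"
    using lev_pos[of n l] lev_mono[of l "Suc l" n] by simp
  then show ?case
  proof (rule nice_mono_K)
    have "?s \<le> 1" using le by linarith
    from \<xi>1_le[OF le(1) this order_refl] have "0 \<le> Q * (\<xi>1 1 - \<xi>1 ?s)" using Q_nn by (intro mult_nonneg_nonneg) linarith+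
    then have "1 \<le> exp (Q * (\<xi>1 1 - \<xi>1 ?s))" by (simp only: one_le_exp_iff)
    \<comment> \<open>The new drop is charged inside the exponential factor, which is at least 1, so
      that it merges with the earlier drops.\<close>
    then have "1 * (2 * (?c - lev n l)) \<le> exp (Q * (\<xi>1 1 - \<xi>1 ?s)) * (2 * (?c - lev n l))"
      using lev_mono[of l "Suc l" n] by (intro mult_right_mono) auto
    then show "exp (Q * (\<xi>1 1 - \<xi>1 ?s)) * (4 + 2 * (1 - ?c)) + 2 * (?c - lev n l) \<le> exp (Q * (\<xi>1 1 - \<xi>1 ?s)) * (4 + 2 * (1 - lev n l))"
      by (simp add: algebra_simps)
  qed
qed

text \<open>A ceiling for the constant of \<open>nice_node\<close> that depends neither on
  \<open>n\<close> nor on the time: full elapsed time, and \<open>4 + 2\<close> for a total drop of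
  at most 1.\<close>

definition KB where "KB = exp (Q * \<xi>1 1) * 6"

definition idx :: "nat \<Rightarrow> real \<Rightarrow> nat" where "idx n s = nat \<lfloor>s * 2 ^ n\<rfloor>"

lemma idx:
  assumes "0 \<le> s" "s < 1"
  shows "real (idx n s) / 2 ^ n \<le> s" "s < real (Suc (idx n s)) / 2 ^ n" "idx n s < 2 ^ n"
proof -
  have f: "0 \<le> \<lfloor>s * 2 ^ n\<rfloor>" using assms by simp
  have r: "real (idx n s) = of_int \<lfloor>s * 2 ^ n\<rfloor>" using f by (simp add: idx_def)
  have "real (idx n s) \<le> s * 2 ^ n" "s * 2 ^ n < real (idx n s) + 1" unfolding r by linarith+
  then show 1: "real (idx n s) / 2 ^ n \<le> s" "s < real (Suc (idx n s)) / 2 ^ n" by (simp_all add: field_simps)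
  have "real (idx n s) \<le> s * 2 ^ n" using \<open>real (idx n s) \<le> s * 2 ^ n\<close> .
  also have "\<dots> < 1 * 2 ^ n" using assms by (intro mult_strict_right_mono) auto
  finally have "real (idx n s) < real (2 ^ n)" by simp
  then show "idx n s < 2 ^ n" by (simp only: of_nat_less_iff)
qed

lemma idx_eq:
  assumes "real l / 2 ^ n \<le> s" "s < real (Suc l) / 2 ^ n"
  shows "idx n s = l"
proof -
  have "real l \<le> s * 2 ^ n" "s * 2 ^ n < real l + 1" using assms by (simp_all add: field_simps)
  then have "\<lfloor>s * 2 ^ n\<rfloor> = int l" by (simp add: floor_eq_iff)
  then show ?thesis by (simp add: idx_def)
qed

definition S :: "nat \<Rightarrow> real \<Rightarrow> real \<Rightarrow> real" where
  "S n s = (if s < 1 then cole_hopf (lev n (Suc (idx n s))) (\<xi>1 (real (Suc (idx n s)) / 2 ^ n) - \<xi>1 s) (node n (Suc (idx n s)))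
     else (\<lambda>x. ln (cosh x)))"

text \<open>By definition \<open>S\<close> uses the cell to the right of a node. That the cell on
  its left gives the same value there, by a Cole-Hopf step of length 0, is what glues the step
  solution.\<close>

lemma S_cell:
  assumes "l < 2 ^ n" "real l / 2 ^ n \<le> s" "s \<le> real (Suc l) / 2 ^ n"
  shows "S n s = cole_hopf (lev n (Suc l)) (\<xi>1 (real (Suc l) / 2 ^ n) - \<xi>1 s) (node n (Suc l))"
proof (cases "s < real (Suc l) / 2 ^ n")
  case True
  then have "s < 1" using Suc_div_le[OF assms(1)] by linarith
  then show ?thesis using idx_eq[OF assms(2) True] by (simp add: S_def)
next
  case False
  then have s: "s = real (Suc l) / 2 ^ n" using assms by simp
  have r: "cole_hopf (lev n (Suc l)) (\<xi>1 (real (Suc l) / 2 ^ n) - \<xi>1 s) (node n (Suc l)) = node n (Suc l)"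
    unfolding s by (simp add: lev_pos fun_eq_iff)
  show ?thesis
  proof (cases "Suc l = 2 ^ n")
    case True
    have "s = 1" unfolding s True by simp
    then have "S n s = node n (Suc l)" unfolding True node_last by (simp add: S_def)
    then show ?thesis unfolding r .
  next
    case False
    then have l: "Suc l < 2 ^ n" using assms(1) by simp
    have "s < real (Suc (Suc l)) / 2 ^ n" unfolding s by (simp add: divide_strict_right_mono)
    then have "idx n s = Suc l" by (intro idx_eq) (simp_all add: s)
    moreover have "s < 1" using Suc_div_le[OF l] \<open>s < real (Suc (Suc l)) / 2 ^ n\<close> by linarith
    ultimately have "S n s = cole_hopf (lev n (Suc (Suc l))) (\<xi>1 (real (Suc (Suc l)) / 2 ^ n) - \<xi>1 (real (Suc l) / 2 ^ n)) (node n (Suc (Suc l)))"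
      by (simp add: S_def s)
    also have "\<dots> = node n (Suc l)" by (rule node_step[OF l, symmetric])
    finally show ?thesis unfolding r .
  qed
qed

lemma S_1: "S n 1 = (\<lambda>x. ln (cosh x))" by (simp add: S_def)

lemma S_0: "S n 0 = node n 0"
  using S_cell[of 0 n 0] node_step[of 0 n] by simp

lemma nice_S:
  assumes "0 \<le> s" "s < 1"
  shows "nice (lev n (Suc (idx n s))) KB (S n s)"
proof -
  let ?l = "Suc (idx n s)"
  let ?t = "real ?l / 2 ^ n"
  note i = idx[OF assms, of n]
  have t: "?t \<le> 1" by (rule Suc_div_le[OF i(3)])
  have v: "0 \<le> \<xi>1 ?t - \<xi>1 s" "\<xi>1 ?t - \<xi>1 s \<le> \<xi>1 1" 
    using \<xi>1_le[of s ?t] \<xi>1_le[of ?t 1] \<xi>1_nn[of s] assms i t by auto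
  have "nice (lev n ?l) (exp (Q * (\<xi>1 1 - \<xi>1 ?t)) * (4 + 2 * (1 - lev n ?l)) * exp (2 * quad_moment (\<xi>1 1) * (\<xi>1 ?t - \<xi>1 s))) (S n s)"
    unfolding S_def using assms(2) i(3) by (simp only: if_True) (rule nice_cole_hopf[OF nice_node lev_pos lev_le v], auto)
  then show ?thesis
  proof (rule nice_mono_K)
    have "exp (Q * (\<xi>1 1 - \<xi>1 ?t)) * (4 + 2 * (1 - lev n ?l)) * exp (2 * quad_moment (\<xi>1 1) * (\<xi>1 ?t - \<xi>1 s))
        = exp (Q * (\<xi>1 1 - \<xi>1 ?t) + Q * (\<xi>1 ?t - \<xi>1 s)) * (4 + 2 * (1 - lev n ?l))"
      unfolding exp_add Q_def by (simp only: mult_ac)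
    also have "Q * (\<xi>1 1 - \<xi>1 ?t) + Q * (\<xi>1 ?t - \<xi>1 s) = Q * (\<xi>1 1 - \<xi>1 s)" by (simp add: algebra_simps)
    also have "exp (Q * (\<xi>1 1 - \<xi>1 s)) * (4 + 2 * (1 - lev n ?l)) \<le> exp (Q * \<xi>1 1) * 6"
      using Q_nn \<xi>1_nn[of s] assms lev_pos[of n ?l] lev_le[of n ?l] by (intro mult_mono) (auto intro!: mult_left_mono)
    finally show "exp (Q * (\<xi>1 1 - \<xi>1 ?t)) * (4 + 2 * (1 - lev n ?l)) * exp (2 * quad_moment (\<xi>1 1) * (\<xi>1 ?t - \<xi>1 s)) \<le> KB"
      by (simp add: KB_def)
  qed
qed

text \<open>None of these bounds involves \<open>n\<close>, so they pass to the limit.\<close>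

lemma S_bounds:
  assumes "s \<in> {0..1}"
  shows "(S n s has_real_derivative deriv (S n s) x) (at x)" "(deriv (S n s) has_real_derivative deriv (deriv (S n s)) x) (at x)"
    "\<bar>deriv (S n s) x\<bar> \<le> 1" "0 \<le> deriv (deriv (S n s)) x" "deriv (deriv (S n s)) x \<le> 1"
    "\<bar>S n s x - S n s y\<bar> \<le> \<bar>x - y\<bar>" "\<bar>deriv (S n s) x - deriv (S n s) y\<bar> \<le> \<bar>x - y\<bar>"
    "\<bar>deriv (deriv (S n s)) x - deriv (deriv (S n s)) y\<bar> \<le> (KB + 2) * \<bar>x - y\<bar>"
proof -
  have "\<exists>c. 0 \<le> c \<and> c \<le> 1 \<and> nice c KB (S n s)"
  proof (cases "s < 1")
    case True
    then show ?thesis using nice_S[of s n] assms lev_pos[of n "Suc (idx n s)"] lev_le[of n "Suc (idx n s)"]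
      by (intro exI[of _ "lev n (Suc (idx n s))"]) auto
  next
    case False
    then have "s = 1" using assms by simp
    have "1 \<le> exp (Q * \<xi>1 1)" using Q_nn \<xi>1_nn[of 1] by simp
    then have "4 \<le> KB" unfolding KB_def by linarith
    then show ?thesis using nice_mono_K[OF nice_ln_cosh[of 1]] unfolding \<open>s = 1\<close> S_1 by (intro exI[of _ 1]) auto
  qed
  then obtain c where c: "0 \<le> c" "c \<le> 1" "nice c KB (S n s)" by blast
  note b = nice_bounds[OF c(3,1)]
  show "(S n s has_real_derivative deriv (S n s) x) (at x)" "(deriv (S n s) has_real_derivative deriv (deriv (S n s)) x) (at x)"
    "\<bar>deriv (S n s) x\<bar> \<le> 1" "0 \<le> deriv (deriv (S n s)) x" "deriv (deriv (S n s)) x \<le> 1"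
    "\<bar>S n s x - S n s y\<bar> \<le> \<bar>x - y\<bar>" "\<bar>deriv (S n s) x - deriv (S n s) y\<bar> \<le> \<bar>x - y\<bar>"
    using b by auto
  have "(KB + 2 * c) * \<bar>x - y\<bar> \<le> (KB + 2) * \<bar>x - y\<bar>" using c by (intro mult_right_mono) auto
  then show "\<bar>deriv (deriv (S n s)) x - deriv (deriv (S n s)) y\<bar> \<le> (KB + 2) * \<bar>x - y\<bar>"
    using b(8)[of x y] by linarith
qed

definition rhs where "rhs n x s = \<xi>2 s / 2 * (deriv (deriv (S n s)) x + lev n (Suc (idx n s)) * (deriv (S n s) x)\<^sup>2)"

lemma DERIV_S_time_aux:
  assumes "0 \<le> s" "s < 1"
  shows "((\<lambda>t. cole_hopf (lev n (Suc (idx n s))) (\<xi>1 (real (Suc (idx n s)) / 2 ^ n) - \<xi>1 t) (node n (Suc (idx n s))) x) has_real_derivative - rhs n x s) (at s)"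
proof -
  let ?l = "Suc (idx n s)"
  let ?t = "real ?l / 2 ^ n" and ?f = "node n ?l" and ?c = "lev n ?l"
  note i = idx[OF assms, of n]
  have t: "?t \<le> 1" by (rule Suc_div_le[OF i(3)])
  have v0: "0 < \<xi>1 ?t - \<xi>1 s" using \<xi>1_less[of s ?t] assms i t by simp
  obtain K where K: "nice ?c K ?f" using nice_node[of ?l n] i(3) by auto
  interpret profile_step ?c "\<xi>1 ?t - \<xi>1 s" K ?f "deriv ?f" "deriv (deriv ?f)" "deriv (deriv (deriv ?f))"
    using K v0 lev_pos lev_le by (simp add: profile_step_def nice_def)
  have Seq: "S n s = cole_hopf ?c (\<xi>1 ?t - \<xi>1 s) ?f" using assms by (simp add: S_def)
  have F1: "F1 = deriv (S n s)" unfolding Seq by (rule ext, rule DERIV_imp_deriv[symmetric], rule DERIV_cole_hopf)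
  have F2: "F2 = deriv (deriv (S n s))" unfolding F1[symmetric] by (rule ext, rule DERIV_imp_deriv[symmetric], rule DERIV_F1)
  have "((\<lambda>t. \<xi>1 ?t - \<xi>1 t) has_real_derivative - \<xi>2 s) (at s)"
    using assms by (auto intro!: derivative_eq_intros der2)
  note d = DERIV_chain'[OF this DERIV_cole_hopf_time[OF v0, of x]]
  have "(F2 x + ?c * (F1 x)\<^sup>2) / 2 * - \<xi>2 s = - rhs n x s" unfolding rhs_def F1 F2 by simp
  with d show ?thesis by (simp only:)
qed

text \<open>At a node this is the right derivative, with the coefficient of the cell to the right;
  the comparison principle asks for exactly this form.\<close>

lemma DERIV_S_time:
  assumes "0 \<le> s" "s < 1"
  shows "((\<lambda>t. S n t x) has_real_derivative - rhs n x s) (at s within {s..})"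
proof (rule has_field_derivative_transform_within[OF has_field_derivative_at_within[OF DERIV_S_time_aux[OF assms]]])
  note i = idx[OF assms, of n]
  show "0 < real (Suc (idx n s)) / 2 ^ n - s" using i by simp
  fix t assume "t \<in> {s..}" "dist t s < real (Suc (idx n s)) / 2 ^ n - s"
  then have "real (idx n s) / 2 ^ n \<le> t" "t \<le> real (Suc (idx n s)) / 2 ^ n" using i by (auto simp: dist_real_def)
  from S_cell[OF i(3) this]
  show "cole_hopf (lev n (Suc (idx n s))) (\<xi>1 (real (Suc (idx n s)) / 2 ^ n) - \<xi>1 t) (node n (Suc (idx n s))) x = S n t x" by simp
qed simp

lemma DERIV_S_time_interior:
  assumes "0 \<le> s" "s < 1" "s \<notin> (\<lambda>l. real l / 2 ^ n) ` {..2 ^ n}"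
  shows "((\<lambda>t. S n t x) has_real_derivative - rhs n x s) (at s)"
proof (rule has_field_derivative_transform_within_open[OF DERIV_S_time_aux[OF assms(1,2)]])
  note i = idx[OF assms(1,2), of n]
  have "real (idx n s) / 2 ^ n \<noteq> s"
  proof
    assume "real (idx n s) / 2 ^ n = s"
    then have "s \<in> (\<lambda>l. real l / 2 ^ n) ` {..2 ^ n}" using i(3) by (intro image_eqI[of _ _ "idx n s"]) auto
    then show False using assms(3) by blast
  qed
  then show "s \<in> {real (idx n s) / 2 ^ n<..<real (Suc (idx n s)) / 2 ^ n}" using i by auto
  fix t assume "t \<in> {real (idx n s) / 2 ^ n<..<real (Suc (idx n s)) / 2 ^ n}"
  then have "real (idx n s) / 2 ^ n \<le> t" "t \<le> real (Suc (idx n s)) / 2 ^ n" by auto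
  from S_cell[OF i(3) this]
  show "cole_hopf (lev n (Suc (idx n s))) (\<xi>1 (real (Suc (idx n s)) / 2 ^ n) - \<xi>1 t) (node n (Suc (idx n s))) x = S n t x" by simp
qed simp

lemma S_continuous_time: "continuous_on {0..1} (\<lambda>s. S n s x)"
proof -
  let ?C = "\<lambda>l. {real l / 2 ^ n..real (Suc l) / 2 ^ n}"
  have "continuous_on (\<Union>l\<in>{..<2 ^ n}. ?C l) (\<lambda>s. S n s x)"
  proof (rule continuous_on_closed_Union)
    fix l assume "l \<in> {..<(2::nat) ^ n}"
    then have l: "l < 2 ^ n" by simp
    let ?t = "real (Suc l) / 2 ^ n"
    have t: "?t \<le> 1" by (rule Suc_div_le[OF l])
    obtain K where K: "nice (lev n (Suc l)) K (node n (Suc l))" using nice_node[of "Suc l" n] l by auto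
    have "0 \<le> real l / 2 ^ n" by simp
    then have sub: "?C l \<subseteq> {0..1}" using t unfolding subset_iff atLeastAtMost_iff by (meson order_trans)
    have "continuous_on (?C l) (\<lambda>s. cole_hopf (lev n (Suc l)) (\<xi>1 ?t - \<xi>1 s) (node n (Suc l)) x)"
    proof (rule continuous_on_compose2[OF cole_hopf_continuous_time[OF lev_pos lev_le K[unfolded nice_def], of "\<xi>1 1"]])
      show "continuous_on (?C l) (\<lambda>s. \<xi>1 ?t - \<xi>1 s)" by (intro continuous_intros continuous_on_subset[OF \<xi>1_cont sub])
      show "(\<lambda>s. \<xi>1 ?t - \<xi>1 s) ` ?C l \<subseteq> {0..\<xi>1 1}"
      proof (rule image_subsetI)
        fix s assume s: "s \<in> ?C l"
        from subsetD[OF sub s] have "0 \<le> s" "s \<le> 1" by (simp_all only: atLeastAtMost_iff)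
        then show "\<xi>1 ?t - \<xi>1 s \<in> {0..\<xi>1 1}" using \<xi>1_le[of s ?t] \<xi>1_le[of ?t 1] \<xi>1_nn[of s] s t by auto
      qed
    qed
    then show "continuous_on (?C l) (\<lambda>s. S n s x)"
    proof (rule continuous_on_eq)
      show "cole_hopf (lev n (Suc l)) (\<xi>1 ?t - \<xi>1 s) (node n (Suc l)) x = S n s x" if "s \<in> ?C l" for s
        using S_cell[OF l, of s] that by simp
    qed
  qed auto
  moreover have "{0..1} \<subseteq> (\<Union>l\<in>{..<2 ^ n}. ?C l)"
  proof
    fix s :: real assume s: "s \<in> {0..1}"
    show "s \<in> (\<Union>l\<in>{..<2 ^ n}. ?C l)"
    proof (cases "s < 1")
      case True
      then show ?thesis using idx[of s n] s by (intro UN_I[of "idx n s"]) auto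
    next
      case False
      then have "s = 1" using s by simp
      moreover have "Suc (2 ^ n - 1) = (2::nat) ^ n" by simp
      ultimately show ?thesis by (intro UN_I[of "2 ^ n - 1"]) (auto simp del: of_nat_Suc simp: divide_le_eq_1)
    qed
  qed
  ultimately show ?thesis by (rule continuous_on_subset)
qed

text \<open>The coefficient of the finer step function is nowhere larger, so comparison makes the
  approximations monotone and their convergence needs no compactness.\<close>

lemma S_decreasing: assumes s: "s \<in> {0..1}" shows "S (Suc n) s x \<le> S n s x"
proof (rule parisi_comparison[where q=0 and u="S n" and v="S (Suc n)" and s=s and x=x and a="\<lambda>s. \<xi>2 s / 2" and A="A2 / 2" and C=1
      and z="\<lambda>s. lev n (Suc (idx n s))" and y="\<lambda>s. lev (Suc n) (Suc (idx (Suc n) s))"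
      and ?u1.0="\<lambda>s. deriv (S n s)" and ?u2.0="\<lambda>s. deriv (deriv (S n s))" and ?v1.0="\<lambda>s. deriv (S (Suc n) s)" and ?v2.0="\<lambda>s. deriv (deriv (S (Suc n) s))"])
  show "continuous_on ({0..1} \<times> UNIV) (\<lambda>(s, x). S n s x)" for n
    by (rule continuous_on_strip[where B=1]) (use S_bounds S_continuous_time in auto)
  then show "continuous_on ({0..1} \<times> UNIV) (\<lambda>(s, x). S (Suc n) s x)" .
  \<comment> \<open>The finer cell containing \<open>s\<close> ends no later than the coarser
    one.\<close>
  show "lev (Suc n) (Suc (idx (Suc n) s)) \<le> lev n (Suc (idx n s))" if "0 \<le> s" "s < 1" for s
  proof -
    have "s * 2 ^ n < real (Suc (idx n s))" using idx(2)[OF that, of n] by (simp add: field_simps)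
    moreover have "real (idx (Suc n) s) \<le> s * 2 ^ Suc n" using idx(1)[OF that, of "Suc n"] by (simp add: field_simps)
    ultimately have "real (idx (Suc n) s) < real (2 * Suc (idx n s))" by simp
    then have "Suc (idx (Suc n) s) \<le> 2 * Suc (idx n s)" by (simp only: of_nat_less_iff Suc_le_eq)
    then have "real (Suc (idx (Suc n) s)) \<le> 2 * real (Suc (idx n s))" by (simp only: of_nat_le_iff[symmetric, where 'a=real] of_nat_mult of_nat_numeral)
    then have "real (Suc (idx (Suc n) s)) / 2 ^ Suc n \<le> 2 * real (Suc (idx n s)) / 2 ^ Suc n" by (rule divide_right_mono) simp
    then have "real (Suc (idx (Suc n) s)) / 2 ^ Suc n \<le> real (Suc (idx n s)) / 2 ^ n" by (simp del: of_nat_Suc)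
    moreover have "(1::real) / 2 ^ Suc n \<le> 1 / 2 ^ n" by (simp add: field_simps)
    ultimately show ?thesis unfolding lev_def by (intro max.mono Z_mono) auto
  qed
  show "((\<lambda>t. S n t x) has_real_derivative - (\<xi>2 s / 2 * (deriv (deriv (S n s)) x + lev n (Suc (idx n s)) * (deriv (S n s) x)\<^sup>2))) (at s within {s..})"
    if "0 \<le> s" "s < 1" for n s x using DERIV_S_time[OF that, of n x] by (simp add: rhs_def)
  then show "((\<lambda>t. S (Suc n) t x) has_real_derivative - (\<xi>2 s / 2 * (deriv (deriv (S (Suc n) s)) x + lev (Suc n) (Suc (idx (Suc n) s)) * (deriv (S (Suc n) s) x)\<^sup>2))) (at s within {s..})"
    if "0 \<le> s" "s < 1" for s x using that by blast
qed (use s S_bounds S_1 \<xi>2_nn A2 lev_le lev_pos in \<open>auto intro: less_imp_le\<close>)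

text \<open>A Cole-Hopf step does not decrease the value, by
  \<open>cole_hopf_time_increment\<close>. The bound is what keeps the decreasing approximations
  convergent.\<close>

lemma node_ge: "l \<le> 2 ^ n \<Longrightarrow> ln (cosh x) \<le> node n l x"
proof (induction l rule: inc_induct)
  case base show ?case by (simp add: node_last)
next
  case (step l)
  let ?s = "real l / 2 ^ n" and ?t = "real (Suc l) / 2 ^ n"
  obtain K where K: "nice (lev n (Suc l)) K (node n (Suc l))" using nice_node[of "Suc l" n] step.hyps by auto
  have "0 \<le> \<xi>1 ?t - \<xi>1 ?s" using \<xi>1_le[of ?s ?t] Suc_div_le[OF step.hyps(2)] by (simp add: divide_right_mono)
  from cole_hopf_time_increment(1)[OF lev_pos lev_le K[unfolded nice_def] _ this, of x]
  have "node n (Suc l) x \<le> node n l x" unfolding node_step[OF step.hyps(2)] by (simp add: lev_pos)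
  then show ?case using step.IH by simp
qed

lemma S_cell_bounds:
  assumes "l < 2 ^ n" "real l / 2 ^ n \<le> s" "s \<le> real (Suc l) / 2 ^ n"
  shows "node n (Suc l) x \<le> S n s x" "S n s x \<le> node n (Suc l) x + (\<xi>1 (real (Suc l) / 2 ^ n) - \<xi>1 s) / 2"
proof -
  let ?t = "real (Suc l) / 2 ^ n"
  obtain K where K: "nice (lev n (Suc l)) K (node n (Suc l))" using nice_node[of "Suc l" n] assms by auto
  have "0 \<le> s" using assms(2) by (rule order_trans[rotated]) simp
  then have v: "0 \<le> \<xi>1 ?t - \<xi>1 s" using \<xi>1_le[of s ?t] Suc_div_le[OF assms(1)] assms by simp
  show "node n (Suc l) x \<le> S n s x" "S n s x \<le> node n (Suc l) x + (\<xi>1 ?t - \<xi>1 s) / 2"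
    using cole_hopf_time_increment[OF lev_pos lev_le K[unfolded nice_def] order_refl v, of x]
    by (simp_all add: S_cell[OF assms] lev_pos)
qed

lemma S_ge: assumes "s \<in> {0..1}" shows "ln (cosh x) \<le> S n s x"
proof (cases "s < 1")
  case True
  note i = idx[of s n]
  have "ln (cosh x) \<le> node n (Suc (idx n s)) x" using i assms True by (intro node_ge) auto
  also have "\<dots> \<le> S n s x" by (rule S_cell_bounds(1)) (use i assms True in auto)
  finally show ?thesis .
qed (use assms in \<open>simp add: S_def\<close>)

definition Phi :: "real \<Rightarrow> real \<Rightarrow> real" where "Phi s x = lim (\<lambda>n. S n s x)"

lemma S_tendsto_Phi: assumes s: "s \<in> {0..1}" shows "(\<lambda>n. S n s x) \<longlonglongrightarrow> Phi s x" "Phi s x \<le> S n s x"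
proof -
  have dec: "decseq (\<lambda>n. S n s x)" by (intro decseq_SucI S_decreasing s)
  obtain L where L: "(\<lambda>n. S n s x) \<longlonglongrightarrow> L" "\<And>i. L \<le> S i s x"
    using decseq_convergent[OF dec, of "ln (cosh x)"] S_ge[OF s] by metis
  then have "Phi s x = L" unfolding Phi_def by (intro limI)
  then show "(\<lambda>n. S n s x) \<longlonglongrightarrow> Phi s x" "Phi s x \<le> S n s x" using L by auto
qed

lemma Phi_ge: "s \<in> {0..1} \<Longrightarrow> ln (cosh x) \<le> Phi s x"
  by (rule LIMSEQ_le_const[OF S_tendsto_Phi(1)]) (use S_ge in auto)

lemma Phi_1: "Phi 1 x = ln (cosh x)"
  using LIMSEQ_unique[OF S_tendsto_Phi(1)[of 1 x] ] by (simp add: S_1)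

lemma Phi_derivatives:
  assumes s: "s \<in> {0..1}"
  shows "(Phi s has_real_derivative deriv (Phi s) x) (at x)" "(deriv (Phi s) has_real_derivative deriv (deriv (Phi s)) x) (at x)"
    "(\<lambda>n. deriv (S n s) x) \<longlonglongrightarrow> deriv (Phi s) x" "(\<lambda>n. deriv (deriv (S n s)) x) \<longlonglongrightarrow> deriv (deriv (Phi s)) x"
    "\<bar>deriv (Phi s) x\<bar> \<le> 1" "0 \<le> deriv (deriv (Phi s)) x" "\<bar>Phi s x - Phi s y\<bar> \<le> 1 * \<bar>x - y\<bar>" "\<bar>deriv (Phi s) x - deriv (Phi s) y\<bar> \<le> 1 * \<bar>x - y\<bar>"
    "\<bar>deriv (deriv (Phi s)) x - deriv (deriv (Phi s)) y\<bar> \<le> (KB + 2) * \<bar>x - y\<bar>"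
proof -
  note b = S_bounds[OF s]
  obtain g where g: "\<And>x. (\<lambda>n. deriv (S n s) x) \<longlonglongrightarrow> g x" "\<And>x. (Phi s has_real_derivative g x) (at x)" "\<And>x y. \<bar>g x - g y\<bar> \<le> 1 * \<bar>x - y\<bar>"
    by (rule C11_pointwise_limit[of "\<lambda>n. S n s" "\<lambda>n. deriv (S n s)" 1 "Phi s"]) (use b S_tendsto_Phi[OF s] in auto)
  have g1: "deriv (Phi s) = g" by (rule ext) (rule DERIV_imp_deriv[OF g(2)])
  obtain h where h: "\<And>x. (\<lambda>n. deriv (deriv (S n s)) x) \<longlonglongrightarrow> h x" "\<And>x. (g has_real_derivative h x) (at x)" "\<And>x y. \<bar>h x - h y\<bar> \<le> (KB + 2) * \<bar>x - y\<bar>"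
    by (rule C11_pointwise_limit[of "\<lambda>n. deriv (S n s)" "\<lambda>n. deriv (deriv (S n s))" "KB + 2" g]) (use b g in auto)
  have h1: "deriv (deriv (Phi s)) = h" unfolding g1 by (rule ext) (rule DERIV_imp_deriv[OF h(2)])
  show "(Phi s has_real_derivative deriv (Phi s) x) (at x)" "(deriv (Phi s) has_real_derivative deriv (deriv (Phi s)) x) (at x)"
    "(\<lambda>n. deriv (S n s) x) \<longlonglongrightarrow> deriv (Phi s) x" "(\<lambda>n. deriv (deriv (S n s)) x) \<longlonglongrightarrow> deriv (deriv (Phi s)) x"
    "\<bar>deriv (Phi s) x - deriv (Phi s) y\<bar> \<le> 1 * \<bar>x - y\<bar>" "\<bar>deriv (deriv (Phi s)) x - deriv (deriv (Phi s)) y\<bar> \<le> (KB + 2) * \<bar>x - y\<bar>"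
    unfolding h1 unfolding g1 using g h by auto
  show d: "\<bar>deriv (Phi s) x\<bar> \<le> 1" for x
    unfolding g1 by (rule LIMSEQ_le_const2[OF tendsto_rabs[OF g(1)]]) (use b(3) in auto)
  show "0 \<le> deriv (deriv (Phi s)) x"
    unfolding h1 by (rule LIMSEQ_le_const[OF h(1)]) (use b(4) in auto)
  show "\<bar>Phi s x - Phi s y\<bar> \<le> 1 * \<bar>x - y\<bar>"
    by (rule DERIV_abs_bound_lipschitz[OF g(2)]) (use d in \<open>simp add: g1\<close>)
qed

text \<open>The right ends of the cells containing \<open>s\<close> converge to \<open>s\<close>
  strictly from the right, so right continuity of \<open>Z\<close> suffices.\<close>

lemma lev_tendsto: assumes s: "0 \<le> s" shows "(\<lambda>n. lev n (Suc (idx n s))) \<longlonglongrightarrow> Z s"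
proof -
  have f: "0 \<le> \<lfloor>s * 2 ^ n\<rfloor>" for n using assms by simp
  have r: "real (idx n s) = of_int \<lfloor>s * 2 ^ n\<rfloor>" for n using f[of n] by (simp add: idx_def)
  have "real (idx n s) \<le> s * 2 ^ n" "s * 2 ^ n < real (idx n s) + 1" for n unfolding r by linarith+
  then have i: "s < real (Suc (idx n s)) / 2 ^ n" "real (Suc (idx n s)) / 2 ^ n \<le> s + 1 / 2 ^ n" for n
    by (simp_all add: field_simps)
  have half: "(\<lambda>n. 1 / 2 ^ n) \<longlonglongrightarrow> (0::real)"
    using LIMSEQ_power_zero[of "1/2 :: real"] by (simp add: power_one_over)
  have "(\<lambda>n. real (Suc (idx n s)) / 2 ^ n) \<longlonglongrightarrow> s"
  proof (rule tendsto_sandwich[of "\<lambda>_. s" _ _ "\<lambda>n. s + 1 / 2 ^ n"])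
    show "(\<lambda>n. s + 1 / 2 ^ n) \<longlonglongrightarrow> s" using tendsto_add[OF tendsto_const[of s] half] by simp
  qed (use i in \<open>auto intro!: less_imp_le always_eventually simp del: of_nat_Suc\<close>)
  then have "filterlim (\<lambda>n. real (Suc (idx n s)) / 2 ^ n) (at_right s) sequentially"
    unfolding filterlim_at
  proof (intro conjI always_eventually allI)
    show "real (Suc (idx n s)) / 2 ^ n \<in> {s<..}" "real (Suc (idx n s)) / 2 ^ n \<noteq> s" for n using i(1)[of n] by (simp_all del: of_nat_Suc)
  qed
  from filterlim_compose[OF Z_right this] have "(\<lambda>n. Z (real (Suc (idx n s)) / 2 ^ n)) \<longlonglongrightarrow> Z s" .
  from tendsto_max[OF this half] show ?thesis using Z_nn[of s] by (simp add: lev_def)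
qed

definition R where "R x s = \<xi>2 s / 2 * (deriv (deriv (Phi s)) x + Z s * (deriv (Phi s) x)\<^sup>2)"

text \<open>The equation passes to the limit in integrated form, where bounded pointwise convergence
  of the right side is enough.\<close>

lemma Phi_integral:
  assumes s: "s \<in> {0..1}"
  shows "R x integrable_on {s..1}" "Phi s x = ln (cosh x) + integral {s..1} (R x)"
proof -
  have hi: "(rhs n x has_integral (S n s x - ln (cosh x))) {s..1}" for n
  proof -
    have "(rhs n x has_integral (- S n 1 x - - S n s x)) {s..1}"
    proof (rule fundamental_theorem_of_calculus_interior_strong[where S="(\<lambda>l. real l / 2 ^ n) ` {..2 ^ n}"])
      show "continuous_on {s..1} (\<lambda>s. - S n s x)"
        using continuous_on_subset[OF S_continuous_time[of n x], of "{s..1}"] s by (intro continuous_intros) auto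
      show "((\<lambda>s. - S n s x) has_vector_derivative rhs n x t) (at t)" if "t \<in> {s<..<1} - (\<lambda>l. real l / 2 ^ n) ` {..2 ^ n}" for t
      proof -
        have "0 \<le> t" "t < 1" "t \<notin> (\<lambda>l. real l / 2 ^ n) ` {..2 ^ n}" using that s by auto
        from DERIV_minus[OF DERIV_S_time_interior[OF this, of x]] show ?thesis
          by (simp add: has_real_derivative_iff_has_vector_derivative)
      qed
    qed (use s in auto)
    then show ?thesis by (simp add: S_1)
  qed
  have 1: "R x integrable_on {s..1} \<and> (\<lambda>n. integral {s..1} (rhs n x)) \<longlonglongrightarrow> integral {s..1} (R x)"
  proof (rule conjI; rule dominated_convergence[where f="\<lambda>n. rhs n x" and h="\<lambda>_. A2"])
    show "rhs n x integrable_on {s..1}" for n using hi by blast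
    show "rhs n x integrable_on {s..1}" for n using hi by blast
    have bd: "norm (rhs n x t) \<le> A2" if "t \<in> {s..1}" for n t
    proof -
      have t: "t \<in> {0..1}" using that s by auto
      let ?w = "deriv (deriv (S n t)) x + lev n (Suc (idx n t)) * (deriv (S n t) x)\<^sup>2"
      have "(deriv (S n t) x)\<^sup>2 \<le> 1" using S_bounds(3)[OF t] by (simp add: abs_square_le_1)
      then have "lev n (Suc (idx n t)) * (deriv (S n t) x)\<^sup>2 \<le> 1 * 1" using lev_le lev_pos by (intro mult_mono) (auto intro: less_imp_le)
      moreover have "0 \<le> lev n (Suc (idx n t)) * (deriv (S n t) x)\<^sup>2" using lev_pos[of n "Suc (idx n t)"] by (intro mult_nonneg_nonneg) auto
      ultimately have w: "0 \<le> ?w" "?w \<le> 2" using S_bounds(4,5)[OF t, of n x] by linarith+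
      have "\<xi>2 t / 2 * ?w \<le> A2 / 2 * 2" using A2(1) A2(2)[OF t] w by (intro mult_mono) auto
      moreover have "0 \<le> \<xi>2 t / 2 * ?w" using \<xi>2_nn[OF t] w by (intro mult_nonneg_nonneg) auto
      ultimately show ?thesis by (simp add: rhs_def)
    qed
    show "norm (rhs n x t) \<le> A2" if "t \<in> {s..1}" for n t using bd that .
    show "norm (rhs n x t) \<le> A2" if "t \<in> {s..1}" for n t using bd that .
    have lm: "(\<lambda>n. rhs n x t) \<longlonglongrightarrow> R x t" if "t \<in> {s..1}" for t
    proof -
      have t: "t \<in> {0..1}" using that s by auto
      then show ?thesis unfolding rhs_def R_def
        by (intro tendsto_intros Phi_derivatives(3,4) lev_tendsto) auto
    qed
    show "(\<lambda>n. rhs n x t) \<longlonglongrightarrow> R x t" if "t \<in> {s..1}" for t using lm that .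
    show "(\<lambda>n. rhs n x t) \<longlonglongrightarrow> R x t" if "t \<in> {s..1}" for t using lm that .
  qed auto
  then show "R x integrable_on {s..1}" ..
  have "(\<lambda>n. S n s x - ln (cosh x)) \<longlonglongrightarrow> integral {s..1} (R x)"
    using 1 integral_unique[OF hi] by simp
  moreover have "(\<lambda>n. S n s x - ln (cosh x)) \<longlonglongrightarrow> Phi s x - ln (cosh x)"
    by (intro tendsto_intros S_tendsto_Phi s)
  ultimately show "Phi s x = ln (cosh x) + integral {s..1} (R x)" using LIMSEQ_unique by fastforce
qed

text \<open>Time continuity of \<open>Phi\<close> itself comes from the integral formula. For the
  space derivatives, \<open>C11_pointwise_limit\<close> along a convergent sequence of times
  transfers continuity from each order to the next.\<close>

lemma Phi_continuous_time:
  shows "continuous_on {0..1} (\<lambda>s. Phi s x)" "continuous_on {0..1} (\<lambda>s. deriv (Phi s) x)"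
    "continuous_on {0..1} (\<lambda>s. deriv (deriv (Phi s)) x)"
proof -
  have "continuous_on {0..1} (\<lambda>s. ln (cosh x) + integral {s..1} (R x))" for x
    by (intro continuous_intros indefinite_integral_continuous_1' Phi_integral) auto
  then show c0: "continuous_on {0..1} (\<lambda>s. Phi s x)" for x
    by (rule continuous_on_eq) (use Phi_integral(2) in auto)
  have c1: "(\<lambda>n. deriv (Phi (X n)) x) \<longlonglongrightarrow> deriv (Phi s) x"
    if s: "s \<in> {0..1}" and X: "\<And>n. X n \<in> {0..1}" "X \<longlonglongrightarrow> s" for s x and X :: "nat \<Rightarrow> real"
  proof -
    have l: "(\<lambda>n. Phi (X n) x) \<longlonglongrightarrow> Phi s x" for x
      using c0[of x] s X unfolding continuous_on_sequentially by (auto simp: comp_def)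
    obtain g where g: "\<And>x. (\<lambda>n. deriv (Phi (X n)) x) \<longlonglongrightarrow> g x" "\<And>x. (Phi s has_real_derivative g x) (at x)"
      by (rule C11_pointwise_limit[of "\<lambda>n. Phi (X n)" "\<lambda>n. deriv (Phi (X n))" 1 "Phi s"]) (use l Phi_derivatives[OF X(1)] in auto)
    show ?thesis using g(1)[of x] DERIV_imp_deriv[OF g(2), of x] by simp
  qed
  then show "continuous_on {0..1} (\<lambda>s. deriv (Phi s) x)"
    unfolding continuous_on_sequentially by (auto simp: comp_def)
  have c2: "(\<lambda>n. deriv (deriv (Phi (X n))) x) \<longlonglongrightarrow> deriv (deriv (Phi s)) x"
    if s: "s \<in> {0..1}" and X: "\<And>n. X n \<in> {0..1}" "X \<longlonglongrightarrow> s" for s and X :: "nat \<Rightarrow> real"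
  proof -
    obtain g where g: "\<And>x. (\<lambda>n. deriv (deriv (Phi (X n))) x) \<longlonglongrightarrow> g x" "\<And>x. (deriv (Phi s) has_real_derivative g x) (at x)"
      by (rule C11_pointwise_limit[of "\<lambda>n. deriv (Phi (X n))" "\<lambda>n. deriv (deriv (Phi (X n)))" "KB + 2" "deriv (Phi s)"])
        (use c1[OF s X] Phi_derivatives[OF X(1)] in auto)
    show ?thesis using g(1)[of x] DERIV_imp_deriv[OF g(2), of x] by simp
  qed
  then show "continuous_on {0..1} (\<lambda>s. deriv (deriv (Phi s)) x)"
    unfolding continuous_on_sequentially by (auto simp: comp_def)
qed

text \<open>Where \<open>Z\<close> is continuous so is the integrand of \<open>Phi_integral\<close>,
  and the fundamental theorem of calculus applies.\<close>

lemma DERIV_Phi_time: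
  assumes s: "0 < s" "s < 1" and Z: "isCont Z s"
  shows "((\<lambda>t. Phi t x) has_real_derivative - R x s) (at s)"
proof -
  have "continuous (at s within {0..1}) (R x)"
  proof -
    have s': "s \<in> {0..1}" using s by simp
    have "continuous (at s within {0..1}) \<xi>2" "continuous (at s within {0..1}) (\<lambda>s. deriv (Phi s) x)"
      "continuous (at s within {0..1}) (\<lambda>s. deriv (deriv (Phi s)) x)"
      using cont2 Phi_continuous_time[of x] s' by (auto simp: continuous_on_eq_continuous_within)
    moreover have "continuous (at s within {0..1}) Z" using Z by (rule continuous_at_imp_continuous_at_within)
    ultimately show ?thesis unfolding R_def by (intro continuous_intros) auto
  qed
  then have "((\<lambda>u. integral {0..u} (R x)) has_vector_derivative R x s) (at s within ({0..1} - {}))"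
    by (intro integral_has_vector_derivative_continuous_at) (use Phi_integral(1)[of 0] s in auto)
  then have "((\<lambda>u. integral {0..u} (R x)) has_real_derivative R x s) (at s within {0..1})"
    by (simp add: has_real_derivative_iff_has_vector_derivative)
  then have "((\<lambda>u. integral {0..u} (R x)) has_real_derivative R x s) (at s)"
    using s by (simp add: at_within_Icc_at)
  then have "((\<lambda>u. (ln (cosh x) + integral {0..1} (R x)) - integral {0..u} (R x)) has_real_derivative - R x s) (at s)"
    by (auto intro!: derivative_eq_intros)
  then show ?thesis
  proof (rule has_field_derivative_transform_within_open)
    show "s \<in> {0<..<1}" using s by simp
    fix t :: real assume t: "t \<in> {0<..<1}"
    have "integral {0..t} (R x) + integral {t..1} (R x) = integral {0..1} (R x)"
      by (rule Henstock_Kurzweil_Integration.integral_combine) (use t Phi_integral(1)[of 0] in auto)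
    then show "(ln (cosh x) + integral {0..1} (R x)) - integral {0..t} (R x) = Phi t x"
      using Phi_integral(2)[of t x] t by simp
  qed simp
qed

lemma Phi_solution:
  assumes "\<And>s. s \<in> {0..1} \<Longrightarrow> measure \<eta> {0..s} = Z s" "\<And>s. measure \<eta> {s} = 0 \<Longrightarrow> isCont Z s"
  shows "parisi_pde_solution \<xi> 0 \<eta> Phi"
  unfolding parisi_pde_solution_def
proof (intro conjI allI ballI impI)
  fix s x :: real assume s: "s \<in> {0..1}"
  show "Phi s differentiable at x" "deriv (Phi s) differentiable at x"
    using Phi_derivatives(1,2)[OF s] unfolding real_differentiable_def by blast+
next
  show "continuous_on ({0..1} \<times> UNIV) (\<lambda>(s, x). Phi s x)" "continuous_on ({0..1} \<times> UNIV) (\<lambda>(s, x). deriv (Phi s) x)"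
    by (rule continuous_on_strip[OF _ Phi_continuous_time(1)], rule Phi_derivatives, assumption,
        rule continuous_on_strip[OF _ Phi_continuous_time(2)], rule Phi_derivatives, assumption)
  show "continuous_on ({0..1} \<times> UNIV) (\<lambda>(s, x). deriv (deriv (Phi s)) x)"
    by (rule continuous_on_strip[OF _ Phi_continuous_time(3)], rule Phi_derivatives, assumption)
  show "\<exists>C. \<forall>s\<in>{0..1}. \<forall>x. \<bar>deriv (Phi s) x\<bar> \<le> C" using Phi_derivatives(5) by blast
  fix s x :: real assume s: "s \<in> {0<..<1}" and m: "measure \<eta> {s} = 0"
  show "((\<lambda>t. Phi t x) has_real_derivative - (\<xi>2 s / 2 * (deriv (deriv (Phi s)) x + measure \<eta> {0..s} * (deriv (Phi s) x)\<^sup>2))) (at s)"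
    using DERIV_Phi_time[OF _ _ assms(2)[OF m], of x] s assms(1)[of s] by (simp add: R_def)
qed (rule Phi_1)

end

subsection \<open>The solution for a probability measure\<close>

lemma cdf_conditions:
  assumes "\<zeta> \<in> probs_on 0 1"
  shows "s \<le> t \<Longrightarrow> cdf \<zeta> s \<le> cdf \<zeta> t" "0 \<le> cdf \<zeta> s" "cdf \<zeta> s \<le> 1" "(cdf \<zeta> \<longlongrightarrow> cdf \<zeta> s) (at_right s)"
proof -
  interpret real_distribution \<zeta> using assms by (rule probs_on_real_distribution)
  show "s \<le> t \<Longrightarrow> cdf \<zeta> s \<le> cdf \<zeta> t" "0 \<le> cdf \<zeta> s" "cdf \<zeta> s \<le> 1" "(cdf \<zeta> \<longlongrightarrow> cdf \<zeta> s) (at_right s)"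
    using cdf_nondecreasing cdf_nonneg cdf_bounded_prob cdf_is_right_cont[of s] by (auto simp: continuous_within)
qed

text \<open>On \<open>[q, 1]\<close> the equation involves only the distribution function above
  \<open>q\<close>. One function on all of \<open>[0, 1]\<close> therefore serves every
  self-overlap.\<close>

lemma Phi_restrict_solution:
  assumes \<zeta>: "\<zeta> \<in> probs_on 0 1" and \<eta>: "\<eta> \<in> probs_on q 1" and q: "0 \<le> q"
    and eq: "\<And>s. q \<le> s \<Longrightarrow> cdf \<eta> s = cdf \<zeta> s"
  shows "parisi_pde_solution \<xi> q \<eta> (Phi (cdf \<zeta>))"
proof -
  interpret Z: real_distribution \<zeta> using \<zeta> by (rule probs_on_real_distribution)
  interpret E: real_distribution \<eta> using \<eta> by (rule probs_on_real_distribution)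
  note cc = cdf_conditions[OF \<zeta>]
  have "parisi_pde_solution \<xi> 0 \<zeta> (Phi (cdf \<zeta>))"
    by (rule Phi_solution) (use cc probs_on_cdf[OF \<zeta>] Z.isCont_cdf in auto)
  note sol = this[unfolded parisi_pde_solution_def]
  have sub: "{q..1} \<times> UNIV \<subseteq> {0..1} \<times> (UNIV :: real set)" using q by auto
  show ?thesis
    unfolding parisi_pde_solution_def
  proof (intro conjI ballI allI impI)
    show "continuous_on ({q..1} \<times> UNIV) (\<lambda>(s, x). Phi (cdf \<zeta>) s x)" "continuous_on ({q..1} \<times> UNIV) (\<lambda>(s, x). deriv (Phi (cdf \<zeta>) s) x)"
      "continuous_on ({q..1} \<times> UNIV) (\<lambda>(s, x). deriv (deriv (Phi (cdf \<zeta>) s)) x)"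
      using sol by (auto intro: continuous_on_subset[OF _ sub])
    show "\<exists>C. \<forall>s\<in>{q..1}. \<forall>x. \<bar>deriv (Phi (cdf \<zeta>) s) x\<bar> \<le> C" using sol q by (meson atLeastAtMost_iff order_trans)
    fix s x :: real
    show "s \<in> {q..1} \<Longrightarrow> Phi (cdf \<zeta>) s differentiable at x" "s \<in> {q..1} \<Longrightarrow> deriv (Phi (cdf \<zeta>) s) differentiable at x"
      using sol q by auto
    assume s: "s \<in> {q<..<1}" and m: "measure \<eta> {s} = 0"
    have "\<forall>\<^sub>F t in nhds s. cdf \<eta> t = cdf \<zeta> t"
      using eventually_nhds_in_open[of "{q<..}" s] s by (auto elim!: eventually_mono intro: eq)
    \<comment> \<open>Atoms are the discontinuities of the distribution function, so above
      \<open>q\<close> the two measures have the same atoms.\<close>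
    then have "isCont (cdf \<zeta>) s" using m E.isCont_cdf[of s] isCont_cong[of "cdf \<eta>" "cdf \<zeta>" s] by simp
    then have "measure \<zeta> {s} = 0" using Z.isCont_cdf by simp
    moreover have "measure \<eta> {q..s} = measure \<zeta> {0..s}"
      using s q eq[of s] by (simp add: probs_on_cdf[OF \<eta>] probs_on_cdf[OF \<zeta>])
    ultimately show "((\<lambda>t. Phi (cdf \<zeta>) t x) has_real_derivative - (\<xi>2 s / 2 * (deriv (deriv (Phi (cdf \<zeta>) s)) x
        + measure \<eta> {q..s} * (deriv (Phi (cdf \<zeta>) s) x)\<^sup>2))) (at s)"
      using sol s q by auto
  qed (use sol in auto)
qed

text \<open>Existence makes the choice in \<open>parisi_Phi\<close> a solution, and uniqueness
  identifies it on the strip.\<close>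

lemma parisi_Phi_eq:
  assumes "\<zeta> \<in> probs_on 0 1" "\<eta> \<in> probs_on q 1" "0 \<le> q" "\<And>s. q \<le> s \<Longrightarrow> cdf \<eta> s = cdf \<zeta> s" "s \<in> {q..1}"
  shows "parisi_Phi \<xi> q \<eta> s x = Phi (cdf \<zeta>) s x"
proof -
  have sol: "parisi_pde_solution \<xi> q \<eta> (Phi (cdf \<zeta>))" by (rule Phi_restrict_solution[OF assms(1-4)])
  then have "parisi_pde_solution \<xi> q \<eta> (parisi_Phi \<xi> q \<eta>)" unfolding parisi_Phi_def by (rule someI[of "parisi_pde_solution \<xi> q \<eta>"])
  then show ?thesis using solution_unique[OF assms(2,3,5) _ sol] by simp
qed

lemma Phi_min_at_0:
  assumes \<zeta>: "\<zeta> \<in> probs_on 0 1" and s: "s \<in> {0..1}"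
  shows "Phi (cdf \<zeta>) s 0 \<le> Phi (cdf \<zeta>) s x"
proof -
  note cc = cdf_conditions[OF \<zeta>]
  let ?f = "Phi (cdf \<zeta>) s"
  have even: "?f (- x) = ?f x" for x
    by (rule solution_even[OF \<zeta> _ s Phi_restrict_solution[OF \<zeta> \<zeta>]]) auto
  have "convex_on UNIV ?f"
    by (rule f''_ge0_imp_convex[where f'="deriv ?f" and f''="deriv (deriv ?f)"]) (use Phi_derivatives[OF cc s] in auto)
  then have "?f ((1 - 1 / 2) *\<^sub>R x + (1 / 2) *\<^sub>R (- x)) \<le> (1 - 1 / 2) * ?f x + (1 / 2) * ?f (- x)"
    by (rule convex_onD) auto
  then show ?thesis using even[of x] by simp
qed

section \<open>The penalty term\<close>

definition pen :: "real measure \<Rightarrow> real \<Rightarrow> real" where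
  "pen \<zeta> q = integral {q..1} (\<lambda>s. s * \<xi>2 s * cdf \<zeta> s)"

lemma pen_integrand_bounds:
  assumes \<zeta>: "\<zeta> \<in> probs_on 0 1" and s: "s \<in> {0..1}"
  shows "0 \<le> s * \<xi>2 s * cdf \<zeta> s" "s * \<xi>2 s * cdf \<zeta> s \<le> A2"
proof -
  note cc = cdf_conditions[OF \<zeta>]
  show 0: "0 \<le> s * \<xi>2 s * cdf \<zeta> s" using s \<xi>2_nn[OF s] cc(2) by (intro mult_nonneg_nonneg) auto
  have "s * \<xi>2 s * cdf \<zeta> s \<le> 1 * A2 * 1" using s \<xi>2_nn[OF s] cc(2,3) A2 by (intro mult_mono) auto
  then show "s * \<xi>2 s * cdf \<zeta> s \<le> A2" by simp
qed

lemma pen_integrand: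
  assumes \<zeta>: "\<zeta> \<in> probs_on 0 1" and q: "0 \<le> a" "b \<le> 1"
  shows "set_integrable lborel {a..b} (\<lambda>s. s * \<xi>2 s * cdf \<zeta> s)" "(\<lambda>s. s * \<xi>2 s * cdf \<zeta> s) integrable_on {a..b}"
proof -
  have "mono (cdf \<zeta>)" using cdf_conditions(1)[OF \<zeta>] by (auto intro: monoI)
  then have m[measurable]: "cdf \<zeta> \<in> borel_measurable borel" by (rule borel_measurable_mono)
  have "continuous_on {a..b} (\<lambda>s. s * \<xi>2 s)"
    by (intro continuous_intros continuous_on_subset[OF cont2]) (use q in auto)
  then have [measurable]: "(\<lambda>s. indicator {a..b} s *\<^sub>R (s * \<xi>2 s)) \<in> borel_measurable borel"
    by (intro borel_measurable_continuous_on_indicator) auto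
  have "integrable lborel (\<lambda>s. indicator {a..b} s * A2)" 
    using integrable_real_indicator[of "{a..b}" lborel] by (intro integrable_mult_left) (auto simp: emeasure_lborel_Icc_eq)
  then show 1: "set_integrable lborel {a..b} (\<lambda>s. s * \<xi>2 s * cdf \<zeta> s)"
    unfolding set_integrable_def
  proof (rule Bochner_Integration.integrable_bound)
    have "(\<lambda>s. (indicator {a..b} s *\<^sub>R (s * \<xi>2 s)) * cdf \<zeta> s) \<in> borel_measurable borel" by measurable
    then show "(\<lambda>s. indicator {a..b} s *\<^sub>R (s * \<xi>2 s * cdf \<zeta> s)) \<in> borel_measurable lborel" by (simp add: mult.assoc)
    show "AE s in lborel. norm (indicator {a..b} s *\<^sub>R (s * \<xi>2 s * cdf \<zeta> s)) \<le> norm (indicator {a..b} s * A2)"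
    proof (intro AE_I2)
      fix s
      show "norm (indicator {a..b} s *\<^sub>R (s * \<xi>2 s * cdf \<zeta> s)) \<le> norm (indicator {a..b} s * A2)"
        using pen_integrand_bounds[OF \<zeta>, of s] q A2(1) by (cases "s \<in> {a..b}") (simp_all del: mult_eq_0_iff abs_mult)
    qed
  qed
  then show "(\<lambda>s. s * \<xi>2 s * cdf \<zeta> s) integrable_on {a..b}" by (rule set_borel_integral_eq_integral)
qed

lemma penalty_eq:
  assumes \<zeta>: "\<zeta> \<in> probs_on 0 1" and \<eta>: "\<eta> \<in> probs_on q 1" and q: "0 \<le> q" and eq: "\<And>s. q \<le> s \<Longrightarrow> cdf \<eta> s = cdf \<zeta> s"
  shows "penalty \<xi> q \<eta> = pen \<zeta> q"
proof -
  have "penalty \<xi> q \<eta> = (LBINT s:{q..1}. s * \<xi>2 s * cdf \<zeta> s)"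
    unfolding penalty_def by (rule set_lebesgue_integral_cong) (auto simp: probs_on_cdf[OF \<eta>] eq)
  also have "\<dots> = pen \<zeta> q" unfolding pen_def
    by (rule set_borel_integral_eq_integral(2)[OF pen_integrand(1)[OF \<zeta> q order_refl]])
  finally show ?thesis .
qed

lemma pen_le: assumes "\<zeta> \<in> probs_on 0 1" "0 \<le> q" "q \<le> 1" shows "pen \<zeta> q \<le> A2"
proof -
  have "pen \<zeta> q \<le> integral {q..1} (\<lambda>_. A2)"
    unfolding pen_def by (rule integral_le[OF pen_integrand(2)]) (use assms pen_integrand_bounds in auto)
  also have "\<dots> = (1 - q) * A2" using assms by simp
  also have "\<dots> \<le> 1 * A2" using assms A2(1) by (intro mult_right_mono) auto
  finally show ?thesis by simp
qed

lemma pen_continuous: "\<zeta> \<in> probs_on 0 1 \<Longrightarrow> continuous_on {0..1} (pen \<zeta>)"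
  unfolding pen_def by (rule indefinite_integral_continuous_1') (rule pen_integrand(2), auto)

text \<open>\<open>s * \<xi>1 s - \<xi> s\<close> is a primitive of \<open>s * \<xi>2 s\<close>, and
  on each cell \<open>lev\<close> dominates the distribution function. The sum has this form
  because, times \<open>N / 2\<close>, it is the contribution of the scalar Gaussians in the
  interpolation.\<close>

lemma pen_step_bound:
  assumes \<zeta>: "\<zeta> \<in> probs_on 0 1" and j: "j \<le> 2 ^ n" and q: "0 \<le> q" "q \<le> real j / 2 ^ n"
  shows "pen \<zeta> 0 - pen \<zeta> q \<le> (\<Sum>l<j. lev (cdf \<zeta>) n (Suc l) *
      ((real (Suc l) / 2 ^ n * \<xi>1 (real (Suc l) / 2 ^ n) - \<xi> (real (Suc l) / 2 ^ n)) - (real l / 2 ^ n * \<xi>1 (real l / 2 ^ n) - \<xi> (real l / 2 ^ n))))"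
proof -
  let ?f = "\<lambda>s. s * \<xi>2 s * cdf \<zeta> s" and ?\<theta> = "\<lambda>s. s * \<xi>1 s - \<xi> s"
  note cc = cdf_conditions[OF \<zeta>]
  have j1: "real j / 2 ^ n \<le> 1" using j by (simp add: divide_le_eq)
  then have q1: "q \<le> 1" using q by linarith
  have "integral {0..q} ?f + integral {q..1} ?f = integral {0..1} ?f"
    by (rule Henstock_Kurzweil_Integration.integral_combine) (use q q1 pen_integrand(2)[OF \<zeta>] in auto)
  then have "pen \<zeta> 0 - pen \<zeta> q = integral {0..q} ?f" by (simp add: pen_def)
  also have "\<dots> \<le> integral {0..real j / 2 ^ n} ?f"
  proof (rule integral_subset_le)
    show "?f integrable_on {0..q}" "?f integrable_on {0..real j / 2 ^ n}"
      by (rule pen_integrand(2)[OF \<zeta> order_refl q1], rule pen_integrand(2)[OF \<zeta> order_refl j1])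
    show "\<forall>s\<in>{0..real j / 2 ^ n}. 0 \<le> ?f s"
    proof (intro ballI pen_integrand_bounds(1)[OF \<zeta>])
      fix s assume "s \<in> {0..real j / 2 ^ n}"
      then have "0 \<le> s" "s \<le> 1" using j1 unfolding atLeastAtMost_iff by linarith+
      then show "s \<in> {0..1}" by simp
    qed
  qed (use q in auto)
  also have "\<dots> \<le> (\<Sum>l<j. lev (cdf \<zeta>) n (Suc l) * (?\<theta> (real (Suc l) / 2 ^ n) - ?\<theta> (real l / 2 ^ n)))"
    using j
  proof (induction j)
    case (Suc j)
    let ?a = "real j / 2 ^ n" and ?b = "real (Suc j) / 2 ^ n"
    have le: "0 \<le> ?a" "?a \<le> ?b" by (auto simp: divide_right_mono)
    have b1: "?b \<le> 1" using Suc.prems by (intro Suc_div_le) auto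
    have "integral {0..?b} ?f = integral {0..?a} ?f + integral {?a..?b} ?f"
      by (rule Henstock_Kurzweil_Integration.integral_combine[symmetric]) (use le b1 pen_integrand(2)[OF \<zeta>] in auto)
    moreover have "integral {?a..?b} ?f \<le> lev (cdf \<zeta>) n (Suc j) * (?\<theta> ?b - ?\<theta> ?a)"
    proof -
      have "((\<lambda>s. s * \<xi>2 s) has_integral (?\<theta> ?b - ?\<theta> ?a)) {?a..?b}"
      proof (rule fundamental_theorem_of_calculus[OF le(2)])
        fix s assume s: "s \<in> {?a..?b}"
        then have "0 \<le> s" "s \<le> 1" using le(1) b1 unfolding atLeastAtMost_iff by linarith+
        then have s1: "s \<in> {-1..1}" by simp
        have "(?\<theta> has_real_derivative s * \<xi>2 s) (at s)"
          by (auto intro!: derivative_eq_intros der1[OF s1] der2[OF s1])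
        then show "(?\<theta> has_vector_derivative s * \<xi>2 s) (at s within {?a..?b})"
          by (simp add: has_real_derivative_iff_has_vector_derivative has_vector_derivative_at_within)
      qed
      then have "((\<lambda>s. lev (cdf \<zeta>) n (Suc j) * (s * \<xi>2 s)) has_integral lev (cdf \<zeta>) n (Suc j) * (?\<theta> ?b - ?\<theta> ?a)) {?a..?b}"
        by (rule has_integral_mult_right)
      moreover have "?f integrable_on {?a..?b}" by (rule pen_integrand(2)[OF \<zeta> le(1) b1])
      moreover have "?f s \<le> lev (cdf \<zeta>) n (Suc j) * (s * \<xi>2 s)" if s: "s \<in> {?a..?b}" for s
      proof -
        have "0 \<le> s" "s \<le> 1" using s le(1) b1 unfolding atLeastAtMost_iff by linarith+
        then have s': "s \<in> {0..1}" by simp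
        have "cdf \<zeta> s \<le> cdf \<zeta> ?b" using s by (intro cc(1)) simp
        also have "\<dots> \<le> lev (cdf \<zeta>) n (Suc j)"
        proof -
          have "lev (cdf \<zeta>) n (Suc j) = max (cdf \<zeta> ?b) (1 / 2 ^ n)" by (rule lev_def) (use cc in auto)
          then show ?thesis by simp
        qed
        finally have "cdf \<zeta> s \<le> lev (cdf \<zeta>) n (Suc j)" .
        moreover have "0 \<le> s * \<xi>2 s" using s' \<xi>2_nn[OF s'] by auto
        ultimately show ?thesis by (metis mult.commute mult_right_mono)
      qed
      ultimately show ?thesis by (intro has_integral_le[OF integrable_integral])
    qed
    ultimately show ?case using Suc by simp
  qed simp
  finally show ?thesis .
qed

end

subsection \<open>Guerra's interpolation\<close>

text \<open>Continuity of the derivative gives local bounds, which dominate when differentiating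
  under the integral along a curve.\<close>

definition C1 :: "(real \<Rightarrow> real) \<Rightarrow> (real \<Rightarrow> real) \<Rightarrow> bool" where
  "C1 f f' \<longleftrightarrow> (\<forall>s. (f has_real_derivative f' s) (at s)) \<and> continuous_on UNIV f'"

lemma C1_D: "C1 f f' \<Longrightarrow> (f has_real_derivative f' s) (at s)" by (simp add: C1_def)

lemma C1_const: "C1 (\<lambda>s. a) (\<lambda>s. 0)" by (simp add: C1_def)

lemma C1_affine: "C1 (\<lambda>s. a + s * b) (\<lambda>s. b)" by (auto simp: C1_def intro!: derivative_eq_intros)

lemma C1_id: "C1 (\<lambda>s. s) (\<lambda>s. 1)" by (simp add: C1_def)

lemma C1_add: "C1 f f' \<Longrightarrow> C1 g g' \<Longrightarrow> C1 (\<lambda>s. f s + g s) (\<lambda>s. f' s + g' s)"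
  by (auto simp: C1_def intro!: derivative_intros continuous_intros)

lemma continuous_bounded_near:
  fixes f :: "real \<Rightarrow> real"
  assumes "continuous_on UNIV f"
  obtains A where "A \<ge> 0" "\<And>s. \<bar>s - s0\<bar> \<le> 1 \<Longrightarrow> \<bar>f s\<bar> \<le> A"
proof -
  have "compact (f ` {s0 - 1..s0 + 1})"
    by (intro compact_continuous_image continuous_on_subset[OF assms]) auto
  then obtain A where "\<forall>w\<in>f ` {s0 - 1..s0 + 1}. norm w \<le> A" using compact_imp_bounded bounded_iff by meson
  then have A: "\<bar>f s\<bar> \<le> \<bar>A\<bar>" if "\<bar>s - s0\<bar> \<le> 1" for s
  proof -
    have "s \<in> {s0 - 1..s0 + 1}" using that by (auto simp: abs_le_iff)
    then have "norm (f s) \<le> A" using \<open>\<forall>w\<in>f ` {s0 - 1..s0 + 1}. norm w \<le> A\<close> by blast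
    then show ?thesis by simp
  qed
  show thesis by (rule that[OF abs_ge_zero A])
qed

lemma DERIV_continuous_on_UNIV: "(\<And>s. (f has_real_derivative f' s) (at s)) \<Longrightarrow> continuous_on UNIV (f :: real \<Rightarrow> real)"
  by (meson DERIV_continuous_on has_field_derivative_at_within)

text \<open>Weights whose squares sum to 1. Unlike square roots of a time parameter they are smooth
  at both ends, and the product of \<open>amp\<close> and \<open>amp'\<close> is the same up to sign
  for both values of \<open>b\<close>.\<close>

definition amp :: "bool \<Rightarrow> real \<Rightarrow> real" where "amp b \<theta> = (if b then sin \<theta> else cos \<theta>)"
definition amp' :: "bool \<Rightarrow> real \<Rightarrow> real" where "amp' b \<theta> = (if b then cos \<theta> else - sin \<theta>)"

lemma amp_le: "\<bar>amp b \<theta>\<bar> \<le> 1" "\<bar>amp' b \<theta>\<bar> \<le> 1" by (auto simp: amp_def amp'_def)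

lemma C1_amp: assumes "C1 p p'" shows "C1 (\<lambda>s. amp b (p s)) (\<lambda>s. amp' b (p s) * p' s)"
proof -
  have "continuous_on UNIV p" by (rule DERIV_continuous_on_UNIV[OF C1_D[OF assms]])
  then show ?thesis using assms
    by (cases b) (auto simp: C1_def amp_def amp'_def intro!: derivative_eq_intros continuous_intros)
qed

lemma C1_cmult: "C1 f f' \<Longrightarrow> C1 (\<lambda>s. a * f s) (\<lambda>s. a * f' s)"
  by (auto simp: C1_def intro!: derivative_eq_intros continuous_intros)

text \<open>The functions of the interpolation live on \<open>I \<rightarrow> \<real>\<close> for a finite index set that is not a type;
  differentiability is therefore expressed along curves.  In \<open>guerra_regular X w W Y B\<close>, \<open>w\<close> is the
  gradient and \<open>W\<close> the Hessian of \<open>X\<close> in \<open>h\<close>, and \<open>Y\<close> is the derivative in the interpolation angle.\<close>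

definition guerra_regular where
  "guerra_regular I X w W Y B \<longleftrightarrow>
    (\<forall>p p' H H'. C1 p p' \<longrightarrow> (\<forall>i. C1 (\<lambda>s. H s i) (H' i)) \<longrightarrow>
      (\<forall>s. ((\<lambda>s. X (p s) (H s)) has_real_derivative
         Y (p s) (H s) * p' s + (\<Sum>i\<in>I. w i (p s) (H s) * H' i s)) (at s))) \<and>
    (\<forall>\<theta> h v s. \<forall>i\<in>I. ((\<lambda>s. w i \<theta> (\<lambda>k. h k + s * v k)) has_real_derivative
         (\<Sum>j\<in>I. W i j \<theta> (\<lambda>k. h k + s * v k) * v j)) (at s)) \<and>
    (\<forall>\<theta> h. \<forall>i\<in>I. 0 \<le> w i \<theta> h) \<and> (\<forall>\<theta> h. (\<Sum>i\<in>I. w i \<theta> h) = 1) \<and>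
    (\<forall>\<theta> h. \<forall>i\<in>I. \<forall>j\<in>I. \<bar>W i j \<theta> h\<bar> \<le> B) \<and> (\<forall>\<theta> h. \<bar>Y \<theta> h\<bar> \<le> B)"

locale guerra_step =
  fixes I :: "'i set" and X :: "real \<Rightarrow> ('i \<Rightarrow> real) \<Rightarrow> real" and w W Y and B c :: real and v :: "'i \<Rightarrow> real" and b :: bool
  assumes fin: "finite I" and reg: "guerra_regular I X w W Y B" and c: "c > 0"
begin

lemma X_curve: "C1 p p' \<Longrightarrow> (\<And>i. C1 (\<lambda>s. H s i) (H' i)) \<Longrightarrow>
   ((\<lambda>s. X (p s) (H s)) has_real_derivative Y (p s) (H s) * p' s + (\<Sum>i\<in>I. w i (p s) (H s) * H' i s)) (at s)"
  and w_line: "i \<in> I \<Longrightarrow> ((\<lambda>s. w i \<theta> (\<lambda>k. h k + s * u k)) has_real_derivative (\<Sum>j\<in>I. W i j \<theta> (\<lambda>k. h k + s * u k) * u j)) (at s)"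
  and w_nn: "i \<in> I \<Longrightarrow> 0 \<le> w i \<theta> h" and w_sum: "(\<Sum>i\<in>I. w i \<theta> h) = 1"
  and W_le: "i \<in> I \<Longrightarrow> j \<in> I \<Longrightarrow> \<bar>W i j \<theta> h\<bar> \<le> B" and Y_le: "\<bar>Y \<theta> h\<bar> \<le> B"
proof -
  note r = reg[unfolded guerra_regular_def]
  show "C1 p p' \<Longrightarrow> (\<And>i. C1 (\<lambda>s. H s i) (H' i)) \<Longrightarrow>
   ((\<lambda>s. X (p s) (H s)) has_real_derivative Y (p s) (H s) * p' s + (\<Sum>i\<in>I. w i (p s) (H s) * H' i s)) (at s)"
    by (rule r[THEN conjunct1, rule_format, of p p' H H' s])
  show "i \<in> I \<Longrightarrow> ((\<lambda>s. w i \<theta> (\<lambda>k. h k + s * u k)) has_real_derivative (\<Sum>j\<in>I. W i j \<theta> (\<lambda>k. h k + s * u k) * u j)) (at s)"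
    using r by blast
  show "i \<in> I \<Longrightarrow> 0 \<le> w i \<theta> h" "(\<Sum>i\<in>I. w i \<theta> h) = 1" "i \<in> I \<Longrightarrow> j \<in> I \<Longrightarrow> \<bar>W i j \<theta> h\<bar> \<le> B" "\<bar>Y \<theta> h\<bar> \<le> B"
    using r by blast+
qed

lemma B_nn: "B \<ge> 0" using order_trans[OF abs_ge_zero Y_le] .

lemma w_le: "i \<in> I \<Longrightarrow> w i \<theta> h \<le> 1"
  using member_le_sum[of i I "\<lambda>i. w i \<theta> h"] w_nn w_sum fin by simp

lemma X_line: "((\<lambda>s. X \<theta> (\<lambda>k. h k + s * u k)) has_real_derivative (\<Sum>i\<in>I. w i \<theta> (\<lambda>k. h k + s * u k) * u i)) (at s)"
  using X_curve[of "\<lambda>_. \<theta>" "\<lambda>_. 0" "\<lambda>s k. h k + s * u k" "\<lambda>i _. u i" s] C1_const C1_affine by auto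

definition nrm :: "('i \<Rightarrow> real) \<Rightarrow> real" where "nrm u = (\<Sum>i\<in>I. \<bar>u i\<bar>)"

lemma nrm_nn: "nrm u \<ge> 0" unfolding nrm_def by (intro sum_nonneg) auto

lemma wu_le: "\<bar>\<Sum>i\<in>I. w i \<theta> h * u i\<bar> \<le> nrm u"
proof -
  have "\<bar>\<Sum>i\<in>I. w i \<theta> h * u i\<bar> \<le> (\<Sum>i\<in>I. \<bar>w i \<theta> h * u i\<bar>)" by (rule sum_abs)
  also have "\<dots> \<le> nrm u"
    unfolding nrm_def by (rule sum_mono) (use w_nn w_le in \<open>auto simp: abs_mult intro!: mult_left_le_one_le\<close>)
  finally show ?thesis .
qed

lemma X_lipschitz: "\<bar>X \<theta> (\<lambda>k. h k + s * u k) - X \<theta> (\<lambda>k. h k + t * u k)\<bar> \<le> nrm u * \<bar>s - t\<bar>"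
  by (rule DERIV_abs_bound_lipschitz[OF X_line wu_le])

text \<open>The observables whose tilted averages make sense: bounded, and measurable along every
  line, since only one Gaussian variable is integrated at a time.\<close>

definition adm :: "(real \<Rightarrow> ('i \<Rightarrow> real) \<Rightarrow> real) \<Rightarrow> bool" where
  "adm k \<longleftrightarrow> (\<exists>A. \<forall>\<theta> h. \<bar>k \<theta> h\<bar> \<le> A) \<and> (\<forall>\<theta> h u. (\<lambda>g. k \<theta> (\<lambda>i. h i + g * u i)) \<in> borel_measurable borel)"

lemma adm_const: "adm (\<lambda>_ _. a)" by (auto simp: adm_def)

lemma adm_add: assumes "adm k" "adm l" shows "adm (\<lambda>\<theta> h. k \<theta> h + l \<theta> h)"
proof -
  obtain A A' where "\<And>\<theta> h. \<bar>k \<theta> h\<bar> \<le> A" "\<And>\<theta> h. \<bar>l \<theta> h\<bar> \<le> A'" using assms by (auto simp: adm_def)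
  then have "\<bar>k \<theta> h + l \<theta> h\<bar> \<le> A + A'" for \<theta> h by (rule order_trans[OF abs_triangle_ineq add_mono])
  moreover have "(\<lambda>g. k \<theta> (\<lambda>i. h i + g * u i) + l \<theta> (\<lambda>i. h i + g * u i)) \<in> borel_measurable borel" for \<theta> h u
    using assms by (intro borel_measurable_add) (simp_all add: adm_def)
  ultimately show ?thesis unfolding adm_def by blast
qed

lemma adm_mult: assumes "adm k" "adm l" shows "adm (\<lambda>\<theta> h. k \<theta> h * l \<theta> h)"
proof -
  obtain A A' where 1: "\<And>\<theta> h. \<bar>k \<theta> h\<bar> \<le> A" "\<And>\<theta> h. \<bar>l \<theta> h\<bar> \<le> A'" using assms by (auto simp: adm_def)
  have "A \<ge> 0" using order_trans[OF abs_ge_zero 1(1)] .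
  then have "\<bar>k \<theta> h * l \<theta> h\<bar> \<le> A * A'" for \<theta> h unfolding abs_mult using 1 by (intro mult_mono) auto
  moreover have "(\<lambda>g. k \<theta> (\<lambda>i. h i + g * u i) * l \<theta> (\<lambda>i. h i + g * u i)) \<in> borel_measurable borel" for \<theta> h u
    using assms by (intro borel_measurable_times) (simp_all add: adm_def)
  ultimately show ?thesis unfolding adm_def by blast
qed

lemma adm_sum: assumes "finite J" "\<And>i. i \<in> J \<Longrightarrow> adm (k i)" shows "adm (\<lambda>\<theta> h. \<Sum>i\<in>J. k i \<theta> h)"
  using assms by (induction J) (auto intro: adm_const adm_add)

lemma adm_w: "i \<in> I \<Longrightarrow> adm (w i)"
proof -
  assume i: "i \<in> I"
  have "\<bar>w i \<theta> h\<bar> \<le> 1" for \<theta> h using w_nn[OF i] w_le[OF i] by simp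
  moreover have "(\<lambda>g. w i \<theta> (\<lambda>k. h k + g * u k)) \<in> borel_measurable borel" for \<theta> h u
    by (rule DERIV_imp_borel_measurable[OF w_line[OF i]])
  ultimately show ?thesis by (auto simp: adm_def)
qed

lemma inverse_Suc_filterlim: "filterlim (\<lambda>n. 1 / real (Suc n)) (at 0) sequentially"
  by (simp add: filterlim_at LIMSEQ_Suc[OF lim_const_over_n[of 1], simplified])

text \<open>Measurability along lines passes from \<open>w i\<close> to its difference quotients in
  the coordinate direction \<open>j\<close> and then to their limit.\<close>

lemma adm_W: "i \<in> I \<Longrightarrow> j \<in> I \<Longrightarrow> adm (W i j)"
proof -
  assume i: "i \<in> I" and j: "j \<in> I"
  have "(\<lambda>g. W i j \<theta> (\<lambda>k. h k + g * u k)) \<in> borel_measurable borel" for \<theta> h u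
  proof (rule borel_measurable_LIMSEQ_real)
    let ?e = "\<lambda>k. if k = j then 1 else 0 :: real"
    let ?q = "\<lambda>n g. (w i \<theta> (\<lambda>k. (h k + 1 / real (Suc n) * ?e k) + g * u k) - w i \<theta> (\<lambda>k. h k + g * u k)) / (1 / real (Suc n))"
    show "?q n \<in> borel_measurable borel" for n
      by (intro borel_measurable_divide borel_measurable_diff DERIV_imp_borel_measurable[OF w_line[OF i]]) simp_all
    fix g
    let ?h = "\<lambda>k. h k + g * u k"
    have "((\<lambda>s. w i \<theta> (\<lambda>k. ?h k + s * ?e k)) has_real_derivative (\<Sum>l\<in>I. W i l \<theta> (\<lambda>k. ?h k + 0 * ?e k) * ?e l)) (at 0)"
      by (rule w_line[OF i])
    moreover have "(\<Sum>l\<in>I. W i l \<theta> (\<lambda>k. ?h k + 0 * ?e k) * ?e l) = W i j \<theta> ?h"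
      using j fin by (simp add: if_distrib[of "\<lambda>x. _ * x"] sum.delta cong: if_cong)
    ultimately have "((\<lambda>s. (w i \<theta> (\<lambda>k. ?h k + (0 + s) * ?e k) - w i \<theta> (\<lambda>k. ?h k + 0 * ?e k)) / s) \<longlongrightarrow> W i j \<theta> ?h) (at 0)"
      unfolding DERIV_def by simp
    from filterlim_compose[OF this inverse_Suc_filterlim]
    show "(\<lambda>n. ?q n g) \<longlonglongrightarrow> W i j \<theta> ?h" by (simp add: add_ac)
  qed
  then show ?thesis using W_le[OF i j] by (auto simp: adm_def)
qed

lemma adm_Y: "adm Y"
proof -
  have "(\<lambda>g. Y \<theta> (\<lambda>k. h k + g * u k)) \<in> borel_measurable borel" for \<theta> h u
  proof (rule borel_measurable_LIMSEQ_real)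
    let ?q = "\<lambda>n g. (X (\<theta> + 1 / real (Suc n)) (\<lambda>k. h k + g * u k) - X \<theta> (\<lambda>k. h k + g * u k)) / (1 / real (Suc n))"
    show "?q n \<in> borel_measurable borel" for n
      by (intro borel_measurable_divide borel_measurable_diff DERIV_imp_borel_measurable[OF X_line]) simp_all
    fix g
    let ?h = "\<lambda>k. h k + g * u k"
    have "((\<lambda>s. X (\<theta> + s * 1) ?h) has_real_derivative Y (\<theta> + 0 * 1) ?h * 1 + (\<Sum>i\<in>I. w i (\<theta> + 0 * 1) ?h * 0)) (at 0)"
      by (rule X_curve[of "\<lambda>s. \<theta> + s * 1" "\<lambda>_. 1" "\<lambda>_. ?h" "\<lambda>_ _. 0", OF C1_affine C1_const])
    then have "((\<lambda>s. (X (\<theta> + s) ?h - X \<theta> ?h) / s) \<longlongrightarrow> Y \<theta> ?h) (at 0)"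
      unfolding DERIV_def by simp
    from filterlim_compose[OF this inverse_Suc_filterlim]
    show "(\<lambda>n. ?q n g) \<longlonglongrightarrow> Y \<theta> ?h" by simp
  qed
  then show ?thesis using Y_le by (auto simp: adm_def)
qed

definition L where "L \<theta> h g = (\<lambda>k. h k + g * (amp b \<theta> * v k))"

definition N where "N k \<theta> h = (\<integral>g. k \<theta> (L \<theta> h g) * exp (c * X \<theta> (L \<theta> h g)) \<partial>gauss)"

abbreviation one where "one \<equiv> (\<lambda>_ _. 1) :: real \<Rightarrow> ('i \<Rightarrow> real) \<Rightarrow> real"

definition T where "T k \<theta> h = N k \<theta> h / N one \<theta> h"

definition V where "V = nrm v"

lemma V_nn: "V \<ge> 0" unfolding V_def by (rule nrm_nn)

lemma nrm_amp: "nrm (\<lambda>k. amp b \<theta> * v k) \<le> V"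
  unfolding nrm_def V_def by (rule sum_mono) (use amp_le in \<open>auto simp: abs_mult intro!: mult_left_le_one_le\<close>)

lemma X_L_le: "\<bar>X \<theta> (L \<theta> h g)\<bar> \<le> \<bar>X \<theta> h\<bar> + V * \<bar>g\<bar>"
proof -
  have "\<bar>X \<theta> (L \<theta> h g) - X \<theta> h\<bar> \<le> nrm (\<lambda>k. amp b \<theta> * v k) * \<bar>g\<bar>"
    using X_lipschitz[of \<theta> h g "\<lambda>k. amp b \<theta> * v k" 0] by (simp add: L_def)
  also have "\<dots> \<le> V * \<bar>g\<bar>" by (rule mult_right_mono[OF nrm_amp]) simp
  finally show ?thesis by linarith
qed

lemma exp_X_L_le: assumes "\<bar>X \<theta> h\<bar> \<le> A" shows "exp (c * X \<theta> (L \<theta> h g)) \<le> exp (c * A) * exp (c * V * \<bar>g\<bar>)"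
proof -
  have "c * X \<theta> (L \<theta> h g) \<le> c * (A + V * \<bar>g\<bar>)"
    using X_L_le[of \<theta> h g] assms c by (intro mult_left_mono) auto
  then have "exp (c * X \<theta> (L \<theta> h g)) \<le> exp (c * A + c * V * \<bar>g\<bar>)" by (simp add: algebra_simps)
  then show ?thesis unfolding exp_add .
qed

lemma X_L_measurable: "(\<lambda>g. X \<theta> (L \<theta> h g)) \<in> borel_measurable borel"
  unfolding L_def by (rule DERIV_imp_borel_measurable[OF X_line])

lemma adm_L_measurable: "adm k \<Longrightarrow> (\<lambda>g. k \<theta> (L \<theta> h g)) \<in> borel_measurable borel"
  by (simp add: adm_def L_def)

lemma N_growth: assumes "adm k" shows "exp_growth (\<lambda>g. k \<theta> (L \<theta> h g) * exp (c * X \<theta> (L \<theta> h g)))"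
proof -
  obtain A where A: "\<And>\<theta> h. \<bar>k \<theta> h\<bar> \<le> A" using assms by (auto simp: adm_def)
  have A0: "A \<ge> 0" using order_trans[OF abs_ge_zero A] .
  show ?thesis
  proof (rule exp_growthI[of _ "c * V" "A * exp (c * \<bar>X \<theta> h\<bar>)"])
    show "(\<lambda>g. k \<theta> (L \<theta> h g) * exp (c * X \<theta> (L \<theta> h g))) \<in> borel_measurable borel"
      using adm_L_measurable[OF assms] X_L_measurable by simp
    show "\<bar>k \<theta> (L \<theta> h g) * exp (c * X \<theta> (L \<theta> h g))\<bar> \<le> A * exp (c * \<bar>X \<theta> h\<bar>) * exp (c * V * \<bar>g\<bar>)" for g
    proof -
      have "\<bar>k \<theta> (L \<theta> h g)\<bar> * exp (c * X \<theta> (L \<theta> h g)) \<le> A * (exp (c * \<bar>X \<theta> h\<bar>) * exp (c * V * \<bar>g\<bar>))"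
        using A A0 exp_X_L_le[OF order_refl] by (intro mult_mono) auto
      then show ?thesis by (simp add: abs_mult mult.assoc)
    qed
  qed (use c V_nn in auto)
qed

lemma N_integrable: "adm k \<Longrightarrow> integrable gauss (\<lambda>g. k \<theta> (L \<theta> h g) * exp (c * X \<theta> (L \<theta> h g)))"
  by (rule exp_growth_integrable0[OF N_growth])

lemma N_add: "adm k \<Longrightarrow> adm l \<Longrightarrow> N (\<lambda>\<theta> h. k \<theta> h + l \<theta> h) \<theta> h = N k \<theta> h + N l \<theta> h"
  unfolding N_def by (simp add: distrib_right Bochner_Integration.integral_add N_integrable)

lemma N_cmult: "N (\<lambda>\<theta> h. a * k \<theta> h) \<theta> h = a * N k \<theta> h"
  unfolding N_def by (simp add: mult.assoc)

lemma N_mono: "adm k \<Longrightarrow> adm l \<Longrightarrow> (\<And>h. k \<theta> h \<le> l \<theta> h) \<Longrightarrow> N k \<theta> h \<le> N l \<theta> h"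
  unfolding N_def by (intro integral_mono N_integrable) (auto intro: mult_right_mono)

lemma Z_pos: "N one \<theta> h > 0"
proof -
  have "(\<integral>g. exp (- c * \<bar>X \<theta> h\<bar>) * exp (- (c * V) * \<bar>g\<bar>) \<partial>gauss) \<le> N one \<theta> h"
    unfolding N_def
  proof (rule integral_mono[OF _ N_integrable[OF adm_const]])
    show "integrable gauss (\<lambda>g. exp (- c * \<bar>X \<theta> h\<bar>) * exp (- (c * V) * \<bar>g\<bar>))"
      by (intro integrable_mult_right exp_growth_integrable0 exp_growth_lipschitz_exp[where b=1]) simp
    fix g
    have "- c * \<bar>X \<theta> h\<bar> + - (c * V) * \<bar>g\<bar> = c * (- (\<bar>X \<theta> h\<bar> + V * \<bar>g\<bar>))" by (simp add: algebra_simps)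
    also have "\<dots> \<le> c * X \<theta> (L \<theta> h g)" using X_L_le[of \<theta> h g] c by (intro mult_left_mono) auto
    finally have "exp (- c * \<bar>X \<theta> h\<bar> + - (c * V) * \<bar>g\<bar>) \<le> exp (c * X \<theta> (L \<theta> h g))" by simp
    then show "exp (- c * \<bar>X \<theta> h\<bar>) * exp (- (c * V) * \<bar>g\<bar>) \<le> 1 * exp (c * X \<theta> (L \<theta> h g))" unfolding exp_add by simp
  qed
  moreover have "0 < (\<integral>g. exp (- c * \<bar>X \<theta> h\<bar>) * exp (- (c * V) * \<bar>g\<bar>) \<partial>gauss)"
  proof -
    have i: "integrable gauss (\<lambda>g. exp (- (c * V) * \<bar>g\<bar>))"
      by (intro exp_growth_integrable0 exp_growth_lipschitz_exp[where b=1]) simp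
    have "(\<integral>g. exp (- (c * V) * \<bar>g\<bar>) \<partial>gauss) \<noteq> 0"
    proof
      assume "(\<integral>g. exp (- (c * V) * \<bar>g\<bar>) \<partial>gauss) = 0"
      then have "AE g in gauss. exp (- (c * V) * \<bar>g\<bar>) = 0"
        using integral_nonneg_eq_0_iff_AE[OF i] by simp
      then have "AE g in gauss. False" by simp
      then show False using prob_space.AE_False[OF prob_space_gauss] by simp
    qed
    moreover have "(\<integral>g. exp (- (c * V) * \<bar>g\<bar>) \<partial>gauss) \<ge> 0" by (rule Bochner_Integration.integral_nonneg) simp
    ultimately have "0 < (\<integral>g. exp (- (c * V) * \<bar>g\<bar>) \<partial>gauss)" by linarith
    then show ?thesis unfolding integral_mult_right_zero by (intro mult_pos_pos) auto
  qed
  ultimately show ?thesis by linarith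
qed

lemma T_const: "T (\<lambda>_ _. a) \<theta> h = a"
  using Z_pos[of \<theta> h] N_cmult[of a one \<theta> h] by (simp add: T_def)

lemma T_add: "adm k \<Longrightarrow> adm l \<Longrightarrow> T (\<lambda>\<theta> h. k \<theta> h + l \<theta> h) \<theta> h = T k \<theta> h + T l \<theta> h"
  by (simp add: T_def N_add add_divide_distrib)

lemma T_cmult: "T (\<lambda>\<theta> h. a * k \<theta> h) \<theta> h = a * T k \<theta> h"
  by (simp add: T_def N_cmult)

lemma T_sum: "finite J \<Longrightarrow> (\<And>i. i \<in> J \<Longrightarrow> adm (k i)) \<Longrightarrow> T (\<lambda>\<theta> h. \<Sum>i\<in>J. k i \<theta> h) \<theta> h = (\<Sum>i\<in>J. T (k i) \<theta> h)"
  by (induction J rule: finite_induct) (simp_all add: T_const T_add adm_sum)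

lemma T_mono: "adm k \<Longrightarrow> adm l \<Longrightarrow> (\<And>h. k \<theta> h \<le> l \<theta> h) \<Longrightarrow> T k \<theta> h \<le> T l \<theta> h"
  using Z_pos[of \<theta> h] by (simp add: T_def N_mono divide_right_mono)

lemma T_abs_le: "adm k \<Longrightarrow> (\<And>h. \<bar>k \<theta> h\<bar> \<le> A) \<Longrightarrow> \<bar>T k \<theta> h\<bar> \<le> A"
  using T_mono[of k "\<lambda>_ _. A" \<theta> h] T_mono[of "\<lambda>_ _. - A" k \<theta> h] by (simp add: T_const adm_const abs_le_iff minus_le_iff)

text \<open>The average over one level, with gradient \<open>w'\<close>, Hessian \<open>W'\<close>
  and angle derivative \<open>Y'\<close>. The tilt adds \<open>c\<close> times a covariance to the
  Hessian. \<open>Hs\<close> is the second derivative of \<open>exp (c * X)\<close> in direction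
  \<open>v\<close>, divided by \<open>c * exp (c * X)\<close>; it enters through the moving
  amplitude of the Gaussian.\<close>

definition X' where "X' \<theta> h = ln (N one \<theta> h) / c"
definition w' where "w' i = T (w i)"
definition W' where "W' i j \<theta> h = T (W i j) \<theta> h + c * (T (\<lambda>\<theta> h. w i \<theta> h * w j \<theta> h) \<theta> h - T (w i) \<theta> h * T (w j) \<theta> h)"
definition Hs where "Hs \<theta> h = (\<Sum>i\<in>I. \<Sum>j\<in>I. v i * v j * (W i j \<theta> h + c * (w i \<theta> h * w j \<theta> h)))"
definition Y' where "Y' \<theta> h = T Y \<theta> h + amp b \<theta> * amp' b \<theta> * T Hs \<theta> h"

lemma adm_ww: "i \<in> I \<Longrightarrow> j \<in> I \<Longrightarrow> adm (\<lambda>\<theta> h. w i \<theta> h * w j \<theta> h)"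
  by (intro adm_mult adm_w)

lemma adm_Hs: "adm Hs"
  unfolding Hs_def by (intro adm_sum fin adm_mult[OF adm_const] adm_add adm_W adm_ww)

lemma T_Hs: "T Hs \<theta> h = (\<Sum>i\<in>I. \<Sum>j\<in>I. v i * v j * (T (W i j) \<theta> h + c * T (\<lambda>\<theta> h. w i \<theta> h * w j \<theta> h) \<theta> h))"
  unfolding Hs_def
  by (simp add: T_sum fin adm_sum adm_mult[OF adm_const] adm_add adm_W adm_ww T_cmult T_add cong: sum.cong)

lemma w'_nn: "i \<in> I \<Longrightarrow> 0 \<le> w' i \<theta> h"
  using T_mono[OF adm_const adm_w, of i 0 \<theta> h] w_nn by (simp add: w'_def T_const)

lemma w'_sum: "(\<Sum>i\<in>I. w' i \<theta> h) = 1"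
  unfolding w'_def using T_sum[OF fin adm_w, of "\<lambda>i. i" \<theta> h] by (simp add: w_sum T_const)

text \<open>The factor \<open>g\<close>, produced by differentiating the amplitude of the Gaussian
  term, is traded for a second derivative in direction \<open>v\<close>.\<close>

lemma Gaussian_parts:
  "(\<integral>g. g * ((\<Sum>i\<in>I. w i \<theta> (L \<theta> h g) * v i) * exp (c * X \<theta> (L \<theta> h g))) \<partial>gauss) = amp b \<theta> * N Hs \<theta> h"
proof -
  let ?u = "\<lambda>k. amp b \<theta> * v k"
  let ?j = "\<lambda>g. (\<Sum>i\<in>I. w i \<theta> (L \<theta> h g) * v i) * exp (c * X \<theta> (L \<theta> h g))"
  let ?j' = "\<lambda>g. (amp b \<theta> * Hs \<theta> (L \<theta> h g)) * exp (c * X \<theta> (L \<theta> h g))"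
  have der: "(?j has_real_derivative ?j' g) (at g)" for g
  proof -
    let ?P = "\<Sum>i\<in>I. (\<Sum>j\<in>I. W i j \<theta> (L \<theta> h g) * ?u j) * v i" and ?Q = "\<Sum>i\<in>I. w i \<theta> (L \<theta> h g) * ?u i"
      and ?R = "\<Sum>i\<in>I. w i \<theta> (L \<theta> h g) * v i"
    have "(?j has_real_derivative ?P * exp (c * X \<theta> (L \<theta> h g)) + exp (c * X \<theta> (L \<theta> h g)) * (c * ?Q) * ?R) (at g)"
      unfolding L_def by (rule derivative_eq_intros w_line X_line refl | assumption)+ simp
    moreover have "(\<Sum>i\<in>I. (\<Sum>j\<in>I. W i j \<theta> (L \<theta> h g) * ?u j) * v i) + c * (\<Sum>i\<in>I. w i \<theta> (L \<theta> h g) * ?u i) * (\<Sum>i\<in>I. w i \<theta> (L \<theta> h g) * v i)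
        = amp b \<theta> * Hs \<theta> (L \<theta> h g)"
      unfolding Hs_def sum_distrib_left sum_distrib_right sum.distrib[symmetric] distrib_left mult.assoc
      by (simp add: sum.distrib sum_distrib_left sum_distrib_right mult_ac)
    moreover have "?P * exp (c * X \<theta> (L \<theta> h g)) + exp (c * X \<theta> (L \<theta> h g)) * (c * ?Q) * ?R = (?P + c * ?Q * ?R) * exp (c * X \<theta> (L \<theta> h g))"
      by (simp add: algebra_simps)
    ultimately show ?thesis by (simp only:)
  qed
  have a1: "adm (\<lambda>\<theta> h. \<Sum>i\<in>I. w i \<theta> h * v i)" by (intro adm_sum fin adm_mult[OF _ adm_const] adm_w)
  have a2: "adm (\<lambda>\<theta>' h. amp b \<theta> * Hs \<theta>' h)" by (intro adm_mult[OF adm_const] adm_Hs)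
  obtain A a where A: "A \<ge> 0" "a \<ge> 0" "\<And>g. \<bar>?j g\<bar> \<le> A * exp (a * \<bar>g\<bar>)" "\<And>g. \<bar>?j' g\<bar> \<le> A * exp (a * \<bar>g\<bar>)"
    by (rule exp_growth2E[OF N_growth[OF a1, of \<theta> h] N_growth[OF a2, of \<theta> h]]) (rule that)
  have "(\<integral>g. g * ?j g \<partial>gauss) = (\<integral>g. ?j' g \<partial>gauss)"
    by (rule gauss_integration_by_parts[OF der A(2-4)])
  also have "\<dots> = amp b \<theta> * N Hs \<theta> h" unfolding N_def by (simp add: mult.assoc)
  finally show ?thesis .
qed

text \<open>Formulated along an arbitrary curve in angle and field, because the lines in
  \<open>h\<close> and the motion of the angle alone are both needed afterwards.\<close>

lemma Z_curve:
  assumes p: "C1 p p'" and H: "\<And>i. C1 (\<lambda>s. H s i) (H' i)"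
  shows "((\<lambda>s. N one (p s) (H s)) has_real_derivative
     c * (N one (p s) (H s) * (Y' (p s) (H s) * p' s + (\<Sum>i\<in>I. w' i (p s) (H s) * H' i s)))) (at s)"
proof -
  define e where "e s g = exp (c * X (p s) (L (p s) (H s) g))" for s g
  \<comment> \<open>The total derivative of the inner function: explicit dependence on the angle,
    motion of \<open>H\<close>, and motion of the amplitude.\<close>
  define D where "D s g = Y (p s) (L (p s) (H s) g) * p' s
      + (\<Sum>i\<in>I. w i (p s) (L (p s) (H s) g) * (H' i s + g * (amp' b (p s) * p' s * v i)))" for s g
  have H1: "C1 (\<lambda>s. L (p s) (H s) g i) (\<lambda>s. H' i s + g * (amp' b (p s) * p' s * v i))" for g i
    unfolding L_def using C1_add[OF H[of i] C1_cmult[OF C1_amp[OF p], of "g * v i" b]] by (simp add: mult_ac)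
  have dX: "((\<lambda>s. X (p s) (L (p s) (H s) g)) has_real_derivative D s g) (at s)" for s g
    unfolding D_def by (rule X_curve[OF p H1])
  have de: "((\<lambda>s. e s g) has_real_derivative c * (D s g * e s g)) (at s)" for s g
    unfolding e_def by (auto intro!: derivative_eq_intros dX)
  obtain P where P: "P \<ge> 0" "\<And>t. \<bar>t - s\<bar> \<le> 1 \<Longrightarrow> \<bar>p' t\<bar> \<le> P"
    by (rule continuous_bounded_near[of p' s]) (use p C1_def in auto)
  have "\<forall>i. \<exists>A\<ge>0. \<forall>t. \<bar>t - s\<bar> \<le> 1 \<longrightarrow> \<bar>H' i t\<bar> \<le> A"
    using continuous_bounded_near[of "H' _" s] H unfolding C1_def by metis
  then obtain Q where Q: "\<And>i. Q i \<ge> 0" "\<And>i t. \<bar>t - s\<bar> \<le> 1 \<Longrightarrow> \<bar>H' i t\<bar> \<le> Q i" by metis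
  have "continuous_on UNIV (\<lambda>s. X (p s) (H s))" by (rule DERIV_continuous_on_UNIV[OF X_curve[OF p H]])
  then obtain A where A: "A \<ge> 0" "\<And>t. \<bar>t - s\<bar> \<le> 1 \<Longrightarrow> \<bar>X (p t) (H t)\<bar> \<le> A" by (rule continuous_bounded_near[of _ s]) (rule that)
  define C where "C = B * P + (\<Sum>i\<in>I. Q i)"
  have D_le: "\<bar>D t g\<bar> \<le> C + P * V * \<bar>g\<bar>" if t: "\<bar>t - s\<bar> \<le> 1" for t g
  proof -
    have "\<bar>Y (p t) (L (p t) (H t) g) * p' t\<bar> \<le> B * P" unfolding abs_mult using Y_le P(2)[OF t] B_nn by (intro mult_mono) auto
    moreover have "\<bar>\<Sum>i\<in>I. w i (p t) (L (p t) (H t) g) * (H' i t + g * (amp' b (p t) * p' t * v i))\<bar> \<le> (\<Sum>i\<in>I. Q i + P * \<bar>v i\<bar> * \<bar>g\<bar>)"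
    proof (rule order_trans[OF sum_abs sum_mono])
      fix i assume i: "i \<in> I"
      have "\<bar>amp' b (p t)\<bar> * \<bar>p' t\<bar> \<le> 1 * P" using amp_le(2) P(2)[OF t] by (intro mult_mono) auto
      then have "\<bar>amp' b (p t)\<bar> * \<bar>p' t\<bar> * (\<bar>v i\<bar> * \<bar>g\<bar>) \<le> P * (\<bar>v i\<bar> * \<bar>g\<bar>)" by (intro mult_right_mono) auto
      then have "\<bar>g * (amp' b (p t) * p' t * v i)\<bar> \<le> P * \<bar>v i\<bar> * \<bar>g\<bar>" by (simp add: abs_mult mult_ac)
      then have "\<bar>H' i t + g * (amp' b (p t) * p' t * v i)\<bar> \<le> Q i + P * \<bar>v i\<bar> * \<bar>g\<bar>" using Q(2)[OF t, of i] by linarith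
      then have "\<bar>w i (p t) (L (p t) (H t) g)\<bar> * \<bar>H' i t + g * (amp' b (p t) * p' t * v i)\<bar> \<le> 1 * (Q i + P * \<bar>v i\<bar> * \<bar>g\<bar>)"
        using w_nn[OF i] w_le[OF i] by (intro mult_mono) auto
      then show "\<bar>w i (p t) (L (p t) (H t) g) * (H' i t + g * (amp' b (p t) * p' t * v i))\<bar> \<le> Q i + P * \<bar>v i\<bar> * \<bar>g\<bar>" by (simp add: abs_mult)
    qed
    moreover have "(\<Sum>i\<in>I. Q i + P * \<bar>v i\<bar> * \<bar>g\<bar>) = (\<Sum>i\<in>I. Q i) + P * V * \<bar>g\<bar>"
      by (simp add: sum.distrib V_def nrm_def sum_distrib_left sum_distrib_right)
    ultimately show ?thesis unfolding D_def C_def by linarith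
  qed
  have C0: "C \<ge> 0" unfolding C_def using B_nn P(1) Q(1) by (intro add_nonneg_nonneg mult_nonneg_nonneg sum_nonneg) auto
  let ?Bd = "\<lambda>g. c * ((C + P * V * \<bar>g\<bar>) * (exp (c * A) * exp (c * V * \<bar>g\<bar>)))"
  have "((\<lambda>s. \<integral>g. e s g \<partial>gauss) has_real_derivative (\<integral>g. c * (D s g * e s g) \<partial>gauss)) (at s)"
  proof (rule DERIV_under_integral[where e=1 and B="?Bd"])
    show "(\<lambda>g. e t g) \<in> borel_measurable gauss" for t unfolding e_def using X_L_measurable by (simp add: borel_measurable_gauss)
    show "integrable gauss (\<lambda>g. e s g)" unfolding e_def using N_integrable[OF adm_const[of 1]] by simp
    show "\<bar>c * (D t g * e t g)\<bar> \<le> ?Bd g" if t: "\<bar>t - s\<bar> < 1" for t g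
    proof -
      have "\<bar>D t g\<bar> * e t g \<le> (C + P * V * \<bar>g\<bar>) * (exp (c * A) * exp (c * V * \<bar>g\<bar>))"
        unfolding e_def using D_le[of t g] exp_X_L_le[OF A(2), of t g] t C0 P V_nn by (intro mult_mono) auto
      then show ?thesis using c by (simp add: abs_mult e_def)
    qed
    have g1: "exp_growth (\<lambda>g. exp (c * V * \<bar>g\<bar>))" by (rule exp_growth_lipschitz_exp[where b=1]) simp
    have g2: "exp_growth (\<lambda>g. \<bar>g\<bar>)" by (rule exp_growthI[of _ 1 1]) (auto simp: abs_le_exp_abs)
    have "integrable gauss (\<lambda>g. (c * C * exp (c * A)) * exp (c * V * \<bar>g\<bar>) + (c * P * V * exp (c * A)) * (\<bar>g\<bar> * exp (c * V * \<bar>g\<bar>)))"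
      by (intro Bochner_Integration.integrable_add integrable_mult_right exp_growth_integrable0[OF g1] exp_growth_integrable0[OF exp_growth_mult[OF g2 g1]])
    then show "integrable gauss ?Bd" by (simp add: algebra_simps)
  qed (use de in auto)
  moreover have "(\<integral>g. c * (D s g * e s g) \<partial>gauss) = c * (N one (p s) (H s) * (Y' (p s) (H s) * p' s + (\<Sum>i\<in>I. w' i (p s) (H s) * H' i s)))"
  proof -
    let ?\<theta> = "p s" and ?h = "H s"
    have a1: "adm (\<lambda>\<theta> h. \<Sum>i\<in>I. w i \<theta> h * v i)" by (intro adm_sum fin adm_mult[OF _ adm_const] adm_w)
    have a2: "adm (\<lambda>\<theta> h. p' s * Y \<theta> h + (\<Sum>i\<in>I. H' i s * w i \<theta> h))" by (intro adm_add adm_sum fin adm_mult[OF adm_const] adm_w adm_Y)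
    have i1: "integrable gauss (\<lambda>g. g * ((\<Sum>i\<in>I. w i ?\<theta> (L ?\<theta> ?h g) * v i) * e s g))"
      unfolding e_def by (rule exp_growth_integrable0[OF exp_growth_mult[OF exp_growth_id N_growth[OF a1]]])
    \<comment> \<open>Only the last summand carries the factor \<open>g\<close>; integration by
      parts is applied to it alone.\<close>
    have "D s g * e s g = (p' s * Y ?\<theta> (L ?\<theta> ?h g) + (\<Sum>i\<in>I. H' i s * w i ?\<theta> (L ?\<theta> ?h g))) * e s g
        + (amp' b ?\<theta> * p' s) * (g * ((\<Sum>i\<in>I. w i ?\<theta> (L ?\<theta> ?h g) * v i) * e s g))" for g
      unfolding D_def by (simp add: algebra_simps sum.distrib sum_distrib_left sum_distrib_right)
    then have "(\<integral>g. D s g * e s g \<partial>gauss) = N (\<lambda>\<theta> h. p' s * Y \<theta> h + (\<Sum>i\<in>I. H' i s * w i \<theta> h)) ?\<theta> ?h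
       + (amp' b ?\<theta> * p' s) * (amp b ?\<theta> * N Hs ?\<theta> ?h)"
      using Gaussian_parts[of ?\<theta> ?h] N_integrable[OF a2, of ?\<theta> ?h] i1
      by (simp add: e_def N_def)
    also have "\<dots> = N one ?\<theta> ?h * (T (\<lambda>\<theta> h. p' s * Y \<theta> h + (\<Sum>i\<in>I. H' i s * w i \<theta> h)) ?\<theta> ?h + (amp' b ?\<theta> * p' s) * (amp b ?\<theta> * T Hs ?\<theta> ?h))"
      using Z_pos[of ?\<theta> ?h] by (simp add: T_def field_simps)
    also have "T (\<lambda>\<theta> h. p' s * Y \<theta> h + (\<Sum>i\<in>I. H' i s * w i \<theta> h)) ?\<theta> ?h = p' s * T Y ?\<theta> ?h + (\<Sum>i\<in>I. H' i s * w' i ?\<theta> ?h)"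
      by (subst T_add, intro adm_mult[OF adm_const] adm_Y, intro adm_sum fin adm_mult[OF adm_const] adm_w, assumption)
         (simp add: T_cmult T_sum fin adm_mult[OF adm_const] adm_w w'_def cong: sum.cong)
    also have "p' s * T Y ?\<theta> ?h + (\<Sum>i\<in>I. H' i s * w' i ?\<theta> ?h) + (amp' b ?\<theta> * p' s) * (amp b ?\<theta> * T Hs ?\<theta> ?h)
       = Y' ?\<theta> ?h * p' s + (\<Sum>i\<in>I. w' i ?\<theta> ?h * H' i s)" unfolding Y'_def by (simp add: algebra_simps)
    finally show ?thesis by simp
  qed
  moreover have "(\<lambda>s. N one (p s) (H s)) = (\<lambda>s. \<integral>g. e s g \<partial>gauss)" by (simp add: N_def e_def fun_eq_iff)
  ultimately show ?thesis by (simp only:)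
qed

lemma X'_curve:
  assumes p: "C1 p p'" and H: "\<And>i. C1 (\<lambda>s. H s i) (H' i)"
  shows "((\<lambda>s. X' (p s) (H s)) has_real_derivative Y' (p s) (H s) * p' s + (\<Sum>i\<in>I. w' i (p s) (H s) * H' i s)) (at s)"
proof -
  have "((\<lambda>s. ln (N one (p s) (H s)) / c) has_real_derivative
     1 / N one (p s) (H s) * (c * (N one (p s) (H s) * (Y' (p s) (H s) * p' s + (\<Sum>i\<in>I. w' i (p s) (H s) * H' i s)))) / c) (at s)"
    by (rule DERIV_cdivide[OF DERIV_chain2[OF DERIV_ln_divide[OF Z_pos] Z_curve[OF p H]]])
  then show ?thesis unfolding X'_def using Z_pos[of "p s" "H s"] c by simp
qed

lemma N_w_line:
  assumes i: "i \<in> I"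
  shows "((\<lambda>s. N (w i) \<theta> (\<lambda>k. h k + s * u k)) has_real_derivative
    (\<Sum>j\<in>I. u j * (N (W i j) \<theta> (\<lambda>k. h k + s * u k) + c * N (\<lambda>\<theta> h. w i \<theta> h * w j \<theta> h) \<theta> (\<lambda>k. h k + s * u k)))) (at s)"
proof -
  define x where "x t g = (\<lambda>k. L \<theta> h g k + t * u k)" for t g
  have xL: "L \<theta> (\<lambda>k. h k + t * u k) g = x t g" for t g by (simp add: L_def x_def fun_eq_iff)
  define D where "D t g = (\<Sum>j\<in>I. u j * (W i j \<theta> (x t g) + c * (w i \<theta> (x t g) * w j \<theta> (x t g)))) * exp (c * X \<theta> (x t g))" for t g
  have der: "((\<lambda>t. w i \<theta> (x t g) * exp (c * X \<theta> (x t g))) has_real_derivative D t g) (at t)" for t g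
  proof -
    have "((\<lambda>t. w i \<theta> (x t g) * exp (c * X \<theta> (x t g))) has_real_derivative
      (\<Sum>j\<in>I. W i j \<theta> (x t g) * u j) * exp (c * X \<theta> (x t g)) + exp (c * X \<theta> (x t g)) * (c * (\<Sum>j\<in>I. w j \<theta> (x t g) * u j)) * w i \<theta> (x t g)) (at t)"
      unfolding x_def by (rule derivative_eq_intros w_line[OF i] X_line refl)+ simp
    then show ?thesis unfolding D_def by (simp add: algebra_simps sum.distrib sum_distrib_left sum_distrib_right)
  qed
  have "continuous_on UNIV (\<lambda>t. X \<theta> (\<lambda>k. h k + t * u k))" by (rule DERIV_continuous_on_UNIV[OF X_line])
  then obtain A where A: "A \<ge> 0" "\<And>t. \<bar>t - s\<bar> \<le> 1 \<Longrightarrow> \<bar>X \<theta> (\<lambda>k. h k + t * u k)\<bar> \<le> A" by (rule continuous_bounded_near[of _ s]) (rule that)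
  have a: "adm (\<lambda>\<theta> h. \<Sum>j\<in>I. u j * (W i j \<theta> h + c * (w i \<theta> h * w j \<theta> h)))"
    by (intro adm_sum fin adm_mult[OF adm_const] adm_add adm_W i adm_ww)
  then obtain C where C: "\<And>\<theta> h. \<bar>\<Sum>j\<in>I. u j * (W i j \<theta> h + c * (w i \<theta> h * w j \<theta> h))\<bar> \<le> C" unfolding adm_def by blast
  have C0: "C \<ge> 0" using order_trans[OF abs_ge_zero C] .
  let ?Bd = "\<lambda>g. C * exp (c * A) * exp (c * V * \<bar>g\<bar>)"
  have "((\<lambda>t. \<integral>g. w i \<theta> (x t g) * exp (c * X \<theta> (x t g)) \<partial>gauss) has_real_derivative (\<integral>g. D s g \<partial>gauss)) (at s)"
  proof (rule DERIV_under_integral[where e=1 and B="?Bd"])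
    show "(\<lambda>g. w i \<theta> (x t g) * exp (c * X \<theta> (x t g))) \<in> borel_measurable gauss" for t
      unfolding xL[symmetric] borel_measurable_gauss by (rule exp_growth_measurable[OF N_growth[OF adm_w[OF i]]])
    show "integrable gauss (\<lambda>g. w i \<theta> (x s g) * exp (c * X \<theta> (x s g)))"
      unfolding xL[symmetric] by (rule N_integrable[OF adm_w[OF i]])
    show "integrable gauss ?Bd" 
      by (intro integrable_mult_right exp_growth_integrable0 exp_growth_lipschitz_exp[where b=1]) simp
    show "\<bar>D t g\<bar> \<le> ?Bd g" if "\<bar>t - s\<bar> < 1" for t g
    proof -
      have "\<bar>\<Sum>j\<in>I. u j * (W i j \<theta> (x t g) + c * (w i \<theta> (x t g) * w j \<theta> (x t g)))\<bar> * exp (c * X \<theta> (x t g)) \<le> C * (exp (c * A) * exp (c * V * \<bar>g\<bar>))"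
        unfolding xL[symmetric] using C C0 exp_X_L_le[OF A(2)[of t]] that by (intro mult_mono) auto
      then show ?thesis unfolding D_def by (simp add: abs_mult mult.assoc)
    qed
  qed (use der in auto)
  moreover have "(\<integral>g. D s g \<partial>gauss) = (\<Sum>j\<in>I. u j * (N (W i j) \<theta> (\<lambda>k. h k + s * u k) + c * N (\<lambda>\<theta> h. w i \<theta> h * w j \<theta> h) \<theta> (\<lambda>k. h k + s * u k)))"
  proof -
    have "(\<integral>g. D s g \<partial>gauss) = N (\<lambda>\<theta> h. \<Sum>j\<in>I. u j * (W i j \<theta> h + c * (w i \<theta> h * w j \<theta> h))) \<theta> (\<lambda>k. h k + s * u k)"
      unfolding N_def D_def xL ..
    also have "\<dots> = N one \<theta> (\<lambda>k. h k + s * u k) * T (\<lambda>\<theta> h. \<Sum>j\<in>I. u j * (W i j \<theta> h + c * (w i \<theta> h * w j \<theta> h))) \<theta> (\<lambda>k. h k + s * u k)"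
      using Z_pos[of \<theta> "\<lambda>k. h k + s * u k"] by (simp add: T_def)
    also have "T (\<lambda>\<theta> h. \<Sum>j\<in>I. u j * (W i j \<theta> h + c * (w i \<theta> h * w j \<theta> h))) \<theta> (\<lambda>k. h k + s * u k)
       = (\<Sum>j\<in>I. u j * (T (W i j) \<theta> (\<lambda>k. h k + s * u k) + c * T (\<lambda>\<theta> h. w i \<theta> h * w j \<theta> h) \<theta> (\<lambda>k. h k + s * u k)))"
      by (simp add: T_sum fin adm_mult[OF adm_const] adm_add adm_W i adm_ww T_cmult T_add cong: sum.cong)
    also have "N one \<theta> (\<lambda>k. h k + s * u k) * \<dots> = (\<Sum>j\<in>I. u j * (N (W i j) \<theta> (\<lambda>k. h k + s * u k) + c * N (\<lambda>\<theta> h. w i \<theta> h * w j \<theta> h) \<theta> (\<lambda>k. h k + s * u k)))"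
      using Z_pos[of \<theta> "\<lambda>k. h k + s * u k"] unfolding sum_distrib_left by (intro sum.cong refl) (simp add: T_def field_simps)
    finally show ?thesis .
  qed
  ultimately show ?thesis unfolding N_def[of "w i"] xL by simp
qed

lemma w'_line:
  assumes i: "i \<in> I"
  shows "((\<lambda>s. w' i \<theta> (\<lambda>k. h k + s * u k)) has_real_derivative (\<Sum>j\<in>I. W' i j \<theta> (\<lambda>k. h k + s * u k) * u j)) (at s)"
proof -
  let ?h = "\<lambda>s k. h k + s * u k"
  have Z: "((\<lambda>s. N one \<theta> (?h s)) has_real_derivative c * (N one \<theta> (?h s) * (\<Sum>j\<in>I. w' j \<theta> (?h s) * u j))) (at s)"
    using Z_curve[of "\<lambda>_. \<theta>" "\<lambda>_. 0" ?h "\<lambda>j _. u j" s] C1_const C1_affine by auto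
  have "((\<lambda>s. N (w i) \<theta> (?h s) / N one \<theta> (?h s)) has_real_derivative
    ((\<Sum>j\<in>I. u j * (N (W i j) \<theta> (?h s) + c * N (\<lambda>\<theta> h. w i \<theta> h * w j \<theta> h) \<theta> (?h s))) * N one \<theta> (?h s)
      - N (w i) \<theta> (?h s) * (c * (N one \<theta> (?h s) * (\<Sum>j\<in>I. w' j \<theta> (?h s) * u j)))) / (N one \<theta> (?h s) * N one \<theta> (?h s))) (at s)"
    by (rule DERIV_divide[OF N_w_line[OF i] Z]) (use Z_pos in \<open>simp add: less_imp_neq[symmetric]\<close>)
  moreover have "((\<Sum>j\<in>I. u j * (N (W i j) \<theta> (?h s) + c * N (\<lambda>\<theta> h. w i \<theta> h * w j \<theta> h) \<theta> (?h s))) * N one \<theta> (?h s)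
      - N (w i) \<theta> (?h s) * (c * (N one \<theta> (?h s) * (\<Sum>j\<in>I. w' j \<theta> (?h s) * u j)))) / (N one \<theta> (?h s) * N one \<theta> (?h s))
    = (\<Sum>j\<in>I. W' i j \<theta> (?h s) * u j)"
  proof -
    let ?Z = "N one \<theta> (?h s)"
    have Z0: "?Z \<noteq> 0" using Z_pos by (simp add: less_imp_neq[symmetric])
    have "(\<Sum>j\<in>I. u j * (N (W i j) \<theta> (?h s) + c * N (\<lambda>\<theta> h. w i \<theta> h * w j \<theta> h) \<theta> (?h s))) * ?Z
      - N (w i) \<theta> (?h s) * (c * (?Z * (\<Sum>j\<in>I. w' j \<theta> (?h s) * u j)))
      = (\<Sum>j\<in>I. W' i j \<theta> (?h s) * u j) * (?Z * ?Z)"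
      unfolding sum_distrib_left sum_distrib_right sum_subtractf[symmetric]
      by (intro sum.cong refl) (use Z0 in \<open>simp add: W'_def w'_def T_def field_simps\<close>)
    then show ?thesis using Z0 by simp
  qed
  ultimately show ?thesis unfolding w'_def T_def by simp
qed

lemma W'_le: assumes "i \<in> I" "j \<in> I" shows "\<bar>W' i j \<theta> h\<bar> \<le> B + 2 * c"
proof -
  have "\<bar>T (W i j) \<theta> h\<bar> \<le> B" by (rule T_abs_le[OF adm_W[OF assms] W_le[OF assms]])
  moreover have w1: "\<bar>w i \<theta> h\<bar> \<le> 1" if "i \<in> I" for i \<theta> h using w_nn[OF that] w_le[OF that] by simp
  have "\<bar>T (\<lambda>\<theta> h. w i \<theta> h * w j \<theta> h) \<theta> h\<bar> \<le> 1 * 1"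
    by (rule T_abs_le[OF adm_ww[OF assms]]) (unfold abs_mult, intro mult_mono w1 assms, auto)
  moreover have "\<bar>T (w i) \<theta> h\<bar> * \<bar>T (w j) \<theta> h\<bar> \<le> 1 * 1"
    by (intro mult_mono T_abs_le adm_w w1 assms) auto
  ultimately have "\<bar>T (W i j) \<theta> h\<bar> \<le> B" "\<bar>T (\<lambda>\<theta> h. w i \<theta> h * w j \<theta> h) \<theta> h - T (w i) \<theta> h * T (w j) \<theta> h\<bar> \<le> 2"
    by (simp_all add: abs_mult[symmetric])
  then have "\<bar>T (W i j) \<theta> h\<bar> \<le> B" "\<bar>c * (T (\<lambda>\<theta> h. w i \<theta> h * w j \<theta> h) \<theta> h - T (w i) \<theta> h * T (w j) \<theta> h)\<bar> \<le> c * 2"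
    using c by (simp_all add: abs_mult)
  then show ?thesis unfolding W'_def by linarith
qed

lemma guerra_regular_step: "\<exists>B'. guerra_regular I X' w' W' Y' B'"
proof -
  obtain A where A: "\<And>\<theta> h. \<bar>Hs \<theta> h\<bar> \<le> A" using adm_Hs unfolding adm_def by blast
  have A0: "A \<ge> 0" using order_trans[OF abs_ge_zero A] .
  have Y'_le: "\<bar>Y' \<theta> h\<bar> \<le> B + A" for \<theta> h
  proof -
    have "\<bar>amp b \<theta> * amp' b \<theta>\<bar> \<le> 1 * 1" unfolding abs_mult using amp_le by (intro mult_mono) auto
    then have "\<bar>amp b \<theta> * amp' b \<theta>\<bar> * \<bar>T Hs \<theta> h\<bar> \<le> 1 * A"
      using T_abs_le[OF adm_Hs A, of \<theta> h] by (intro mult_mono) auto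
    then have "\<bar>amp b \<theta> * amp' b \<theta> * T Hs \<theta> h\<bar> \<le> A" by (simp add: abs_mult)
    moreover have "\<bar>T Y \<theta> h\<bar> \<le> B" by (rule T_abs_le[OF adm_Y Y_le])
    ultimately show ?thesis unfolding Y'_def by linarith
  qed
  show ?thesis
    unfolding guerra_regular_def
  proof (intro exI[of _ "B + 2 * c + A"] conjI allI impI ballI)
    fix p p' :: "real \<Rightarrow> real" and H :: "real \<Rightarrow> 'i \<Rightarrow> real" and H' s assume "C1 p p'" "\<forall>i. C1 (\<lambda>s. H s i) (H' i)"
    then show "((\<lambda>s. X' (p s) (H s)) has_real_derivative Y' (p s) (H s) * p' s + (\<Sum>i\<in>I. w' i (p s) (H s) * H' i s)) (at s)"
      by (intro X'_curve) auto
  next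
    fix \<theta> h
    show "\<bar>Y' \<theta> h\<bar> \<le> B + 2 * c + A" using Y'_le[of \<theta> h] c by linarith
    fix i j assume "i \<in> I" "j \<in> I"
    then show "\<bar>W' i j \<theta> h\<bar> \<le> B + 2 * c + A" using W'_le[of i j \<theta> h] A0 by linarith
  qed (use w'_line w'_nn w'_sum in auto)
qed

text \<open>How the key quantity of the interpolation passes through one step: the increment \<open>c - c0\<close> of the
  exponent multiplies the quadratic form of the accumulated covariance difference \<open>D\<close>.\<close>

lemma guerra_bound_step:
  fixes D :: "'i \<Rightarrow> 'i \<Rightarrow> real" and \<theta> :: real
  defines "\<kappa> \<equiv> sin \<theta> * cos \<theta>" and "\<epsilon> \<equiv> (if b then 1 else -1)"
  assumes \<kappa>: "\<kappa> \<ge> 0"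
    and IH: "\<And>h. Y \<theta> h + \<kappa> * (\<Sum>i\<in>I. \<Sum>j\<in>I. (W i j \<theta> h + c * (w i \<theta> h * w j \<theta> h)) * (D i j + \<epsilon> * (v i * v j))) \<le> \<kappa> * E"
    and c0: "c0 \<le> c" "c0 = c \<or> (\<forall>i\<in>I. \<forall>j\<in>I. 0 \<le> D i j)"
  shows "Y' \<theta> h + \<kappa> * (\<Sum>i\<in>I. \<Sum>j\<in>I. (W' i j \<theta> h + c0 * (w' i \<theta> h * w' j \<theta> h)) * D i j) \<le> \<kappa> * E"
proof -
  let ?M = "\<lambda>i j. T (W i j) \<theta> h + c * T (\<lambda>\<theta> h. w i \<theta> h * w j \<theta> h) \<theta> h"
  let ?k = "\<lambda>\<theta>' h. Y \<theta>' h + \<kappa> * (\<Sum>i\<in>I. \<Sum>j\<in>I. (D i j + \<epsilon> * (v i * v j)) * (W i j \<theta>' h + c * (w i \<theta>' h * w j \<theta>' h)))"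
  have a: "adm (\<lambda>\<theta> h. W i j \<theta> h + c * (w i \<theta> h * w j \<theta> h))" if "i \<in> I" "j \<in> I" for i j
    using that by (intro adm_add adm_W adm_mult[OF adm_const] adm_ww)
  have adm2: "adm (\<lambda>\<theta>' h. \<kappa> * (\<Sum>i\<in>I. \<Sum>j\<in>I. (D i j + \<epsilon> * (v i * v j)) * (W i j \<theta>' h + c * (w i \<theta>' h * w j \<theta>' h))))"
    by (intro adm_mult[OF adm_const] adm_sum fin a)
  have "T ?k \<theta> h \<le> T (\<lambda>_ _. \<kappa> * E) \<theta> h"
    by (rule T_mono[OF adm_add[OF adm_Y adm2] adm_const]) (use IH in \<open>simp add: mult_ac\<close>)
  moreover have "T ?k \<theta> h = T Y \<theta> h + \<kappa> * (\<Sum>i\<in>I. \<Sum>j\<in>I. (D i j + \<epsilon> * (v i * v j)) * ?M i j)"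
    by (subst T_add[OF adm_Y adm2])
      (simp add: T_cmult T_sum fin adm_sum adm_mult[OF adm_const] a T_add adm_W adm_ww cong: sum.cong)
  ultimately have 1: "T Y \<theta> h + \<kappa> * (\<Sum>i\<in>I. \<Sum>j\<in>I. (D i j + \<epsilon> * (v i * v j)) * ?M i j) \<le> \<kappa> * E" by (simp add: T_const)
  \<comment> \<open>Both kinds of level contribute with the same \<open>\<kappa>\<close> and differ
    in sign only; this is the gain from interpolating along an angle.\<close>
  have amp: "amp b \<theta> * amp' b \<theta> = \<kappa> * \<epsilon>" by (simp add: amp_def amp'_def \<kappa>_def \<epsilon>_def)
  have 2: "(\<Sum>i\<in>I. \<Sum>j\<in>I. (D i j + \<epsilon> * (v i * v j)) * ?M i j) = (\<Sum>i\<in>I. \<Sum>j\<in>I. D i j * ?M i j) + \<epsilon> * T Hs \<theta> h"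
    unfolding T_Hs by (simp add: sum.distrib sum_distrib_left distrib_right mult_ac)
  \<comment> \<open>Lowering the exponent from \<open>c\<close> to \<open>c0\<close> subtracts a
    form in the nonnegative weights \<open>w'\<close>, which has a sign once \<open>D\<close> is
    entrywise nonnegative.\<close>
  have 3: "(\<Sum>i\<in>I. \<Sum>j\<in>I. (W' i j \<theta> h + c0 * (w' i \<theta> h * w' j \<theta> h)) * D i j)
     = (\<Sum>i\<in>I. \<Sum>j\<in>I. D i j * ?M i j) - (c - c0) * (\<Sum>i\<in>I. \<Sum>j\<in>I. w' i \<theta> h * w' j \<theta> h * D i j)"
    unfolding W'_def w'_def sum_distrib_left sum_subtractf[symmetric] by (intro sum.cong refl) (simp add: algebra_simps)
  have "0 \<le> \<kappa> * ((c - c0) * (\<Sum>i\<in>I. \<Sum>j\<in>I. w' i \<theta> h * w' j \<theta> h * D i j))"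
  proof (cases "c0 = c")
    case False
    then have "\<forall>i\<in>I. \<forall>j\<in>I. 0 \<le> D i j" using c0(2) by blast
    then show ?thesis using \<kappa> c0(1) w'_nn by (intro mult_nonneg_nonneg sum_nonneg) auto
  qed simp
  then show ?thesis using 1 unfolding 2 3 Y'_def amp by (simp add: algebra_simps)
qed

end

section \<open>Nested Gaussian averages over a finite index set\<close>

definition softmax :: "'i set \<Rightarrow> real \<Rightarrow> ('i \<Rightarrow> real) \<Rightarrow> real" where
  "softmax I lam h = ln (\<Sum>i\<in>I. exp (lam * h i)) / lam"

text \<open>A level \<open>(c, v, b)\<close> adds a centered Gaussian with covariance \<open>v i * v j\<close>, scaled by
  \<open>sin \<theta>\<close> if \<open>b\<close> and by \<open>cos \<theta>\<close> otherwise, and averages it with exponent \<open>c\<close>.\<close>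

fun nested :: "'i set \<Rightarrow> real \<Rightarrow> (real \<times> ('i \<Rightarrow> real) \<times> bool) list \<Rightarrow> real \<Rightarrow> ('i \<Rightarrow> real) \<Rightarrow> real" where
  "nested I lam [] \<theta> h = softmax I lam h"
| "nested I lam ((c, v, b) # S) \<theta> h =
     ln (\<integral>g. exp (c * nested I lam S \<theta> (\<lambda>k. h k + g * (amp b \<theta> * v k))) \<partial>gauss) / c"

text \<open>\<open>D\<close> accumulates the covariances of the \<open>sin\<close> levels minus those of the \<open>cos\<close> levels, and \<open>cl\<close> is
  the exponent of the preceding level.\<close>

fun comparable :: "'i set \<Rightarrow> real \<Rightarrow> real \<Rightarrow> real \<Rightarrow> ('i \<Rightarrow> 'i \<Rightarrow> real) \<Rightarrow> (real \<times> ('i \<Rightarrow> real) \<times> bool) list \<Rightarrow> bool" where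
  "comparable I lam E cl D [] \<longleftrightarrow> (\<forall>p. (\<forall>i\<in>I. 0 \<le> p i) \<and> (\<Sum>i\<in>I. p i) = 1 \<longrightarrow>
     lam * ((\<Sum>i\<in>I. p i * D i i) - (\<Sum>i\<in>I. \<Sum>j\<in>I. p i * p j * D i j)) + cl * (\<Sum>i\<in>I. \<Sum>j\<in>I. p i * p j * D i j) \<le> E)"
| "comparable I lam E cl D ((c, v, b) # S) \<longleftrightarrow> 0 < c \<and> cl \<le> c \<and> (cl = c \<or> (\<forall>i\<in>I. \<forall>j\<in>I. 0 \<le> D i j)) \<and>
     comparable I lam E c (\<lambda>i j. D i j + (if b then 1 else -1) * (v i * v j)) S"

lemma comparable_pos: "comparable I lam E cl D S \<Longrightarrow> \<forall>x\<in>set S. 0 < fst x"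
proof (induction S arbitrary: cl D)
  case (Cons x S)
  obtain c v b where x: "x = (c, v, b)" by (cases x)
  from Cons.prems have c: "0 < c" and "comparable I lam E c (\<lambda>i j. D i j + (if b then 1 else -1) * (v i * v j)) S" by (simp_all add: x)
  from Cons.IH[OF this(2)] c show ?case by (simp add: x)
qed simp

context
  fixes I :: "'i set" and lam :: real
  assumes fin: "finite I" and ne: "I \<noteq> {}" and lam: "lam > 0"
begin

lemma guerra_regular_softmax:
  defines "w \<equiv> \<lambda>i (\<theta>::real) h. exp (lam * h i) / (\<Sum>i\<in>I. exp (lam * h i))"
  defines "W \<equiv> \<lambda>i j \<theta> h. lam * ((if i = j then w i \<theta> h else 0) - w i \<theta> h * w j \<theta> h)"
  shows "guerra_regular I (nested I lam []) w W (\<lambda>_ _. 0) (2 * lam)"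
proof -
  have Z: "(\<Sum>i\<in>I. exp (lam * h i)) > 0" for h :: "'i \<Rightarrow> real" using fin ne by (intro sum_pos) auto
  have wnn: "0 \<le> w i \<theta> h" for i \<theta> h unfolding w_def using Z[of h] by simp
  have wsum: "(\<Sum>i\<in>I. w i \<theta> h) = 1" for \<theta> h
    unfolding w_def sum_divide_distrib[symmetric] using Z[of h] by simp
  have wle: "w i \<theta> h \<le> 1" if "i \<in> I" for i \<theta> h
    using member_le_sum[of i I "\<lambda>i. w i \<theta> h"] that wnn wsum fin by simp
  show ?thesis
    unfolding guerra_regular_def
  proof (intro conjI allI impI ballI)
    fix p p' :: "real \<Rightarrow> real" and H :: "real \<Rightarrow> 'i \<Rightarrow> real" and H' :: "'i \<Rightarrow> real \<Rightarrow> real" and s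
    assume H: "\<forall>i. C1 (\<lambda>s. H s i) (H' i)"
    have "((\<lambda>s. \<Sum>i\<in>I. exp (lam * H s i)) has_real_derivative (\<Sum>i\<in>I. exp (lam * H s i) * (lam * H' i s))) (at s)"
      by (intro DERIV_sum) (use H in \<open>auto simp: C1_def intro!: derivative_eq_intros\<close>)
    from DERIV_cdivide[OF DERIV_chain2[OF DERIV_ln_divide[OF Z] this], of lam]
    have "((\<lambda>s. softmax I lam (H s)) has_real_derivative 1 / (\<Sum>i\<in>I. exp (lam * H s i)) * (\<Sum>i\<in>I. exp (lam * H s i) * (lam * H' i s)) / lam) (at s)"
      unfolding softmax_def .
    moreover have "1 / (\<Sum>i\<in>I. exp (lam * H s i)) * (\<Sum>i\<in>I. exp (lam * H s i) * (lam * H' i s)) / lam = (\<Sum>i\<in>I. w i (p s) (H s) * H' i s)"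
      unfolding w_def sum_distrib_left sum_divide_distrib by (intro sum.cong refl) (use lam in simp)
    ultimately show "((\<lambda>s. nested I lam [] (p s) (H s)) has_real_derivative 0 * p' s + (\<Sum>i\<in>I. w i (p s) (H s) * H' i s)) (at s)"
      by simp
  next
    fix \<theta> :: real and h v :: "'i \<Rightarrow> real" and s :: real and i assume i: "i \<in> I"
    let ?h = "\<lambda>s k. h k + s * v k"
    let ?Z = "\<lambda>s. \<Sum>i\<in>I. exp (lam * ?h s i)"
    have dZ: "(?Z has_real_derivative (\<Sum>i\<in>I. exp (lam * ?h s i) * (lam * v i))) (at s)"
      by (intro DERIV_sum) (auto intro!: derivative_eq_intros)
    have "((\<lambda>s. exp (lam * ?h s i)) has_real_derivative exp (lam * ?h s i) * (lam * v i)) (at s)"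
      by (auto intro!: derivative_eq_intros)
    from DERIV_divide[OF this dZ] Z[of "?h s"]
    have "((\<lambda>s. w i \<theta> (?h s)) has_real_derivative
       (exp (lam * ?h s i) * (lam * v i) * ?Z s - exp (lam * ?h s i) * (\<Sum>i\<in>I. exp (lam * ?h s i) * (lam * v i))) / (?Z s * ?Z s)) (at s)"
      unfolding w_def by (simp add: less_imp_neq[symmetric])
    moreover have "(exp (lam * ?h s i) * (lam * v i) * ?Z s - exp (lam * ?h s i) * (\<Sum>i\<in>I. exp (lam * ?h s i) * (lam * v i))) / (?Z s * ?Z s)
      = (\<Sum>j\<in>I. W i j \<theta> (?h s) * v j)"
    proof -
      have "(\<Sum>j\<in>I. W i j \<theta> (?h s) * v j) = (\<Sum>j\<in>I. lam * (if i = j then w i \<theta> (?h s) * v j else 0)) - (\<Sum>j\<in>I. lam * (w i \<theta> (?h s) * w j \<theta> (?h s) * v j))"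
        unfolding W_def sum_subtractf[symmetric] by (intro sum.cong refl) (simp add: algebra_simps)
      also have "(\<Sum>j\<in>I. lam * (if i = j then w i \<theta> (?h s) * v j else 0)) = lam * (w i \<theta> (?h s) * v i)"
        unfolding sum_distrib_left[symmetric] using i fin by simp
      also have "(\<Sum>j\<in>I. lam * (w i \<theta> (?h s) * w j \<theta> (?h s) * v j)) = exp (lam * ?h s i) * (\<Sum>i\<in>I. exp (lam * ?h s i) * (lam * v i)) / (?Z s * ?Z s)"
      proof -
        have "(\<Sum>j\<in>I. lam * (w i \<theta> (?h s) * w j \<theta> (?h s) * v j)) = (\<Sum>j\<in>I. exp (lam * ?h s i) * (exp (lam * ?h s j) * (lam * v j)) / (?Z s * ?Z s))"
          unfolding w_def by (intro sum.cong refl) (simp add: mult_ac)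
        then show ?thesis by (simp only: sum_divide_distrib[symmetric] sum_distrib_left[symmetric])
      qed
      finally show ?thesis using Z[of "?h s"] unfolding w_def by (simp add: diff_divide_distrib)
    qed
    ultimately show "((\<lambda>s. w i \<theta> (?h s)) has_real_derivative (\<Sum>j\<in>I. W i j \<theta> (?h s) * v j)) (at s)" by simp
  next
    fix \<theta> h i j assume ij: "i \<in> I" "j \<in> I"
    have "0 \<le> w i \<theta> h * w j \<theta> h" "w i \<theta> h * w j \<theta> h \<le> 1 * 1"
      using wnn wle[OF ij(1)] wle[OF ij(2)] by (intro mult_nonneg_nonneg mult_mono; auto)+
    moreover have "0 \<le> (if i = j then w i \<theta> h else 0)" "(if i = j then w i \<theta> h else 0) \<le> 1"
      using wnn[of i \<theta> h] wle[OF ij(1), of \<theta> h] by auto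
    ultimately have "\<bar>(if i = j then w i \<theta> h else 0) - w i \<theta> h * w j \<theta> h\<bar> \<le> 2" by linarith
    then show "\<bar>W i j \<theta> h\<bar> \<le> 2 * lam" unfolding W_def using lam by (simp add: abs_mult)
  qed (use wnn wsum lam in auto)
qed

text \<open>Regularity and the differential inequality concern the same \<open>w\<close>,
  \<open>W\<close> and \<open>Y\<close>, so one induction carries both. The inequality is quantified
  over \<open>cl\<close> and \<open>D\<close> because each level hands modified values to the rest
  of the list.\<close>

lemma guerra_regular_nested:
  assumes "\<forall>x\<in>set S. 0 < fst x"
  shows "\<exists>w W Y B. guerra_regular I (nested I lam S) w W Y B \<and>
    (\<forall>cl D E \<theta> h. comparable I lam E cl D S \<longrightarrow> 0 \<le> sin \<theta> * cos \<theta> \<longrightarrow>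
      Y \<theta> h + (sin \<theta> * cos \<theta>) * (\<Sum>i\<in>I. \<Sum>j\<in>I. (W i j \<theta> h + cl * (w i \<theta> h * w j \<theta> h)) * D i j) \<le> (sin \<theta> * cos \<theta>) * E)"
  using assms
proof (induction S)
  case Nil
  define w where "w \<equiv> \<lambda>i (\<theta>::real) h. exp (lam * h i) / (\<Sum>i\<in>I. exp (lam * h i))"
  define W where "W \<equiv> \<lambda>i j \<theta> h. lam * ((if i = j then w i \<theta> h else 0) - w i \<theta> h * w j \<theta> h)"
  have reg: "guerra_regular I (nested I lam []) w W (\<lambda>_ _. 0) (2 * lam)"
    unfolding w_def W_def by (rule guerra_regular_softmax)
  have "0 + (sin \<theta> * cos \<theta>) * (\<Sum>i\<in>I. \<Sum>j\<in>I. (W i j \<theta> h + cl * (w i \<theta> h * w j \<theta> h)) * D i j) \<le> (sin \<theta> * cos \<theta>) * E"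
    if g: "comparable I lam E cl D []" and k: "0 \<le> sin \<theta> * cos \<theta>" for cl D E \<theta> h
  proof -
    \<comment> \<open>The Hessian of the softmax is \<open>lam\<close> times a covariance, which
      produces the expression in the first clause of \<open>comparable\<close>.\<close>
    have "(\<Sum>i\<in>I. \<Sum>j\<in>I. (W i j \<theta> h + cl * (w i \<theta> h * w j \<theta> h)) * D i j)
      = (\<Sum>i\<in>I. \<Sum>j\<in>I. lam * (if i = j then w i \<theta> h * D i j else 0)) - lam * (\<Sum>i\<in>I. \<Sum>j\<in>I. w i \<theta> h * w j \<theta> h * D i j)
        + cl * (\<Sum>i\<in>I. \<Sum>j\<in>I. w i \<theta> h * w j \<theta> h * D i j)"
      unfolding W_def sum_distrib_left sum_subtractf[symmetric] sum.distrib[symmetric] by (intro sum.cong refl) (simp add: algebra_simps)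
    also have "(\<Sum>i\<in>I. \<Sum>j\<in>I. lam * (if i = j then w i \<theta> h * D i j else 0)) = lam * (\<Sum>i\<in>I. w i \<theta> h * D i i)"
      unfolding sum_distrib_left[symmetric] using fin by simp
    finally have eq: "(\<Sum>i\<in>I. \<Sum>j\<in>I. (W i j \<theta> h + cl * (w i \<theta> h * w j \<theta> h)) * D i j)
      = lam * ((\<Sum>i\<in>I. w i \<theta> h * D i i) - (\<Sum>i\<in>I. \<Sum>j\<in>I. w i \<theta> h * w j \<theta> h * D i j)) + cl * (\<Sum>i\<in>I. \<Sum>j\<in>I. w i \<theta> h * w j \<theta> h * D i j)"
      by (simp add: algebra_simps)
    have "(\<forall>i\<in>I. 0 \<le> w i \<theta> h) \<and> (\<Sum>i\<in>I. w i \<theta> h) = 1" using reg unfolding guerra_regular_def by blast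
    then have "(\<Sum>i\<in>I. \<Sum>j\<in>I. (W i j \<theta> h + cl * (w i \<theta> h * w j \<theta> h)) * D i j) \<le> E"
      unfolding eq using g[unfolded comparable.simps, rule_format, of "\<lambda>i. w i \<theta> h"] by simp
    then show ?thesis using mult_left_mono[OF _ k] by simp
  qed
  with reg show ?case by blast
next
  case (Cons x S)
  obtain c v b where x: "x = (c, v, b)" by (cases x)
  have c: "0 < c" using Cons.prems x by simp
  have pos: "\<forall>x\<in>set S. 0 < fst x" using Cons.prems by simp
  from Cons.IH[OF pos] obtain w W Y B where reg: "guerra_regular I (nested I lam S) w W Y B" and
    bnd0: "\<forall>cl D E \<theta> h. comparable I lam E cl D S \<longrightarrow> 0 \<le> sin \<theta> * cos \<theta> \<longrightarrow>
      Y \<theta> h + (sin \<theta> * cos \<theta>) * (\<Sum>i\<in>I. \<Sum>j\<in>I. (W i j \<theta> h + cl * (w i \<theta> h * w j \<theta> h)) * D i j) \<le> (sin \<theta> * cos \<theta>) * E"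
    by (elim exE conjE)
  note bnd = bnd0[rule_format]
  interpret guerra_step I "nested I lam S" w W Y B c v b using fin reg c by unfold_locales
  have X': "X' = nested I lam (x # S)" by (simp add: x X'_def N_def L_def fun_eq_iff)
  obtain B' where "guerra_regular I (nested I lam (x # S)) w' W' Y' B'" using guerra_regular_step unfolding X' by blast
  moreover have "Y' \<theta> h + (sin \<theta> * cos \<theta>) * (\<Sum>i\<in>I. \<Sum>j\<in>I. (W' i j \<theta> h + cl * (w' i \<theta> h * w' j \<theta> h)) * D i j) \<le> (sin \<theta> * cos \<theta>) * E"
    if g: "comparable I lam E cl D (x # S)" and k: "0 \<le> sin \<theta> * cos \<theta>" for cl D E \<theta> h
  proof (rule guerra_bound_step[OF k])
    show "cl \<le> c" "cl = c \<or> (\<forall>i\<in>I. \<forall>j\<in>I. 0 \<le> D i j)" using g by (auto simp: x)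
    have "comparable I lam E c (\<lambda>i j. D i j + (if b then 1 else -1) * (v i * v j)) S" using g by (simp add: x)
    from bnd[OF this k]
    show "Y \<theta> h + (sin \<theta> * cos \<theta>) * (\<Sum>i\<in>I. \<Sum>j\<in>I. (W i j \<theta> h + c * (w i \<theta> h * w j \<theta> h)) * (D i j + (if b then 1 else -1) * (v i * v j))) \<le> (sin \<theta> * cos \<theta>) * E" for h .
  qed
  ultimately show ?case by blast
qed

text \<open>With \<open>D = 0\<close> at the start the angle derivative is at most
  \<open>E * (sin \<theta> * cos \<theta>)\<close>, whose integral over the quarter circle is
  \<open>E / 2\<close>.\<close>

theorem guerra_comparison:
  assumes g: "comparable I lam E c0 (\<lambda>_ _. 0) S"
  shows "nested I lam S (pi / 2) h \<le> nested I lam S 0 h + E / 2"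
proof -
  from guerra_regular_nested[of S, OF comparable_pos[OF g]]
  obtain w W Y B where reg: "guerra_regular I (nested I lam S) w W Y B" and
    bnd0: "\<forall>cl D E \<theta> h. comparable I lam E cl D S \<longrightarrow> 0 \<le> sin \<theta> * cos \<theta> \<longrightarrow>
      Y \<theta> h + (sin \<theta> * cos \<theta>) * (\<Sum>i\<in>I. \<Sum>j\<in>I. (W i j \<theta> h + cl * (w i \<theta> h * w j \<theta> h)) * D i j) \<le> (sin \<theta> * cos \<theta>) * E"
    by (elim exE conjE)
  note bnd = bnd0[rule_format]
  have der: "((\<lambda>\<theta>. nested I lam S \<theta> h) has_real_derivative Y \<theta> h) (at \<theta>)" for \<theta>
    using reg[unfolded guerra_regular_def, THEN conjunct1, rule_format, of "\<lambda>s. s" "\<lambda>s. 1" "\<lambda>_. h" "\<lambda>_ _. 0" \<theta>, OF C1_id C1_const] by simp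
  have "nested I lam S (pi / 2) h - E / 2 * (sin (pi / 2))\<^sup>2 \<le> nested I lam S 0 h - E / 2 * (sin 0)\<^sup>2"
  proof (rule DERIV_nonpos_imp_nonincreasing[where f="\<lambda>\<theta>. nested I lam S \<theta> h - E / 2 * (sin \<theta>)\<^sup>2"])
    fix \<theta> :: real assume t: "0 \<le> \<theta>" "\<theta> \<le> pi / 2"
    have "0 \<le> sin \<theta>" using t by (intro sin_ge_zero) auto
    moreover have "0 \<le> cos \<theta>" using t by (intro cos_ge_zero) auto
    ultimately have "0 \<le> sin \<theta> * cos \<theta>" by simp
    from bnd[OF g this, of h] have "Y \<theta> h - E * (sin \<theta> * cos \<theta>) \<le> 0" by (simp add: mult.commute)
    moreover have "((\<lambda>\<theta>. nested I lam S \<theta> h - E / 2 * (sin \<theta>)\<^sup>2) has_real_derivative Y \<theta> h - E * (sin \<theta> * cos \<theta>)) (at \<theta>)"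
      by (auto intro!: derivative_eq_intros der)
    ultimately show "\<exists>y. ((\<lambda>\<theta>. nested I lam S \<theta> h - E / 2 * (sin \<theta>)\<^sup>2) has_real_derivative y) (at \<theta>) \<and> y \<le> 0" by blast
  qed simp
  then show ?thesis by simp
qed

lemma nested_integrable:
  assumes "\<forall>x\<in>set S. 0 < fst x" and c: "0 < c"
  shows "integrable gauss (\<lambda>g. exp (c * nested I lam S \<theta> (\<lambda>k. h k + g * (amp b \<theta> * v k))))"
    and "0 < (\<integral>g. exp (c * nested I lam S \<theta> (\<lambda>k. h k + g * (amp b \<theta> * v k))) \<partial>gauss)"
proof -
  from guerra_regular_nested[of S, OF assms(1)]
  obtain w W Y B where reg: "guerra_regular I (nested I lam S) w W Y B" by (elim exE conjE)
  interpret guerra_step I "nested I lam S" w W Y B c v b using fin reg c by unfold_locales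
  show "integrable gauss (\<lambda>g. exp (c * nested I lam S \<theta> (\<lambda>k. h k + g * (amp b \<theta> * v k))))"
    using N_integrable[OF adm_const[of 1], of \<theta> h] by (simp add: L_def)
  show "0 < (\<integral>g. exp (c * nested I lam S \<theta> (\<lambda>k. h k + g * (amp b \<theta> * v k))) \<partial>gauss)"
    using Z_pos[of \<theta> h] by (simp add: N_def L_def)
qed

lemma nested_sin_0: "0 < c \<Longrightarrow> nested I lam ((c, v, True) # S) 0 h = nested I lam S 0 h"
  by (simp add: amp_def del: lebesgue_integral_const)

lemma nested_cos_pi_half: "0 < c \<Longrightarrow> nested I lam ((c, v, False) # S) (pi / 2) h = nested I lam S (pi / 2) h"
  by (simp add: amp_def del: lebesgue_integral_const)

lemma nested_cos_0_le:
  assumes "\<forall>x\<in>set S. 0 < fst x" and c: "0 < c"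
    and le: "\<And>g. nested I lam S 0 (\<lambda>k. h k + g * v k) \<le> \<phi> g" and int: "integrable gauss (\<lambda>g. exp (c * \<phi> g))"
  shows "nested I lam ((c, v, False) # S) 0 h \<le> ln (\<integral>g. exp (c * \<phi> g) \<partial>gauss) / c"
proof -
  note n = nested_integrable[OF assms(1) c, where \<theta>=0 and h=h and b=False and v=v, simplified amp_def, simplified]
  have "(\<integral>g. exp (c * nested I lam S 0 (\<lambda>k. h k + g * v k)) \<partial>gauss) \<le> (\<integral>g. exp (c * \<phi> g) \<partial>gauss)"
    by (rule integral_mono[OF n(1) int]) (use le c in auto)
  then show ?thesis using n(2) c by (simp add: amp_def divide_right_mono)
qed

lemma nested_shift:
  assumes "\<forall>x\<in>set S. 0 < fst x"
  shows "nested I lam S \<theta> (\<lambda>i. h i + s) = nested I lam S \<theta> h + s"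
  using assms
proof (induction S arbitrary: h)
  case Nil
  have Z: "(\<Sum>i\<in>I. exp (lam * h i)) > 0" using fin ne by (intro sum_pos) auto
  have "(\<Sum>i\<in>I. exp (lam * (h i + s))) = exp (lam * s) * (\<Sum>i\<in>I. exp (lam * h i))"
    unfolding sum_distrib_left by (intro sum.cong refl) (simp add: distrib_left exp_add)
  then show ?case using Z lam by (simp add: softmax_def ln_mult add_divide_distrib)
next
  case (Cons x S)
  obtain c v b where x: "x = (c, v, b)" by (cases x)
  have c: "0 < c" using Cons.prems x by simp
  have pos: "\<forall>x\<in>set S. 0 < fst x" using Cons.prems by simp
  let ?N = "\<lambda>g. nested I lam S \<theta> (\<lambda>k. h k + g * (amp b \<theta> * v k))"
  have "nested I lam S \<theta> (\<lambda>k. h k + s + g * (amp b \<theta> * v k)) = ?N g + s" for g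
    using Cons.IH[OF pos, of "\<lambda>k. h k + g * (amp b \<theta> * v k)"] by (simp add: add_ac)
  then have "(\<integral>g. exp (c * nested I lam S \<theta> (\<lambda>k. h k + s + g * (amp b \<theta> * v k))) \<partial>gauss) = exp (c * s) * (\<integral>g. exp (c * ?N g) \<partial>gauss)"
    by (simp add: distrib_left exp_add mult.commute)
  then show ?case using nested_integrable(2)[OF pos c, where \<theta>=\<theta> and h=h and b=b and v=v] c by (simp add: x ln_mult add_divide_distrib)
qed

text \<open>A Gaussian common to all indices only shifts the inner value, so its exponential mean is
  explicit. This is how the scalar Gaussians turn into a deterministic constant.\<close>

lemma nested_const_pi_half:
  assumes "\<forall>x\<in>set S. 0 < fst x" and c: "0 < c"
  shows "nested I lam ((c, \<lambda>_. y, True) # S) (pi / 2) h = nested I lam S (pi / 2) h + c * y\<^sup>2 / 2"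
proof -
  have "nested I lam S (pi / 2) (\<lambda>k. h k + g * (amp True (pi / 2) * y)) = nested I lam S (pi / 2) h + g * y" for g
    using nested_shift[OF assms(1), where \<theta>="pi / 2" and h=h and s="g * y"] by (simp add: amp_def)
  then have "(\<integral>g. exp (c * nested I lam S (pi / 2) (\<lambda>k. h k + g * (amp True (pi / 2) * y))) \<partial>gauss)
     = (\<integral>g. exp (c * nested I lam S (pi / 2) h) * exp ((c * y) * g) \<partial>gauss)"
    by (simp add: distrib_left exp_add mult_ac)
  also have "\<dots> = exp (c * nested I lam S (pi / 2) h + (c * y)\<^sup>2 / 2)" by (simp add: integral_gauss_exp exp_add)
  finally show ?thesis using c by (simp add: add_divide_distrib power2_eq_square)
qed

end

definition levels :: "real \<Rightarrow> (('i \<Rightarrow> real) \<times> bool) list \<Rightarrow> (real \<times> ('i \<Rightarrow> real) \<times> bool) list" where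
  "levels c vs = map (\<lambda>(v, b). (c, v, b)) vs"

text \<open>After the first level of a group the exponent no longer changes, so the sign of
  \<open>D\<close> matters only on entry, and the partial sums inside the group may be
  negative.\<close>

lemma comparable_levels:
  assumes "comparable I lam E c (\<lambda>i j. D i j + (\<Sum>(v, b)\<leftarrow>vs. (if b then 1 else -1) * (v i * v j))) S"
    "vs \<noteq> []" "0 < c" "cl \<le> c" "cl = c \<or> (\<forall>i\<in>I. \<forall>j\<in>I. 0 \<le> D i j)"
  shows "comparable I lam E cl D (levels c vs @ S)"
  using assms
proof (induction vs arbitrary: cl D)
  case (Cons x vs)
  obtain v b where x: "x = (v, b)" by (cases x)
  show ?case
  proof (cases "vs = []")
    case True
    then show ?thesis using Cons.prems by (simp add: levels_def x)
  next
    case False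
    have "comparable I lam E c (\<lambda>i j. D i j + (if b then 1 else -1) * (v i * v j)) (levels c vs @ S)"
      by (rule Cons.IH) (use Cons.prems False in \<open>simp_all add: x add.assoc\<close>)
    then show ?thesis using Cons.prems by (simp add: levels_def x)
  qed
qed simp

lemma levels_pos: "0 < c \<Longrightarrow> \<forall>x\<in>set S. 0 < fst x \<Longrightarrow> \<forall>x\<in>set (levels c vs @ S). 0 < fst x"
  by (auto simp: levels_def)

subsection \<open>Finite-dimensional Gaussian laws\<close>

text \<open>Levy's uniqueness theorem in one dimension, with weights. The weights will carry the
  events already fixed for other coordinates.\<close>

lemma weighted_char_uniqueness:
  fixes X :: "'a \<Rightarrow> real" and X' :: "'b \<Rightarrow> real"
  assumes "prob_space M" "prob_space M'"
    and [measurable]: "X \<in> borel_measurable M" "X' \<in> borel_measurable M'" "w \<in> borel_measurable M" "w' \<in> borel_measurable M'"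
    and w: "\<And>a. 0 \<le> w a" "\<And>a. w a \<le> C" "\<And>a. 0 \<le> w' a" "\<And>a. w' a \<le> C"
    and cos: "\<And>t. (\<integral>a. w a * cos (t * X a) \<partial>M) = (\<integral>a. w' a * cos (t * X' a) \<partial>M')"
    and sin: "\<And>t. (\<integral>a. w a * sin (t * X a) \<partial>M) = (\<integral>a. w' a * sin (t * X' a) \<partial>M')"
    and [measurable]: "A \<in> sets borel"
  shows "(\<integral>a. w a * indicator A (X a) \<partial>M) = (\<integral>a. w' a * indicator A (X' a) \<partial>M')"
proof -
  interpret M: prob_space M by fact
  interpret M': prob_space M' by fact
  have int: "integrable M (\<lambda>a. w a * f a)" if "f \<in> borel_measurable M" "\<And>a. \<bar>f a\<bar> \<le> 1" for f
  proof (rule M.integrable_const_bound[where B=C])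
    show "(\<lambda>a. w a * f a) \<in> borel_measurable M" using that by simp
    have "w a * \<bar>f a\<bar> \<le> C * 1" for a using w(1,2)[of a] that(2)[of a] by (intro mult_mono) auto
    then show "AE a in M. norm (w a * f a) \<le> C" using w(1) by (simp add: abs_mult)
  qed
  have int': "integrable M' (\<lambda>a. w' a * f a)" if "f \<in> borel_measurable M'" "\<And>a. \<bar>f a\<bar> \<le> 1" for f
  proof (rule M'.integrable_const_bound[where B=C])
    show "(\<lambda>a. w' a * f a) \<in> borel_measurable M'" using that by simp
    have "w' a * \<bar>f a\<bar> \<le> C * 1" for a using w(3,4)[of a] that(2)[of a] by (intro mult_mono) auto
    then show "AE a in M'. norm (w' a * f a) \<le> C" using w(3) by (simp add: abs_mult)
  qed
  define m where "m = (\<integral>a. w a \<partial>M)"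
  have m': "m = (\<integral>a. w' a \<partial>M')" using cos[of 0] by (simp add: m_def)
  have m0: "m \<ge> 0" unfolding m_def using w by (intro Bochner_Integration.integral_nonneg) auto
  show ?thesis
  \<comment> \<open>The weights are to be normalised to probability laws. If their total mass
    vanishes, both sides are 0.\<close>
  proof (cases "m = 0")
    case True
    have "(\<integral>a. w a * indicator A (X a) \<partial>M) \<le> m" unfolding m_def
      by (rule integral_mono) (use int[of "\<lambda>a. indicator A (X a)"] int[of "\<lambda>_. 1"] w in \<open>auto simp: indicator_def\<close>)
    moreover have "(\<integral>a. w' a * indicator A (X' a) \<partial>M') \<le> m" unfolding m'
      by (rule integral_mono) (use int'[of "\<lambda>a. indicator A (X' a)"] int'[of "\<lambda>_. 1"] w in \<open>auto simp: indicator_def\<close>)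
    moreover have "0 \<le> (\<integral>a. w a * indicator A (X a) \<partial>M)" "0 \<le> (\<integral>a. w' a * indicator A (X' a) \<partial>M')"
      using w by (auto intro!: Bochner_Integration.integral_nonneg)
    ultimately show ?thesis using True by simp
  next
    case False
    then have mpos: "m > 0" using m0 by simp
    define \<mu> where "\<mu> = distr (density M (\<lambda>a. ennreal (w a / m))) borel X"
    define \<mu>' where "\<mu>' = distr (density M' (\<lambda>a. ennreal (w' a / m))) borel X'"
    have I: "(\<integral>x. f x \<partial>\<mu>) = (\<integral>a. w a * f (X a) \<partial>M) / m" if [measurable]: "f \<in> borel_measurable borel" for f :: "real \<Rightarrow> real"
      unfolding \<mu>_def by (subst integral_distr, simp, simp, subst integral_density) (use w mpos in auto)
    have I': "(\<integral>x. f x \<partial>\<mu>') = (\<integral>a. w' a * f (X' a) \<partial>M') / m" if [measurable]: "f \<in> borel_measurable borel" for f :: "real \<Rightarrow> real"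
      unfolding \<mu>'_def by (subst integral_distr, simp, simp, subst integral_density) (use w mpos in auto)
    have "emeasure (density M (\<lambda>a. ennreal (w a / m))) (space M) = 1"
    proof -
      have "emeasure (density M (\<lambda>a. ennreal (w a / m))) (space M) = (\<integral>\<^sup>+a. ennreal (w a / m) \<partial>M)"
        by (subst emeasure_density) (auto intro!: nn_integral_cong)
      also have "\<dots> = ennreal (\<integral>a. w a / m \<partial>M)"
        by (rule nn_integral_eq_integral) (use int[of "\<lambda>_. 1 / m * m"] int[of "\<lambda>_. 1"] mpos w in \<open>auto\<close>)
      also have "(\<integral>a. w a / m \<partial>M) = 1" using mpos by (simp add: m_def)
      finally show ?thesis by simp
    qed
    then have "prob_space (density M (\<lambda>a. ennreal (w a / m)))" by (intro prob_spaceI) simp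
    then have p: "prob_space \<mu>" unfolding \<mu>_def by (rule prob_space.prob_space_distr) simp
    have "emeasure (density M' (\<lambda>a. ennreal (w' a / m))) (space M') = 1"
    proof -
      have "emeasure (density M' (\<lambda>a. ennreal (w' a / m))) (space M') = (\<integral>\<^sup>+a. ennreal (w' a / m) \<partial>M')"
        by (subst emeasure_density) (auto intro!: nn_integral_cong)
      also have "\<dots> = ennreal (\<integral>a. w' a / m \<partial>M')"
        by (rule nn_integral_eq_integral) (use int'[of "\<lambda>_. 1"] mpos w in \<open>auto\<close>)
      also have "(\<integral>a. w' a / m \<partial>M') = 1" using mpos by (simp add: m')
      finally show ?thesis by simp
    qed
    then have "prob_space (density M' (\<lambda>a. ennreal (w' a / m)))" by (intro prob_spaceI) simp
    then have p': "prob_space \<mu>'" unfolding \<mu>'_def by (rule prob_space.prob_space_distr) simp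
    have rd: "real_distribution \<mu>" "real_distribution \<mu>'"
      using p p' by (auto simp: real_distribution_def real_distribution_axioms_def \<mu>_def \<mu>'_def)
    interpret R: real_distribution \<mu> by (rule rd)
    interpret R': real_distribution \<mu>' by (rule rd)
    have "char \<mu> = char \<mu>'"
    proof
      fix t
      have "Re (char \<mu> t) = Re (char \<mu>' t)" "Im (char \<mu> t) = Im (char \<mu>' t)"
        unfolding char_def by (simp_all add: R.integrable_iexp R'.integrable_iexp integral_Re[symmetric] integral_Im[symmetric] I I' cos sin Re_exp Im_exp
            del: integral_Re integral_Im)
      then show "char \<mu> t = char \<mu>' t" by (rule complex_eqI)
    qed
    then have "\<mu> = \<mu>'" by (rule Levy_uniqueness[OF rd])
    then have "(\<integral>x. indicator A x \<partial>\<mu>) = (\<integral>x. indicator A x \<partial>\<mu>' :: real)" by simp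
    then show ?thesis using I[of "indicator A"] I'[of "indicator A"] mpos by simp
  qed
qed

text \<open>Coordinates are converted one at a time from trigonometric functions to indicators. The
  indicator of coordinate \<open>k\<close> is absorbed into the weight, and the induction
  hypothesis, general in the weights, handles the rest.\<close>

lemma vector_char_uniqueness:
  fixes X :: "'i \<Rightarrow> 'a \<Rightarrow> real" and X' :: "'i \<Rightarrow> 'b \<Rightarrow> real"
  assumes "finite J" and ps: "prob_space M" "prob_space M'"
    and X: "\<And>j. j \<in> J \<Longrightarrow> X j \<in> borel_measurable M" "\<And>j. j \<in> J \<Longrightarrow> X' j \<in> borel_measurable M'"
    and "w \<in> borel_measurable M" "w' \<in> borel_measurable M'"
    and "\<And>a. 0 \<le> w a" "\<And>a. w a \<le> C" "\<And>a. 0 \<le> w' a" "\<And>a. w' a \<le> C"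
    and "\<And>u. (\<integral>a. w a * cos (\<Sum>j\<in>J. u j * X j a) \<partial>M) = (\<integral>a. w' a * cos (\<Sum>j\<in>J. u j * X' j a) \<partial>M')"
    and "\<And>u. (\<integral>a. w a * sin (\<Sum>j\<in>J. u j * X j a) \<partial>M) = (\<integral>a. w' a * sin (\<Sum>j\<in>J. u j * X' j a) \<partial>M')"
    and A: "\<And>j. j \<in> J \<Longrightarrow> A j \<in> sets borel"
  shows "(\<integral>a. w a * (\<Prod>j\<in>J. indicator (A j) (X j a)) \<partial>M) = (\<integral>a. w' a * (\<Prod>j\<in>J. indicator (A j) (X' j a)) \<partial>M')"
  using assms(1) X A assms(6-13)
proof (induction J arbitrary: w w')
  case empty
  then show ?case using empty.prems(11)[of "\<lambda>_. 0"] by simp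
next
  case (insert k J)
  interpret M: prob_space M by fact
  interpret M': prob_space M' by fact
  note [measurable] = insert.prems(4,5)
  have mX[measurable]: "X k \<in> borel_measurable M" "X' k \<in> borel_measurable M'" "A k \<in> sets borel" using insert.prems by auto
  have mJ: "\<And>j. j \<in> J \<Longrightarrow> X j \<in> borel_measurable M" "\<And>j. j \<in> J \<Longrightarrow> X' j \<in> borel_measurable M'" using insert.prems by auto
  note cs = insert.prems(10) and sn = insert.prems(11)
  note wb = insert.prems(6-9)
  define Y where "Y u a = (\<Sum>j\<in>J. u j * X j a)" for u a
  define Y' where "Y' u a = (\<Sum>j\<in>J. u j * X' j a)" for u a
  have mY[measurable]: "Y u \<in> borel_measurable M" "Y' u \<in> borel_measurable M'" for u
    unfolding Y_def[abs_def] Y'_def[abs_def] using mJ by (auto intro!: borel_measurable_sum borel_measurable_times)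
  have int: "integrable M (\<lambda>a. w a * f a)" if "f \<in> borel_measurable M" "\<And>a. \<bar>f a\<bar> \<le> 1" for f
  proof (rule M.integrable_const_bound[where B=C])
    show "(\<lambda>a. w a * f a) \<in> borel_measurable M" using that by simp
    have "w a * \<bar>f a\<bar> \<le> C * 1" for a using wb(1,2)[of a] that(2)[of a] by (intro mult_mono) auto
    then show "AE a in M. norm (w a * f a) \<le> C" using wb(1) by (simp add: abs_mult)
  qed
  have int': "integrable M' (\<lambda>a. w' a * f a)" if "f \<in> borel_measurable M'" "\<And>a. \<bar>f a\<bar> \<le> 1" for f
  proof (rule M'.integrable_const_bound[where B=C])
    show "(\<lambda>a. w' a * f a) \<in> borel_measurable M'" using that by simp
    have "w' a * \<bar>f a\<bar> \<le> C * 1" for a using wb(3,4)[of a] that(2)[of a] by (intro mult_mono) auto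
    then show "AE a in M'. norm (w' a * f a) \<le> C" using wb(3) by (simp add: abs_mult)
  qed
  have S: "(\<Sum>j\<in>insert k J. (if j = k then t else u j) * X j a) = t * X k a + Y u a"
     "(\<Sum>j\<in>insert k J. (if j = k then t else u j) * X' j b) = t * X' k b + Y' u b" for t u a b
    unfolding Y_def Y'_def using insert.hyps by (auto intro!: sum.cong)
  have c1: "(\<integral>a. w a * cos (t * X k a + Y u a) \<partial>M) = (\<integral>a. w' a * cos (t * X' k a + Y' u a) \<partial>M')"
    and s1: "(\<integral>a. w a * sin (t * X k a + Y u a) \<partial>M) = (\<integral>a. w' a * sin (t * X' k a + Y' u a) \<partial>M')" for t u
    using cs[of "\<lambda>j. if j = k then t else u j"] sn[of "\<lambda>j. if j = k then t else u j"] unfolding S by auto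
  have Ym: "Y (\<lambda>j. - u j) a = - Y u a" "Y' (\<lambda>j. - u j) b = - Y' u b" for u a b
    by (simp_all add: Y_def Y'_def sum_negf)
  \<comment> \<open>The test vectors \<open>u\<close> and \<open>- u\<close> on the remaining
    coordinates give a sum and a difference, so the addition formulas separate the products.\<close>
  have prods: "(\<integral>a. w a * (cos (t * X k a) * cos (Y u a)) \<partial>M) = (\<integral>a. w' a * (cos (t * X' k a) * cos (Y' u a)) \<partial>M')"
      "(\<integral>a. w a * (sin (t * X k a) * sin (Y u a)) \<partial>M) = (\<integral>a. w' a * (sin (t * X' k a) * sin (Y' u a)) \<partial>M')"
      "(\<integral>a. w a * (sin (t * X k a) * cos (Y u a)) \<partial>M) = (\<integral>a. w' a * (sin (t * X' k a) * cos (Y' u a)) \<partial>M')"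
      "(\<integral>a. w a * (cos (t * X k a) * sin (Y u a)) \<partial>M) = (\<integral>a. w' a * (cos (t * X' k a) * sin (Y' u a)) \<partial>M')" for t u
  proof -
    have b: "\<bar>cos x * cos y\<bar> \<le> 1" "\<bar>sin x * sin y\<bar> \<le> 1" "\<bar>sin x * cos y\<bar> \<le> 1" "\<bar>cos x * sin y\<bar> \<le> (1::real)" for x y
      unfolding abs_mult by (auto intro!: mult_le_one)
    note ii = int[of "\<lambda>a. cos (t * X k a) * cos (Y u a)"] int[of "\<lambda>a. sin (t * X k a) * sin (Y u a)"]
      int[of "\<lambda>a. sin (t * X k a) * cos (Y u a)"] int[of "\<lambda>a. cos (t * X k a) * sin (Y u a)"]
    note ii' = int'[of "\<lambda>a. cos (t * X' k a) * cos (Y' u a)"] int'[of "\<lambda>a. sin (t * X' k a) * sin (Y' u a)"]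
      int'[of "\<lambda>a. sin (t * X' k a) * cos (Y' u a)"] int'[of "\<lambda>a. cos (t * X' k a) * sin (Y' u a)"]
    have "(\<integral>a. w a * (cos (t * X k a) * cos (Y u a)) \<partial>M) - (\<integral>a. w a * (sin (t * X k a) * sin (Y u a)) \<partial>M)
      = (\<integral>a. w' a * (cos (t * X' k a) * cos (Y' u a)) \<partial>M') - (\<integral>a. w' a * (sin (t * X' k a) * sin (Y' u a)) \<partial>M')"
      using c1[of t u] ii ii' b by (simp add: cos_add right_diff_distrib)
    moreover have "(\<integral>a. w a * (cos (t * X k a) * cos (Y u a)) \<partial>M) + (\<integral>a. w a * (sin (t * X k a) * sin (Y u a)) \<partial>M)
      = (\<integral>a. w' a * (cos (t * X' k a) * cos (Y' u a)) \<partial>M') + (\<integral>a. w' a * (sin (t * X' k a) * sin (Y' u a)) \<partial>M')"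
      using c1[of t "\<lambda>j. - u j"] ii ii' b by (simp add: Ym cos_diff distrib_left)
    ultimately show "(\<integral>a. w a * (cos (t * X k a) * cos (Y u a)) \<partial>M) = (\<integral>a. w' a * (cos (t * X' k a) * cos (Y' u a)) \<partial>M')"
      "(\<integral>a. w a * (sin (t * X k a) * sin (Y u a)) \<partial>M) = (\<integral>a. w' a * (sin (t * X' k a) * sin (Y' u a)) \<partial>M')"
      by linarith+
    have "(\<integral>a. w a * (sin (t * X k a) * cos (Y u a)) \<partial>M) + (\<integral>a. w a * (cos (t * X k a) * sin (Y u a)) \<partial>M)
      = (\<integral>a. w' a * (sin (t * X' k a) * cos (Y' u a)) \<partial>M') + (\<integral>a. w' a * (cos (t * X' k a) * sin (Y' u a)) \<partial>M')"
      using s1[of t u] ii ii' b by (simp add: sin_add distrib_left)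
    moreover have "(\<integral>a. w a * (sin (t * X k a) * cos (Y u a)) \<partial>M) - (\<integral>a. w a * (cos (t * X k a) * sin (Y u a)) \<partial>M)
      = (\<integral>a. w' a * (sin (t * X' k a) * cos (Y' u a)) \<partial>M') - (\<integral>a. w' a * (cos (t * X' k a) * sin (Y' u a)) \<partial>M')"
      using s1[of t "\<lambda>j. - u j"] ii ii' b by (simp add: Ym sin_diff right_diff_distrib)
    ultimately show "(\<integral>a. w a * (sin (t * X k a) * cos (Y u a)) \<partial>M) = (\<integral>a. w' a * (sin (t * X' k a) * cos (Y' u a)) \<partial>M')"
      "(\<integral>a. w a * (cos (t * X k a) * sin (Y u a)) \<partial>M) = (\<integral>a. w' a * (cos (t * X' k a) * sin (Y' u a)) \<partial>M')"
      by linarith+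
  qed
  have cosY: "(\<integral>a. (w a * indicator (A k) (X k a)) * cos (Y u a) \<partial>M) = (\<integral>a. (w' a * indicator (A k) (X' k a)) * cos (Y' u a) \<partial>M')" for u
  proof -
    have c0: "(\<integral>a. w a * cos (t * X k a) \<partial>M) = (\<integral>a. w' a * cos (t * X' k a) \<partial>M')"
      "(\<integral>a. w a * sin (t * X k a) \<partial>M) = (\<integral>a. w' a * sin (t * X' k a) \<partial>M')" for t
      using c1[of t "\<lambda>_. 0"] s1[of t "\<lambda>_. 0"] by (simp_all add: Y_def Y'_def)
    have 0: "(\<integral>a. w a * indicator (A k) (X k a) \<partial>M) = (\<integral>a. w' a * indicator (A k) (X' k a) \<partial>M')"
      by (rule weighted_char_uniqueness[OF ps _ _ _ _ wb c0]) measurable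
    \<comment> \<open>A weight must be nonnegative, so \<open>1 + cos\<close> stands in for
      \<open>cos\<close>; the contribution of the 1 is known from fact \<open>0\<close> and is
      subtracted afterwards.\<close>
    have 1: "(\<integral>a. (w a * (1 + cos (Y u a))) * indicator (A k) (X k a) \<partial>M) = (\<integral>a. (w' a * (1 + cos (Y' u a))) * indicator (A k) (X' k a) \<partial>M')"
    proof (rule weighted_char_uniqueness[OF ps, where C="C * 2"])
      have r: "0 \<le> 1 + cos x" "1 + cos x \<le> 2" for x :: real
        using cos_ge_minus_one[of x] cos_le_one[of x] by linarith+
      show "0 \<le> w a * (1 + cos (Y u a))" "0 \<le> w' b * (1 + cos (Y' u b))" for a b
        by (intro mult_nonneg_nonneg wb r)+
      have C: "0 \<le> C" using order_trans[OF wb(1,2)] .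
      show "w a * (1 + cos (Y u a)) \<le> C * 2" "w' b * (1 + cos (Y' u b)) \<le> C * 2" for a b
        by (intro mult_mono wb r C)+
      fix t
      have b: "\<bar>cos (x::real)\<bar> \<le> 1" "\<bar>sin x\<bar> \<le> 1" "\<bar>cos y * cos x\<bar> \<le> 1" "\<bar>sin y * cos x\<bar> \<le> (1::real)" for x y
        unfolding abs_mult by (auto intro!: mult_le_one)
      show "(\<integral>a. w a * (1 + cos (Y u a)) * cos (t * X k a) \<partial>M) = (\<integral>a. w' a * (1 + cos (Y' u a)) * cos (t * X' k a) \<partial>M')"
      proof -
        have "(\<integral>a. w a * (1 + cos (Y u a)) * cos (t * X k a) \<partial>M) = (\<integral>a. w a * cos (t * X k a) + w a * (cos (t * X k a) * cos (Y u a)) \<partial>M)"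
          by (simp add: algebra_simps)
        also have "\<dots> = (\<integral>a. w' a * cos (t * X' k a) + w' a * (cos (t * X' k a) * cos (Y' u a)) \<partial>M')"
          using int[OF _ b(1)] int'[OF _ b(1)] int[OF _ b(3)] int'[OF _ b(3)] by (simp add: c0 prods)
        finally show ?thesis by (simp add: algebra_simps)
      qed
      show "(\<integral>a. w a * (1 + cos (Y u a)) * sin (t * X k a) \<partial>M) = (\<integral>a. w' a * (1 + cos (Y' u a)) * sin (t * X' k a) \<partial>M')"
      proof -
        have "(\<integral>a. w a * (1 + cos (Y u a)) * sin (t * X k a) \<partial>M) = (\<integral>a. w a * sin (t * X k a) + w a * (sin (t * X k a) * cos (Y u a)) \<partial>M)"
          by (simp add: algebra_simps)
        also have "\<dots> = (\<integral>a. w' a * sin (t * X' k a) + w' a * (sin (t * X' k a) * cos (Y' u a)) \<partial>M')"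
          using int[OF _ b(2)] int'[OF _ b(2)] int[OF _ b(4)] int'[OF _ b(4)] by (simp add: c0 prods)
        finally show ?thesis by (simp add: algebra_simps)
      qed
    qed measurable
    have b: "\<bar>indicator (A k) x :: real\<bar> \<le> 1" "\<bar>cos y * indicator (A k) x\<bar> \<le> (1::real)" for x y by (auto simp: indicator_def)
    have "(\<integral>a. w a * indicator (A k) (X k a) + w a * (cos (Y u a) * indicator (A k) (X k a)) \<partial>M)
       = (\<integral>a. w' a * indicator (A k) (X' k a) + w' a * (cos (Y' u a) * indicator (A k) (X' k a)) \<partial>M')"
      using 1 by (simp add: algebra_simps)
    then show ?thesis
      using 0 int[OF _ b(1)] int'[OF _ b(1)] int[OF _ b(2)] int'[OF _ b(2)] by (simp add: mult_ac)
  qed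
  have sinY: "(\<integral>a. (w a * indicator (A k) (X k a)) * sin (Y u a) \<partial>M) = (\<integral>a. (w' a * indicator (A k) (X' k a)) * sin (Y' u a) \<partial>M')" for u
  proof -
    have c0: "(\<integral>a. w a * cos (t * X k a) \<partial>M) = (\<integral>a. w' a * cos (t * X' k a) \<partial>M')"
      "(\<integral>a. w a * sin (t * X k a) \<partial>M) = (\<integral>a. w' a * sin (t * X' k a) \<partial>M')" for t
      using c1[of t "\<lambda>_. 0"] s1[of t "\<lambda>_. 0"] by (simp_all add: Y_def Y'_def)
    have 0: "(\<integral>a. w a * indicator (A k) (X k a) \<partial>M) = (\<integral>a. w' a * indicator (A k) (X' k a) \<partial>M')"
      by (rule weighted_char_uniqueness[OF ps _ _ _ _ wb c0]) measurable
    have 1: "(\<integral>a. (w a * (1 + sin (Y u a))) * indicator (A k) (X k a) \<partial>M) = (\<integral>a. (w' a * (1 + sin (Y' u a))) * indicator (A k) (X' k a) \<partial>M')"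
    proof (rule weighted_char_uniqueness[OF ps, where C="C * 2"])
      have r: "0 \<le> 1 + sin x" "1 + sin x \<le> 2" for x :: real
        using sin_ge_minus_one[of x] sin_le_one[of x] by linarith+
      show "0 \<le> w a * (1 + sin (Y u a))" "0 \<le> w' b * (1 + sin (Y' u b))" for a b
        by (intro mult_nonneg_nonneg wb r)+
      have C: "0 \<le> C" using order_trans[OF wb(1,2)] .
      show "w a * (1 + sin (Y u a)) \<le> C * 2" "w' b * (1 + sin (Y' u b)) \<le> C * 2" for a b
        by (intro mult_mono wb r C)+
      fix t
      have b: "\<bar>cos (x::real)\<bar> \<le> 1" "\<bar>sin x\<bar> \<le> 1" "\<bar>cos y * sin x\<bar> \<le> 1" "\<bar>sin y * sin x\<bar> \<le> (1::real)" for x y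
        unfolding abs_mult by (auto intro!: mult_le_one)
      show "(\<integral>a. w a * (1 + sin (Y u a)) * cos (t * X k a) \<partial>M) = (\<integral>a. w' a * (1 + sin (Y' u a)) * cos (t * X' k a) \<partial>M')"
      proof -
        have "(\<integral>a. w a * (1 + sin (Y u a)) * cos (t * X k a) \<partial>M) = (\<integral>a. w a * cos (t * X k a) + w a * (cos (t * X k a) * sin (Y u a)) \<partial>M)"
          by (simp add: algebra_simps)
        also have "\<dots> = (\<integral>a. w' a * cos (t * X' k a) + w' a * (cos (t * X' k a) * sin (Y' u a)) \<partial>M')"
          using int[OF _ b(1)] int'[OF _ b(1)] int[OF _ b(3)] int'[OF _ b(3)] by (simp add: c0 prods)
        finally show ?thesis by (simp add: algebra_simps)
      qed
      show "(\<integral>a. w a * (1 + sin (Y u a)) * sin (t * X k a) \<partial>M) = (\<integral>a. w' a * (1 + sin (Y' u a)) * sin (t * X' k a) \<partial>M')"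
      proof -
        have "(\<integral>a. w a * (1 + sin (Y u a)) * sin (t * X k a) \<partial>M) = (\<integral>a. w a * sin (t * X k a) + w a * (sin (t * X k a) * sin (Y u a)) \<partial>M)"
          by (simp add: algebra_simps)
        also have "\<dots> = (\<integral>a. w' a * sin (t * X' k a) + w' a * (sin (t * X' k a) * sin (Y' u a)) \<partial>M')"
          using int[OF _ b(2)] int'[OF _ b(2)] int[OF _ b(4)] int'[OF _ b(4)] by (simp add: c0 prods)
        finally show ?thesis by (simp add: algebra_simps)
      qed
    qed measurable
    have b: "\<bar>indicator (A k) x :: real\<bar> \<le> 1" "\<bar>sin y * indicator (A k) x\<bar> \<le> (1::real)" for x y by (auto simp: indicator_def)
    have "(\<integral>a. w a * indicator (A k) (X k a) + w a * (sin (Y u a) * indicator (A k) (X k a)) \<partial>M)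
       = (\<integral>a. w' a * indicator (A k) (X' k a) + w' a * (sin (Y' u a) * indicator (A k) (X' k a)) \<partial>M')"
      using 1 by (simp add: algebra_simps)
    then show ?thesis
      using 0 int[OF _ b(1)] int'[OF _ b(1)] int[OF _ b(2)] int'[OF _ b(2)] by (simp add: mult_ac)
  qed
  have "(\<integral>a. (w a * indicator (A k) (X k a)) * (\<Prod>j\<in>J. indicator (A j) (X j a)) \<partial>M)
      = (\<integral>a. (w' a * indicator (A k) (X' k a)) * (\<Prod>j\<in>J. indicator (A j) (X' j a)) \<partial>M')"
  proof (rule insert.IH)
    show "0 \<le> w a * indicator (A k) (X k a)" "0 \<le> w' b * indicator (A k) (X' k b)" for a b using wb by auto
    have C: "0 \<le> C" using order_trans[OF wb(1,2)] .
    show "w a * indicator (A k) (X k a) \<le> C" "w' b * indicator (A k) (X' k b) \<le> C" for a b using wb C by (auto simp: indicator_def)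
  qed (use mJ insert.prems cosY sinY in \<open>auto simp: Y_def Y'_def\<close>)
  then show ?case using insert.hyps by (simp add: mult.assoc)
qed

text \<open>Boxes determine a measure on a finite product, and their probabilities are the case of
  constant weight 1.\<close>

lemma vector_law_eq:
  fixes X :: "'i \<Rightarrow> 'a \<Rightarrow> real" and X' :: "'i \<Rightarrow> 'b \<Rightarrow> real"
  assumes J: "finite J" and ps: "prob_space M" "prob_space M'"
    and X: "\<And>j. j \<in> J \<Longrightarrow> X j \<in> borel_measurable M" "\<And>j. j \<in> J \<Longrightarrow> X' j \<in> borel_measurable M'"
    and c: "\<And>u. (\<integral>a. cos (\<Sum>j\<in>J. u j * X j a) \<partial>M) = (\<integral>a. cos (\<Sum>j\<in>J. u j * X' j a) \<partial>M')"
    and s: "\<And>u. (\<integral>a. sin (\<Sum>j\<in>J. u j * X j a) \<partial>M) = (\<integral>a. sin (\<Sum>j\<in>J. u j * X' j a) \<partial>M')"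
  shows "distr M (Pi\<^sub>M J (\<lambda>_. borel)) (\<lambda>a. \<lambda>j\<in>J. X j a) = distr M' (Pi\<^sub>M J (\<lambda>_. borel)) (\<lambda>a. \<lambda>j\<in>J. X' j a)" (is "?P = ?Q")
proof -
  interpret M: prob_space M by fact
  interpret M': prob_space M' by fact
  have mX: "(\<lambda>a. \<lambda>j\<in>J. X j a) \<in> measurable M (Pi\<^sub>M J (\<lambda>_. borel))" "(\<lambda>a. \<lambda>j\<in>J. X' j a) \<in> measurable M' (Pi\<^sub>M J (\<lambda>_. borel))"
    using X by (auto intro!: measurable_restrict)
  show ?thesis
  proof (rule measure_eqI_PiM_finite[OF J])
    fix A :: "'i \<Rightarrow> real set" assume A: "\<And>i. i \<in> J \<Longrightarrow> A i \<in> sets borel"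
    have int: "(\<integral>a. 1 * (\<Prod>j\<in>J. indicator (A j) (X j a)) \<partial>M) = (\<integral>a. 1 * (\<Prod>j\<in>J. indicator (A j) (X' j a)) \<partial>M' :: real)"
      by (rule vector_char_uniqueness[OF J ps X, where C=1]) (use c s A in auto)
    have *: "(\<Prod>j\<in>J. indicator (A j) (f j) :: real) = indicator (Pi\<^sub>E J A) (\<lambda>j\<in>J. f j)" for f
      using J by (auto simp: indicator_def PiE_iff prod_zero_iff extensional_def)
    have PA: "Pi\<^sub>E J A \<in> sets (Pi\<^sub>M J (\<lambda>_. borel))" using A J by (intro sets_PiM_I_finite) auto
    have sp: "emeasure ?P (Pi\<^sub>E J A) = ennreal (\<integral>a. indicator (Pi\<^sub>E J A) (\<lambda>j\<in>J. X j a) \<partial>M)"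
    proof -
      interpret P: prob_space ?P by (rule M.prob_space_distr[OF mX(1)])
      have "(\<integral>a. indicator (Pi\<^sub>E J A) (\<lambda>j\<in>J. X j a) \<partial>M) = (\<integral>x. indicator (Pi\<^sub>E J A) x \<partial>?P :: real)"
        by (rule integral_distr[OF mX(1) borel_measurable_indicator[OF PA], symmetric])
      then show ?thesis using PA by (simp add: P.emeasure_eq_measure)
    qed
    have sp': "emeasure ?Q (Pi\<^sub>E J A) = ennreal (\<integral>a. indicator (Pi\<^sub>E J A) (\<lambda>j\<in>J. X' j a) \<partial>M')"
    proof -
      interpret Q: prob_space ?Q by (rule M'.prob_space_distr[OF mX(2)])
      have "(\<integral>a. indicator (Pi\<^sub>E J A) (\<lambda>j\<in>J. X' j a) \<partial>M') = (\<integral>x. indicator (Pi\<^sub>E J A) x \<partial>?Q :: real)"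
        by (rule integral_distr[OF mX(2) borel_measurable_indicator[OF PA], symmetric])
      then show ?thesis using PA by (simp add: Q.emeasure_eq_measure)
    qed
    show "emeasure ?P (Pi\<^sub>E J A) = emeasure ?Q (Pi\<^sub>E J A)" unfolding sp sp' using int by (simp add: *)
  next
    show "range (\<lambda>n::nat. space (Pi\<^sub>M J (\<lambda>_. borel :: real measure))) \<subseteq> prod_algebra J (\<lambda>_. borel)"
      using J by (auto simp: space_PiM intro!: prod_algebraI_finite)
    show "emeasure ?P (space (Pi\<^sub>M J (\<lambda>_. borel))) \<noteq> \<infinity>"
    proof -
      interpret P: prob_space ?P by (rule M.prob_space_distr[OF mX(1)])
      show ?thesis using P.emeasure_space_1 by simp
    qed
  qed auto
qed

section \<open>Centered Gaussian families and their covariances\<close>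

lemma gauss_cos: "(\<integral>g. cos (t * g) \<partial>gauss) = exp (- t\<^sup>2 / 2)" and gauss_sin: "(\<integral>g. sin (t * g) \<partial>gauss) = 0"
proof -
  interpret real_distribution gauss by (rule real_dist_normal_dist)
  have "char gauss t = complex_of_real (exp (- t\<^sup>2 / 2))" using char_std_normal_distribution by (simp add: fun_eq_iff)
  then have "Re (char gauss t) = exp (- t\<^sup>2 / 2)" "Im (char gauss t) = 0" by simp_all
  moreover have "Re (char gauss t) = (\<integral>g. cos (t * g) \<partial>gauss)" "Im (char gauss t) = (\<integral>g. sin (t * g) \<partial>gauss)"
    unfolding char_def by (simp_all add: integrable_iexp integral_Re[symmetric] integral_Im[symmetric] Re_exp Im_exp del: integral_Re integral_Im)
  ultimately show "(\<integral>g. cos (t * g) \<partial>gauss) = exp (- t\<^sup>2 / 2)" "(\<integral>g. sin (t * g) \<partial>gauss) = 0" by simp_all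
qed

text \<open>In both cases of the definition, degenerate or not, the characteristic function depends
  on the second moment alone. Joint laws are therefore determined by covariances.\<close>

lemma centered_gaussian_facts:
  assumes ps: "prob_space M" and X: "centered_gaussian M X"
  shows "X \<in> borel_measurable M" "integrable M (\<lambda>a. (X a)\<^sup>2)"
    "(\<integral>a. cos (X a) \<partial>M) = exp (- (\<integral>a. (X a)\<^sup>2 \<partial>M) / 2)" "(\<integral>a. sin (X a) \<partial>M) = 0"
proof -
  interpret prob_space M by fact
  show m[measurable]: "X \<in> borel_measurable M" using X by (simp add: centered_gaussian_def)
  have "integrable M (\<lambda>a. (X a)\<^sup>2) \<and> (\<integral>a. cos (X a) \<partial>M) = exp (- (\<integral>a. (X a)\<^sup>2 \<partial>M) / 2) \<and> (\<integral>a. sin (X a) \<partial>M) = 0"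
  proof (cases "AE a in M. X a = 0")
    case True
    have "integrable M (\<lambda>a. (X a)\<^sup>2) \<longleftrightarrow> integrable M (\<lambda>a. 0::real)"
      by (rule integrable_cong_AE) (use True in \<open>auto elim: eventually_mono\<close>)
    moreover have "(\<integral>a. (X a)\<^sup>2 \<partial>M) = (\<integral>a. 0 \<partial>M)"
      by (rule integral_cong_AE) (use True in \<open>auto elim: eventually_mono\<close>)
    moreover have "(\<integral>a. cos (X a) \<partial>M) = (\<integral>a. 1 \<partial>M)" "(\<integral>a. sin (X a) \<partial>M) = (\<integral>a. 0 \<partial>M)"
      by (rule integral_cong_AE; use True in \<open>auto elim: eventually_mono\<close>)+
    ultimately show ?thesis by (simp add: prob_space)
  next
    case False
    then obtain \<sigma> where \<sigma>: "\<sigma> > 0" "distributed M lborel X (\<lambda>x. ennreal (normal_density 0 \<sigma> x))"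
      using X by (auto simp: centered_gaussian_def)
    have s: "distributed M lborel (\<lambda>a. X a / \<sigma>) (\<lambda>x. ennreal (std_normal_density x))"
      using normal_standard_normal_convert[OF \<sigma>(1), of X 0] \<sigma>(2) by simp
    have E: "(\<integral>a. f (X a) \<partial>M) = (\<integral>g. f (\<sigma> * g) \<partial>gauss)" if [measurable]: "f \<in> borel_measurable borel" for f :: "real \<Rightarrow> real"
    proof -
      have "(\<integral>x. std_normal_density x * f (\<sigma> * x) \<partial>lborel) = (\<integral>a. f (\<sigma> * (X a / \<sigma>)) \<partial>M)"
        by (rule distributed_integral[OF s]) auto
      then show ?thesis using \<sigma>(1) by (subst integral_density) auto
    qed
    have "integrable lborel (\<lambda>x. \<sigma>\<^sup>2 * (std_normal_density x * x\<^sup>2))"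
      by (intro integrable_mult_right integrable_std_normal_moment)
    then have "integrable lborel (\<lambda>x. std_normal_density x * (\<sigma> * x)\<^sup>2)"
      by (simp add: power_mult_distrib mult.left_commute)
    then have "integrable M (\<lambda>a. (\<sigma> * (X a / \<sigma>))\<^sup>2)"
      by (subst distributed_integrable[OF s, symmetric]) auto
    then have i: "integrable M (\<lambda>a. (X a)\<^sup>2)" using \<sigma>(1) by simp
    have "(\<integral>g. g ^ 2 \<partial>gauss) = 1" using std_normal_distribution_even_moments(1)[of 1] by simp
    then have "(\<integral>a. (X a)\<^sup>2 \<partial>M) = \<sigma>\<^sup>2" using E[of "\<lambda>x. x\<^sup>2"] by (simp add: power_mult_distrib)
    then show ?thesis using i E[of cos] E[of sin] by (simp add: gauss_cos gauss_sin)
  qed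
  then show "integrable M (\<lambda>a. (X a)\<^sup>2)" "(\<integral>a. cos (X a) \<partial>M) = exp (- (\<integral>a. (X a)\<^sup>2 \<partial>M) / 2)" "(\<integral>a. sin (X a) \<partial>M) = 0" by auto
qed

text \<open>A Gram factorisation by elimination: one index is split off and the induction applies to
  the Schur complement. The factors are indexed by natural numbers because each \<open>V k\<close>
  will be one level of a list.\<close>

lemma cholesky:
  fixes C :: "'i \<Rightarrow> 'i \<Rightarrow> real"
  assumes "finite I" "\<And>i j. i \<in> I \<Longrightarrow> j \<in> I \<Longrightarrow> C i j = C j i" "\<And>u. 0 \<le> (\<Sum>i\<in>I. \<Sum>j\<in>I. u i * u j * C i j)"
  obtains d and V :: "nat \<Rightarrow> 'i \<Rightarrow> real" where "\<And>i j. i \<in> I \<Longrightarrow> j \<in> I \<Longrightarrow> C i j = (\<Sum>k<d. V k i * V k j)"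
proof -
  have "\<exists>d. \<exists>V :: nat \<Rightarrow> 'i \<Rightarrow> real. \<forall>i\<in>I. \<forall>j\<in>I. C i j = (\<Sum>k<d. V k i * V k j)"
    using assms
  proof (induction I arbitrary: C)
    case empty then show ?case by simp
  next
    case (insert a I)
    have sym: "C i j = C j i" if "i \<in> insert a I" "j \<in> insert a I" for i j using insert.prems that by blast
    define q where "q u = (\<Sum>i\<in>I. \<Sum>j\<in>I. u i * u j * C i j)" for u
    define l where "l u = (\<Sum>i\<in>I. u i * C a i)" for u
    have psd: "0 \<le> t\<^sup>2 * C a a + 2 * t * l u + q u" for t u
    proof -
      let ?u = "\<lambda>i. if i = a then t else u i"
      have "(\<Sum>j\<in>insert a I. ?u i * ?u j * C i j) = ?u i * t * C i a + (\<Sum>j\<in>I. ?u i * u j * C i j)" for i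
      proof -
        have "(\<Sum>j\<in>insert a I. ?u i * ?u j * C i j) = ?u i * ?u a * C i a + (\<Sum>j\<in>I. ?u i * ?u j * C i j)"
          by (rule sum.insert[OF insert.hyps])
        also have "(\<Sum>j\<in>I. ?u i * ?u j * C i j) = (\<Sum>j\<in>I. ?u i * u j * C i j)"
          using insert.hyps by (intro sum.cong) auto
        finally show ?thesis by simp
      qed
      then have "(\<Sum>i\<in>insert a I. \<Sum>j\<in>insert a I. ?u i * ?u j * C i j) = (\<Sum>i\<in>insert a I. ?u i * t * C i a + (\<Sum>j\<in>I. ?u i * u j * C i j))" by simp
      also have "\<dots> = t * t * C a a + (\<Sum>j\<in>I. t * u j * C a j) + (\<Sum>i\<in>I. u i * t * C i a + (\<Sum>j\<in>I. u i * u j * C i j))"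
      proof -
        have "(\<Sum>i\<in>I. ?u i * t * C i a + (\<Sum>j\<in>I. ?u i * u j * C i j)) = (\<Sum>i\<in>I. u i * t * C i a + (\<Sum>j\<in>I. u i * u j * C i j))"
          using insert.hyps by (intro sum.cong) auto
        then show ?thesis using insert.hyps by simp
      qed
      also have "\<dots> = t\<^sup>2 * C a a + 2 * t * l u + q u"
      proof -
        have "(\<Sum>i\<in>I. u i * t * C i a) = t * l u" "(\<Sum>j\<in>I. t * u j * C a j) = t * l u"
          unfolding l_def sum_distrib_left by (auto intro!: sum.cong simp: sym)
        then show ?thesis by (simp add: sum.distrib q_def power2_eq_square)
      qed
      finally show ?thesis using insert.prems(2)[of ?u] by simp
    qed
    have q0: "q (\<lambda>_. 0) = 0" "l (\<lambda>_. 0) = 0" by (simp_all add: q_def l_def)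
    have Caa: "C a a \<ge> 0" using psd[of 1 "\<lambda>_. 0"] by (simp add: q0)
    show ?case
    proof (cases "C a a = 0")
      case True
      \<comment> \<open>A zero on the diagonal forces a zero row: otherwise the coefficient of the
        split index can be chosen so that the form takes the value \<open>-1\<close>.\<close>
      have Cai: "C a i = 0" if i: "i \<in> I" for i
      proof (rule ccontr)
        assume ne: "C a i \<noteq> 0"
        let ?u = "\<lambda>j. if j = i then 1 else 0 :: real"
        have l: "l ?u = C a i" unfolding l_def using i insert.hyps by (simp add: if_distrib[of "\<lambda>x. x * _"] cong: if_cong)
        have "0 \<le> 2 * (- (q ?u + 1) / (2 * C a i)) * C a i + q ?u"
          using psd[of "- (q ?u + 1) / (2 * C a i)" ?u] True l by simp
        then show False using ne by (simp add: field_simps)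
      qed
      have qnn: "0 \<le> q u" for u using psd[of 0 u] by simp
      have "\<exists>d. \<exists>V :: nat \<Rightarrow> 'i \<Rightarrow> real. \<forall>i\<in>I. \<forall>j\<in>I. C i j = (\<Sum>k<d. V k i * V k j)"
        by (rule insert.IH) (rule sym, simp, simp, rule qnn[unfolded q_def])
      then obtain d and V :: "nat \<Rightarrow> 'i \<Rightarrow> real" where V: "\<forall>i\<in>I. \<forall>j\<in>I. C i j = (\<Sum>k<d. V k i * V k j)" by blast
      have "\<forall>i\<in>insert a I. \<forall>j\<in>insert a I. C i j = (\<Sum>k<d. (if i = a then 0 else V k i) * (if j = a then 0 else V k j))"
      proof (intro ballI)
        fix i j assume ij: "i \<in> insert a I" "j \<in> insert a I"
        show "C i j = (\<Sum>k<d. (if i = a then 0 else V k i) * (if j = a then 0 else V k j))"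
          using V Cai True sym[OF ij(1), of a] ij by (cases "i = a"; cases "j = a") auto
      qed
      then show ?thesis by (intro exI[of _ d] exI[of _ "\<lambda>k i. if i = a then 0 else V k i"])
    next
      case False
      then have pos: "C a a > 0" using Caa by simp
      define V0 where "V0 i = C a i / sqrt (C a a)" for i
      have V0V0: "V0 i * V0 j = C a i * C a j / C a a" for i j using pos by (simp add: V0_def)
      have psd0: "0 \<le> (\<Sum>i\<in>I. \<Sum>j\<in>I. u i * u j * (C i j - V0 i * V0 j))" for u
      proof -
        have "(\<Sum>i\<in>I. \<Sum>j\<in>I. u i * u j * (C i j - V0 i * V0 j)) = q u - (l u)\<^sup>2 / C a a"
        proof -
          have "(l u)\<^sup>2 / C a a = (\<Sum>i\<in>I. \<Sum>j\<in>I. u i * u j * (V0 i * V0 j))"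
            unfolding V0V0 l_def power2_eq_square sum_product sum_divide_distrib by (intro sum.cong refl) simp
          then show ?thesis unfolding q_def by (simp add: right_diff_distrib sum_subtractf)
        qed
        \<comment> \<open>The choice \<open>t = - l u / C a a\<close> minimises the form in the
          split direction, and the minimum is the Schur complement.\<close>
        also have "\<dots> = (- l u / C a a)\<^sup>2 * C a a + 2 * (- l u / C a a) * l u + q u"
          using pos by (simp add: power2_eq_square field_simps)
        also have "\<dots> \<ge> 0" by (rule psd)
        finally show ?thesis .
      qed
      have "\<exists>d. \<exists>V :: nat \<Rightarrow> 'i \<Rightarrow> real. \<forall>i\<in>I. \<forall>j\<in>I. C i j - V0 i * V0 j = (\<Sum>k<d. V k i * V k j)"
      proof (rule insert.IH)
        show "C i j - V0 i * V0 j = C j i - V0 j * V0 i" if "i \<in> I" "j \<in> I" for i j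
          using sym[of i j] that by (simp add: mult.commute)
      qed (rule psd0)
      then obtain d and V :: "nat \<Rightarrow> 'i \<Rightarrow> real" where V: "\<forall>i\<in>I. \<forall>j\<in>I. C i j - V0 i * V0 j = (\<Sum>k<d. V k i * V k j)" by blast
      define V' where "V' k i = (case k of 0 \<Rightarrow> V0 i | Suc k \<Rightarrow> if i = a then 0 else V k i)" for k i
      have "C i j = (\<Sum>k<Suc d. V' k i * V' k j)" if ij: "i \<in> insert a I" "j \<in> insert a I" for i j
      proof -
        have "(\<Sum>k<Suc d. V' k i * V' k j) = V0 i * V0 j + (\<Sum>k<d. (if i = a then 0 else V k i) * (if j = a then 0 else V k j))"
          unfolding sum.lessThan_Suc_shift by (simp add: V'_def)
        moreover have "V0 a * V0 j = C a j" "V0 i * V0 a = C i a" using pos sym[OF ij(1), of a] by (auto simp: V0V0)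
        ultimately show ?thesis using ij V[rule_format, of i j] by (cases "i = a"; cases "j = a") (auto simp: algebra_simps)
      qed
      then show ?thesis by blast
    qed
  qed
  then show thesis using that by blast
qed

lemma gaussian_image_trig:
  fixes a :: "nat \<Rightarrow> real" and d :: nat
  defines "N \<equiv> Pi\<^sub>M {..<d} (\<lambda>_. gauss)"
  shows "(\<integral>x. cos (\<Sum>k<d. a k * x k) \<partial>N) = exp (- (\<Sum>k<d. (a k)\<^sup>2) / 2)" "(\<integral>x. sin (\<Sum>k<d. a k * x k) \<partial>N) = 0"
proof -
  interpret product_sigma_finite "\<lambda>_::nat. gauss"
    by (intro product_sigma_finite.intro prob_space_imp_sigma_finite prob_space_gauss)
  interpret G: real_distribution gauss by (rule real_dist_normal_dist)
  interpret N: prob_space N unfolding N_def by (rule prob_space_PiM) (rule prob_space_gauss)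
  have c: "(\<integral>x. iexp (a k * x) \<partial>gauss) = exp (- (a k)\<^sup>2 / 2)" for k
    using char_std_normal_distribution by (simp add: fun_eq_iff char_def)
  have x: "(\<lambda>x. x k) \<in> borel_measurable N" if "k < d" for k
    using measurable_component_singleton[of k "{..<d}" "\<lambda>_. gauss"] that unfolding N_def by (simp add: measurable_cong_sets[of N N gauss borel])
  have m: "(\<lambda>x. \<Sum>k<d. a k * x k) \<in> borel_measurable N" using x by (intro borel_measurable_sum borel_measurable_times) auto
  have int: "integrable N (\<lambda>x. iexp (\<Sum>k<d. a k * x k))"
  proof (rule N.integrable_const_bound[where B=1])
    have "iexp \<in> borel_measurable borel" by measurable
    from measurable_compose[OF m this] show "(\<lambda>x. iexp (\<Sum>k<d. a k * x k)) \<in> borel_measurable N" .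
    show "AE x in N. cmod (iexp (\<Sum>k<d. a k * x k)) \<le> 1" by (simp only: norm_exp_i_times) simp
  qed
  have "(\<integral>x. iexp (\<Sum>k<d. a k * x k) \<partial>N) = (\<integral>x. (\<Prod>k<d. iexp (a k * x k)) \<partial>N)"
    by (simp add: exp_sum[symmetric] sum_distrib_left of_real_sum)
  also have "\<dots> = (\<Prod>k<d. \<integral>x. iexp (a k * x) \<partial>gauss)"
    unfolding N_def by (rule product_integral_prod) (auto intro!: G.integrable_iexp)
  also have "\<dots> = complex_of_real (exp (- (\<Sum>k<d. (a k)\<^sup>2) / 2))"
    unfolding c by (simp add: exp_sum[symmetric] of_real_prod[symmetric] sum_negf sum_divide_distrib del: of_real_prod)
  finally have E: "(\<integral>x. iexp (\<Sum>k<d. a k * x k) \<partial>N) = complex_of_real (exp (- (\<Sum>k<d. (a k)\<^sup>2) / 2))" .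
  have "(\<integral>x. cos (\<Sum>k<d. a k * x k) \<partial>N) = Re (\<integral>x. iexp (\<Sum>k<d. a k * x k) \<partial>N)"
    "(\<integral>x. sin (\<Sum>k<d. a k * x k) \<partial>N) = Im (\<integral>x. iexp (\<Sum>k<d. a k * x k) \<partial>N)"
    unfolding integral_Re[OF int, symmetric] integral_Im[OF int, symmetric] by (simp_all add: Re_exp Im_exp)
  then show "(\<integral>x. cos (\<Sum>k<d. a k * x k) \<partial>N) = exp (- (\<Sum>k<d. (a k)\<^sup>2) / 2)" "(\<integral>x. sin (\<Sum>k<d. a k * x k) \<partial>N) = 0"
    unfolding E by simp_all
qed

lemma softmax_cong: "(\<And>i. i \<in> I \<Longrightarrow> h i = h' i) \<Longrightarrow> softmax I lam h = softmax I lam h'"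
  by (simp add: softmax_def cong: sum.cong)

lemma softmax_measurable:
  "finite I \<Longrightarrow> (\<And>i. i \<in> I \<Longrightarrow> (\<lambda>x. h x i) \<in> borel_measurable N) \<Longrightarrow> (\<lambda>x. softmax I lam (h x)) \<in> borel_measurable N"
  unfolding softmax_def
  by (intro borel_measurable_divide borel_measurable_ln borel_measurable_sum borel_measurable_exp borel_measurable_times) auto

lemma measurable_gauss_component: "k < d \<Longrightarrow> (\<lambda>x. x k) \<in> borel_measurable (Pi\<^sub>M {..<d} (\<lambda>_. gauss))"
  using measurable_component_singleton[of k "{..<d}" "\<lambda>_. gauss"] measurable_cong_sets[of "Pi\<^sub>M {..<d} (\<lambda>_. gauss)" _ gauss borel] by auto

text \<open>Consecutive levels with the same exponent form one Gaussian average, since the logarithm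
  and the exponential between them cancel. The list is reversed because its head is the variable
  added last to the product measure.\<close>

lemma nested_iterated:
  fixes h :: "'i \<Rightarrow> real"
  assumes I: "finite I" "I \<noteq> {}" "lam > 0" and S: "\<forall>x\<in>set S. 0 < fst x" and c: "0 < c"
    and K: "\<And>h. nested I lam S (pi / 2) h = softmax I lam h + K"
  shows "ennreal (exp (c * nested I lam (levels c (map (\<lambda>k. (V k, True)) (rev [0..<d])) @ S) (pi / 2) h))
    = (\<integral>\<^sup>+x. ennreal (exp (c * (softmax I lam (\<lambda>i. h i + (\<Sum>k<d. V k i * x k)) + K))) \<partial>Pi\<^sub>M {..<d} (\<lambda>_. gauss))"
proof (induction d arbitrary: h)
  interpret product_sigma_finite "\<lambda>_::nat. gauss"
    by (intro product_sigma_finite.intro prob_space_imp_sigma_finite prob_space_gauss)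
  case 0
  have "emeasure (Pi\<^sub>M {} (\<lambda>_::nat. gauss)) (space (Pi\<^sub>M {} (\<lambda>_. gauss))) = 1"
    by (intro prob_space.emeasure_space_1 prob_space_PiM prob_space_gauss)
  then show ?case by (simp add: levels_def K lessThan_0)
next
  interpret product_sigma_finite "\<lambda>_::nat. gauss"
    by (intro product_sigma_finite.intro prob_space_imp_sigma_finite prob_space_gauss)
  case (Suc d)
  let ?S = "levels c (map (\<lambda>k. (V k, True)) (rev [0..<d])) @ S"
  let ?F = "\<lambda>d h x. ennreal (exp (c * (softmax I lam (\<lambda>i. h i + (\<Sum>k<d. V k i * x k)) + K)))"
  have pos: "\<forall>x\<in>set ?S. 0 < fst x" by (rule levels_pos[OF c S])
  note n = nested_integrable[OF I pos c, where \<theta>="pi / 2" and h=h and b=True and v="V d"]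
  have L: "levels c (map (\<lambda>k. (V k, True)) (rev [0..<Suc d])) @ S = (c, V d, True) # ?S" by (simp add: levels_def)
  have "exp (c * nested I lam ((c, V d, True) # ?S) (pi / 2) h) = (\<integral>g. exp (c * nested I lam ?S (pi / 2) (\<lambda>k. h k + g * (amp True (pi / 2) * V d k))) \<partial>gauss)"
    using n(2) c by simp
  then have "ennreal (exp (c * nested I lam ((c, V d, True) # ?S) (pi / 2) h))
     = (\<integral>\<^sup>+g. ennreal (exp (c * nested I lam ?S (pi / 2) (\<lambda>k. h k + g * (amp True (pi / 2) * V d k)))) \<partial>gauss)"
    using nn_integral_eq_integral[OF n(1)] by simp
  also have "\<dots> = (\<integral>\<^sup>+g. (\<integral>\<^sup>+x. ?F d (\<lambda>k. h k + g * (amp True (pi / 2) * V d k)) x \<partial>Pi\<^sub>M {..<d} (\<lambda>_. gauss)) \<partial>gauss)"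
    by (simp only: Suc.IH)
  also have "\<dots> = (\<integral>\<^sup>+g. (\<integral>\<^sup>+x. ?F (Suc d) h (x(d := g)) \<partial>Pi\<^sub>M {..<d} (\<lambda>_. gauss)) \<partial>gauss)"
  proof -
    have "(\<Sum>k<Suc d. V k i * (x(d := g)) k) = g * V d i + (\<Sum>k<d. V k i * x k)" for x i and g :: real
      by (simp add: mult.commute)
    then show ?thesis by (simp add: amp_def add_ac mult.commute)
  qed
  also have "\<dots> = (\<integral>\<^sup>+x. ?F (Suc d) h x \<partial>Pi\<^sub>M (insert d {..<d}) (\<lambda>_. gauss))"
  proof (rule product_nn_integral_insert_rev[symmetric])
    have "(\<lambda>x. softmax I lam (\<lambda>i. h i + (\<Sum>k<Suc d. V k i * x k))) \<in> borel_measurable (Pi\<^sub>M {..<Suc d} (\<lambda>_. gauss))"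
      using I(1) by (intro softmax_measurable borel_measurable_add borel_measurable_sum borel_measurable_times measurable_gauss_component) auto
    then show "?F (Suc d) h \<in> borel_measurable (Pi\<^sub>M (insert d {..<d}) (\<lambda>_. gauss))" unfolding lessThan_Suc by simp
  qed auto
  finally show ?case unfolding L lessThan_Suc .
qed

lemma gaussian_family:
  fixes X :: "'i \<Rightarrow> 'w \<Rightarrow> real"
  assumes I: "finite I" and M: "prob_space M" and X: "\<And>u. centered_gaussian M (\<lambda>a. \<Sum>i\<in>I. u i * X i a)"
  shows "i \<in> I \<Longrightarrow> centered_gaussian M (X i)"
    "(\<integral>a. (\<Sum>i\<in>I. u i * X i a)\<^sup>2 \<partial>M) = (\<Sum>i\<in>I. \<Sum>j\<in>I. u i * u j * (\<integral>a. X i a * X j a \<partial>M))"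
proof -
  have single: "centered_gaussian M (X i)" if "i \<in> I" for i
  proof -
    have "(\<Sum>j\<in>I. (if j = i then 1 else 0) * X j a) = X i a" for a
      using that I by (simp add: if_distrib[of "\<lambda>x. x * _"] cong: if_cong)
    then show ?thesis using X[of "\<lambda>j. if j = i then 1 else 0"] by simp
  qed
  have mX: "X i \<in> borel_measurable M" if "i \<in> I" for i by (rule centered_gaussian_facts(1)[OF M single[OF that]])
  have iXX: "integrable M (\<lambda>a. X i a * X j a)" if "i \<in> I" "j \<in> I" for i j
  proof (rule Bochner_Integration.integrable_bound)
    show "integrable M (\<lambda>a. (X i a)\<^sup>2 + (X j a)\<^sup>2)"
      using centered_gaussian_facts(2)[OF M single] that by (intro Bochner_Integration.integrable_add) auto
    show "(\<lambda>a. X i a * X j a) \<in> borel_measurable M" using mX that by simp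
    show "AE a in M. norm (X i a * X j a) \<le> norm ((X i a)\<^sup>2 + (X j a)\<^sup>2)"
    proof (intro AE_I2)
      fix a
      have "0 \<le> (\<bar>X i a\<bar> - \<bar>X j a\<bar>)\<^sup>2" "0 \<le> \<bar>X i a\<bar> * \<bar>X j a\<bar>" by auto
      moreover have "(\<bar>X i a\<bar> - \<bar>X j a\<bar>)\<^sup>2 = (X i a)\<^sup>2 + (X j a)\<^sup>2 - 2 * (\<bar>X i a\<bar> * \<bar>X j a\<bar>)"
        by (simp add: power2_diff)
      ultimately have "\<bar>X i a\<bar> * \<bar>X j a\<bar> \<le> (X i a)\<^sup>2 + (X j a)\<^sup>2" by linarith
      then show "norm (X i a * X j a) \<le> norm ((X i a)\<^sup>2 + (X j a)\<^sup>2)" by (simp add: abs_mult)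
    qed
  qed
  show "i \<in> I \<Longrightarrow> centered_gaussian M (X i)" by (rule single)
  have "(\<integral>a. (\<Sum>i\<in>I. u i * X i a)\<^sup>2 \<partial>M) = (\<integral>a. (\<Sum>i\<in>I. \<Sum>j\<in>I. u i * u j * (X i a * X j a)) \<partial>M)"
    unfolding power2_eq_square sum_product by (simp add: mult_ac)
  also have "\<dots> = (\<Sum>i\<in>I. \<Sum>j\<in>I. u i * u j * (\<integral>a. X i a * X j a \<partial>M))"
    by (subst Bochner_Integration.integral_sum, intro Bochner_Integration.integrable_sum integrable_mult_right iXX, assumption, assumption,
        intro sum.cong refl, subst Bochner_Integration.integral_sum, intro integrable_mult_right iXX, assumption, assumption, simp)
  finally show "(\<integral>a. (\<Sum>i\<in>I. u i * X i a)\<^sup>2 \<partial>M) = (\<Sum>i\<in>I. \<Sum>j\<in>I. u i * u j * (\<integral>a. X i a * X j a \<partial>M))" .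
qed

text \<open>The process enters only through its covariance. It is replaced by the linear image of
  independent Gaussians with the same Gram factors, whose average is a group of levels.\<close>

lemma nested_gaussian_process:
  fixes X :: "'i \<Rightarrow> 'w \<Rightarrow> real" and h :: "'i \<Rightarrow> real"
  assumes I: "finite I" "I \<noteq> {}" "lam > 0" and S: "\<forall>x\<in>set S. 0 < fst x" and c: "0 < c"
    and K: "\<And>h. nested I lam S (pi / 2) h = softmax I lam h + K"
    and M: "prob_space M" and X: "\<And>u. centered_gaussian M (\<lambda>a. \<Sum>i\<in>I. u i * X i a)"
    and V: "\<And>i j. i \<in> I \<Longrightarrow> j \<in> I \<Longrightarrow> (\<integral>a. X i a * X j a \<partial>M) = (\<Sum>k<d. V k i * V k j)"
  shows "(\<integral>\<^sup>+a. ennreal (exp (c * (softmax I lam (\<lambda>i. h i + X i a) + K))) \<partial>M)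
    = ennreal (exp (c * nested I lam (levels c (map (\<lambda>k. (V k, True)) (rev [0..<d])) @ S) (pi / 2) h))"
proof -
  interpret M: prob_space M by fact
  let ?N = "Pi\<^sub>M {..<d} (\<lambda>_. gauss)"
  interpret N: prob_space ?N by (rule prob_space_PiM) (rule prob_space_gauss)
  define X' where "X' i x = (\<Sum>k<d. V k i * x k)" for i and x :: "nat \<Rightarrow> real"
  have mX: "X i \<in> borel_measurable M" if "i \<in> I" for i
    by (rule centered_gaussian_facts(1)[OF M gaussian_family(1)[OF I(1) M X that]])
  have mX': "X' i \<in> borel_measurable ?N" for i
    unfolding X'_def by (intro borel_measurable_sum borel_measurable_times measurable_gauss_component) auto
  have var: "(\<integral>a. (\<Sum>i\<in>I. u i * X i a)\<^sup>2 \<partial>M) = (\<Sum>k<d. (\<Sum>i\<in>I. u i * V k i)\<^sup>2)" for u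
  proof -
    have "(\<integral>a. (\<Sum>i\<in>I. u i * X i a)\<^sup>2 \<partial>M) = (\<Sum>i\<in>I. \<Sum>j\<in>I. u i * u j * (\<Sum>k<d. V k i * V k j))"
      unfolding gaussian_family(2)[OF I(1) M X] by (intro sum.cong refl) (simp add: V)
    also have "\<dots> = (\<Sum>k<d. (\<Sum>i\<in>I. u i * V k i)\<^sup>2)"
    proof -
      have "(\<Sum>k<d. (\<Sum>i\<in>I. u i * V k i)\<^sup>2) = (\<Sum>k<d. \<Sum>i\<in>I. \<Sum>j\<in>I. u i * u j * (V k i * V k j))"
        unfolding power2_eq_square sum_product by (simp add: mult_ac)
      also have "\<dots> = (\<Sum>i\<in>I. \<Sum>k<d. \<Sum>j\<in>I. u i * u j * (V k i * V k j))" by (rule sum.swap)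
      also have "\<dots> = (\<Sum>i\<in>I. \<Sum>j\<in>I. \<Sum>k<d. u i * u j * (V k i * V k j))" by (intro sum.cong refl sum.swap)
      also have "\<dots> = (\<Sum>i\<in>I. \<Sum>j\<in>I. u i * u j * (\<Sum>k<d. V k i * V k j))" by (simp add: sum_distrib_left)
      finally show ?thesis by simp
    qed
    finally show ?thesis .
  qed
  have lin: "(\<Sum>i\<in>I. u i * X' i x) = (\<Sum>k<d. (\<Sum>i\<in>I. u i * V k i) * x k)" for u x
    unfolding X'_def sum_distrib_left sum_distrib_right by (subst sum.swap) (simp add: mult_ac)
  have law: "distr M (Pi\<^sub>M I (\<lambda>_. borel)) (\<lambda>a. \<lambda>i\<in>I. X i a) = distr ?N (Pi\<^sub>M I (\<lambda>_. borel)) (\<lambda>x. \<lambda>i\<in>I. X' i x)"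
  proof (rule vector_law_eq[OF I(1) M N.prob_space_axioms mX mX'])
    fix u
    show "(\<integral>a. cos (\<Sum>i\<in>I. u i * X i a) \<partial>M) = (\<integral>x. cos (\<Sum>i\<in>I. u i * X' i x) \<partial>?N)"
      "(\<integral>a. sin (\<Sum>i\<in>I. u i * X i a) \<partial>M) = (\<integral>x. sin (\<Sum>i\<in>I. u i * X' i x) \<partial>?N)"
      unfolding lin gaussian_image_trig centered_gaussian_facts(3,4)[OF M X] var by simp_all
  qed
  let ?F = "\<lambda>y. ennreal (exp (c * (softmax I lam (\<lambda>i. h i + y i) + K)))"
  have F: "?F \<in> borel_measurable (Pi\<^sub>M I (\<lambda>_. borel))"
  proof -
    have "(\<lambda>y. softmax I lam (\<lambda>i. h i + y i)) \<in> borel_measurable (Pi\<^sub>M I (\<lambda>_. borel))"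
      using I(1) by (intro softmax_measurable borel_measurable_add measurable_component_singleton) auto
    then show ?thesis by simp
  qed
  have r: "?F (\<lambda>i\<in>I. y i) = ?F y" for y
    by (intro arg_cong[where f="\<lambda>x. ennreal (exp (c * (x + K)))"] softmax_cong) simp
  have image1: "(\<integral>\<^sup>+a. ?F (\<lambda>i. Y i a) \<partial>Q) = (\<integral>\<^sup>+y. ?F y \<partial>distr Q (Pi\<^sub>M I (\<lambda>_. borel)) (\<lambda>a. \<lambda>i\<in>I. Y i a))"
    if "\<And>i. i \<in> I \<Longrightarrow> Y i \<in> borel_measurable Q" for Q :: "'w measure" and Y
  proof -
    have "(\<lambda>a. \<lambda>i\<in>I. Y i a) \<in> measurable Q (Pi\<^sub>M I (\<lambda>_. borel))" using that by (rule measurable_restrict)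
    moreover from F have "?F \<in> borel_measurable (distr Q (Pi\<^sub>M I (\<lambda>_. borel)) (\<lambda>a. \<lambda>i\<in>I. Y i a))"
      by (simp only: measurable_distr_eq1)
    ultimately show ?thesis using nn_integral_distr[of "\<lambda>a. \<lambda>i\<in>I. Y i a" Q _ ?F] unfolding r by simp
  qed
  have image2: "(\<integral>\<^sup>+a. ?F (\<lambda>i. Y i a) \<partial>Q) = (\<integral>\<^sup>+y. ?F y \<partial>distr Q (Pi\<^sub>M I (\<lambda>_. borel)) (\<lambda>a. \<lambda>i\<in>I. Y i a))"
    if "\<And>i. i \<in> I \<Longrightarrow> Y i \<in> borel_measurable Q" for Q :: "(nat \<Rightarrow> real) measure" and Y
  proof -
    have "(\<lambda>a. \<lambda>i\<in>I. Y i a) \<in> measurable Q (Pi\<^sub>M I (\<lambda>_. borel))" using that by (rule measurable_restrict)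
    moreover from F have "?F \<in> borel_measurable (distr Q (Pi\<^sub>M I (\<lambda>_. borel)) (\<lambda>a. \<lambda>i\<in>I. Y i a))"
      by (simp only: measurable_distr_eq1)
    ultimately show ?thesis using nn_integral_distr[of "\<lambda>a. \<lambda>i\<in>I. Y i a" Q _ ?F] unfolding r by simp
  qed
  have "(\<integral>\<^sup>+a. ?F (\<lambda>i. X i a) \<partial>M) = (\<integral>\<^sup>+y. ?F y \<partial>distr M (Pi\<^sub>M I (\<lambda>_. borel)) (\<lambda>a. \<lambda>i\<in>I. X i a))"
    by (rule image1[OF mX])
  also have "\<dots> = (\<integral>\<^sup>+x. ?F (\<lambda>i. X' i x) \<partial>?N)"
    unfolding law by (rule image2[OF mX', symmetric])
  also have "\<dots> = ennreal (exp (c * nested I lam (levels c (map (\<lambda>k. (V k, True)) (rev [0..<d])) @ S) (pi / 2) h))"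
    unfolding X'_def by (rule nested_iterated[OF I S c K, symmetric])
  finally show ?thesis .
qed

subsection \<open>The interpolation on a class of nearly constant self-overlap\<close>

definition lower_conj :: "(real \<Rightarrow> real) \<Rightarrow> real \<Rightarrow> real" where
  "lower_conj f a = (INF x. f x - a * x)"

text \<open>\<open>ln (cosh x)\<close> is at least \<open>\<bar>x\<bar> - ln 2\<close>, so the
  infimum is finite for slopes of modulus at most 1, which covers all coordinates of points of the
  cube.\<close>

lemma lower_conj_bounds:
  assumes f: "\<And>x. ln (cosh x) \<le> f x" and a: "\<bar>a\<bar> \<le> 1"
  shows "- ln 2 \<le> lower_conj f a" "lower_conj f a + a * x \<le> f x"
proof -
  have low: "- ln 2 \<le> f x - a * x" for x
  proof -
    have "exp \<bar>x\<bar> / 2 \<le> cosh x" by (auto simp: cosh_field_def abs_real_def)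
    then have "ln (exp \<bar>x\<bar> / 2) \<le> ln (cosh x)" by (subst ln_le_cancel_iff) auto
    moreover have "ln (exp \<bar>x\<bar> / 2) = \<bar>x\<bar> - ln 2" by (simp add: ln_div)
    moreover have "a * x \<le> \<bar>x\<bar>" using mult_right_mono[OF a, of "\<bar>x\<bar>"] by (simp add: abs_mult[symmetric])
    ultimately show ?thesis using f[of x] by linarith
  qed
  then show "- ln 2 \<le> lower_conj f a" unfolding lower_conj_def by (intro cINF_greatest) auto
  have "lower_conj f a \<le> f x - a * x" unfolding lower_conj_def by (rule cINF_lower) (auto intro!: bdd_belowI2[where m="- ln 2"] low)
  then show "lower_conj f a + a * x \<le> f x" by simp
qed

lemma lower_conj_le:
  assumes f: "\<And>x. ln (cosh x) \<le> f x" and le: "\<And>x. f x \<le> g x + d" and a: "\<bar>a\<bar> \<le> 1"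
  shows "lower_conj f a \<le> lower_conj g a + d"
proof -
  have "lower_conj f a - d \<le> lower_conj g a"
    unfolding lower_conj_def[of g]
  proof (rule cINF_greatest)
    fix x show "lower_conj f a - d \<le> g x - a * x" using lower_conj_bounds(2)[OF f a, of x] le[of x] by linarith
  qed simp
  then show ?thesis by simp
qed

text \<open>By \<open>le\<close> the inner bound is a sum over coordinates that no longer contains
  \<open>m\<close>. Each level averages over one coordinate, so it replaces one summand
  \<open>f (x k)\<close> by its Cole-Hopf transform and sees the others as a constant.\<close>

lemma nested_coordinates_le:
  assumes I: "finite I" "I \<noteq> {}" "lam > 0" and S: "\<forall>x\<in>set S. 0 < fst x" and c: "0 < c" and v: "0 \<le> v"
    and lip: "\<And>x y. \<bar>f x - f y\<bar> \<le> \<bar>x - y\<bar>"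
    and le: "\<And>x. nested I lam S 0 (\<lambda>m. h m + (\<Sum>i<N. m i * x i)) \<le> C + (\<Sum>i<N. f (x i))" and k: "k \<le> N"
  shows "nested I lam (levels c (map (\<lambda>i. (\<lambda>m. sqrt v * m i, False)) [k..<N]) @ S) 0 (\<lambda>m. h m + (\<Sum>i<N. m i * x i))
    \<le> C + (\<Sum>i<k. f (x i)) + (\<Sum>i=k..<N. cole_hopf c v f (x i))"
  using k
proof (induction k arbitrary: x rule: inc_induct)
  case base
  then show ?case using le by (simp add: levels_def)
next
  case (step k)
  let ?L = "\<lambda>k. levels c (map (\<lambda>i. (\<lambda>m. sqrt v * m i, False)) [k..<N]) @ S"
  define A where "A = C + (\<Sum>i<k. f (x i)) + (\<Sum>i=Suc k..<N. cole_hopf c v f (x i))"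
  have L: "?L k = (c, \<lambda>m. sqrt v * m k, False) # ?L (Suc k)" using step.hyps by (simp add: upt_conv_Cons levels_def)
  have g: "exp_growth (\<lambda>y. exp (c * f y))" by (rule exp_growth_lipschitz_exp[of f 1]) (use lip in simp)
  have int: "integrable gauss (\<lambda>g. exp (c * (A + f (x k + sqrt v * g))))"
    using exp_growth_integrable[OF g, of "x k" "sqrt v", THEN integrable_mult_right, of "exp (c * A)"] by (simp add: distrib_left exp_add)
  have pos: "0 < (\<integral>g. exp (c * f (x k + sqrt v * g)) \<partial>gauss)"
  proof -
    interpret prob_space gauss by (rule prob_space_gauss)
    have "(\<integral>g. exp (c * f (x k + sqrt v * g)) \<partial>gauss) \<noteq> 0"
      by (subst integral_nonneg_eq_0_iff_AE) (use exp_growth_integrable[OF g, of "x k" "sqrt v"] in auto)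
    moreover have "0 \<le> (\<integral>g. exp (c * f (x k + sqrt v * g)) \<partial>gauss)" by (rule Bochner_Integration.integral_nonneg) simp
    ultimately show ?thesis by linarith
  qed
  have "nested I lam (?L k) 0 (\<lambda>m. h m + (\<Sum>i<N. m i * x i)) \<le> ln (\<integral>g. exp (c * (A + f (x k + sqrt v * g))) \<partial>gauss) / c"
    unfolding L
  proof (rule nested_cos_0_le[OF I _ c _ int])
    show "\<forall>x\<in>set (?L (Suc k)). 0 < fst x" by (rule levels_pos[OF c S])
    fix g
    let ?x = "x(k := x k + sqrt v * g)"
    have "(\<Sum>i<N. m i * ?x i) = (\<Sum>i<N. m i * x i) + g * (sqrt v * m k)" for m
    proof -
      have "(\<Sum>i<N. m i * ?x i) = (\<Sum>i<N. m i * x i + (if i = k then g * (sqrt v * m k) else 0))"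
        by (intro sum.cong refl) (simp add: algebra_simps)
      then show ?thesis using step.hyps by (simp add: sum.distrib)
    qed
    moreover have "(\<Sum>i<Suc k. f (?x i)) = (\<Sum>i<k. f (x i)) + f (x k + sqrt v * g)"
      by simp
    moreover have "(\<Sum>i=Suc k..<N. cole_hopf c v f (?x i)) = (\<Sum>i=Suc k..<N. cole_hopf c v f (x i))"
      by (intro sum.cong refl) auto
    ultimately show "nested I lam (?L (Suc k)) 0 (\<lambda>m. h m + (\<Sum>i<N. m i * x i) + g * (sqrt v * m k)) \<le> A + f (x k + sqrt v * g)"
      using step.IH[of ?x] by (simp add: A_def add_ac)
  qed
  also have "\<dots> = A + cole_hopf c v f (x k)"
    using pos c by (simp add: distrib_left exp_add cole_hopf_def ln_mult add_divide_distrib)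
  also have "\<dots> = C + (\<Sum>i<k. f (x i)) + (\<Sum>i=k..<N. cole_hopf c v f (x i))"
    using step.hyps by (simp add: A_def sum.atLeast_Suc_lessThan)
  finally show ?case .
qed

text \<open>The scalar \<open>sin\<close> level carries the variance \<open>N * b l\<close> missing from \<open>N\<close> coordinate fields of
  variance \<open>a l\<close>, so that the accumulated difference is \<open>N\<close> times the gap between \<open>\<xi>\<close> and a tangent.\<close>

definition tower :: "(nat \<Rightarrow> real) \<Rightarrow> (nat \<Rightarrow> real) \<Rightarrow> (nat \<Rightarrow> real) \<Rightarrow> nat \<Rightarrow> nat \<Rightarrow> nat \<Rightarrow> (real \<times> ((nat \<Rightarrow> real) \<Rightarrow> real) \<times> bool) list" where
  "tower c b a N l j = concat (map (\<lambda>l. levels (c l)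
     ((\<lambda>_. sqrt (N * b l), True) # map (\<lambda>i. (\<lambda>m. sqrt (a l) * m i, False)) [0..<N])) [l..<j])"

lemma tower_Suc: "l < j \<Longrightarrow> tower c b a N l j @ S = levels (c l)
    ((\<lambda>_. sqrt (N * b l), True) # map (\<lambda>i. (\<lambda>m. sqrt (a l) * m i, False)) [0..<N]) @ tower c b a N (Suc l) j @ S"
  by (simp add: tower_def upt_conv_Cons)

lemma tower_pos:
  assumes "\<And>l. 0 < c l" "\<forall>x\<in>set S. 0 < fst x" shows "\<forall>x\<in>set (tower c b a N l j @ S). 0 < fst x"
  using assms by (auto simp: tower_def levels_def)

text \<open>At angle 0 the scalar levels are switched off, and each group of coordinate fields
  performs one step of the Parisi recursion in every coordinate.\<close>

lemma nested_tower_0_le: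
  assumes I: "finite I" "I \<noteq> {}" "lam > 0" and S: "\<forall>x\<in>set S. 0 < fst x" and c: "\<And>l. 0 < c l" and a: "\<And>l. l < j \<Longrightarrow> 0 \<le> a l"
    and lip: "\<And>l x y. 1 \<le> l \<Longrightarrow> l \<le> j \<Longrightarrow> \<bar>f l x - f l y\<bar> \<le> \<bar>x - y\<bar>"
    and f: "\<And>l. l < j \<Longrightarrow> f l = cole_hopf (c l) (a l) (f (Suc l))"
    and le: "\<And>x. nested I lam S 0 (\<lambda>m. h m + (\<Sum>i<N. m i * x i)) \<le> C + (\<Sum>i<N. f j (x i))" and l: "l \<le> j"
  shows "nested I lam (tower c b a N l j @ S) 0 (\<lambda>m. h m + (\<Sum>i<N. m i * x i)) \<le> C + (\<Sum>i<N. f l (x i))"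
  using l
proof (induction l arbitrary: x rule: inc_induct)
  case base
  then show ?case using le by (simp add: tower_def)
next
  case (step l)
  have "nested I lam (levels (c l) (map (\<lambda>i. (\<lambda>m. sqrt (a l) * m i, False)) [0..<N]) @ tower c b a N (Suc l) j @ S) 0
      (\<lambda>m. h m + (\<Sum>i<N. m i * x i)) \<le> C + (\<Sum>i<0. f (Suc l) (x i)) + (\<Sum>i=0..<N. cole_hopf (c l) (a l) (f (Suc l)) (x i))"
    by (rule nested_coordinates_le[OF I tower_pos[OF c S] c a _ step.IH]) (use step.hyps lip in auto)
  then show ?case using step.hyps nested_sin_0[OF I c] by (simp add: tower_Suc levels_def f atLeast0LessThan del: nested.simps)
qed

text \<open>At the other end the fields are switched off and the scalar levels leave only a
  constant: \<open>N / 2\<close> times the bound of \<open>pen_step_bound\<close>, once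
  \<open>b\<close> and \<open>c\<close> are chosen accordingly.\<close>

lemma nested_tower_pi_half:
  assumes I: "finite I" "I \<noteq> {}" "lam > 0" and S: "\<forall>x\<in>set S. 0 < fst x" and c: "\<And>l. 0 < c l" and b: "\<And>l. l < j \<Longrightarrow> 0 \<le> b l"
    and l: "l \<le> j"
  shows "nested I lam (tower c b a N l j @ S) (pi / 2) h = nested I lam S (pi / 2) h + (\<Sum>l=l..<j. c l * (N * b l) / 2)"
  using l
proof (induction l rule: inc_induct)
  case base
  then show ?case by (simp add: tower_def)
next
  case (step l)
  have *: "nested I lam (levels (c l) (map (\<lambda>i. (w i, False)) xs) @ T) (pi / 2) h = nested I lam T (pi / 2) h"
    for w :: "nat \<Rightarrow> (nat \<Rightarrow> real) \<Rightarrow> real" and xs T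
    by (induction xs) (simp_all add: levels_def nested_cos_pi_half[OF I c] del: nested.simps)
  let ?z = "map (\<lambda>i. (\<lambda>m. sqrt (a l) * m i, False)) [0..<N]" and ?T = "tower c b a N (Suc l) j @ S"
  have "nested I lam (tower c b a N l j @ S) (pi / 2) h = nested I lam ((c l, \<lambda>_. sqrt (N * b l), True) # levels (c l) ?z @ ?T) (pi / 2) h"
    unfolding tower_Suc[OF step.hyps(2)] by (simp add: levels_def del: nested.simps)
  also have "\<dots> = nested I lam (levels (c l) ?z @ ?T) (pi / 2) h + c l * (sqrt (N * b l))\<^sup>2 / 2"
    by (rule nested_const_pi_half[OF I levels_pos[OF c tower_pos[OF c S]] c])
  also have "\<dots> = nested I lam ?T (pi / 2) h + c l * (N * b l) / 2"
    unfolding * using b[OF step.hyps(2)] by simp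
  finally have "nested I lam (tower c b a N l j @ S) (pi / 2) h = nested I lam ?T (pi / 2) h + c l * (N * b l) / 2" .
  then show ?case using step by (simp add: sum.atLeast_Suc_lessThan)
qed

lemma comparable_cong:
  assumes "\<And>i k. i \<in> I \<Longrightarrow> k \<in> I \<Longrightarrow> D i k = D' i k"
  shows "comparable I lam E cl D S \<longleftrightarrow> comparable I lam E cl D' S"
  using assms
proof (induction S arbitrary: cl D D')
  case (Cons x S)
  obtain c v b where x: "x = (c, v, b)" by (cases x)
  show ?case using Cons.IH[of "\<lambda>i k. D i k + (if b then 1 else -1) * (v i * v k)" "\<lambda>i k. D' i k + (if b then 1 else -1) * (v i * v k)" c] Cons.prems by (simp add: x)
qed (simp cong: sum.cong)

lemma sum_list_map_uminus: "(\<Sum>x\<leftarrow>xs. - f x) = - (\<Sum>x\<leftarrow>xs. f x :: real)"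
  by (induction xs) auto

text \<open>\<open>D l\<close> is the covariance difference before group \<open>l\<close>. Its sign
  is checked only between groups, where the exponent rises.\<close>

lemma comparable_tower:
  fixes D :: "nat \<Rightarrow> (nat \<Rightarrow> real) \<Rightarrow> (nat \<Rightarrow> real) \<Rightarrow> real"
  assumes D: "\<And>l m m'. l < j \<Longrightarrow> m \<in> I \<Longrightarrow> m' \<in> I \<Longrightarrow> D (Suc l) m m' = D l m m' + N * b l - a l * dotp N m m'"
    and nn: "\<And>l m m'. l < j \<Longrightarrow> m \<in> I \<Longrightarrow> m' \<in> I \<Longrightarrow> 0 \<le> D l m m'"
    and a: "\<And>l. l < j \<Longrightarrow> 0 \<le> a l" and b: "\<And>l. l < j \<Longrightarrow> 0 \<le> b l"
    and c: "\<And>l. 0 < c l" "\<And>l. c l \<le> c (Suc l)" and j: "0 < j"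
    and S: "comparable I lam E (c (j - 1)) (D j) S" and l: "l \<le> j"
  shows "comparable I lam E (c (l - 1)) (D l) (tower c b a N l j @ S)"
  using l
proof (induction l rule: inc_induct)
  case base
  then show ?case using S by (simp add: tower_def)
next
  case (step l)
  let ?vs = "(\<lambda>_. sqrt (N * b l), True) # map (\<lambda>i. (\<lambda>m. sqrt (a l) * m i, False)) [0..<N]"
  show ?case
    unfolding tower_Suc[OF step.hyps(2)]
  proof (rule comparable_levels)
    have "comparable I lam E (c l) (D (Suc l)) (tower c b a N (Suc l) j @ S)" using step.IH by simp
    then show "comparable I lam E (c l) (\<lambda>i k. D l i k + (\<Sum>(v, b)\<leftarrow>?vs. (if b then 1 else - 1) * (v i * v k))) (tower c b a N (Suc l) j @ S)"
    proof (rule comparable_cong[THEN iffD1, rotated])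
      fix m m' assume m: "m \<in> I" "m' \<in> I"
      have "(\<Sum>i\<leftarrow>[0..<N]. sqrt (a l) * m i * (sqrt (a l) * m' i)) = a l * dotp N m m'"
        unfolding interv_sum_list_conv_sum_set_nat dotp_def sum_distrib_left
        by (rule sum.cong) (use a[OF step.hyps(2)] real_sqrt_mult_self[of "a l"] in \<open>auto simp: algebra_simps\<close>)
      then show "D (Suc l) m m' = D l m m' + (\<Sum>(v, b)\<leftarrow>?vs. (if b then 1 else - 1) * (v m * v m'))"
        using D[OF step.hyps(2) m] b[OF step.hyps(2)]
        by (simp add: comp_def sum_list_map_uminus)
    qed
    \<comment> \<open>For \<open>l = 0\<close> truncated subtraction gives \<open>c 0\<close>: the
      process levels in front of the tower will have the exponent of its first group.\<close>
    show "c (l - 1) \<le> c l" by (cases l) (use c in auto)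
    show "c (l - 1) = c l \<or> (\<forall>i\<in>I. \<forall>k\<in>I. 0 \<le> D l i k)" using nn step.hyps by blast
  qed (use c in auto)
qed

lemma softmax_bounds:
  assumes "finite I" "I \<noteq> {}" "0 < lam"
  shows "i \<in> I \<Longrightarrow> h i \<le> softmax I lam h"
    "(\<And>i. i \<in> I \<Longrightarrow> h i \<le> B) \<Longrightarrow> softmax I lam h \<le> B + ln (card I) / lam"
proof -
  show "h i \<le> softmax I lam h" if i: "i \<in> I"
  proof -
    have "exp (lam * h i) \<le> (\<Sum>i\<in>I. exp (lam * h i))" by (rule member_le_sum) (use i assms in auto)
    then have "ln (exp (lam * h i)) \<le> ln (\<Sum>i\<in>I. exp (lam * h i))" using exp_gt_zero[of "lam * h i"] by (subst ln_le_cancel_iff) linarith+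
    then show ?thesis using assms(3) by (simp add: softmax_def field_simps)
  qed
  show "softmax I lam h \<le> B + ln (card I) / lam" if B: "\<And>i. i \<in> I \<Longrightarrow> h i \<le> B"
  proof -
    have pos: "0 < (\<Sum>i\<in>I. exp (lam * h i))" "0 < real (card I)" using assms by (auto intro!: sum_pos simp: card_gt_0_iff)
    have "(\<Sum>i\<in>I. exp (lam * h i)) \<le> card I * exp (lam * B)" by (rule sum_bounded_above) (use B assms(3) in auto)
    then have "ln (\<Sum>i\<in>I. exp (lam * h i)) \<le> ln (card I * exp (lam * B))" using pos by (subst ln_le_cancel_iff) auto
    also have "\<dots> = ln (card I) + lam * B" using pos by (simp add: ln_mult)
    finally show ?thesis using assms(3) by (simp add: softmax_def field_simps)
  qed
qed

text \<open>The first hypothesis makes the diagonal mean at most the full mean under every weight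
  \<open>p\<close>. The factor \<open>lam\<close> of their difference may then be lowered to
  \<open>c\<close>, the off-diagonal terms cancel, and a bound free of \<open>lam\<close> is
  left.\<close>

lemma comparable_Nil:
  assumes D: "\<And>i k. i \<in> I \<Longrightarrow> k \<in> I \<Longrightarrow> D i i + D k k \<le> 2 * D i k" "\<And>i. i \<in> I \<Longrightarrow> D i i \<le> d"
    and c: "0 \<le> c" "c \<le> lam"
  shows "comparable I lam (c * d) c D []"
  unfolding comparable.simps
proof (intro allI impI, elim conjE)
  fix p assume p: "\<forall>i\<in>I. 0 \<le> p i" "(\<Sum>i\<in>I. p i) = (1::real)"
  define Y where "Y = (\<Sum>i\<in>I. \<Sum>k\<in>I. p i * p k * D i k)"
  define A where "A = (\<Sum>i\<in>I. p i * D i i)"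
  have "(\<Sum>i\<in>I. \<Sum>k\<in>I. p i * p k * (D i i + D k k)) \<le> (\<Sum>i\<in>I. \<Sum>k\<in>I. p i * p k * (2 * D i k))"
    using p D by (intro sum_mono mult_left_mono) auto
  moreover have *: "(\<Sum>k\<in>I. p i * p k * D i i) = p i * D i i" for i
  proof -
    have "(\<Sum>k\<in>I. p i * p k * D i i) = (\<Sum>k\<in>I. p k) * (p i * D i i)"
      unfolding sum_distrib_right by (intro sum.cong refl) (simp only: mult_ac)
    then show ?thesis using p(2) by simp
  qed
  then have "(\<Sum>i\<in>I. \<Sum>k\<in>I. p i * p k * D i i) = A" by (simp add: A_def)
  moreover have "(\<Sum>i\<in>I. \<Sum>k\<in>I. p i * p k * D k k) = A"
    using * by (subst sum.swap) (simp add: A_def mult.commute[of "p _" "p _"])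
  moreover have "(\<Sum>i\<in>I. \<Sum>k\<in>I. p i * p k * (2 * D i k)) = 2 * Y"
    by (simp add: Y_def sum_distrib_left mult_ac)
  ultimately have "A - Y \<le> 0" by (simp add: distrib_left sum.distrib)
  then have "lam * (A - Y) \<le> c * (A - Y)" by (rule mult_right_mono_neg[OF c(2)])
  moreover have "c * A \<le> c * d"
  proof (rule mult_left_mono[OF _ c(1)])
    have "A \<le> (\<Sum>i\<in>I. p i * d)" unfolding A_def using p D by (intro sum_mono mult_left_mono) auto
    then show "A \<le> d" using p(2) by (simp add: sum_distrib_right[symmetric])
  qed
  ultimately have "lam * (A - Y) + c * Y \<le> c * d" by (simp add: algebra_simps)
  then show "lam * ((\<Sum>i\<in>I. p i * D i i) - (\<Sum>i\<in>I. \<Sum>k\<in>I. p i * p k * D i k)) + c * (\<Sum>i\<in>I. \<Sum>k\<in>I. p i * p k * D i k) \<le> c * d"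
    by (simp add: A_def Y_def)
qed

lemma overlap_bounds:
  assumes N: "N \<ge> 1" and m: "m \<in> cube N" "m' \<in> cube N"
  shows "dotp N m m' / N \<in> {-1..1}" "self_overlap N m \<in> {0..1}"
    "dotp N m m' / N \<le> sqrt (self_overlap N m * self_overlap N m')"
proof -
  have b: "\<bar>m i\<bar> \<le> 1" if "m \<in> cube N" "i < N" for m i using that by (auto simp: cube_def abs_le_iff dest!: PiE_mem)
  have s: "\<bar>dotp N m m'\<bar> \<le> N" if "m \<in> cube N" "m' \<in> cube N" for m m'
  proof -
    have "\<bar>dotp N m m'\<bar> \<le> (\<Sum>i<N. \<bar>m i * m' i\<bar>)" unfolding dotp_def by (rule sum_abs)
    also have "\<dots> \<le> (\<Sum>i<N. 1)" using b that by (intro sum_mono) (auto simp: abs_mult intro!: mult_le_one)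
    finally show ?thesis by simp
  qed
  show "dotp N m m' / N \<in> {-1..1}" using s[OF m] N by (auto simp: abs_le_iff divide_le_eq le_divide_eq)
  have "0 \<le> dotp N m m" by (simp add: dotp_def sum_nonneg)
  then show "self_overlap N m \<in> {0..1}" using s[OF m(1) m(1)] N by (auto simp: self_overlap_def divide_le_eq)
  have "(dotp N m m')\<^sup>2 \<le> dotp N m m * dotp N m' m'"
    unfolding dotp_def using Cauchy_Schwarz_ineq_sum[of m m' "{..<N}"] by (simp add: power2_eq_square)
  then have "(dotp N m m' / N)\<^sup>2 \<le> self_overlap N m * self_overlap N m'"
    by (simp add: self_overlap_def power_divide divide_right_mono power2_eq_square)
  then show "dotp N m m' / N \<le> sqrt (self_overlap N m * self_overlap N m')" by (rule real_le_rsqrt)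
qed

text \<open>\<open>sqrt_bound\<close> compares the mixture at two self-overlaps with its value at
  the largest overlap that Cauchy-Schwarz permits. The quadratic right side matters: a single
  Gaussian level linear in the self-overlap can compensate it.\<close>

locale guerra_mixture = mixture_function +
  fixes L :: real
  assumes sqrt_bound: "q \<in> {0..1} \<Longrightarrow> q' \<in> {0..1} \<Longrightarrow> \<xi> q + \<xi> q' - 2 * \<xi> (sqrt (q * q')) \<le> L\<^sup>2 * (q - q')\<^sup>2"
begin

text \<open>Grouped by origin: the process, the coordinate fields, the scalar Gaussians.\<close>

definition excess :: "real \<Rightarrow> real \<Rightarrow> real" where
  "excess r x = \<xi> x - x * deriv \<xi> r + (r * deriv \<xi> r - \<xi> r)"

lemma excess_nonneg: "x \<in> {-1..1} \<Longrightarrow> r \<in> {0..1} \<Longrightarrow> 0 \<le> excess r x"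
  using tangent[of x r] by (simp add: excess_def algebra_simps)

lemma excess_diag:
  assumes "0 \<le> q" "q \<le> r" "r \<le> 1" shows "excess r q \<le> (r - q) * deriv \<xi> 1"
proof -
  have "\<xi> q + deriv \<xi> q * (r - q) \<le> \<xi> r" using tangent[of r q] assms by auto
  moreover have "0 \<le> deriv \<xi> q * (r - q)" using \<xi>1_nn[of q] assms by simp
  moreover have "(r - q) * deriv \<xi> r \<le> (r - q) * deriv \<xi> 1" using \<xi>1_le[of r 1] assms by (intro mult_left_mono) auto
  ultimately show ?thesis by (simp add: excess_def algebra_simps)
qed

text \<open>By convexity \<open>excess r\<close> decreases up to \<open>r\<close>, so the overlap
  \<open>R\<close> may be raised to the geometric mean of \<open>q\<close> and \<open>q'\<close>.
  There the linear parts compare by the inequality of arithmetic and geometric means, and the rest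
  is \<open>sqrt_bound\<close>.\<close>

lemma excess_offdiag:
  fixes R :: real
  assumes q: "0 \<le> q" "q \<le> r" "0 \<le> q'" "q' \<le> r" "r \<le> 1" and R: "R \<in> {-1..1}" "R \<le> sqrt (q * q')"
  shows "excess r q + excess r q' \<le> 2 * excess r R + L\<^sup>2 * (q - q')\<^sup>2"
proof -
  define s where "s = sqrt (q * q')"
  have s: "0 \<le> s" "s \<le> r" using q by (auto simp: s_def intro!: real_le_lsqrt mult_mono simp: power2_eq_square)
  have s2: "2 * s \<le> q + q'" using arith_geo_mean_sqrt[of q q'] q by (simp add: s_def)
  have t: "\<xi> s + deriv \<xi> s * (R - s) \<le> \<xi> R" using tangent[of R s] R s q by auto
  have "0 \<le> (deriv \<xi> s - deriv \<xi> r) * (R - s)"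
    using \<xi>1_le[of s r] s q R by (intro mult_nonpos_nonpos) (auto simp: s_def)
  with t have "excess r s \<le> excess r R" by (simp add: excess_def algebra_simps)
  moreover have "0 \<le> deriv \<xi> r * (q + q' - 2 * s)" using \<xi>1_nn[of r] q s2 by (intro mult_nonneg_nonneg) auto
  moreover have "\<xi> q + \<xi> q' - 2 * \<xi> s \<le> L\<^sup>2 * (q - q')\<^sup>2" using sqrt_bound[of q q'] q by (simp add: s_def)
  ultimately show ?thesis by (simp add: excess_def algebra_simps)
qed

text \<open>The last level pays for the variation of the self-overlap within the class.\<close>

lemma comparable_excess:
  assumes N: "N \<ge> 1" and I: "I \<subseteq> cube N" and r: "r \<le> 1" and q: "\<And>m. m \<in> I \<Longrightarrow> self_overlap N m \<le> r \<and> r - self_overlap N m \<le> \<Delta>"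
    and c: "0 < c" "c \<le> lam"
  shows "comparable I lam (c * (N * (\<Delta> * deriv \<xi> 1))) c (\<lambda>m m'. N * excess r (dotp N m m' / N))
    [(c, \<lambda>m. sqrt N * (L * (self_overlap N m - r)), False)]"
proof -
  let ?D = "\<lambda>m m'. N * excess r (dotp N m m' / N) + (if False then 1 else -1) * ((sqrt N * (L * (self_overlap N m - r))) * (sqrt N * (L * (self_overlap N m' - r))))"
  have sq: "sqrt (real N) * (a::real) * (sqrt N * b) = N * (a * b)" for a b
    using real_sqrt_mult_self[of "real N"] by (simp add: algebra_simps)
  have "comparable I lam (c * (N * (\<Delta> * deriv \<xi> 1))) c ?D []"
  proof (rule comparable_Nil)
    fix m m' assume m: "m \<in> I" "m' \<in> I"
    define e e' e'' u u' where "e = excess r (self_overlap N m)" and "e' = excess r (self_overlap N m')" and "e'' = excess r (dotp N m m' / N)"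
      and "u = L * (self_overlap N m - r)" and "u' = L * (self_overlap N m' - r)"
    have "e + e' \<le> 2 * e'' + L\<^sup>2 * (self_overlap N m - self_overlap N m')\<^sup>2"
      unfolding e_def e'_def e''_def by (rule excess_offdiag) (use overlap_bounds[OF N] m I q r in \<open>auto simp: subset_iff\<close>)
    \<comment> \<open>Polarisation: this error is exactly what subtracting the rank one covariance
      of the additional level removes.\<close>
    also have "L\<^sup>2 * (self_overlap N m - self_overlap N m')\<^sup>2 = u * u + u' * u' - 2 * (u * u')"
      unfolding u_def u'_def by (simp add: power2_eq_square algebra_simps)
    finally have "N * (e + e') \<le> N * (2 * e'' + (u * u + u' * u' - 2 * (u * u')))" by (rule mult_left_mono) simp
    then show "?D m m + ?D m' m' \<le> 2 * ?D m m'"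
      unfolding sq u_def[symmetric] u'_def[symmetric] e''_def[symmetric]
      by (simp add: self_overlap_def[symmetric] e_def[symmetric] e'_def[symmetric] algebra_simps)
  next
    fix m assume m: "m \<in> I"
    have b: "0 \<le> self_overlap N m" using overlap_bounds(2)[OF N] m I by force
    have "excess r (self_overlap N m) \<le> (r - self_overlap N m) * deriv \<xi> 1" by (rule excess_diag) (use b q[OF m] r in auto)
    also have "\<dots> \<le> \<Delta> * deriv \<xi> 1" by (rule mult_right_mono) (use q[OF m] \<xi>1_nn[of 1] in auto)
    finally have "N * excess r (self_overlap N m) \<le> N * (\<Delta> * deriv \<xi> 1)" by (rule mult_left_mono) simp
    moreover define t where "t = sqrt N * (L * (self_overlap N m - r))"
    moreover have "0 \<le> t * t" by (rule zero_le_square)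
    ultimately show "?D m m \<le> N * (\<Delta> * deriv \<xi> 1)"
      unfolding self_overlap_def[symmetric] t_def[symmetric] if_False by linarith
  qed (use c in auto)
  then show ?thesis using c by simp
qed

text \<open>The list of levels consists of the process, the tower up to the right end of the class,
  and the compensating level. \<open>C\<close> collects the errors: 1 for the softmax, the terms
  with \<open>ln 2\<close> and \<open>L\<close> for the compensating level, and the last for the
  diagonal. The exponent \<open>c 0\<close> is the same for every class.\<close>

lemma guerra_class_bound:
  fixes X :: "(nat \<Rightarrow> real) \<Rightarrow> 'w \<Rightarrow> real"
  assumes \<zeta>: "\<zeta> \<in> probs_on 0 1" and N: "N \<ge> 1" and I: "finite I" "I \<noteq> {}" "I \<subseteq> cube N"
    and j: "0 < j" "j \<le> 2 ^ n"
    and q: "\<And>m. m \<in> I \<Longrightarrow> self_overlap N m \<le> real j / 2 ^ n \<and> real j / 2 ^ n - self_overlap N m \<le> 1 / 2 ^ n"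
    and M: "prob_space M" and X: "\<And>u. centered_gaussian M (\<lambda>a. \<Sum>m\<in>I. u m * X m a)"
    and cov: "\<And>m m'. m \<in> I \<Longrightarrow> m' \<in> I \<Longrightarrow> (\<integral>a. X m a * X m' a \<partial>M) = N * \<xi> (dotp N m m' / N)"
  defines "c \<equiv> \<lambda>l. lev (cdf \<zeta>) n (Suc l)"
    and "b \<equiv> \<lambda>l. (real (Suc l) / 2 ^ n * deriv \<xi> (real (Suc l) / 2 ^ n) - \<xi> (real (Suc l) / 2 ^ n)) - (real l / 2 ^ n * deriv \<xi> (real l / 2 ^ n) - \<xi> (real l / 2 ^ n))"
    and "C \<equiv> 1 + ln 2 / lev (cdf \<zeta>) n 1 + N * (L / 2 ^ n)\<^sup>2 / 2 + N * deriv \<xi> 1 / 2 ^ n / 2"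
  shows "(\<integral>\<^sup>+a. ennreal (exp (c 0 * ((MAX m\<in>I. (\<Sum>i<N. lower_conj (node (cdf \<zeta>) n j) (m i)) + X m a) + (\<Sum>l<j. c l * (N * b l) / 2)))) \<partial>M)
    \<le> ennreal (exp (c 0 * (N * node (cdf \<zeta>) n 0 0 + C)))"
proof -
  note cc = cdf_conditions[OF \<zeta>]
  define f where "f = node (cdf \<zeta>) n"
  \<comment> \<open>The entropy cost \<open>ln (card I) / lam\<close> of the softmax is then at most
    1, and \<open>lam\<close> is at least every exponent.\<close>
  define lam where "lam = max 1 (ln (card I))"
  define r where "r l = real l / 2 ^ n" for l
  define a where "a l = deriv \<xi> (r (Suc l)) - deriv \<xi> (r l)" for l
  define D where "D l m m' = N * excess (r l) (dotp N m m' / N)" for l m m'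
  define v where "v m = sqrt N * (L * (self_overlap N m - r j))" for m
  define h where "h m = (\<Sum>i<N. lower_conj (f j) (m i))" for m :: "nat \<Rightarrow> real"
  define V where "V = sqrt N * (\<bar>L\<bar> * (1 / 2 ^ n))"
  have lam: "lam > 0" "lam \<ge> 1" "ln (card I) / lam \<le> 1" by (auto simp: lam_def divide_le_eq)
  note Il = I(1,2) lam(1)
  have rl: "0 \<le> r l" "l \<le> j \<Longrightarrow> r l \<le> 1" "r l \<le> r (Suc l)" for l
  proof -
    show "0 \<le> r l" "r l \<le> r (Suc l)" by (auto simp: r_def divide_right_mono)
    assume "l \<le> j"
    then have "real l \<le> 2 ^ n" using j by (metis le_trans of_nat_le_iff of_nat_numeral of_nat_power)
    then show "r l \<le> 1" by (simp add: r_def)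
  qed
  have c: "0 < c l" "c l \<le> c (Suc l)" "c l \<le> 1" "c 0 \<le> c l" for l
    unfolding c_def using lev_pos[OF cc] lev_mono[OF cc] lev_le[OF cc] by simp_all
  have b: "0 \<le> b l" if l: "l < j" for l
  proof -
    have "\<xi> (r (Suc l)) + deriv \<xi> (r (Suc l)) * (r l - r (Suc l)) \<le> \<xi> (r l)" using tangent[of "r l" "r (Suc l)"] rl[of l] rl[of "Suc l"] l by auto
    moreover have "0 \<le> r l * (deriv \<xi> (r (Suc l)) - deriv \<xi> (r l))" using \<xi>1_le[of "r l" "r (Suc l)"] rl[of l] rl[of "Suc l"] l by auto
    ultimately show ?thesis unfolding b_def r_def[symmetric] by (simp add: algebra_simps)
  qed
  have a: "0 \<le> a l" if "l < j" for l using \<xi>1_le[of "r l" "r (Suc l)"] rl[of l] rl[of "Suc l"] that by (auto simp: a_def)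
  have fl: "\<bar>f l x - f l y\<bar> \<le> \<bar>x - y\<bar>" if "1 \<le> l" "l \<le> j" for l x y
  proof -
    have "nice (lev (cdf \<zeta>) n l) (exp (Q * (deriv \<xi> 1 - deriv \<xi> (real l / 2 ^ n))) * (4 + 2 * (1 - lev (cdf \<zeta>) n l))) (f l)"
      unfolding f_def by (rule nice_node[OF cc that(1) order_trans[OF that(2) j(2)]])
    then show ?thesis using lev_pos[OF cc, of n l] by (intro nice_bounds(6)) auto
  qed
  have fs: "f l = cole_hopf (c l) (a l) (f (Suc l))" if "l < j" for l
    unfolding f_def c_def a_def r_def by (rule node_step[OF cc]) (use that j in auto)
  have fge: "ln (cosh x) \<le> f j x" for x unfolding f_def by (rule node_ge[OF cc j(2)])
  let ?last = "[(c (j - 1), v, False)]"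
  have Spos: "\<forall>x\<in>set ?last. 0 < fst x" using c by simp
  have PSD: "0 \<le> (\<Sum>m\<in>I. \<Sum>m'\<in>I. u m * u m' * (N * \<xi> (dotp N m m' / N)))" for u
  proof -
    have "0 \<le> (\<integral>a. (\<Sum>m\<in>I. u m * X m a)\<^sup>2 \<partial>M)" by (rule Bochner_Integration.integral_nonneg) simp
    also have "\<dots> = (\<Sum>m\<in>I. \<Sum>m'\<in>I. u m * u m' * (N * \<xi> (dotp N m m' / N)))"
      unfolding gaussian_family(2)[OF I(1) M X] by (intro sum.cong refl) (simp add: cov)
    finally show ?thesis .
  qed
  obtain d and W :: "nat \<Rightarrow> (nat \<Rightarrow> real) \<Rightarrow> real"
    where W: "\<And>m m'. m \<in> I \<Longrightarrow> m' \<in> I \<Longrightarrow> N * \<xi> (dotp N m m' / N) = (\<Sum>k<d. W k m * W k m')"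
    by (rule cholesky[OF I(1) _ PSD], simp add: dotp_def mult.commute, rule that, assumption)
  let ?T = "tower c b a N 0 j @ ?last" and ?W = "map (\<lambda>k. (W k, True)) (rev [0..<d])"
  have Tpos: "\<forall>x\<in>set ?T. 0 < fst x" by (rule tower_pos[OF c(1) Spos])
  \<comment> \<open>\<open>excess (r 0)\<close> is \<open>\<xi>\<close> itself, as
    \<open>\<xi>\<close> and its derivative vanish at 0; the tower starts from the covariance of the
    process.\<close>
  have cT: "comparable I lam (c (j - 1) * (N * (1 / 2 ^ n * deriv \<xi> 1))) (c 0) (D 0) ?T"
  proof -
    have "comparable I lam (c (j - 1) * (N * (1 / 2 ^ n * deriv \<xi> 1))) (c (0 - 1)) (D 0) ?T"
    proof (rule comparable_tower[where j=j])
      fix l m m' assume l: "l < j" and m: "m \<in> I" "m' \<in> I"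
      show "0 \<le> D l m m'" unfolding D_def
        by (rule mult_nonneg_nonneg[OF _ excess_nonneg]) (use overlap_bounds(1)[OF N] rl[of l] l m I in \<open>auto simp: subset_iff\<close>)
      have "N * (dotp N m m' / N) = dotp N m m'" using N by simp
      moreover have "N * excess (r (Suc l)) x = N * excess (r l) x + N * b l - a l * (N * x)" for x :: real
        unfolding excess_def b_def a_def r_def[symmetric] by (simp add: algebra_simps)
      ultimately show "D (Suc l) m m' = D l m m' + N * b l - a l * dotp N m m'" unfolding D_def by simp
    next
      show "comparable I lam (c (j - 1) * (N * (1 / 2 ^ n * deriv \<xi> 1))) (c (j - 1)) (D j) ?last"
        unfolding D_def v_def
        by (rule comparable_excess[OF N I(3)]) (use rl[of j] q c[of "j - 1"] lam(2) in \<open>auto simp: r_def\<close>)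
    qed (use a b c j in auto)
    then show ?thesis by simp
  qed
  \<comment> \<open>The process levels accumulate their covariance from 0 under the single exponent
    \<open>c 0\<close>, so no sign is asked of the partial sums.\<close>
  have comp: "comparable I lam (c (j - 1) * (N * (1 / 2 ^ n * deriv \<xi> 1))) (c 0) (\<lambda>_ _. 0) (levels (c 0) ?W @ ?T)"
  proof -
    have sum: "D 0 m m' = 0 + (\<Sum>(v, b)\<leftarrow>?W. (if b then 1 else -1) * (v m * v m'))" if "m \<in> I" "m' \<in> I" for m m'
      using W[OF that] zero by (simp add: D_def excess_def r_def comp_def rev_map[symmetric] sum_list_rev interv_sum_list_conv_sum_set_nat atLeast0LessThan)
    have T: "comparable I lam (c (j - 1) * (N * (1 / 2 ^ n * deriv \<xi> 1))) (c 0) (\<lambda>m m'. 0 + (\<Sum>(v, b)\<leftarrow>?W. (if b then 1 else -1) * (v m * v m'))) ?T"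
      by (rule comparable_cong[THEN iffD1, OF sum cT])
    show ?thesis
    proof (cases "?W = []")
      case False
      then show ?thesis using T c by (intro comparable_levels) auto
    qed (use T in \<open>auto simp: levels_def\<close>)
  qed
  have E: "c (j - 1) * (N * (1 / 2 ^ n * deriv \<xi> 1)) \<le> N * deriv \<xi> 1 / 2 ^ n"
    using mult_right_mono[OF c(3)[of "j - 1"], of "N * (1 / 2 ^ n * deriv \<xi> 1)"] \<xi>1_nn[of 1] by simp
  have V: "\<bar>v m\<bar> \<le> V" if "m \<in> I" for m
    unfolding v_def V_def abs_mult r_def by (intro mult_mono) (use q[OF that] in auto)
  \<comment> \<open>Inside all fields the points \<open>m\<close> disappear by the conjugate
    inequality. What remains is the softmax entropy and the compensating level, whose coefficient
    has modulus at most \<open>V\<close>.\<close>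
  have base: "nested I lam ?last 0 (\<lambda>m. h m + (\<Sum>i<N. m i * x i)) \<le> (1 + ln 2 / c 0 + N * (L / 2 ^ n)\<^sup>2 / 2) + (\<Sum>i<N. f j (x i))" for x
  proof -
    define B where "B = 1 + (\<Sum>i<N. f j (x i))"
    let ?c = "c (j - 1)"
    have c': "0 < ?c" "?c \<le> 1" "c 0 \<le> ?c" using c by auto
    have cV: "0 \<le> ?c * V" using c' by (simp add: V_def)
    have int: "integrable gauss (\<lambda>g. exp (?c * (B + V * \<bar>g\<bar>)))"
      using integrable_mult_right[OF integrable_gauss_exp_abs[OF cV], of "exp (?c * B)"] by (simp add: distrib_left exp_add mult.assoc)
    have "nested I lam ?last 0 (\<lambda>m. h m + (\<Sum>i<N. m i * x i)) \<le> ln (\<integral>g. exp (?c * (B + V * \<bar>g\<bar>)) \<partial>gauss) / ?c"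
    proof (rule nested_cos_0_le[OF Il _ c'(1) _ int])
      fix g
      have "softmax I lam (\<lambda>m. h m + (\<Sum>i<N. m i * x i) + g * v m) \<le> (\<Sum>i<N. f j (x i)) + V * \<bar>g\<bar> + ln (card I) / lam"
      proof (rule softmax_bounds(2)[OF Il])
        fix m assume m: "m \<in> I"
        have "\<bar>m i\<bar> \<le> 1" if "i < N" for i using m I that by (auto simp: cube_def abs_le_iff dest!: PiE_mem subsetD)
        then have "(\<Sum>i<N. lower_conj (f j) (m i) + m i * x i) \<le> (\<Sum>i<N. f j (x i))"
          by (intro sum_mono lower_conj_bounds(2) fge) auto
        then have "h m + (\<Sum>i<N. m i * x i) \<le> (\<Sum>i<N. f j (x i))" by (simp add: h_def sum.distrib)
        moreover have "\<bar>g * v m\<bar> \<le> V * \<bar>g\<bar>" using mult_left_mono[OF V[OF m], of "\<bar>g\<bar>"] by (simp add: abs_mult mult.commute)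
        ultimately show "h m + (\<Sum>i<N. m i * x i) + g * v m \<le> (\<Sum>i<N. f j (x i)) + V * \<bar>g\<bar>" by linarith
      qed
      then show "nested I lam [] 0 (\<lambda>m. h m + (\<Sum>i<N. m i * x i) + g * v m) \<le> B + V * \<bar>g\<bar>" using lam(3) by (simp add: B_def)
    qed simp
    \<comment> \<open>\<open>ln 2\<close> and the square come from the bound
      \<open>2 * exp (a\<^sup>2 / 2)\<close> for the exponential moment of
      \<open>\<bar>g\<bar>\<close>.\<close>
    also have "\<dots> \<le> (?c * B + (ln 2 + (?c * V)\<^sup>2 / 2)) / ?c"
    proof (rule divide_right_mono)
      have i: "integrable gauss (\<lambda>g. exp (?c * V * \<bar>g\<bar>))" by (rule integrable_gauss_exp_abs[OF cV])
      have eq: "(\<integral>g. exp (?c * (B + V * \<bar>g\<bar>)) \<partial>gauss) = exp (?c * B) * (\<integral>g. exp (?c * V * \<bar>g\<bar>) \<partial>gauss)"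
        by (simp add: distrib_left exp_add mult.assoc)
      have pos: "0 < (\<integral>g. exp (?c * V * \<bar>g\<bar>) \<partial>gauss)"
      proof -
        interpret prob_space gauss by (rule prob_space_gauss)
        have "(\<integral>g. exp (?c * V * \<bar>g\<bar>) \<partial>gauss) \<noteq> 0" by (subst integral_nonneg_eq_0_iff_AE) (use i in auto)
        moreover have "0 \<le> (\<integral>g. exp (?c * V * \<bar>g\<bar>) \<partial>gauss)" by (rule Bochner_Integration.integral_nonneg) simp
        ultimately show ?thesis by linarith
      qed
      have "ln (\<integral>g. exp (?c * V * \<bar>g\<bar>) \<partial>gauss) \<le> ln (2 * exp ((?c * V)\<^sup>2 / 2))"
        using pos integral_gauss_exp_abs_le[OF cV] by (subst ln_le_cancel_iff) auto
      then show "ln (\<integral>g. exp (?c * (B + V * \<bar>g\<bar>)) \<partial>gauss) \<le> ?c * B + (ln 2 + (?c * V)\<^sup>2 / 2)"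
        unfolding eq using pos by (simp add: ln_mult)
    qed (use c' in auto)
    also have "\<dots> = B + ln 2 / ?c + ?c * (V\<^sup>2 / 2)" using c' by (simp add: field_simps power2_eq_square)
    also have "\<dots> \<le> B + ln 2 / c 0 + V\<^sup>2 / 2"
    proof -
      have "ln 2 / ?c \<le> ln 2 / c 0" using c(1)[of 0] c' by (intro divide_left_mono) auto
      moreover have "?c * (V\<^sup>2 / 2) \<le> 1 * (V\<^sup>2 / 2)" by (rule mult_right_mono) (use c' in auto)
      ultimately show ?thesis by simp
    qed
    also have "V\<^sup>2 = N * (L / 2 ^ n)\<^sup>2" by (simp add: V_def power_mult_distrib power_divide)
    finally show ?thesis by (simp add: B_def)
  qed
  have "nested I lam ?T 0 (\<lambda>m. h m + (\<Sum>i<N. m i * 0)) \<le> (1 + ln 2 / c 0 + N * (L / 2 ^ n)\<^sup>2 / 2) + (\<Sum>i<N. f 0 0)"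
    by (rule nested_tower_0_le[OF Il Spos c(1) a fl fs base]) auto
  then have lower: "nested I lam ?T 0 h \<le> (1 + ln 2 / c 0 + N * (L / 2 ^ n)\<^sup>2 / 2) + N * f 0 0" by simp
  have drop: "nested I lam (levels (c 0) (map (\<lambda>k. (W k, True)) ks) @ ?T) 0 h = nested I lam ?T 0 h" for ks
    by (induction ks) (simp_all add: levels_def nested_sin_0[OF Il c(1)] del: nested.simps)
  have aux: "x \<le> y + t / 2 \<Longrightarrow> y \<le> A + B \<Longrightarrow> t \<le> u \<Longrightarrow> x \<le> B + (A + u / 2)" for x y t u A B :: real by linarith
  have Ceq: "C = 1 + ln 2 / c 0 + N * (L / 2 ^ n)\<^sup>2 / 2 + N * deriv \<xi> 1 / 2 ^ n / 2" by (simp add: C_def c_def)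
  have "nested I lam (levels (c 0) ?W @ ?T) (pi / 2) h \<le> nested I lam (levels (c 0) ?W @ ?T) 0 h + c (j - 1) * (N * (1 / 2 ^ n * deriv \<xi> 1)) / 2"
    by (rule guerra_comparison[OF Il comp])
  then have upper: "nested I lam (levels (c 0) ?W @ ?T) (pi / 2) h \<le> N * f 0 0 + C"
    unfolding drop Ceq by (rule aux[OF _ lower E])
  define K where "K = (\<Sum>l<j. c l * (N * b l) / 2)"
  \<comment> \<open>At this end the compensating level is switched off as well, so it never meets
    the process.\<close>
  have K: "nested I lam ?T (pi / 2) h = softmax I lam h + K" for h
    using nested_tower_pi_half[OF Il Spos c(1) b le0, where N=N and a=a and h=h] nested_cos_pi_half[OF Il c(1), where v=v and S="[]" and h=h]
    by (simp add: K_def atLeast0LessThan)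
  have "(\<integral>\<^sup>+a. ennreal (exp (c 0 * ((MAX m\<in>I. h m + X m a) + K))) \<partial>M) \<le> (\<integral>\<^sup>+a. ennreal (exp (c 0 * (softmax I lam (\<lambda>m. h m + X m a) + K))) \<partial>M)"
  proof (rule nn_integral_mono)
    fix a
    have "(MAX m\<in>I. h m + X m a) \<le> softmax I lam (\<lambda>m. h m + X m a)"
      using I softmax_bounds(1)[OF Il, where h="\<lambda>m. h m + X m a"] by (subst Max_le_iff) auto
    then show "ennreal (exp (c 0 * ((MAX m\<in>I. h m + X m a) + K))) \<le> ennreal (exp (c 0 * (softmax I lam (\<lambda>m. h m + X m a) + K)))"
      using c(1)[of 0] by (intro ennreal_leI) simp
  qed
  also have "\<dots> = ennreal (exp (c 0 * nested I lam (levels (c 0) ?W @ ?T) (pi / 2) h))"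
    by (rule nested_gaussian_process[OF Il Tpos c(1) K M X]) (simp add: cov W)
  also have "\<dots> \<le> ennreal (exp (c 0 * (N * f 0 0 + C)))"
    using upper c(1)[of 0] by (intro ennreal_leI) simp
  finally show ?thesis by (simp add: h_def K_def f_def)
qed

end

subsection \<open>The mixture\<close>

text \<open>For \<open>p >= 2\<close> the derivative of \<open>t ^ p\<close> on the unit interval is
  at most that of \<open>real p / 2 * t\<^sup>2\<close>. The right side is written in squares
  because \<open>u\<close> and \<open>v\<close> will be square roots of self-overlaps.\<close>

lemma power_diff_square_le:
  fixes u v :: real
  assumes "0 \<le> u" "u \<le> 1" "0 \<le> v" "v \<le> 1" "2 \<le> p"
  shows "(u ^ p - v ^ p)\<^sup>2 \<le> (real p / 2 * (u\<^sup>2 - v\<^sup>2))\<^sup>2"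
proof -
  have *: "\<bar>u ^ p - v ^ p\<bar> \<le> real p / 2 * (u\<^sup>2 - v\<^sup>2)" if "0 \<le> v" "v \<le> u" "u \<le> 1" for u v :: real
  proof -
    have "real p / 2 * v\<^sup>2 - v ^ p \<le> real p / 2 * u\<^sup>2 - u ^ p"
    proof (rule DERIV_nonneg_imp_nondecreasing[OF that(2)])
      fix t assume t: "v \<le> t" "t \<le> u"
      have "t ^ (p - 1) \<le> t ^ 1" using t that assms(5) by (intro power_decreasing) auto
      then have "real p * t ^ (p - 1) \<le> real p * t" by (intro mult_left_mono) auto
      moreover have "((\<lambda>t. real p / 2 * t\<^sup>2 - t ^ p) has_real_derivative real p * t - real p * t ^ (p - 1)) (at t)"
        by (auto intro!: derivative_eq_intros)
      ultimately show "\<exists>y. ((\<lambda>t. real p / 2 * t\<^sup>2 - t ^ p) has_real_derivative y) (at t) \<and> 0 \<le> y" by force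
    qed
    moreover have "v ^ p \<le> u ^ p" using that by (intro power_mono) auto
    ultimately show ?thesis by (simp add: algebra_simps)
  qed
  show ?thesis
  proof (cases "v \<le> u")
    case True
    then show ?thesis using *[of v u] assms by (intro power2_le_iff_abs_le[THEN iffD2]) (auto simp: abs_mult)
  next
    case False
    then have "(v ^ p - u ^ p)\<^sup>2 \<le> (real p / 2 * (v\<^sup>2 - u\<^sup>2))\<^sup>2"
      using *[of u v] assms by (intro power2_le_iff_abs_le[THEN iffD2]) (auto simp: abs_mult)
    then show ?thesis by (simp add: power2_commute[of "u ^ p"] power_mult_distrib power_divide power2_commute[of "u\<^sup>2"])
  qed
qed

context
  fixes \<beta> :: "nat \<Rightarrow> real"
  assumes radius: "conv_radius (mixture_coeff \<beta>) > 1" and convex: "strictly_convex_on {-1..1} (mixture \<beta>)"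
begin

private abbreviation (input) "a \<equiv> mixture_coeff \<beta>"

text \<open>A radius strictly beyond 1 makes \<open>-1\<close> and \<open>1\<close> interior, so
  that two-sided derivatives exist on the closed interval.\<close>

lemma mixture_radius: obtains K where "K > 1" "\<And>x. \<bar>x\<bar> < K \<Longrightarrow> summable (\<lambda>p. a p * x ^ p)"
proof -
  obtain K where "1 < ereal K" "ereal K < conv_radius a" using ereal_dense2[OF radius] by auto
  moreover have "summable (\<lambda>p. a p * x ^ p)" if "\<bar>x\<bar> < K" for x
    by (rule summable_in_conv_radius, rule less_trans[of _ "ereal K"]) (use that \<open>ereal K < _\<close> in auto)
  ultimately show ?thesis using that[of K] by auto
qed

lemma mixture_derivatives:
  assumes x: "x \<in> {-1..1}"
  shows "summable (\<lambda>p. a p * x ^ p)" "summable (\<lambda>p. diffs (diffs a) p * x ^ p)"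
    "(mixture \<beta> has_real_derivative deriv (mixture \<beta>) x) (at x)"
    "deriv (mixture \<beta>) x = (\<Sum>p. diffs a p * x ^ p)"
    "(deriv (mixture \<beta>) has_real_derivative deriv (deriv (mixture \<beta>)) x) (at x)"
    "deriv (deriv (mixture \<beta>)) x = (\<Sum>p. diffs (diffs a) p * x ^ p)"
    "isCont (\<lambda>x. \<Sum>p. diffs (diffs a) p * x ^ p) x"
proof -
  obtain K where K: "K > 1" "\<And>x. \<bar>x\<bar> < K \<Longrightarrow> summable (\<lambda>p. a p * x ^ p)" by (rule mixture_radius) (rule that)
  have xK: "\<bar>x\<bar> < K" using x K(1) by auto
  have s1: "summable (\<lambda>p. diffs a p * x ^ p)" if "\<bar>x\<bar> < K" for x by (rule termdiff_converges[of x K]) (use that K in auto)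
  have s2: "summable (\<lambda>p. diffs (diffs a) p * x ^ p)" if "\<bar>x\<bar> < K" for x by (rule termdiff_converges[of x K]) (use that s1 in auto)
  have d1: "(mixture \<beta> has_real_derivative (\<Sum>p. diffs a p * x ^ p)) (at x)" if "\<bar>x\<bar> < K" for x
    unfolding mixture_def[abs_def] by (rule termdiffs_strong'[of K]) (use that K in auto)
  have e1: "deriv (mixture \<beta>) x = (\<Sum>p. diffs a p * x ^ p)" if "\<bar>x\<bar> < K" for x by (rule DERIV_imp_deriv[OF d1[OF that]])
  have d2: "(deriv (mixture \<beta>) has_real_derivative (\<Sum>p. diffs (diffs a) p * x ^ p)) (at x)" if "\<bar>x\<bar> < K" for x
  proof (rule has_field_derivative_transform_within_open[where S="{-K<..<K}"])
    show "((\<lambda>x. \<Sum>p. diffs a p * x ^ p) has_real_derivative (\<Sum>p. diffs (diffs a) p * x ^ p)) (at x)"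
      by (rule termdiffs_strong'[of K]) (use that s1 in auto)
  qed (use that e1 in auto)
  have d3: "((\<lambda>x. \<Sum>p. diffs (diffs a) p * x ^ p) has_real_derivative (\<Sum>p. diffs (diffs (diffs a)) p * x ^ p)) (at x)"
    by (rule termdiffs_strong'[of K]) (use xK s2 in auto)
  show "summable (\<lambda>p. a p * x ^ p)" "summable (\<lambda>p. diffs (diffs a) p * x ^ p)"
    "deriv (mixture \<beta>) x = (\<Sum>p. diffs a p * x ^ p)" using K s2 e1 xK by auto
  show "(mixture \<beta> has_real_derivative deriv (mixture \<beta>) x) (at x)" using d1[OF xK] e1[OF xK] by simp
  show e2: "deriv (deriv (mixture \<beta>)) x = (\<Sum>p. diffs (diffs a) p * x ^ p)" by (rule DERIV_imp_deriv[OF d2[OF xK]])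
  show "(deriv (mixture \<beta>) has_real_derivative deriv (deriv (mixture \<beta>)) x) (at x)" using d2[OF xK] e2 by simp
  show "isCont (\<lambda>x. \<Sum>p. diffs (diffs a) p * x ^ p) x" by (rule DERIV_isCont[OF d3])
qed

lemma diffs2_mixture_coeff: "diffs (diffs a) p = (real p + 1) * (real p + 2) * a (p + 2)" "0 \<le> diffs (diffs a) p"
  by (simp_all add: diffs_def mixture_coeff_def algebra_simps)

text \<open>If the tangent at \<open>r\<close> exceeded the function at \<open>x\<close>, then the
  function would start above its chord on the segment from \<open>r\<close> to
  \<open>x\<close>.\<close>

lemma mixture_tangent:
  assumes x: "x \<in> {-1..1}" and r: "r \<in> {-1..1}"
  shows "mixture \<beta> r + deriv (mixture \<beta>) r * (x - r) \<le> mixture \<beta> x"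
proof (rule ccontr)
  assume "\<not> ?thesis"
  then have pos: "0 < deriv (mixture \<beta>) r * (x - r) - (mixture \<beta> x - mixture \<beta> r)" by simp
  define k where "k t = mixture \<beta> (r + t * (x - r)) - t * (mixture \<beta> x - mixture \<beta> r)" for t
  have "((\<lambda>t. mixture \<beta> (r + t * (x - r))) has_real_derivative deriv (mixture \<beta>) r * (x - r)) (at 0)"
    by (rule DERIV_chain2[where f="mixture \<beta>"]) (use mixture_derivatives(3)[OF r] in \<open>auto intro!: derivative_eq_intros\<close>)
  then have "(k has_real_derivative deriv (mixture \<beta>) r * (x - r) - (mixture \<beta> x - mixture \<beta> r)) (at 0)"
    unfolding k_def by (auto intro!: derivative_eq_intros)
  from DERIV_pos_inc_right[OF this pos] obtain d where d: "d > 0" "\<And>h. 0 < h \<Longrightarrow> h < d \<Longrightarrow> k 0 < k (0 + h)" by blast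
  define t where "t = min (d / 2) (1 / 2)"
  have t: "0 < t" "t < d" "t < 1" using d(1) by (auto simp: t_def)
  have "k t \<le> k 0"
  proof (cases "x = r")
    case False
    have "mixture \<beta> ((1 - t) * r + t * x) < (1 - t) * mixture \<beta> r + t * mixture \<beta> x"
      by (rule convex[unfolded strictly_convex_on_def, THEN conjunct2, rule_format, OF r x]) (use t False in auto)
    then show ?thesis by (simp add: k_def algebra_simps)
  qed (simp add: k_def)
  then show False using d(2)[OF t(1,2)] by simp
qed

text \<open>For each power, \<open>q ^ p + q' ^ p - 2 * sqrt (q * q') ^ p\<close> is the square of
  \<open>sqrt q ^ p - sqrt q' ^ p\<close>. It is at most \<open>p\<^sup>2 / 4\<close>, hence for
  \<open>p >= 2\<close> at most \<open>p * (p - 1) / 2\<close>, times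
  \<open>(q - q')\<^sup>2\<close>. Summing \<open>p * (p - 1)\<close> against the coefficients gives
  the second derivative at 1, whence the constant.\<close>

lemma guerra_mixture_mixture: "guerra_mixture (mixture \<beta>) (sqrt (deriv (deriv (mixture \<beta>)) 1 / 2))"
proof unfold_locales
  let ?\<xi> = "mixture \<beta>"
  have n0: "a p \<ge> 0" for p by (simp add: mixture_coeff_def)
  show "x \<in> {-1..1} \<Longrightarrow> (?\<xi> has_real_derivative deriv ?\<xi> x) (at x)" for x by (rule mixture_derivatives(3))
  show "x \<in> {-1..1} \<Longrightarrow> (deriv ?\<xi> has_real_derivative deriv (deriv ?\<xi>) x) (at x)" for x by (rule mixture_derivatives(5))
  have "continuous_on {0..1} (\<lambda>x. \<Sum>p. diffs (diffs a) p * x ^ p)"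
    using mixture_derivatives(7) by (intro continuous_at_imp_continuous_on) auto
  moreover have "continuous_on {0..1} (deriv (deriv ?\<xi>)) \<longleftrightarrow> continuous_on {0..1} (\<lambda>x. \<Sum>p. diffs (diffs a) p * x ^ p)"
    by (rule continuous_on_cong) (use mixture_derivatives(6) in auto)
  ultimately show "continuous_on {0..1} (deriv (deriv ?\<xi>))" by simp
  show z: "?\<xi> 0 = 0" "deriv ?\<xi> 0 = 0"
    using mixture_derivatives(4)[of 0] by (simp_all add: mixture_def powser_zero mixture_coeff_def diffs_def)
  show "0 < deriv (deriv ?\<xi>) x" if x: "0 < x" "x \<le> 1" for x
  proof -
    \<comment> \<open>Strict convexity excludes the zero mixture, and one positive coefficient
      already makes the second derivative positive at positive points.\<close>
    have "\<exists>p. a p \<noteq> 0"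
    proof (rule ccontr)
      assume "\<nexists>p. a p \<noteq> 0"
      then have "?\<xi> x = 0" for x by (simp add: mixture_def)
      moreover have "?\<xi> ((1 - 1 / 2) * 0 + 1 / 2 * 1) < (1 - 1 / 2) * ?\<xi> 0 + 1 / 2 * ?\<xi> 1"
        using convex[unfolded strictly_convex_on_def, THEN conjunct2, rule_format, of 0 1 "1 / 2"] by simp
      ultimately show False by simp
    qed
    then obtain p where p: "a p \<noteq> 0" by blast
    then have "2 \<le> p" by (auto simp: mixture_coeff_def split: if_splits)
    then obtain k where k: "p = k + 2" by (metis le_add_diff_inverse2)
    have "0 < a p" using p n0[of p] by simp
    then have "0 < diffs (diffs a) k * x ^ k" using x by (simp add: diffs2_mixture_coeff k)
    then have "0 < (\<Sum>p. diffs (diffs a) p * x ^ p)"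
      by (intro suminf_pos2[of _ k]) (use mixture_derivatives(2)[of x] diffs2_mixture_coeff(2) x in auto)
    then show ?thesis using mixture_derivatives(6)[of x] x by simp
  qed
  show "0 \<le> deriv (deriv ?\<xi>) 0" using mixture_derivatives(6)[of 0] diffs2_mixture_coeff(2)[of 0] by simp
  show "?\<xi> r + deriv ?\<xi> r * (x - r) \<le> ?\<xi> x" if "x \<in> {-1..1}" "r \<in> {0..1}" for x r
    by (rule mixture_tangent) (use that in auto)
  fix q q' :: real assume q: "q \<in> {0..1}" "q' \<in> {0..1}"
  have d1: "deriv (deriv ?\<xi>) 1 = (\<Sum>p. diffs (diffs a) p)" "summable (diffs (diffs a))"
    using mixture_derivatives(2,6)[of 1] by simp_all
  have low: "a i * x ^ i = 0" if "i < 2" for i x using that by (simp add: mixture_coeff_def)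
  have shift: "summable (\<lambda>p. a (p + 2) * x ^ (p + 2))" "?\<xi> x = (\<Sum>p. a (p + 2) * x ^ (p + 2))" if "x \<in> {-1..1}" for x
    using mixture_derivatives(1)[OF that] summable_iff_shift[of "\<lambda>p. a p * x ^ p" 2] suminf_split_initial_segment[of "\<lambda>p. a p * x ^ p" 2]
    by (simp_all add: mixture_def low)
  define s where "s = sqrt (q * q')"
  have s: "s \<in> {-1..1}" "q \<in> {-1..1}" "q' \<in> {-1..1}" using q by (auto simp: s_def mult_le_one intro: order_trans[of "-1" 0])
  have "?\<xi> q + ?\<xi> q' - 2 * ?\<xi> s = (\<Sum>p. a (p + 2) * q ^ (p + 2) + a (p + 2) * q' ^ (p + 2) - 2 * (a (p + 2) * s ^ (p + 2)))"
    unfolding shift(2)[OF s(1)] shift(2)[OF s(2)] shift(2)[OF s(3)]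
    by (rule sums_unique, intro sums_diff sums_add sums_mult summable_sums shift(1) s)
  also have "\<dots> \<le> (\<Sum>p. diffs (diffs a) p * ((q - q')\<^sup>2 / 2))"
  proof (rule suminf_le)
    fix p
    let ?u = "sqrt q" and ?v = "sqrt q'"
    have "(?u ^ (p + 2) - ?v ^ (p + 2))\<^sup>2 \<le> (real (p + 2) / 2 * (?u\<^sup>2 - ?v\<^sup>2))\<^sup>2" by (rule power_diff_square_le) (use q in auto)
    also have "\<dots> = (real p + 2) * (real p + 2) / 4 * (q - q')\<^sup>2" using q by (simp add: power_mult_distrib power2_eq_square add.commute)
    also have "\<dots> \<le> (real p + 1) * (real p + 2) / 2 * (q - q')\<^sup>2" by (intro mult_right_mono) (auto simp: field_simps)
    finally have 1: "(?u ^ (p + 2) - ?v ^ (p + 2))\<^sup>2 \<le> (real p + 1) * (real p + 2) * ((q - q')\<^sup>2 / 2)" by simp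
    have sq: "(x ^ k)\<^sup>2 = (x\<^sup>2) ^ k" for x :: real and k by (simp add: power_mult[symmetric] mult.commute)
    have "(?u ^ (p + 2) - ?v ^ (p + 2))\<^sup>2 = q ^ (p + 2) + q' ^ (p + 2) - 2 * s ^ (p + 2)"
      unfolding power2_diff sq s_def real_sqrt_mult power_mult_distrib using q by (simp only: real_sqrt_pow2 atLeastAtMost_iff)
    then have "a (p + 2) * q ^ (p + 2) + a (p + 2) * q' ^ (p + 2) - 2 * (a (p + 2) * s ^ (p + 2)) = a (p + 2) * (?u ^ (p + 2) - ?v ^ (p + 2))\<^sup>2"
      by (simp only:) (simp add: algebra_simps)
    also have "\<dots> \<le> a (p + 2) * ((real p + 1) * (real p + 2) * ((q - q')\<^sup>2 / 2))" by (rule mult_left_mono[OF 1 n0])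
    finally show "a (p + 2) * q ^ (p + 2) + a (p + 2) * q' ^ (p + 2) - 2 * (a (p + 2) * s ^ (p + 2)) \<le> diffs (diffs a) p * ((q - q')\<^sup>2 / 2)"
      by (simp only: diffs2_mixture_coeff mult_ac)
  next
    show "summable (\<lambda>p. a (p + 2) * q ^ (p + 2) + a (p + 2) * q' ^ (p + 2) - 2 * (a (p + 2) * s ^ (p + 2)))"
      using shift(1)[OF s(1)] shift(1)[OF s(2)] shift(1)[OF s(3)] by (intro summable_add summable_diff summable_mult)
    show "summable (\<lambda>p. diffs (diffs a) p * ((q - q')\<^sup>2 / 2))" by (rule summable_mult2[OF d1(2)])
  qed
  also have "\<dots> = deriv (deriv ?\<xi>) 1 / 2 * (q - q')\<^sup>2" unfolding suminf_mult2[OF d1(2), symmetric] d1(1) by simp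
  also have "\<dots> = (sqrt (deriv (deriv ?\<xi>) 1 / 2))\<^sup>2 * (q - q')\<^sup>2"
    using d1 diffs2_mixture_coeff(2) suminf_nonneg[OF d1(2)] by simp
  finally show "?\<xi> q + ?\<xi> q' - 2 * ?\<xi> (sqrt (q * q')) \<le> (sqrt (deriv (deriv ?\<xi>) 1 / 2))\<^sup>2 * (q - q')\<^sup>2" by (simp add: s_def)
qed

end

subsection \<open>The TAP free energy\<close>

lemma cube_abs_le: "m \<in> cube N \<Longrightarrow> i < N \<Longrightarrow> \<bar>m i\<bar> \<le> 1"
  by (auto simp: cube_def abs_le_iff dest!: PiE_mem)

lemma zero_in_cube: "(\<lambda>i\<in>{..<N}. 0) \<in> cube N"
  by (auto simp: cube_def)

text \<open>Extensional functions take the fixed value \<open>undefined\<close> outside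
  \<open>{..<N}\<close>, so the cube is a product of compact sets over all natural numbers.\<close>

lemma compact_cube: "compact (cube N)"
proof -
  have eq: "cube N = Pi\<^sub>E UNIV (\<lambda>i. if i < N then {-1..1} else {undefined})"
    by (fastforce simp: cube_def PiE_def Pi_def extensional_def split: if_splits)
  have "compactin (product_topology (\<lambda>i. euclidean) UNIV) (cube N)"
    unfolding eq compactin_PiE by auto
  then show ?thesis by (simp add: euclidean_product_topology)
qed

text \<open>The hypothesis is upper semicontinuity in the form in which an infimum of continuous
  functions has it. If every \<open>m\<close> were beaten by some \<open>y m\<close>, then
  \<open>g m\<close> would stay below \<open>F (y m)\<close> near \<open>m\<close>, and the best of
  the finitely many points \<open>y m\<close> of a subcover would be beaten by another of
  them.\<close>

lemma dominated_attains_maximum: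
  fixes F :: "'a::topological_space \<Rightarrow> real"
  assumes S: "compact S" "S \<noteq> {}"
    and dom: "\<And>m e. m \<in> S \<Longrightarrow> 0 < e \<Longrightarrow> \<exists>g. continuous_on S g \<and> (\<forall>x\<in>S. F x \<le> g x) \<and> g m < F m + e"
  shows "\<exists>m\<in>S. \<forall>x\<in>S. F x \<le> F m"
proof (rule ccontr)
  assume "\<not> ?thesis"
  then have "\<forall>m\<in>S. \<exists>y. y \<in> S \<and> F m < F y" by (simp add: not_le) blast
  from bchoice[OF this] obtain y where y: "\<And>m. m \<in> S \<Longrightarrow> y m \<in> S" "\<And>m. m \<in> S \<Longrightarrow> F m < F (y m)" by blast
  have "\<exists>g. continuous_on S g \<and> (\<forall>x\<in>S. F x \<le> g x) \<and> g m < F (y m)" if "m \<in> S" for m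
    using dom[OF that, of "F (y m) - F m"] y(2)[OF that] by simp
  then obtain g where g: "\<And>m. m \<in> S \<Longrightarrow> continuous_on S (g m)" "\<And>m x. m \<in> S \<Longrightarrow> x \<in> S \<Longrightarrow> F x \<le> g m x" "\<And>m. m \<in> S \<Longrightarrow> g m m < F (y m)"
    by metis
  have "\<exists>U. open U \<and> U \<inter> S = {x\<in>S. g m x < F (y m)}" if "m \<in> S" for m
  proof -
    have "openin (top_of_set S) (S \<inter> g m -` {..<F (y m)})" by (rule continuous_openin_preimage_gen[OF g(1)[OF that]]) simp
    then obtain U where "open U" "S \<inter> g m -` {..<F (y m)} = S \<inter> U" by (auto simp: openin_open)
    then show ?thesis by (intro exI[of _ U]) auto
  qed
  then obtain U where U: "\<And>m. m \<in> S \<Longrightarrow> open (U m)" "\<And>m. m \<in> S \<Longrightarrow> U m \<inter> S = {x\<in>S. g m x < F (y m)}" by metis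
  have cover: "S \<subseteq> (\<Union>m\<in>S. U m)" using U(2) g(3) by blast
  obtain C where C: "C \<subseteq> S" "finite C" "S \<subseteq> (\<Union>m\<in>C. U m)" by (rule compactE_image[OF S(1) U(1) cover])
  then have "C \<noteq> {}" using S(2) by auto
  then have "Max ((\<lambda>c. F (y c)) ` C) \<in> (\<lambda>c. F (y c)) ` C" using C(2) by (intro Max_in) auto
  then obtain m where m: "m \<in> C" "Max ((\<lambda>c. F (y c)) ` C) = F (y m)" by blast
  have ym: "y m \<in> S" using m C y by auto
  then obtain c where c: "c \<in> C" "y m \<in> U c" using C(3) by auto
  then have cS: "c \<in> S" using C(1) by auto
  have "y m \<in> {x\<in>S. g c x < F (y c)}" using U(2)[OF cS] c ym by blast
  then have "F (y m) < F (y c)" using g(2)[OF cS ym] by simp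
  moreover have "F (y c) \<le> F (y m)" unfolding m(2)[symmetric] using C(2) c(1) by (intro Max_ge) auto
  ultimately show False by simp
qed

text \<open>As \<open>F\<close> need not be continuous, \<open>D\<close> comes from a dense subset of its graph.\<close>

lemma countable_graph_dense:
  fixes F :: "'a::{metric_space, second_countable_topology} \<Rightarrow> real"
  obtains D where "countable D" "D \<subseteq> S"
    "\<And>m h e. m \<in> S \<Longrightarrow> continuous_on S h \<Longrightarrow> 0 < e \<Longrightarrow> \<exists>d\<in>D. h m + F m < h d + F d + e"
proof -
  let ?G = "(\<lambda>x. (x, F x)) ` S"
  obtain T where T: "countable T" "T \<subseteq> ?G" "?G \<subseteq> closure T" by (rule separable)
  show ?thesis
  proof (rule that[of "fst ` T"])
    show "countable (fst ` T)" using T by simp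
    show "fst ` T \<subseteq> S" using T by auto
    fix m and h :: "'a \<Rightarrow> real" and e :: real assume m: "m \<in> S" and h: "continuous_on S h" and e: "0 < e"
    then obtain d where d: "d > 0" "\<And>x. x \<in> S \<Longrightarrow> dist x m < d \<Longrightarrow> dist (h x) (h m) < e / 2"
      using h[unfolded continuous_on_iff, rule_format, OF m, of "e / 2"] by auto
    have "(m, F m) \<in> closure T" using T m by auto
    then obtain p where p: "p \<in> T" "dist p (m, F m) < min d (e / 2)"
      unfolding closure_approachable using d(1) e by (metis half_gt_zero min_less_iff_conj)
    then obtain x where x: "x \<in> S" "p = (x, F x)" using T by auto
    have "dist x m < d" "dist (F x) (F m) < e / 2"
      using p(2) dist_fst_le[of p "(m, F m)"] dist_snd_le[of p "(m, F m)"] by (auto simp: x)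
    then have "dist (h x) (h m) < e / 2" "dist (F x) (F m) < e / 2" using d x by auto
    then have "h m + F m < h x + F x + e" unfolding dist_real_def by linarith
    then show "\<exists>d\<in>fst ` T. h m + F m < h d + F d + e" using p x by force
  qed
qed

lemma maximum_on_eq:
  assumes "m \<in> S" "\<And>x. x \<in> S \<Longrightarrow> f x \<le> f m" shows "maximum_on S f = f m"
  unfolding maximum_on_def by (rule Greatest_equality) (use assms in auto)

lemma probs_on_subset: assumes "q \<ge> a" "\<eta> \<in> probs_on q 1" shows "\<eta> \<in> probs_on a 1"
proof -
  interpret prob_space \<eta> using assms by (simp add: probs_on_def)
  have "measure \<eta> {q..1} \<le> measure \<eta> {a..1}" using assms by (intro finite_measure_mono) (auto simp: probs_on_def)
  then show ?thesis using assms antisym[OF prob_le_1[of "{a..1}"]] by (auto simp: probs_on_def)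
qed

lemma probs_on_nonempty: "q \<le> 1 \<Longrightarrow> return borel 1 \<in> probs_on q 1"
  by (auto simp: probs_on_def measure_return intro!: prob_space_return)

lemma probs_on_push:
  assumes \<zeta>: "\<zeta> \<in> probs_on 0 1" and q: "q \<in> {0..1}"
  obtains \<eta> where "\<eta> \<in> probs_on q 1" "\<And>s. q \<le> s \<Longrightarrow> cdf \<eta> s = cdf \<zeta> s"
proof (rule that[of "distr \<zeta> borel (max q)"])
  interpret prob_space \<zeta> using \<zeta> by (simp add: probs_on_def)
  have sets: "sets \<zeta> = sets borel" "space \<zeta> = UNIV" using \<zeta> sets_eq_imp_space_eq[of \<zeta> borel] by (auto simp: probs_on_def)
  have m: "max q \<in> measurable \<zeta> borel" by (simp add: measurable_cong_sets[OF sets(1) refl])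
  have "measure \<zeta> {0..1} \<le> measure \<zeta> (max q -` {q..1})"
    using q by (intro finite_measure_mono) (auto simp: sets measurable_sets[OF m, simplified sets] vimage_def)
  then have "measure \<zeta> (max q -` {q..1}) = 1" using \<zeta> antisym[OF prob_le_1[of "max q -` {q..1}"]] by (auto simp: probs_on_def)
  then show "distr \<zeta> borel (max q) \<in> probs_on q 1"
    using m by (auto simp: probs_on_def measure_distr sets intro!: prob_space_distr)
  fix s assume s: "q \<le> s"
  have "max q -` {..s} = {..s}" using s by auto
  then show "cdf (distr \<zeta> borel (max q)) s = cdf \<zeta> s" using m by (simp add: cdf_def measure_distr sets)
qed

context guerra_mixture
begin

text \<open>The part of the functional beside the Hamiltonian. A measure on \<open>[0, 1]\<close>
  can index all \<open>m\<close> at once, as only its distribution function above the self-overlap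
  is seen.\<close>

definition dual :: "real measure \<Rightarrow> nat \<Rightarrow> (nat \<Rightarrow> real) \<Rightarrow> real" where
  "dual \<zeta> N m = (\<Sum>i<N. lower_conj (Phi (cdf \<zeta>) (self_overlap N m)) (m i)) - real N / 2 * pen \<zeta> (self_overlap N m)"

lemma F_TAP_at_eq:
  assumes "\<zeta> \<in> probs_on 0 1" "N \<ge> 1" "m \<in> cube N" "\<eta> \<in> probs_on (self_overlap N m) 1"
    and "\<And>s. self_overlap N m \<le> s \<Longrightarrow> cdf \<eta> s = cdf \<zeta> s"
  shows "F_TAP_at \<xi> N h \<eta> m = h m + dual \<zeta> N m"
proof -
  have q: "0 \<le> self_overlap N m" "self_overlap N m \<in> {self_overlap N m..1}" using overlap_bounds(2)[OF assms(2,3,3)] by auto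
  have "Phi_star \<xi> (self_overlap N m) \<eta> a = lower_conj (Phi (cdf \<zeta>) (self_overlap N m)) a" for a
    unfolding Phi_star_def lower_conj_def by (simp add: parisi_Phi_eq[OF assms(1,4) q(1) assms(5) q(2)])
  then show ?thesis by (simp add: F_TAP_at_def dual_def penalty_eq[OF assms(1,4) q(1) assms(5)])
qed

lemma Phi_ge_ln_cosh: "\<zeta> \<in> probs_on 0 1 \<Longrightarrow> q \<in> {0..1} \<Longrightarrow> ln (cosh x) \<le> Phi (cdf \<zeta>) q x"
  by (rule Phi_ge[OF cdf_conditions])

text \<open>The bound does not depend on the measure, which makes the infimum over measures a
  genuine one.\<close>

lemma dual_ge:
  assumes \<zeta>: "\<zeta> \<in> probs_on 0 1" and N: "N \<ge> 1" and m: "m \<in> cube N"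
  shows "- (real N * ln 2) - real N / 2 * A2 \<le> dual \<zeta> N m"
proof -
  have q: "self_overlap N m \<in> {0..1}" using overlap_bounds(2)[OF N m m] .
  have "(\<Sum>i<N. - ln 2) \<le> (\<Sum>i<N. lower_conj (Phi (cdf \<zeta>) (self_overlap N m)) (m i))"
    by (intro sum_mono lower_conj_bounds(1) Phi_ge_ln_cosh[OF \<zeta> q]) (use cube_abs_le[OF m] in auto)
  moreover have "real N / 2 * pen \<zeta> (self_overlap N m) \<le> real N / 2 * A2" using pen_le[OF \<zeta>] q by (intro mult_left_mono) auto
  ultimately show ?thesis by (simp add: dual_def)
qed

lemma F_TAP_bdd_below:
  assumes "N \<ge> 1" "m \<in> cube N"
  shows "bdd_below ((\<lambda>\<eta>. F_TAP_at \<xi> N h \<eta> m) ` probs_on (self_overlap N m) 1)"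
proof (rule bdd_belowI2)
  have q: "0 \<le> self_overlap N m" using overlap_bounds(2)[OF assms(1,2,2)] by simp
  fix \<eta> assume \<eta>: "\<eta> \<in> probs_on (self_overlap N m) 1"
  then have "\<eta> \<in> probs_on 0 1" by (rule probs_on_subset[OF q])
  from F_TAP_at_eq[OF this assms \<eta> refl] dual_ge[OF this assms]
  show "h m + (- (real N * ln 2) - real N / 2 * A2) \<le> F_TAP_at \<xi> N h \<eta> m" by simp
qed

lemma F_TAP_le:
  assumes "\<zeta> \<in> probs_on 0 1" "N \<ge> 1" "m \<in> cube N"
  shows "F_TAP \<xi> N h m \<le> h m + dual \<zeta> N m"
proof -
  obtain \<eta> where \<eta>: "\<eta> \<in> probs_on (self_overlap N m) 1" "\<And>s. self_overlap N m \<le> s \<Longrightarrow> cdf \<eta> s = cdf \<zeta> s"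
    by (rule probs_on_push[OF assms(1) overlap_bounds(2)[OF assms(2,3,3)]]) (rule that)
  have "F_TAP \<xi> N h m \<le> F_TAP_at \<xi> N h \<eta> m"
    unfolding F_TAP_def by (rule cINF_lower[OF F_TAP_bdd_below[OF assms(2,3)] \<eta>(1)])
  then show ?thesis using F_TAP_at_eq[OF assms \<eta>] by simp
qed

lemma F_TAP_approx:
  assumes "N \<ge> 1" "m \<in> cube N" "e > 0"
  obtains \<zeta> where "\<zeta> \<in> probs_on 0 1" "h m + dual \<zeta> N m < F_TAP \<xi> N h m + e"
proof -
  have q: "0 \<le> self_overlap N m" "self_overlap N m \<le> 1" using overlap_bounds(2)[OF assms(1,2,2)] by auto
  have "F_TAP \<xi> N h m < F_TAP \<xi> N h m + e" using assms by simp
  then obtain \<eta> where \<eta>: "\<eta> \<in> probs_on (self_overlap N m) 1" "F_TAP_at \<xi> N h \<eta> m < F_TAP \<xi> N h m + e"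
    unfolding F_TAP_def using cINF_less_iff[OF _ F_TAP_bdd_below[OF assms(1,2)]] probs_on_nonempty[OF q(2)] by blast
  have \<zeta>: "\<eta> \<in> probs_on 0 1" by (rule probs_on_subset[OF q(1) \<eta>(1)])
  show ?thesis by (rule that[OF \<zeta>]) (use \<eta>(2) F_TAP_at_eq[OF \<zeta> assms(1,2) \<eta>(1) refl] in simp)
qed

text \<open>The Hamiltonian enters additively, so all randomness sits in \<open>h\<close> and the
  remaining function of \<open>m\<close> is deterministic.\<close>

lemma F_TAP_shift:
  assumes "N \<ge> 1" "m \<in> cube N"
  shows "F_TAP \<xi> N h m = h m + F_TAP \<xi> N (\<lambda>_. 0) m"
proof (rule antisym)
  show "F_TAP \<xi> N h m \<le> h m + F_TAP \<xi> N (\<lambda>_. 0) m"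
  proof (rule field_le_epsilon)
    fix e :: real assume "e > 0"
    then obtain \<zeta> where "\<zeta> \<in> probs_on 0 1" "0 + dual \<zeta> N m < F_TAP \<xi> N (\<lambda>_. 0) m + e" by (rule F_TAP_approx[OF assms, where h="\<lambda>_. 0"])
    then show "F_TAP \<xi> N h m \<le> h m + F_TAP \<xi> N (\<lambda>_. 0) m + e" using F_TAP_le[OF _ assms, of \<zeta> h] by simp
  qed
  show "h m + F_TAP \<xi> N (\<lambda>_. 0) m \<le> F_TAP \<xi> N h m"
  proof (rule field_le_epsilon)
    fix e :: real assume "e > 0"
    then obtain \<zeta> where "\<zeta> \<in> probs_on 0 1" "h m + dual \<zeta> N m < F_TAP \<xi> N h m + e" by (rule F_TAP_approx[OF assms])
    then show "h m + F_TAP \<xi> N (\<lambda>_. 0) m \<le> F_TAP \<xi> N h m + e" using F_TAP_le[OF _ assms, of \<zeta> "\<lambda>_. 0"] by simp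
  qed
qed

text \<open>A nearly optimal measure and nearly optimal points \<open>x i\<close>, chosen at
  \<open>m\<close> and then frozen, give an upper bound that is continuous in the point and almost
  sharp at \<open>m\<close>.\<close>

lemma F_TAP_dominated:
  assumes N: "N \<ge> 1" and m: "m \<in> cube N" and e: "e > 0" and h: "continuous_on (cube N) h"
  shows "\<exists>g. continuous_on (cube N) g \<and> (\<forall>x\<in>cube N. F_TAP \<xi> N h x \<le> g x) \<and> g m < F_TAP \<xi> N h m + e"
proof -
  have "e / 2 > 0" using e by simp
  then obtain \<zeta> where \<zeta>: "\<zeta> \<in> probs_on 0 1" "h m + dual \<zeta> N m < F_TAP \<xi> N h m + e / 2" by (rule F_TAP_approx[OF N m])
  have qc: "self_overlap N x \<in> {0..1}" if "x \<in> cube N" for x using overlap_bounds(2)[OF N that that] .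
  \<comment> \<open>The slack \<open>e / (2 * N)\<close> per coordinate adds up to
    \<open>e / 2\<close>.\<close>
  have "\<forall>i. \<exists>x. Phi (cdf \<zeta>) (self_overlap N m) x - m i * x \<le> lower_conj (Phi (cdf \<zeta>) (self_overlap N m)) (m i) + e / (2 * N)"
  proof
    fix i
    have "lower_conj (Phi (cdf \<zeta>) (self_overlap N m)) (m i) < lower_conj (Phi (cdf \<zeta>) (self_overlap N m)) (m i) + e / (2 * N)"
      using e N by simp
    from cInf_lessD[OF _ this[unfolded lower_conj_def[of _ "m i"]]]
    show "\<exists>x. Phi (cdf \<zeta>) (self_overlap N m) x - m i * x \<le> lower_conj (Phi (cdf \<zeta>) (self_overlap N m)) (m i) + e / (2 * N)"
      unfolding lower_conj_def by (auto intro: less_imp_le)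
  qed
  from choice[OF this] obtain x
    where x: "\<And>i. Phi (cdf \<zeta>) (self_overlap N m) (x i) - m i * x i \<le> lower_conj (Phi (cdf \<zeta>) (self_overlap N m)) (m i) + e / (2 * N)" by blast
  define g where "g m = h m + (\<Sum>i<N. Phi (cdf \<zeta>) (self_overlap N m) (x i) - m i * x i) - real N / 2 * pen \<zeta> (self_overlap N m)" for m
  have so: "continuous_on (cube N) (self_overlap N)"
    unfolding self_overlap_def[abs_def] dotp_def
    by (intro continuous_intros continuous_on_subset[OF continuous_on_product_coordinates]) (use N in auto)
  have "continuous_on (cube N) g"
    unfolding g_def
  proof (intro continuous_on_diff continuous_on_add continuous_on_sum h continuous_on_mult continuous_on_const)
    show "continuous_on (cube N) (\<lambda>m. pen \<zeta> (self_overlap N m))"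
      by (rule continuous_on_compose2[OF pen_continuous[OF \<zeta>(1)] so]) (use qc in auto)
    show "continuous_on (cube N) (\<lambda>m. Phi (cdf \<zeta>) (self_overlap N m) (x i))" for i
      by (rule continuous_on_compose2[OF Phi_continuous_time(1)[OF cdf_conditions[OF \<zeta>(1)]] so]) (use qc in auto)
    show "continuous_on (cube N) (\<lambda>m. m i)" for i by (rule continuous_on_subset[OF continuous_on_product_coordinates]) auto
  qed
  moreover have "F_TAP \<xi> N h y \<le> g y" if y: "y \<in> cube N" for y
  proof -
    have "lower_conj (Phi (cdf \<zeta>) (self_overlap N y)) (y i) + y i * x i \<le> Phi (cdf \<zeta>) (self_overlap N y) (x i)" if "i < N" for i
      by (rule lower_conj_bounds(2)[OF Phi_ge_ln_cosh[OF \<zeta>(1) qc[OF y]] cube_abs_le[OF y that]])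
    then have "(\<Sum>i<N. lower_conj (Phi (cdf \<zeta>) (self_overlap N y)) (y i)) \<le> (\<Sum>i<N. Phi (cdf \<zeta>) (self_overlap N y) (x i) - y i * x i)"
      by (intro sum_mono) (simp add: le_diff_eq)
    then show ?thesis using F_TAP_le[OF \<zeta>(1) N y, of h] by (simp add: g_def dual_def)
  qed
  moreover have "g m < F_TAP \<xi> N h m + e"
  proof -
    have "(\<Sum>i<N. Phi (cdf \<zeta>) (self_overlap N m) (x i) - m i * x i) \<le> (\<Sum>i<N. lower_conj (Phi (cdf \<zeta>) (self_overlap N m)) (m i) + e / (2 * N))"
      by (rule sum_mono) (rule x)
    also have "\<dots> = (\<Sum>i<N. lower_conj (Phi (cdf \<zeta>) (self_overlap N m)) (m i)) + e / 2" using N by (simp add: sum.distrib)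
    finally show ?thesis using \<zeta>(2) by (simp add: g_def dual_def)
  qed
  ultimately show ?thesis by blast
qed

lemma F_TAP_attains_maximum:
  assumes N: "N \<ge> 1" and h: "continuous_on (cube N) h"
  obtains m where "m \<in> cube N" "\<And>x. x \<in> cube N \<Longrightarrow> F_TAP \<xi> N h x \<le> F_TAP \<xi> N h m"
    "maximum_on (cube N) (F_TAP \<xi> N h) = F_TAP \<xi> N h m"
proof -
  have "\<exists>m\<in>cube N. \<forall>x\<in>cube N. F_TAP \<xi> N h x \<le> F_TAP \<xi> N h m"
    by (rule dominated_attains_maximum[OF compact_cube _ F_TAP_dominated[OF N _ _ h]]) (use zero_in_cube[of N] in auto)
  then show ?thesis using that maximum_on_eq[of _ "cube N" "F_TAP \<xi> N h"] by blast
qed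

lemma \<xi>1_lipschitz: assumes "0 \<le> s" "s \<le> t" "t \<le> 1" shows "deriv \<xi> t - deriv \<xi> s \<le> A2 * (t - s)"
proof -
  have "deriv \<xi> t - A2 * t \<le> deriv \<xi> s - A2 * s"
  proof (rule DERIV_nonpos_imp_nonincreasing[OF assms(2)])
    fix x assume "s \<le> x" "x \<le> t"
    then have x: "x \<in> {0..1}" "x \<in> {-1..1}" using assms by auto
    have "((\<lambda>x. deriv \<xi> x - A2 * x) has_real_derivative deriv (deriv \<xi>) x - A2) (at x)"
      by (auto intro!: derivative_eq_intros der2[OF x(2)])
    then show "\<exists>y. ((\<lambda>x. deriv \<xi> x - A2 * x) has_real_derivative y) (at x) \<and> y \<le> 0" using A2(2)[OF x(1)] by force
  qed
  then show ?thesis by (simp add: algebra_simps)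
qed

text \<open>\<open>Phi\<close> lies below the step solution, which exceeds the node at the right end
  of the cell by at most half the increment of \<open>deriv \<xi>\<close>. The penalty is split as
  the full one minus the part below the self-overlap, which \<open>pen_step_bound\<close> turns into
  the constant of the scalar levels.\<close>

lemma dual_class_le:
  assumes \<zeta>: "\<zeta> \<in> probs_on 0 1" and N: "N \<ge> 1" and m: "m \<in> cube N" and l: "l < 2 ^ n"
    and q: "real l / 2 ^ n \<le> self_overlap N m" "self_overlap N m \<le> real (Suc l) / 2 ^ n"
  shows "dual \<zeta> N m \<le> (\<Sum>i<N. lower_conj (node (cdf \<zeta>) n (Suc l)) (m i)) + N * (A2 / 2 ^ n / 2) - real N / 2 * pen \<zeta> 0
    + (\<Sum>k<Suc l. lev (cdf \<zeta>) n (Suc k) * (N * ((real (Suc k) / 2 ^ n * deriv \<xi> (real (Suc k) / 2 ^ n) - \<xi> (real (Suc k) / 2 ^ n))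
      - (real k / 2 ^ n * deriv \<xi> (real k / 2 ^ n) - \<xi> (real k / 2 ^ n)))) / 2)"
proof -
  note cc = cdf_conditions[OF \<zeta>]
  let ?q = "self_overlap N m"
  have q1: "?q \<in> {0..1}" using overlap_bounds(2)[OF N m m] .
  have r1: "real (Suc l) / 2 ^ n \<le> 1" by (rule Suc_div_le[OF l])
  have "deriv \<xi> (real (Suc l) / 2 ^ n) - deriv \<xi> ?q \<le> A2 * (real (Suc l) / 2 ^ n - ?q)" by (rule \<xi>1_lipschitz) (use q q1 r1 in auto)
  also have "\<dots> \<le> A2 * (1 / 2 ^ n)" using q(1) A2(1) by (intro mult_left_mono) (auto simp: add_divide_distrib)
  finally have d: "(deriv \<xi> (real (Suc l) / 2 ^ n) - deriv \<xi> ?q) / 2 \<le> A2 / 2 ^ n / 2" by simp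
  have "Phi (cdf \<zeta>) ?q x \<le> node (cdf \<zeta>) n (Suc l) x + A2 / 2 ^ n / 2" for x
    using S_tendsto_Phi(2)[OF cc q1, of x n] S_cell_bounds(2)[OF cc l q, of x] d by linarith
  then have "(\<Sum>i<N. lower_conj (Phi (cdf \<zeta>) ?q) (m i)) \<le> (\<Sum>i<N. lower_conj (node (cdf \<zeta>) n (Suc l)) (m i) + A2 / 2 ^ n / 2)"
    by (intro sum_mono lower_conj_le Phi_ge_ln_cosh[OF \<zeta> q1]) (use cube_abs_le[OF m] in auto)
  then have conj: "(\<Sum>i<N. lower_conj (Phi (cdf \<zeta>) ?q) (m i)) \<le> (\<Sum>i<N. lower_conj (node (cdf \<zeta>) n (Suc l)) (m i)) + N * (A2 / 2 ^ n / 2)"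
    by (simp add: sum.distrib)
  define b where "b k = (real (Suc k) / 2 ^ n * deriv \<xi> (real (Suc k) / 2 ^ n) - \<xi> (real (Suc k) / 2 ^ n)) - (real k / 2 ^ n * deriv \<xi> (real k / 2 ^ n) - \<xi> (real k / 2 ^ n))" for k
  have "real N / 2 * (pen \<zeta> 0 - pen \<zeta> ?q) \<le> real N / 2 * (\<Sum>k<Suc l. lev (cdf \<zeta>) n (Suc k) * b k)"
    unfolding b_def by (rule mult_left_mono[OF pen_step_bound[OF \<zeta>]]) (use l q q1 in auto)
  also have "real N / 2 * (\<Sum>k<Suc l. lev (cdf \<zeta>) n (Suc k) * b k) = (\<Sum>k<Suc l. lev (cdf \<zeta>) n (Suc k) * (N * b k) / 2)"
    unfolding sum_distrib_left by (intro sum.cong refl) simp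
  finally show ?thesis
    using conj unfolding dual_def b_def[symmetric] right_diff_distrib[of "real N / 2"] by linarith
qed

end

section \<open>From exponential moments to the expected maximum\<close>

lemma expectation_le_exp_moment:
  fixes Y :: "'w \<Rightarrow> real"
  assumes M: "prob_space M" and Y: "Y \<in> borel_measurable M" and A: "AE w in M. A \<le> Y w" and c: "0 < c" and T: "0 < T"
    and le: "(\<integral>\<^sup>+w. ennreal (exp (c * Y w)) \<partial>M) \<le> ennreal T"
  shows "A \<le> (\<integral>w. Y w \<partial>M)" "(\<integral>w. Y w \<partial>M) \<le> ln T / c"
proof -
  interpret prob_space M by fact
  have iE: "integrable M (\<lambda>w. exp (c * Y w))"
  proof (rule integrableI_bounded)
    have "(\<integral>\<^sup>+w. ennreal (norm (exp (c * Y w))) \<partial>M) \<le> ennreal T" using le by simp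
    then show "(\<integral>\<^sup>+w. ennreal (norm (exp (c * Y w))) \<partial>M) < \<infinity>" by (rule order_le_less_trans) simp
  qed (use Y in measurable)
  \<comment> \<open>The lower bound \<open>A\<close> controls the negative part and the exponential
    moment the positive one.\<close>
  have iY: "integrable M Y"
  proof (rule Bochner_Integration.integrable_bound)
    show "integrable M (\<lambda>w. \<bar>A\<bar> + exp (c * Y w) / c)" using iE by simp
    show "AE w in M. norm (Y w) \<le> norm (\<bar>A\<bar> + exp (c * Y w) / c)"
      using A
    proof eventually_elim
      case (elim w)
      have "c * Y w \<le> exp (c * Y w)" using exp_ge_add_one_self[of "c * Y w"] by linarith
      then have "Y w \<le> exp (c * Y w) / c" using c by (simp add: le_divide_eq mult.commute)
      moreover have "0 \<le> exp (c * Y w) / c" using c by simp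
      ultimately show ?case using elim by (simp add: abs_le_iff) linarith
    qed
  qed fact
  have "(\<integral>w. A \<partial>M) \<le> (\<integral>w. Y w \<partial>M)" by (rule integral_mono_AE[OF _ iY A]) simp
  then show "A \<le> (\<integral>w. Y w \<partial>M)" by (simp add: prob_space)
  have "ennreal (\<integral>w. exp (c * Y w) \<partial>M) \<le> ennreal T" using le nn_integral_eq_integral[OF iE] by simp
  then have E: "(\<integral>w. exp (c * Y w) \<partial>M) \<le> T" using T by (simp add: ennreal_le_iff)
  \<comment> \<open>Jensen's inequality by way of the tangent to the exponential at
    \<open>ln T\<close>.\<close>
  have "(\<integral>w. 1 + (c * Y w - ln T) \<partial>M) \<le> (\<integral>w. exp (c * Y w) / T \<partial>M)"
  proof (rule integral_mono)
    fix w
    have "1 + (c * Y w - ln T) \<le> exp (c * Y w - ln T)" by (rule exp_ge_add_one_self)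
    then show "1 + (c * Y w - ln T) \<le> exp (c * Y w) / T" using T by (simp add: exp_diff)
  qed (use iE iY in auto)
  also have "\<dots> \<le> 1" using E T by simp
  finally have "c * (\<integral>w. Y w \<partial>M) \<le> ln T" using iY by (simp add: prob_space)
  then show "(\<integral>w. Y w \<partial>M) \<le> ln T / c" using c by (simp add: le_divide_eq mult.commute)
qed

text \<open>The cells are closed so that the last one contains 1. Neighbouring classes may share
  points, which a union bound tolerates.\<close>

lemma overlap_class:
  assumes "q \<in> {0..1}"
  obtains l where "l < 2 ^ n" "real l / 2 ^ n \<le> q" "q \<le> real (Suc l) / 2 ^ n"
proof (cases "q = 1")
  case True
  have e: "Suc (2 ^ n - 1) = 2 ^ n" by simp
  show ?thesis
  proof (rule that[of "2 ^ n - 1"])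
    have "real (2 ^ n - 1) \<le> 2 ^ n" by (simp add: of_nat_diff)
    then show "real (2 ^ n - 1) / 2 ^ n \<le> q" unfolding True by (simp only: divide_le_eq_1) simp
    show "q \<le> real (Suc (2 ^ n - 1)) / 2 ^ n" unfolding e True by simp
  qed simp
next
  case False
  define l where "l = nat \<lfloor>q * 2 ^ n\<rfloor>"
  have f: "real l \<le> q * 2 ^ n" "q * 2 ^ n < real l + 1" using assms unfolding l_def by (auto simp: of_nat_nat)
  have "q * 2 ^ n < 1 * 2 ^ n" using assms False by (intro mult_strict_right_mono) auto
  then have "real l < 2 ^ n" using f by linarith
  then have "l < 2 ^ n" by (metis of_nat_less_iff of_nat_numeral of_nat_power)
  then show ?thesis by (rule that) (use f in \<open>auto simp: divide_le_eq le_divide_eq\<close>)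
qed

context guerra_mixture
begin

text \<open>\<open>N\<close> times a quantity that tends to the Parisi functional as
  \<open>n\<close> grows, plus a term free of \<open>N\<close>.\<close>

definition free_energy_bound :: "real measure \<Rightarrow> nat \<Rightarrow> nat \<Rightarrow> real" where
  "free_energy_bound \<zeta> n N = N * (node (cdf \<zeta>) n 0 0 - pen \<zeta> 0 / 2 + A2 / 2 ^ n / 2 + (L / 2 ^ n)\<^sup>2 / 2 + deriv \<xi> 1 / 2 ^ n / 2)
     + (1 + ln 2 / lev (cdf \<zeta>) n 1)"

text \<open>All classes share the exponent \<open>lev (cdf \<zeta>) n 1\<close>, so the exponential
  moments of the class maxima can be added, and the number of classes costs only its
  logarithm.\<close>

lemma exp_max_F_TAP_le:
  fixes X :: "(nat \<Rightarrow> real) \<Rightarrow> 'w \<Rightarrow> real" and n :: nat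
  assumes \<zeta>: "\<zeta> \<in> probs_on 0 1" and N: "N \<ge> 1" and I: "finite I" "I \<noteq> {}" "I \<subseteq> cube N"
    and X: "centered_gaussian_process M (cube N) X"
    and cov: "\<And>m m'. m \<in> cube N \<Longrightarrow> m' \<in> cube N \<Longrightarrow> (\<integral>a. X m a * X m' a \<partial>M) = N * \<xi> (dotp N m m' / N)"
  defines "c \<equiv> lev (cdf \<zeta>) n 1"
  shows "(\<integral>\<^sup>+a. ennreal (exp (c * (MAX m\<in>I. X m a + F_TAP \<xi> N (\<lambda>_. 0) m))) \<partial>M) \<le> ennreal (2 ^ n * exp (c * free_energy_bound \<zeta> n N))"
proof -
  note cc = cdf_conditions[OF \<zeta>]
  have c: "0 < c" unfolding c_def by (rule lev_pos[OF cc])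
  have M: "prob_space M" and G: "\<And>S u. finite S \<Longrightarrow> S \<subseteq> cube N \<Longrightarrow> centered_gaussian M (\<lambda>w. \<Sum>t\<in>S. u t * X t w)"
    using X by (auto simp: centered_gaussian_process_def)
  have mX: "X m \<in> borel_measurable M" if "m \<in> cube N" for m
    using G[of "{m}" "\<lambda>_. 1"] that by (simp add: centered_gaussian_def)
  define b where "b k = (real (Suc k) / 2 ^ n * deriv \<xi> (real (Suc k) / 2 ^ n) - \<xi> (real (Suc k) / 2 ^ n)) - (real k / 2 ^ n * deriv \<xi> (real k / 2 ^ n) - \<xi> (real k / 2 ^ n))" for k
  define K where "K l = (\<Sum>k<Suc l. lev (cdf \<zeta>) n (Suc k) * (N * b k) / 2)" for l
  define J where "J l = {m\<in>I. real l / 2 ^ n \<le> self_overlap N m \<and> self_overlap N m \<le> real (Suc l) / 2 ^ n}" for l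
  define P where "P l a = (MAX m\<in>J l. (\<Sum>i<N. lower_conj (node (cdf \<zeta>) n (Suc l)) (m i)) + X m a)" for l a
  define s where "s = N * (A2 / 2 ^ n / 2) - real N / 2 * pen \<zeta> 0"
  \<comment> \<open>Empty classes are left out, since \<open>Max\<close> of the empty set carries no
    information.\<close>
  define Ls where "Ls = {l. l < 2 ^ n \<and> J l \<noteq> {}}"
  define C where "C = 1 + ln 2 / lev (cdf \<zeta>) n 1 + N * (L / 2 ^ n)\<^sup>2 / 2 + N * deriv \<xi> 1 / 2 ^ n / 2"
  have J: "finite (J l)" "J l \<subseteq> I" for l using I(1) by (auto simp: J_def)
  have mP: "P l \<in> borel_measurable M" for l
    unfolding P_def using J[of l] I(3) mX by (intro borel_measurable_Max) auto
  have pw: "exp (c * (MAX m\<in>I. X m a + F_TAP \<xi> N (\<lambda>_. 0) m)) \<le> (\<Sum>l\<in>Ls. exp (c * s) * exp (c * (P l a + K l)))" for a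
  proof -
    have "Max ((\<lambda>m. X m a + F_TAP \<xi> N (\<lambda>_. 0) m) ` I) \<in> (\<lambda>m. X m a + F_TAP \<xi> N (\<lambda>_. 0) m) ` I" using I by (intro Max_in) auto
    then obtain m where m: "m \<in> I" "(MAX m\<in>I. X m a + F_TAP \<xi> N (\<lambda>_. 0) m) = X m a + F_TAP \<xi> N (\<lambda>_. 0) m" by blast
    have mc: "m \<in> cube N" using m I by auto
    obtain l where l: "l < 2 ^ n" "real l / 2 ^ n \<le> self_overlap N m" "self_overlap N m \<le> real (Suc l) / 2 ^ n"
      by (rule overlap_class[OF overlap_bounds(2)[OF N mc mc]]) (rule that)
    have mJ: "m \<in> J l" using l m by (auto simp: J_def)
    then have "(\<Sum>i<N. lower_conj (node (cdf \<zeta>) n (Suc l)) (m i)) + X m a \<le> P l a"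
      unfolding P_def using J by (intro Max_ge) auto
    moreover have "F_TAP \<xi> N (\<lambda>_. 0) m \<le> (\<Sum>i<N. lower_conj (node (cdf \<zeta>) n (Suc l)) (m i)) + s + K l"
      using F_TAP_le[OF \<zeta> N mc, of "\<lambda>_. 0"] dual_class_le[OF \<zeta> N mc l] unfolding s_def K_def b_def by linarith
    ultimately have "X m a + F_TAP \<xi> N (\<lambda>_. 0) m \<le> s + (P l a + K l)" by linarith
    then have "c * (X m a + F_TAP \<xi> N (\<lambda>_. 0) m) \<le> c * (s + (P l a + K l))" using c by (intro mult_left_mono) auto
    then have "exp (c * (X m a + F_TAP \<xi> N (\<lambda>_. 0) m)) \<le> exp (c * s) * exp (c * (P l a + K l))"
      by (simp add: exp_add[symmetric] distrib_left)
    also have "\<dots> \<le> (\<Sum>l\<in>Ls. exp (c * s) * exp (c * (P l a + K l)))"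
      by (rule member_le_sum[of l Ls "\<lambda>l. exp (c * s) * exp (c * (P l a + K l))"]) (use l mJ in \<open>auto simp: Ls_def\<close>)
    finally show ?thesis using m(2) by simp
  qed
  have "(\<integral>\<^sup>+a. ennreal (exp (c * (MAX m\<in>I. X m a + F_TAP \<xi> N (\<lambda>_. 0) m))) \<partial>M)
      \<le> (\<integral>\<^sup>+a. (\<Sum>l\<in>Ls. ennreal (exp (c * s)) * ennreal (exp (c * (P l a + K l)))) \<partial>M)"
  proof (rule nn_integral_mono)
    fix a
    have "(\<Sum>l\<in>Ls. ennreal (exp (c * s)) * ennreal (exp (c * (P l a + K l)))) = ennreal (\<Sum>l\<in>Ls. exp (c * s) * exp (c * (P l a + K l)))"
      by (subst sum_ennreal[symmetric]) (auto simp: ennreal_mult')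
    then show "ennreal (exp (c * (MAX m\<in>I. X m a + F_TAP \<xi> N (\<lambda>_. 0) m))) \<le> (\<Sum>l\<in>Ls. ennreal (exp (c * s)) * ennreal (exp (c * (P l a + K l))))"
      using ennreal_leI[OF pw[of a]] by simp
  qed
  also have "\<dots> = (\<Sum>l\<in>Ls. ennreal (exp (c * s)) * (\<integral>\<^sup>+a. ennreal (exp (c * (P l a + K l))) \<partial>M))"
    using mP by (subst nn_integral_sum) (auto simp: nn_integral_cmult)
  also have "\<dots> \<le> (\<Sum>l\<in>Ls. ennreal (exp (c * free_energy_bound \<zeta> n N)))"
  proof (rule sum_mono)
    fix l assume l: "l \<in> Ls"
    have "(\<integral>\<^sup>+a. ennreal (exp (lev (cdf \<zeta>) n (Suc 0) * (P l a + K l))) \<partial>M) \<le> ennreal (exp (lev (cdf \<zeta>) n (Suc 0) * (N * node (cdf \<zeta>) n 0 0 + C)))"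
      unfolding P_def K_def b_def C_def
    proof (rule guerra_class_bound[OF \<zeta> N J(1) _ _ _ _ _ M])
      show "J l \<noteq> {}" "Suc l \<le> 2 ^ n" "J l \<subseteq> cube N" using l J(2)[of l] I(3) by (auto simp: Ls_def)
      then show "centered_gaussian M (\<lambda>a. \<Sum>m\<in>J l. u m * X m a)" for u by (intro G J)
      show "(\<integral>a. X m a * X m' a \<partial>M) = N * \<xi> (dotp N m m' / N)" if "m \<in> J l" "m' \<in> J l" for m m'
        using that \<open>J l \<subseteq> cube N\<close> by (intro cov) auto
      fix m assume "m \<in> J l"
      then have "real l / 2 ^ n \<le> self_overlap N m" "self_overlap N m \<le> real (Suc l) / 2 ^ n" by (auto simp: J_def)
      moreover have "real (Suc l) / 2 ^ n = real l / 2 ^ n + 1 / 2 ^ n" by (simp add: add_divide_distrib)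
      ultimately show "self_overlap N m \<le> real (Suc l) / 2 ^ n \<and> real (Suc l) / 2 ^ n - self_overlap N m \<le> 1 / 2 ^ n" by linarith
    qed simp
    then have "(\<integral>\<^sup>+a. ennreal (exp (c * (P l a + K l))) \<partial>M) \<le> ennreal (exp (c * (N * node (cdf \<zeta>) n 0 0 + C)))" by (simp add: c_def)
    then have "ennreal (exp (c * s)) * (\<integral>\<^sup>+a. ennreal (exp (c * (P l a + K l))) \<partial>M) \<le> ennreal (exp (c * s)) * ennreal (exp (c * (N * node (cdf \<zeta>) n 0 0 + C)))"
      by (rule mult_left_mono) simp
    also have "\<dots> = ennreal (exp (c * s + c * (N * node (cdf \<zeta>) n 0 0 + C)))" by (simp add: ennreal_mult'[symmetric] exp_add)
    also have "c * s + c * (N * node (cdf \<zeta>) n 0 0 + C) = c * free_energy_bound \<zeta> n N"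
      by (simp add: s_def C_def free_energy_bound_def algebra_simps)
    finally show "ennreal (exp (c * s)) * (\<integral>\<^sup>+a. ennreal (exp (c * (P l a + K l))) \<partial>M) \<le> ennreal (exp (c * free_energy_bound \<zeta> n N))" .
  qed
  also have "\<dots> = of_nat (card Ls) * ennreal (exp (c * free_energy_bound \<zeta> n N))" by simp
  also have "\<dots> = ennreal (card Ls * exp (c * free_energy_bound \<zeta> n N))" by (simp add: ennreal_mult ennreal_of_nat_eq_real_of_nat)
  also have "\<dots> \<le> ennreal (2 ^ n * exp (c * free_energy_bound \<zeta> n N))"
  proof (intro ennreal_leI mult_right_mono)
    have "card Ls \<le> card {..<(2::nat) ^ n}" by (rule card_mono) (auto simp: Ls_def)
    then have "card Ls \<le> 2 ^ n" by simp
    then show "real (card Ls) \<le> 2 ^ n" by (metis of_nat_le_iff of_nat_numeral of_nat_power)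
  qed simp
  finally show ?thesis .
qed

lemma parisi_functional_eq: "\<zeta> \<in> probs_on 0 1 \<Longrightarrow> parisi_functional \<xi> \<zeta> = Phi (cdf \<zeta>) 0 0 - pen \<zeta> 0 / 2"
  by (simp add: parisi_functional_def parisi_Phi_eq[of \<zeta> \<zeta>] penalty_eq[of \<zeta> \<zeta>])

lemma parisi_functional_bdd_below: "bdd_below (parisi_functional \<xi> ` probs_on 0 1)"
proof (rule bdd_belowI2)
  fix \<zeta> assume \<zeta>: "\<zeta> \<in> probs_on 0 1"
  show "- (A2 / 2) \<le> parisi_functional \<xi> \<zeta>"
    using Phi_ge_ln_cosh[OF \<zeta>, of 0 0] pen_le[OF \<zeta>, of 0] by (simp add: parisi_functional_eq[OF \<zeta>])
qed

lemma F_TAP_0_ge: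
  assumes "N \<ge> 1"
  shows "real N * (INF \<zeta>\<in>probs_on 0 1. parisi_functional \<xi> \<zeta>) \<le> F_TAP \<xi> N (\<lambda>_. 0) (\<lambda>i\<in>{..<N}. 0)"
proof (rule field_le_epsilon)
  let ?m = "\<lambda>i\<in>{..<N}. 0 :: real"
  fix e :: real assume "e > 0"
  then obtain \<zeta> where \<zeta>: "\<zeta> \<in> probs_on 0 1" "0 + dual \<zeta> N ?m < F_TAP \<xi> N (\<lambda>_. 0) ?m + e"
    by (rule F_TAP_approx[OF assms zero_in_cube, where h="\<lambda>_. 0"])
  have q: "self_overlap N ?m = 0" by (simp add: self_overlap_def dotp_def)
  have "Phi (cdf \<zeta>) 0 0 \<le> lower_conj (Phi (cdf \<zeta>) 0) 0"
    unfolding lower_conj_def by (rule cINF_greatest) (use Phi_min_at_0[OF \<zeta>(1), of 0] in auto)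
  then have "N * Phi (cdf \<zeta>) 0 0 \<le> (\<Sum>i<N. lower_conj (Phi (cdf \<zeta>) 0) (?m i))"
    by (simp add: mult_left_mono)
  then have "N * parisi_functional \<xi> \<zeta> \<le> dual \<zeta> N ?m"
    unfolding dual_def q parisi_functional_eq[OF \<zeta>(1)] by (simp add: right_diff_distrib)
  moreover have "N * (INF \<zeta>\<in>probs_on 0 1. parisi_functional \<xi> \<zeta>) \<le> N * parisi_functional \<xi> \<zeta>"
    by (intro mult_left_mono cINF_lower parisi_functional_bdd_below \<zeta>(1)) simp
  ultimately show "N * (INF \<zeta>\<in>probs_on 0 1. parisi_functional \<xi> \<zeta>) \<le> F_TAP \<xi> N (\<lambda>_. 0) ?m + e" using \<zeta>(2) by linarith
qed

text \<open>Increasing maxima over finite subsets of one countable set, fixed before the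
  realisation, make the maximum measurable and carry the exponential bound over by monotone
  convergence.\<close>

lemma expected_maximum_F_TAP:
  fixes H :: "(nat \<Rightarrow> real) \<Rightarrow> 'w \<Rightarrow> real"
  assumes N: "N \<ge> 1" and H: "centered_gaussian_process M (cube N) H"
    and cov: "\<And>m m'. m \<in> cube N \<Longrightarrow> m' \<in> cube N \<Longrightarrow> (\<integral>a. H m a * H m' a \<partial>M) = N * \<xi> (dotp N m m' / N)"
    and cont: "\<And>w. w \<in> space M \<Longrightarrow> continuous_on (cube N) (\<lambda>m. H m w)"
  defines "Y \<equiv> \<lambda>w. maximum_on (cube N) (F_TAP \<xi> N (\<lambda>m. H m w))"
  shows "N * (INF \<zeta>\<in>probs_on 0 1. parisi_functional \<xi> \<zeta>) \<le> (\<integral>w. Y w \<partial>M)"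
    "\<zeta> \<in> probs_on 0 1 \<Longrightarrow> (\<integral>w. Y w \<partial>M) \<le> free_energy_bound \<zeta> n N + n * ln 2 / lev (cdf \<zeta>) n 1"
proof -
  let ?F = "F_TAP \<xi> N (\<lambda>_. 0)" and ?m = "\<lambda>i\<in>{..<N}. 0 :: real"
  have M: "prob_space M" and G: "\<And>S u. finite S \<Longrightarrow> S \<subseteq> cube N \<Longrightarrow> centered_gaussian M (\<lambda>w. \<Sum>t\<in>S. u t * H t w)"
    using H by (auto simp: centered_gaussian_process_def)
  have G1: "centered_gaussian M (H m)" if "m \<in> cube N" for m using G[of "{m}" "\<lambda>_. 1"] that by simp
  have mH: "H m \<in> borel_measurable M" if "m \<in> cube N" for m using G1[OF that] by (simp add: centered_gaussian_def)
  have max: "\<exists>m\<in>cube N. Y w = H m w + ?F m \<and> (\<forall>x\<in>cube N. H x w + ?F x \<le> H m w + ?F m)" if w: "w \<in> space M" for w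
  proof -
    obtain m where "m \<in> cube N" "\<And>x. x \<in> cube N \<Longrightarrow> F_TAP \<xi> N (\<lambda>m. H m w) x \<le> F_TAP \<xi> N (\<lambda>m. H m w) m"
      "maximum_on (cube N) (F_TAP \<xi> N (\<lambda>m. H m w)) = F_TAP \<xi> N (\<lambda>m. H m w) m"
      by (rule F_TAP_attains_maximum[OF N cont[OF w]]) (rule that)
    then show ?thesis unfolding Y_def by (intro bexI[of _ m]) (simp_all add: F_TAP_shift[OF N, of _ "\<lambda>m. H m w"])
  qed
  obtain D where D: "countable D" "D \<subseteq> cube N"
    "\<And>m h e. m \<in> cube N \<Longrightarrow> continuous_on (cube N) h \<Longrightarrow> 0 < e \<Longrightarrow> \<exists>d\<in>D. h m + ?F m < h d + ?F d + e"
    by (rule countable_graph_dense[of "cube N" ?F]) (rule that)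
  have D0: "D \<noteq> {}" using D(3)[OF zero_in_cube continuous_on_const, of 1 0] by auto
  define I where "I k = from_nat_into D ` {..k}" for k :: nat
  have I: "finite (I k)" "I k \<noteq> {}" "I k \<subseteq> cube N" for k using from_nat_into[OF D0] D(2) by (auto simp: I_def)
  define Yk where "Yk k w = (MAX m\<in>I k. H m w + ?F m)" for k w
  have inc: "Yk k w \<le> Yk k' w" if "k \<le> k'" for k k' w
    unfolding Yk_def by (rule Max_mono) (use that I in \<open>auto simp: I_def\<close>)
  have mYk: "Yk k \<in> borel_measurable M" for k
    unfolding Yk_def using I by (intro borel_measurable_Max borel_measurable_add mH borel_measurable_const) auto
  have lim: "(\<lambda>k. Yk k w) \<longlonglongrightarrow> Y w" if w: "w \<in> space M" for w
  proof -
    obtain m where m: "m \<in> cube N" "Y w = H m w + ?F m" "\<And>x. x \<in> cube N \<Longrightarrow> H x w + ?F x \<le> H m w + ?F m" using max[OF w] by blast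
    have up: "Yk k w \<le> Y w" for k unfolding Yk_def m(2) using I(1,2) subsetD[OF I(3)] m(3) by (subst Max_le_iff) auto
    show ?thesis
    proof (rule increasing_tendsto)
      fix x assume "x < Y w"
      then obtain d where d: "d \<in> D" "H m w + ?F m < H d w + ?F d + (Y w - x)" using D(3)[OF m(1) cont[OF w], of "Y w - x"] by auto
      then have x: "x < H d w + ?F d" using m(2) by simp
      obtain j where j: "d = from_nat_into D j" using from_nat_into_surj[OF D(1) d(1)] by metis
      have "H d w + ?F d \<le> Yk j w" unfolding Yk_def using I(1) j by (intro Max_ge) (auto simp: I_def)
      then show "\<forall>\<^sub>F k in sequentially. x < Yk k w" using x inc unfolding eventually_sequentially by (intro exI[of _ j]) (meson less_le_trans order_trans)
    qed (use up in auto)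
  qed
  have mY: "Y \<in> borel_measurable M" by (rule borel_measurable_LIMSEQ_real[OF lim mYk])
  have low: "AE w in M. N * (INF \<zeta>\<in>probs_on 0 1. parisi_functional \<xi> \<zeta>) \<le> Y w"
  proof -
    have "(\<integral>w. (H ?m w)\<^sup>2 \<partial>M) = 0" using cov[OF zero_in_cube zero_in_cube] zero by (simp add: power2_eq_square dotp_def)
    then have "AE w in M. (H ?m w)\<^sup>2 = 0"
      using integral_nonneg_eq_0_iff_AE[OF centered_gaussian_facts(2)[OF M G1[OF zero_in_cube]]] by simp
    then show ?thesis
      using AE_space
    proof eventually_elim
      case (elim w)
      obtain m where m: "Y w = H m w + ?F m" "\<And>x. x \<in> cube N \<Longrightarrow> H x w + ?F x \<le> H m w + ?F m" using max[OF elim(2)] by blast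
      show ?case using m(2)[OF zero_in_cube] F_TAP_0_ge[OF N] elim(1) unfolding m(1) by simp
    qed
  qed
  have up: "(\<integral>\<^sup>+w. ennreal (exp (lev (cdf \<zeta>) n 1 * Y w)) \<partial>M) \<le> ennreal (2 ^ n * exp (lev (cdf \<zeta>) n 1 * free_energy_bound \<zeta> n N))"
    if \<zeta>: "\<zeta> \<in> probs_on 0 1" for \<zeta> n
  proof -
    let ?c = "lev (cdf \<zeta>) n 1"
    have c: "0 < ?c" by (rule lev_pos[OF cdf_conditions[OF \<zeta>]])
    have incs: "incseq (\<lambda>k w. ennreal (exp (?c * Yk k w)))"
      using inc c by (auto simp: incseq_def le_fun_def intro!: ennreal_leI)
    have "(\<integral>\<^sup>+w. ennreal (exp (?c * Y w)) \<partial>M) = (\<integral>\<^sup>+w. (SUP k. ennreal (exp (?c * Yk k w))) \<partial>M)"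
    proof (rule nn_integral_cong)
      fix w assume w: "w \<in> space M"
      have "(\<lambda>k. ennreal (exp (?c * Yk k w))) \<longlonglongrightarrow> ennreal (exp (?c * Y w))" by (intro tendsto_intros lim w)
      moreover have "(\<lambda>k. ennreal (exp (?c * Yk k w))) \<longlonglongrightarrow> (SUP k. ennreal (exp (?c * Yk k w)))"
        by (rule LIMSEQ_SUP) (use incs in \<open>auto simp: incseq_def le_fun_def\<close>)
      ultimately show "ennreal (exp (?c * Y w)) = (SUP k. ennreal (exp (?c * Yk k w)))" by (rule LIMSEQ_unique)
    qed
    also have "\<dots> = (SUP k. \<integral>\<^sup>+w. ennreal (exp (?c * Yk k w)) \<partial>M)" by (rule nn_integral_monotone_convergence_SUP[OF incs]) (use mYk in measurable)
    also have "\<dots> \<le> ennreal (2 ^ n * exp (?c * free_energy_bound \<zeta> n N))"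
      unfolding Yk_def by (rule SUP_least) (rule exp_max_F_TAP_le[OF \<zeta> N I H cov])
    finally show ?thesis .
  qed
  have pos: "0 < 2 ^ n * exp (lev (cdf \<zeta>) n 1 * free_energy_bound \<zeta> n N)" for \<zeta> n by simp
  \<comment> \<open>For the lower bound any order parameter will do; it supplies the exponential
    moment that makes \<open>Y\<close> integrable.\<close>
  have "return borel 1 \<in> probs_on 0 1" by (rule probs_on_nonempty) simp
  from expectation_le_exp_moment(1)[OF M mY low lev_pos[OF cdf_conditions[OF this]] pos up[OF this]]
  show "N * (INF \<zeta>\<in>probs_on 0 1. parisi_functional \<xi> \<zeta>) \<le> (\<integral>w. Y w \<partial>M)" .
  assume \<zeta>: "\<zeta> \<in> probs_on 0 1"
  have c: "0 < lev (cdf \<zeta>) n 1" by (rule lev_pos[OF cdf_conditions[OF \<zeta>]])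
  from expectation_le_exp_moment(2)[OF M mY low c pos up[OF \<zeta>]]
  show "(\<integral>w. Y w \<partial>M) \<le> free_energy_bound \<zeta> n N + n * ln 2 / lev (cdf \<zeta>) n 1"
    using c by (simp add: ln_mult ln_realpow field_simps)
qed

lemma free_energy_bound_tendsto:
  assumes \<zeta>: "\<zeta> \<in> probs_on 0 1"
  shows "(\<lambda>n. node (cdf \<zeta>) n 0 0 - pen \<zeta> 0 / 2 + A2 / 2 ^ n / 2 + (L / 2 ^ n)\<^sup>2 / 2 + deriv \<xi> 1 / 2 ^ n / 2) \<longlonglongrightarrow> parisi_functional \<xi> \<zeta>"
proof -
  note cc = cdf_conditions[OF \<zeta>]
  have z: "(\<lambda>n. a / 2 ^ n) \<longlonglongrightarrow> 0" for a :: real by (rule LIMSEQ_divide_realpow_zero) simp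
  have "(\<lambda>n. node (cdf \<zeta>) n 0 0) \<longlonglongrightarrow> Phi (cdf \<zeta>) 0 0"
    using S_tendsto_Phi(1)[OF cc, of 0 0] by (simp add: S_0[OF cc])
  then have "(\<lambda>n. node (cdf \<zeta>) n 0 0 - pen \<zeta> 0 / 2 + A2 / 2 ^ n / 2 + (L / 2 ^ n)\<^sup>2 / 2 + deriv \<xi> 1 / 2 ^ n / 2)
      \<longlonglongrightarrow> Phi (cdf \<zeta>) 0 0 - pen \<zeta> 0 / 2 + 0 / 2 + 0\<^sup>2 / 2 + 0 / 2"
    by (intro tendsto_intros z) auto
  then show ?thesis by (simp add: parisi_functional_eq[OF \<zeta>])
qed

end

theorem proposition2p1:
  fixes \<beta> :: "nat \<Rightarrow> real"
    and M :: "nat \<Rightarrow> 'w measure"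
    and H :: "nat \<Rightarrow> (nat \<Rightarrow> real) \<Rightarrow> 'w \<Rightarrow> real"
  assumes radius: "conv_radius (mixture_coeff \<beta>) > 1"
    and convex: "strictly_convex_on {-1..1} (mixture \<beta>)"
    and gaussian: "\<And>N. N \<ge> 1 \<Longrightarrow> centered_gaussian_process (M N) (cube N) (H N)"
    and covariance: "\<And>N m m'. N \<ge> 1 \<Longrightarrow> m \<in> cube N \<Longrightarrow> m' \<in> cube N \<Longrightarrow>
          prob_space.expectation (M N) (\<lambda>w. H N m w * H N m' w)
            = real N * mixture \<beta> (dotp N m m' / real N)"
    and continuous: "\<And>N w. N \<ge> 1 \<Longrightarrow> w \<in> space (M N) \<Longrightarrow>
          continuous_on (cube N) (\<lambda>m. H N m w)"
  shows "(\<lambda>N. 1 / real N * prob_space.expectation (M N)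
            (\<lambda>w. maximum_on (cube N) (F_TAP (mixture \<beta>) N (\<lambda>m. H N m w))))
         \<longlonglongrightarrow> (INF \<zeta>\<in>probs_on 0 1. parisi_functional (mixture \<beta>) \<zeta>)"
proof (rule LIMSEQ_I)
  interpret guerra_mixture "mixture \<beta>" "sqrt (deriv (deriv (mixture \<beta>)) 1 / 2)"
    by (rule guerra_mixture_mixture[OF radius convex])
  let ?P = "INF \<zeta>\<in>probs_on 0 1. parisi_functional (mixture \<beta>) \<zeta>"
  let ?E = "\<lambda>N. \<integral>w. maximum_on (cube N) (F_TAP (mixture \<beta>) N (\<lambda>m. H N m w)) \<partial>M N"
  fix e :: real assume e: "e > 0"
  \<comment> \<open>The error is split in three: choice of the order parameter, of the mesh, and of
    \<open>N\<close>.\<close>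
  have "?P < ?P + e / 3" using e by simp
  then obtain \<zeta> where \<zeta>: "\<zeta> \<in> probs_on 0 1" "parisi_functional (mixture \<beta>) \<zeta> < ?P + e / 3"
    using cINF_less_iff[OF _ parisi_functional_bdd_below, of "?P + e / 3"] probs_on_nonempty[of 0] by fastforce
  define g where "g n = node (cdf \<zeta>) n 0 0 - pen \<zeta> 0 / 2 + A2 / 2 ^ n / 2 + (sqrt (deriv (deriv (mixture \<beta>)) 1 / 2) / 2 ^ n)\<^sup>2 / 2 + deriv (mixture \<beta>) 1 / 2 ^ n / 2" for n
  have "g \<longlonglongrightarrow> parisi_functional (mixture \<beta>) \<zeta>" using free_energy_bound_tendsto[OF \<zeta>(1)] by (simp add: g_def[abs_def])
  then have "\<forall>\<^sub>F n in sequentially. g n < parisi_functional (mixture \<beta>) \<zeta> + e / 3" by (rule order_tendstoD) (use e in simp)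
  then obtain n where n: "g n < parisi_functional (mixture \<beta>) \<zeta> + e / 3" by (auto simp: eventually_sequentially)
  \<comment> \<open>Everything that does not grow with \<open>N\<close>: the constant in
    \<open>free_energy_bound\<close>, and the logarithm \<open>n * ln 2\<close> of the number of
    classes divided by the exponent.\<close>
  define K where "K = 1 + ln 2 / lev (cdf \<zeta>) n 1 + n * ln 2 / lev (cdf \<zeta>) n 1"
  obtain N0 where N0: "3 * K / e < real N0" using reals_Archimedean2 by blast
  show "\<exists>no. \<forall>N\<ge>no. norm (1 / real N * ?E N - ?P) < e"
  proof (intro exI allI impI)
    fix N assume N: "max 1 N0 \<le> N"
    then have N1: "N \<ge> 1" and NK: "3 * K / e < real N" using N0 by auto
    have Np: "real N > 0" using N1 by simp
    have low: "?P \<le> 1 / real N * ?E N"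
      using expected_maximum_F_TAP(1)[OF N1 gaussian[OF N1] covariance[OF N1] continuous[OF N1]] Np by (simp add: le_divide_eq mult.commute)
    have "?E N \<le> N * g n + K"
      using expected_maximum_F_TAP(2)[OF N1 gaussian[OF N1] covariance[OF N1] continuous[OF N1] \<zeta>(1), of n] by (simp add: free_energy_bound_def g_def K_def)
    then have "?E N / N \<le> (N * g n + K) / N" by (rule divide_right_mono) simp
    also have "\<dots> = g n + K / N" using Np by (simp add: add_divide_distrib)
    also have "K / N < e / 3" using NK e Np by (simp add: field_simps)
    finally have "1 / real N * ?E N < ?P + e" using n \<zeta>(2) by simp
    with low show "norm (1 / real N * ?E N - ?P) < e" by simp
  qed
qed

end
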